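(* Let $k$ be an algebraically closed field of characteristic zero. Let $X$ be a nondegenerate reduced quadratic scheme in $\mathbb{P}^{r+e}$ of codimension $e$ and let $I$ be the quadratic ideal of $X$. Suppose that $I$ satisfies property $\mathbf{N}_{2,p}$, and let $\beta_{0,2}(I)$ be the number of (minimal) generators of $I$. Then $$e\cdot p-\frac{p(p-1)}{2}\ \le\ \beta_{0,2}(I)\ \le\ \beta_{0,2}(I_X)=h^0(\mathcal{I}_X(2)).$$
   Context: Let $R$ be the homogeneous coordinate ring of $\mathbb{P}^{r+e}$. $X$ is nondegenerate if it is contained in no hyperplane. $X$ is quadratic if there is a homogeneous ideal $I\subset R$ generated by forms of degree 2 which defines $X$ scheme-theoretically (the sheafification of $I$ is the ideal sheaf $\mathcal{I}_X$; $I$ need not be saturated); such an $I$ is called a quadratic ideal of $X$. $I_X$ is the saturated ideal of $X$. For $p\ge1$, $I$ satisfies property $\mathbf{N}_{2,p}$ if $\mathrm{Tor}_i^R(R/I,k)_{i+j}=0$ for all $0\le i\le p$ and $j\ge 2$. For a homogeneous ideal $I$, $\beta_{0,2}(I)=\dim_k\mathrm{Tor}_0^R(I,k)_2$. *)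

theory Defs
  imports
    "HOL-Library.Poly_Mapping"
    "HOL-Library.Function_Algebras"
    "HOL-Library.Extended_Nat"
    "HOL-Computational_Algebra.Polynomial"
    "HOL-Computational_Algebra.Fraction_Field"
    "HOL-Algebra.Ideal"
begin

section \<open>The homogeneous coordinate ring of projective space\<close>

text \<open>
  Polynomials in the countably many variables \<open>x\<^sub>0, x\<^sub>1, \<dots>\<close>; the homogeneous coordinate ring of
  \<open>\<bbbP>\<^sup>n\<close> is the subring of those polynomials that involve \<open>x\<^sub>0, \<dots>, x\<^sub>n\<close> only. Working inside one
  ambient type allows \<open>n\<close> to be an ordinary natural number.
\<close>

type_synonym 'k mpol = "(nat \<Rightarrow>\<^sub>0 nat) \<Rightarrow>\<^sub>0 'k"

definition coord_ring :: "nat \<Rightarrow> ('k::field) mpol ring" where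
  "coord_ring n = \<lparr>carrier = {p. \<forall>m\<in>Poly_Mapping.keys p. Poly_Mapping.keys m \<subseteq> {..n}},
     mult = (*), one = 1, zero = 0, add = (+)\<rparr>"

definition mdeg :: "(nat \<Rightarrow>\<^sub>0 nat) \<Rightarrow> nat" where
  "mdeg m = (\<Sum>x\<in>Poly_Mapping.keys m. Poly_Mapping.lookup m x)"

text \<open>As usual, \<open>0\<close> is homogeneous of every degree.\<close>

definition homog :: "nat \<Rightarrow> ('k::field) mpol \<Rightarrow> bool" where
  "homog d p \<longleftrightarrow> (\<forall>m\<in>Poly_Mapping.keys p. mdeg m = d)"

definition hom_part :: "nat \<Rightarrow> ('k::field) mpol \<Rightarrow> 'k mpol" where
  "hom_part d p = (\<Sum>m\<in>{m\<in>Poly_Mapping.keys p. mdeg m = d}. Poly_Mapping.single m (Poly_Mapping.lookup p m))"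

definition forms :: "nat \<Rightarrow> nat \<Rightarrow> ('k::field) mpol set" where
  "forms n d = {f \<in> carrier (coord_ring n). homog d f}"

definition homog_ideal :: "nat \<Rightarrow> ('k::field) mpol set \<Rightarrow> bool" where
  "homog_ideal n I \<longleftrightarrow> ideal I (coord_ring n) \<and> (\<forall>f\<in>I. \<forall>d. hom_part d f \<in> I)"

definition const :: "'k::field \<Rightarrow> 'k mpol" where
  "const c = Poly_Mapping.single 0 c"

definition irrelevant_ideal :: "nat \<Rightarrow> ('k::field) mpol set" where
  "irrelevant_ideal n = {f \<in> carrier (coord_ring n). Poly_Mapping.lookup f 0 = 0}"


section \<open>Projective space and its closed subschemes\<close>

text \<open>The points of the scheme \<open>\<bbbP>\<^sup>n = Proj R\<close>.\<close>

definition Proj :: "nat \<Rightarrow> ('k::field) mpol set set" where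
  "Proj n = {P. primeideal P (coord_ring n) \<and> homog_ideal n P \<and> \<not> irrelevant_ideal n \<subseteq> P}"

text \<open>
  All sheaves below are subsheaves of the constant sheaf with value the fraction field of \<open>R\<close>, and
  are given by their stalks. For a homogeneous ideal \<open>I\<close>, \<^term>\<open>tilde n I d P\<close> is the stalk at \<open>P\<close>
  of the sheaf associated with the graded module \<open>I(d)\<close>, that is, the degree \<open>d\<close> part of the
  homogeneous localization of \<open>I\<close> at \<open>P\<close>.
\<close>

type_synonym 'k stalks = "'k mpol set \<Rightarrow> 'k mpol fract set"

definition tilde :: "nat \<Rightarrow> ('k::field) mpol set \<Rightarrow> nat \<Rightarrow> 'k stalks" where
  "tilde n I d P = {Fract f g | f g m. f \<in> I \<and> homog (m + d) f \<and> g \<in> forms n m \<and> g \<notin> P}"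

abbreviation O_twist :: "nat \<Rightarrow> nat \<Rightarrow> ('k::field) stalks" where
  "O_twist n d \<equiv> tilde n (carrier (coord_ring n)) d"

definition local_ring :: "nat \<Rightarrow> ('k::field) mpol set \<Rightarrow> 'k mpol fract ring" where
  "local_ring n P = \<lparr>carrier = O_twist n 0 P, mult = (*), one = 1, zero = 0, add = (+)\<rparr>"

text \<open>
  A closed subscheme \<open>X\<close> of \<open>\<bbbP>\<^sup>n\<close> is represented by (the stalks of) its ideal sheaf
  \<open>\<I>\<^sub>X \<subseteq> \<O>\<close>. Quasi-coherence: on suitable basic open sets \<open>D\<^sub>+(h)\<close> covering \<open>\<bbbP>\<^sup>n\<close>, the ideal sheaf
  is generated by a set of sections over \<open>D\<^sub>+(h)\<close>, i.e. of elements of the degree-zero part of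
  \<open>R\<^sub>h\<close>.
\<close>

definition closed_subscheme :: "nat \<Rightarrow> ('k::field) stalks \<Rightarrow> bool" where
  "closed_subscheme n X \<longleftrightarrow> (\<forall>P\<in>Proj n. \<exists>d. \<exists>h\<in>forms n d. h \<notin> P \<and>
     (\<exists>A \<subseteq> {Fract f (h ^ m) | f m. f \<in> forms n (m * d)}.
        \<forall>Q\<in>Proj n. h \<notin> Q \<longrightarrow> X Q = genideal (local_ring n Q) A))"

text \<open>Reducedness of the local rings \<open>\<O>\<^bsub>X,P\<^esub> = \<O>\<^bsub>\<bbbP>,P\<^esub> / \<I>\<^bsub>X,P\<^esub>\<close>.\<close>

definition reduced :: "nat \<Rightarrow> ('k::field) stalks \<Rightarrow> bool" where
  "reduced n X \<longleftrightarrow> (\<forall>P\<in>Proj n. \<forall>s\<in>carrier (local_ring n P). \<forall>m. s ^ m \<in> X P \<longrightarrow> s \<in> X P)"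

text \<open>The hyperplane \<open>l = 0\<close> contains \<open>X\<close> iff its ideal sheaf is contained in that of \<open>X\<close>.\<close>

definition nondegenerate :: "nat \<Rightarrow> ('k::field) stalks \<Rightarrow> bool" where
  "nondegenerate n X \<longleftrightarrow> \<not> (\<exists>l\<in>forms n 1. l \<noteq> 0 \<and>
     (\<forall>P\<in>Proj n. tilde n (genideal (coord_ring n) {l}) 0 P \<subseteq> X P))"

definition supp :: "nat \<Rightarrow> ('k::field) stalks \<Rightarrow> 'k mpol set set" where
  "supp n X = {P \<in> Proj n. X P \<noteq> carrier (local_ring n P)}"

text \<open>
  The codimension of a closed subset: the infimum, over the irreducible closed sets \<open>Z\<close> contained in
  it, of the supremum of the lengths of chains of irreducible closed sets starting at \<open>Z\<close>.
  Irreducible closed sets are the closures of points, and inclusion is reversed on passing to the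
  corresponding homogeneous primes. The empty set has codimension \<open>\<infinity>\<close>.
\<close>

definition height :: "nat \<Rightarrow> ('k::field) mpol set \<Rightarrow> enat" where
  "height n P = (SUP m \<in> {m. \<exists>c. c m = P \<and> (\<forall>i\<le>m. c i \<in> Proj n) \<and> (\<forall>i<m. c i \<subset> c (Suc i))}. enat m)"

definition codim :: "nat \<Rightarrow> ('k::field) stalks \<Rightarrow> enat" where
  "codim n X = (INF P \<in> supp n X. height n P)"

definition quadratic_ideal :: "nat \<Rightarrow> ('k::field) mpol set \<Rightarrow> 'k stalks \<Rightarrow> bool" where
  "quadratic_ideal n I X \<longleftrightarrow> homog_ideal n I \<and>
     (\<exists>G \<subseteq> forms n 2. I = genideal (coord_ring n) G) \<and>
     (\<forall>P\<in>Proj n. tilde n I 0 P = X P)"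

text \<open>
  \<open>\<I>\<^sub>X(d) = \<I>\<^sub>X \<otimes> \<O>(d)\<close>, which is the product \<open>\<I>\<^sub>X \<cdot> \<O>(d)\<close> inside the constant sheaf; since the
  stalk of \<open>\<O>(d)\<close> is free of rank one over the local ring, no sums of products are needed.
\<close>

definition twist :: "nat \<Rightarrow> ('k::field) stalks \<Rightarrow> nat \<Rightarrow> 'k stalks" where
  "twist n X d P = {s * t | s t. s \<in> X P \<and> t \<in> O_twist n d P}"

text \<open>
  The saturated ideal \<open>I\<^sub>X = \<Oplus>\<^sub>d H\<^sup>0(\<I>\<^sub>X(d)) \<subseteq> \<Oplus>\<^sub>d H\<^sup>0(\<O>(d)) = R\<close>.
\<close>

definition saturated_ideal :: "nat \<Rightarrow> ('k::field) stalks \<Rightarrow> 'k mpol set" where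
  "saturated_ideal n X = {f \<in> carrier (coord_ring n).
     \<forall>d. \<forall>P\<in>Proj n. Fract (hom_part d f) 1 \<in> twist n X d P}"

text \<open>
  Global sections of a subsheaf of the constant sheaf with stalks \<open>F\<close>: locally constant functions
  with \<open>s P \<in> F P\<close> for all points \<open>P\<close>. Since functions are total, they are normalized to be \<open>0\<close> outside
  \<^term>\<open>Proj n\<close>.
\<close>

definition global_sections :: "nat \<Rightarrow> ('k::field) stalks \<Rightarrow> ('k mpol set \<Rightarrow> 'k mpol fract) set" where
  "global_sections n F = {s. (\<forall>P. P \<notin> Proj n \<longrightarrow> s P = 0) \<and>
     (\<forall>P\<in>Proj n. s P \<in> F P \<and>
        (\<exists>d. \<exists>h\<in>forms n d. h \<notin> P \<and> (\<forall>Q\<in>Proj n. h \<notin> Q \<longrightarrow> s Q = s P)))}"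

definition scale_section ::
  "'k::field \<Rightarrow> ('k mpol set \<Rightarrow> 'k mpol fract) \<Rightarrow> ('k mpol set \<Rightarrow> 'k mpol fract)" where
  "scale_section c s = (\<lambda>P. Fract (const c) 1 * s P)"

definition h0 :: "nat \<Rightarrow> ('k::field) stalks \<Rightarrow> nat" where
  "h0 n F = vector_space.dim scale_section (global_sections n F)"


section \<open>Graded free resolutions and Tor\<close>

text \<open>
  Complexes of finitely generated graded free modules \<open>F\<^sub>i = \<Oplus>\<^bsub>j < rk i\<^esub> R(-shift i j)\<close>. The matrix
  \<open>diff i\<close> describes the map \<open>F\<^bsub>i+1\<^esub> \<rightarrow> F\<^sub>i\<close>, and the row \<open>aug\<close> the map \<open>F\<^sub>0 \<rightarrow> R\<close>.
\<close>

record 'a free_complex =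
  rk :: "nat \<Rightarrow> nat"
  shift :: "nat \<Rightarrow> nat \<Rightarrow> nat"
  diff :: "nat \<Rightarrow> nat \<Rightarrow> nat \<Rightarrow> 'a"
  aug :: "nat \<Rightarrow> 'a"

definition free_mod :: "nat \<Rightarrow> nat \<Rightarrow> (nat \<Rightarrow> ('k::field) mpol) set" where
  "free_mod n b = {v. (\<forall>j<b. v j \<in> carrier (coord_ring n)) \<and> (\<forall>j\<ge>b. v j = 0)}"

definition mat_app :: "nat \<Rightarrow> nat \<Rightarrow> (nat \<Rightarrow> nat \<Rightarrow> 'a) \<Rightarrow> (nat \<Rightarrow> 'a) \<Rightarrow> nat \<Rightarrow> 'a::comm_ring_1" where
  "mat_app a b D v = (\<lambda>l. if l < a then \<Sum>j<b. D l j * v j else 0)"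

definition diff_map :: "('k::field) mpol free_complex \<Rightarrow> nat \<Rightarrow> (nat \<Rightarrow> 'k mpol) \<Rightarrow> nat \<Rightarrow> 'k mpol" where
  "diff_map F i = mat_app (rk F i) (rk F (Suc i)) (diff F i)"

definition aug_map :: "('k::field) mpol free_complex \<Rightarrow> (nat \<Rightarrow> 'k mpol) \<Rightarrow> 'k mpol" where
  "aug_map F v = (\<Sum>j<rk F 0. aug F j * v j)"

text \<open>
  \<open>F\<close> is a graded free resolution of the graded module \<open>A/B\<close>, where \<open>B \<subseteq> A\<close> are homogeneous ideals
  of \<open>R\<close>: \<open>\<dots> \<rightarrow> F\<^sub>1 \<rightarrow> F\<^sub>0 \<rightarrow> A/B \<rightarrow> 0\<close> is exact with maps of degree zero.
\<close>

definition graded_free_resolution ::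
  "nat \<Rightarrow> ('k::field) mpol set \<Rightarrow> 'k mpol set \<Rightarrow> 'k mpol free_complex \<Rightarrow> bool" where
  "graded_free_resolution n A B F \<longleftrightarrow>
     (\<forall>j<rk F 0. aug F j \<in> A \<and> homog (shift F 0 j) (aug F j)) \<and>
     (\<forall>i. \<forall>l<rk F i. \<forall>j<rk F (Suc i). diff F i l j \<in> carrier (coord_ring n) \<and>
        (\<forall>m\<in>Poly_Mapping.keys (diff F i l j). shift F i l + mdeg m = shift F (Suc i) j)) \<and>
     (\<forall>a\<in>A. \<exists>v\<in>free_mod n (rk F 0). a - aug_map F v \<in> B) \<and>
     {v \<in> free_mod n (rk F 0). aug_map F v \<in> B} = diff_map F 0 ` free_mod n (rk F 1) \<and>
     (\<forall>i. {v \<in> free_mod n (rk F (Suc i)). diff_map F i v = 0}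
            = diff_map F (Suc i) ` free_mod n (rk F (Suc (Suc i))))"

text \<open>
  The degree \<open>d\<close> part of \<open>F\<^sub>i \<otimes>\<^sub>R k\<close> has the basis vectors of \<open>F\<^sub>i\<close> of degree \<open>d\<close> as a basis, and the
  differential of \<open>F \<otimes>\<^sub>R k\<close> is given by the constant terms of the matrices of \<open>F\<close>.
\<close>

definition fibre :: "('k::field) mpol free_complex \<Rightarrow> nat \<Rightarrow> nat \<Rightarrow> (nat \<Rightarrow> 'k) set" where
  "fibre F i d = {w. \<forall>j. w j \<noteq> 0 \<longrightarrow> j < rk F i \<and> shift F i j = d}"

definition fibre_map :: "('k::field) mpol free_complex \<Rightarrow> nat \<Rightarrow> (nat \<Rightarrow> 'k) \<Rightarrow> nat \<Rightarrow> 'k" where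
  "fibre_map F i = mat_app (rk F i) (rk F (Suc i)) (\<lambda>l j. Poly_Mapping.lookup (diff F i l j) 0)"

definition cycles :: "('k::field) mpol free_complex \<Rightarrow> nat \<Rightarrow> nat \<Rightarrow> (nat \<Rightarrow> 'k) set" where
  "cycles F i d = {w \<in> fibre F i d. \<forall>i'. i = Suc i' \<longrightarrow> fibre_map F i' w = 0}"

definition boundaries :: "('k::field) mpol free_complex \<Rightarrow> nat \<Rightarrow> nat \<Rightarrow> (nat \<Rightarrow> 'k) set" where
  "boundaries F i d = fibre_map F i ` fibre F (Suc i) d"

definition scale_vec :: "'k::field \<Rightarrow> (nat \<Rightarrow> 'k) \<Rightarrow> (nat \<Rightarrow> 'k)" where
  "scale_vec c w = (\<lambda>j. c * w j)"

definition homology_dim :: "('k::field) mpol free_complex \<Rightarrow> nat \<Rightarrow> nat \<Rightarrow> nat" where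
  "homology_dim F i d =
     vector_space.dim scale_vec (cycles F i d) - vector_space.dim scale_vec (boundaries F i d)"

text \<open>
  \<open>dim\<^sub>k Tor\<^sub>i\<^sup>R(A/B, k)\<^sub>d\<close>. Graded free resolutions by finitely generated modules exist because \<open>R\<close> is
  noetherian, and the value does not depend on the chosen one.
\<close>

definition tor_dim :: "nat \<Rightarrow> ('k::field) mpol set \<Rightarrow> 'k mpol set \<Rightarrow> nat \<Rightarrow> nat \<Rightarrow> nat" where
  "tor_dim n A B i d = homology_dim (SOME F. graded_free_resolution n A B F) i d"

definition property_N2 :: "nat \<Rightarrow> nat \<Rightarrow> ('k::field) mpol set \<Rightarrow> bool" where
  "property_N2 n p I \<longleftrightarrow>
     (\<forall>i\<le>p. \<forall>j\<ge>2. tor_dim n (carrier (coord_ring n)) I i (i + j) = 0)"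

definition betti02 :: "nat \<Rightarrow> ('k::field) mpol set \<Rightarrow> nat" where
  "betti02 n I = tor_dim n I {0} 0 2"


section \<open>The structures used above are what they should be\<close>

lemma cring_coord_ring: "cring (coord_ring n :: ('k::field) mpol ring)"
proof -
  have add: "Poly_Mapping.keys m \<subseteq> {..n}" if "m \<in> Poly_Mapping.keys (p + q)"
    "\<forall>m\<in>Poly_Mapping.keys p. Poly_Mapping.keys m \<subseteq> {..n}" "\<forall>m\<in>Poly_Mapping.keys q. Poly_Mapping.keys m \<subseteq> {..n}" for p q :: "'k mpol" and m
    using that Poly_Mapping.keys_add[of p q] by blast
  have mult: "Poly_Mapping.keys m \<subseteq> {..n}" if prems: "m \<in> Poly_Mapping.keys (p * q)"
    "\<forall>m\<in>Poly_Mapping.keys p. Poly_Mapping.keys m \<subseteq> {..n}" "\<forall>m\<in>Poly_Mapping.keys q. Poly_Mapping.keys m \<subseteq> {..n}" for p q :: "'k mpol" and m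
  proof -
    obtain a b where "m = a + b" "a \<in> Poly_Mapping.keys p" "b \<in> Poly_Mapping.keys q"
      using prems(1) Poly_Mapping.keys_mult[of p q] by blast
    then show ?thesis using Poly_Mapping.keys_add[of a b] prems by blast
  qed
  have inv: "\<exists>y. (\<forall>m\<in>Poly_Mapping.keys y. Poly_Mapping.keys m \<subseteq> {..n}) \<and> x + y = 0"
    if "\<forall>m\<in>Poly_Mapping.keys x. Poly_Mapping.keys m \<subseteq> {..n}" for x :: "'k mpol"
    by (rule exI[of _ "- x"]) (use that in simp)
  show ?thesis
    by (rule cringI, rule abelian_groupI)
      (auto simp: coord_ring_def algebra_simps comm_monoid_def monoid_def comm_monoid_axioms_def
        dest: add mult intro: inv)
qed

lemma mdeg_add: "mdeg (a + b) = mdeg a + mdeg b"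
proof -
  have *: "mdeg c = (\<Sum>x\<in>Poly_Mapping.keys a \<union> Poly_Mapping.keys b. Poly_Mapping.lookup c x)"
    if "Poly_Mapping.keys c \<subseteq> Poly_Mapping.keys a \<union> Poly_Mapping.keys b" for c
    unfolding mdeg_def using that
    by (intro sum.mono_neutral_left) (auto simp: in_keys_iff)
  show ?thesis
    using Poly_Mapping.keys_add[of a b] by (simp add: * lookup_add sum.distrib)
qed

lemma forms_add: "f \<in> forms n d \<Longrightarrow> g \<in> forms n d \<Longrightarrow> f + g \<in> forms n d"
  using Poly_Mapping.keys_add[of f g] unfolding forms_def coord_ring_def homog_def by fastforce

lemma forms_mult:
  assumes "f \<in> forms n d" "g \<in> forms n d'"
  shows "f * g \<in> forms n (d + d')"
proof -
  have "Poly_Mapping.keys m \<subseteq> {..n} \<and> mdeg m = d + d'" if m: "m \<in> Poly_Mapping.keys (f * g)" for m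
  proof -
    obtain a b where "m = a + b" "a \<in> Poly_Mapping.keys f" "b \<in> Poly_Mapping.keys g"
      using m Poly_Mapping.keys_mult[of f g] by blast
    then show ?thesis
      using Poly_Mapping.keys_add[of a b] assms
      by (fastforce simp: forms_def coord_ring_def homog_def mdeg_add)
  qed
  then show ?thesis by (auto simp: forms_def coord_ring_def homog_def)
qed

lemma cring_local_ring:
  assumes P: "P \<in> Proj n"
  shows "cring (local_ring n P :: ('k::field) mpol fract ring)"
proof -
  interpret primeideal P "coord_ring n" using P by (simp add: Proj_def)
  have O: "O_twist n 0 P = {Fract f g | f g m. f \<in> forms n m \<and> g \<in> forms n m \<and> g \<notin> P}"
    by (auto simp: tilde_def forms_def)
  have z: "0 \<in> P" using a_subset additive_subgroup.zero_closed[OF is_additive_subgroup]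
    by (simp add: coord_ring_def)
  have pm: "g * g' \<notin> P" if "g \<in> forms n m" "g' \<in> forms n m'" "g \<notin> P" "g' \<notin> P" for g g' m m'
    using I_prime[of g g'] that by (auto simp: forms_def coord_ring_def)
  have one: "1 \<notin> P"
    using one_imp_carrier I_notcarr by (auto simp: coord_ring_def)
  have form1: "1 \<in> forms n 0" and form0: "0 \<in> forms n m" for m
    by (auto simp: forms_def coord_ring_def homog_def mdeg_def)
  have neg: "- f \<in> forms n m" if "f \<in> forms n m" for f m
    using that by (auto simp: forms_def coord_ring_def homog_def)
  have add: "x + y \<in> O_twist n 0 P" if xy: "x \<in> O_twist n 0 P" "y \<in> O_twist n 0 P" for x y
  proof -
    obtain f g m where x: "x = Fract f g" "f \<in> forms n m" "g \<in> forms n m" "g \<notin> P" using xy(1) O by auto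
    obtain f' g' m' where y: "y = Fract f' g'" "f' \<in> forms n m'" "g' \<in> forms n m'" "g' \<notin> P"
      using xy(2) O by auto
    have "x + y = Fract (f * g' + f' * g) (g * g')" 
      unfolding x(1) y(1) using x(4) y(4) z by (intro add_fract) auto
    moreover have "f * g' + f' * g \<in> forms n (m + m')"
      using forms_mult[OF x(2) y(3)] forms_mult[OF y(2) x(3)] by (auto intro: forms_add simp: add.commute)
    ultimately show ?thesis using forms_mult[OF x(3) y(3)] pm x y O by blast
  qed
  have mult: "x * y \<in> O_twist n 0 P" if xy: "x \<in> O_twist n 0 P" "y \<in> O_twist n 0 P" for x y
  proof -
    obtain f g m where x: "x = Fract f g" "f \<in> forms n m" "g \<in> forms n m" "g \<notin> P" using xy(1) O by auto
    obtain f' g' m' where y: "y = Fract f' g'" "f' \<in> forms n m'" "g' \<in> forms n m'" "g' \<notin> P"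
      using xy(2) O by auto
    have "x * y = Fract (f * f') (g * g')" using x y by simp
    then show ?thesis using forms_mult[OF x(3) y(3)] forms_mult[OF x(2) y(2)] pm x y O by blast
  qed
  have uminus: "- x \<in> O_twist n 0 P" if x: "x \<in> O_twist n 0 P" for x
    using x neg unfolding O by fastforce
  have one': "1 \<in> O_twist n 0 P" and zero': "0 \<in> O_twist n 0 P"
    unfolding O One_fract_def Zero_fract_def using form1 form0 one by blast+
  have inv: "\<exists>y\<in>O_twist n 0 P. x + y = 0" if "x \<in> O_twist n 0 P" for x
    by (rule bexI[OF _ uminus[OF that]]) simp
  show ?thesis
    by (rule cringI, rule abelian_groupI)
      (auto simp: local_ring_def algebra_simps comm_monoid_def monoid_def comm_monoid_axioms_def
        intro: add mult one' zero' inv)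
qed

lemma vector_space_scale_section: "vector_space (scale_section :: 'k::field \<Rightarrow> _)"
proof
  fix a b :: 'k and x y :: "'k mpol set \<Rightarrow> 'k mpol fract"
  show "scale_section a (x + y) = scale_section a x + scale_section a y"
    by (simp add: scale_section_def fun_eq_iff algebra_simps)
  have "Fract (const (a + b)) 1 = Fract (const a) 1 + Fract (const b) 1"
    by (simp add: const_def single_add)
  then show "scale_section (a + b) x = scale_section a x + scale_section b x"
    by (simp only: scale_section_def fun_eq_iff plus_fun_def ring_distribs) simp
  have "Fract (const (a * b)) 1 = Fract (const a) 1 * Fract (const b) 1"
    by (simp add: const_def mult_single)
  then show "scale_section a (scale_section b x) = scale_section (a * b) x"
    by (simp add: scale_section_def fun_eq_iff algebra_simps)
  have "Fract (const 1) 1 = (1 :: 'k mpol fract)"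
    by (simp add: const_def One_fract_def)
  then show "scale_section 1 x = x"
    by (simp add: scale_section_def)
qed

lemma vector_space_scale_vec: "vector_space (scale_vec :: 'k::field \<Rightarrow> _)"
  by standard (auto simp: scale_vec_def fun_eq_iff algebra_simps)

end

theory Submission imports Defs
begin

text \<open>
  The lower bound \<open>dim I\<^sub>2 \<ge> e + (e - 1) + \<dots> + (e - p + 1)\<close> is obtained by projecting from a general
  point \<open>q\<close> of \<open>X\<close>, moved to \<open>(0 : \<dots> : 0 : 1)\<close> by a shear. Since \<open>X\<close> is reduced and cut out by \<open>I\<close>, the
  tangent cone at \<open>q\<close> is a linear space of codimension \<open>|C| \<ge> e\<close>, and its equations \<open>l\<^sub>c\<close> are leading
  coefficients of quadrics \<open>x\<^sub>n l\<^sub>c + Q\<^sub>c\<close> in \<open>I\<close>. The quadrics of \<open>I\<close> that do not involve \<open>x\<^sub>n\<close> belong to the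
  elimination ideal \<open>I' = I \<inter> k[x\<^sub>0, \<dots>, x\<^bsub>n-1\<^esub>]\<close>, so \<open>dim I\<^sub>2 \<ge> |C| + dim I'\<^sub>2\<close>, and one concludes by
  induction on \<open>p\<close>: \<open>I'\<close> inherits reducedness away from the irrelevant ideal, nondegeneracy, codimension
  at least \<open>e - 1\<close> and property \<open>N\<^bsub>2,p-1\<^esub>\<close>. For the last point, \<open>N\<^bsub>2,p\<^esub>\<close> is read as the vanishing of the
  Koszul homology of \<open>R/I\<close> in exterior degrees \<open>1, \<dots>, p\<close> and coefficient degrees \<open>\<ge> 2\<close>. It makes
  multiplication by \<open>x\<^sub>n\<close> injective, respectively surjective, on the Koszul homology of \<open>R/I\<close> with
  respect to \<open>x\<^sub>0, \<dots>, x\<^bsub>n-1\<^esub>\<close> in these degrees, which carries the vanishing, known for \<open>I'\<close> in large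
  degrees by the existence of finite resolutions, down to degree two.

  For the upper bound and the last equality, the saturated ideal contains \<open>I\<close>, and a global section of
  \<open>\<I>\<^sub>X(2)\<close> is a single fraction with a denominator ideal primary to the irrelevant ideal, hence a form.
\<close>

section \<open>Polynomials in a set of variables\<close>

text \<open>Let S = k[x_0, ..., x_{n-1}], let I' be the elimination ideal, and filter R/I by the
  degree in x_n. The tangent cone at the centre of projection is linear and its equations come from
  quadrics of I, so the subquotients in positive x_n-degree are copies of S modulo linear forms.
  Their Koszul homology sits in coefficient degree 0 alone. Hence a chain over R can be pushed down
  to S except for a constant symbol at the highest possible power of x_n. This symbol is the
  obstacle: it is lifted to a cycle in a large degree, where exactness over S is known, and brought
  back by the surjectivity of x_n. Injectivity in exterior degree i and surjectivity in degree i + 1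
  both come from exactness in degree i + 1, which is why each projection costs one unit of p.

  I' need not be saturated, so reducedness, nondegeneracy and codimension are stated for homogeneous
  ideals up to the irrelevant ideal. Linearity of the tangent cone is obtained by differentiating
  equations, without regular local rings.\<close>

abbreviation lookup :: "('a \<Rightarrow>\<^sub>0 'b::zero) \<Rightarrow> 'a \<Rightarrow> 'b" where "lookup \<equiv> Poly_Mapping.lookup"
abbreviation keys :: "('a \<Rightarrow>\<^sub>0 'b::zero) \<Rightarrow> 'a set" where "keys \<equiv> Poly_Mapping.keys"
abbreviation single :: "'a \<Rightarrow> 'b \<Rightarrow> ('a \<Rightarrow>\<^sub>0 'b::zero)" where "single \<equiv> Poly_Mapping.single"

definition PV :: "nat set \<Rightarrow> ('k::field) mpol set" where
  "PV B = {p. \<forall>m\<in>keys p. keys m \<subseteq> B}"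

definition Var :: "nat \<Rightarrow> ('k::field) mpol" where "Var i = single (single i 1) 1"

lemma mpol_sum: "p = (\<Sum>m\<in>keys p. single m (lookup p m))"
  by (rule poly_mapping_eqI)
    (auto simp: lookup_sum lookup_single when_def in_keys_iff sum.delta)

lemma mpol_induct [consumes 0, case_names zero single add]:
  assumes "Q 0" "\<And>m c. m \<in> keys p \<Longrightarrow> Q (single m c)" "\<And>p q. Q p \<Longrightarrow> Q q \<Longrightarrow> Q (p + q)"
  shows "Q (p :: 'a \<Rightarrow>\<^sub>0 'b::comm_monoid_add)"
proof -
  have "Q (\<Sum>m\<in>A. single m (lookup p m))" if "finite A" "A \<subseteq> keys p" for A
    using that by (induction A rule: finite_induct) (auto intro: assms)
  then show ?thesis using mpol_sum[of p] by (metis finite_keys order_refl)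
qed

lemma additive_sum:
  assumes "f 0 = (0::'b::comm_monoid_add)" "\<And>x y. f (x + y) = f x + f y"
  shows "f (sum g A) = (\<Sum>x\<in>A. f (g x))"
  using assms by (induction A rule: infinite_finite_induct) auto

lemma PV_add: "p \<in> PV B \<Longrightarrow> q \<in> PV B \<Longrightarrow> p + q \<in> PV B"
  using Poly_Mapping.keys_add[of p q] by (auto simp: PV_def)

lemma PV_mult:
  assumes "p \<in> PV B" "q \<in> PV B" shows "p * q \<in> PV B"
proof -
  have "keys m \<subseteq> B" if "m \<in> keys (p * q)" for m
  proof -
    obtain a b where "m = a + b" "a \<in> keys p" "b \<in> keys q"
      using \<open>m \<in> _\<close> Poly_Mapping.keys_mult[of p q] by blast
    then show ?thesis using Poly_Mapping.keys_add[of a b] assms by (auto simp: PV_def)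
  qed
  then show ?thesis by (auto simp: PV_def)
qed

lemma PV_zero [simp]: "0 \<in> PV B" by (auto simp: PV_def)
lemma PV_one [simp]: "1 \<in> PV B" by (auto simp: PV_def)
lemma PV_const [simp]: "const c \<in> PV B" by (auto simp: PV_def const_def)
lemma PV_uminus: "p \<in> PV B \<Longrightarrow> - p \<in> PV B" by (auto simp: PV_def)
lemma PV_minus: "p \<in> PV B \<Longrightarrow> q \<in> PV B \<Longrightarrow> p - q \<in> PV B"
  using PV_add[of p B "- q"] PV_uminus[of q B] by simp
lemma PV_Var [simp]: "i \<in> B \<Longrightarrow> Var i \<in> PV B" by (auto simp: PV_def Var_def)
lemma PV_sum: "(\<And>x. x \<in> A \<Longrightarrow> f x \<in> PV B) \<Longrightarrow> sum f A \<in> PV B"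
  by (induction A rule: infinite_finite_induct) (auto intro: PV_add)
lemma PV_prod: "(\<And>x. x \<in> A \<Longrightarrow> f x \<in> PV B) \<Longrightarrow> prod f A \<in> PV B"
  by (induction A rule: infinite_finite_induct) (auto intro: PV_mult)
lemma PV_power: "p \<in> PV B \<Longrightarrow> p ^ k \<in> PV B"
  by (induction k) (auto intro: PV_mult)
lemma PV_mono: "p \<in> PV A \<Longrightarrow> A \<subseteq> B \<Longrightarrow> p \<in> PV B" by (auto simp: PV_def)

lemmas PV_intros = PV_add PV_mult PV_uminus PV_minus PV_sum PV_prod PV_power

lemma carrier_coord_ring: "carrier (coord_ring n) = PV {..n}"
  by (simp add: coord_ring_def PV_def)

lemma const_0 [simp]: "const 0 = 0" and const_1 [simp]: "const 1 = 1"
  by (auto simp: const_def)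
lemma const_add: "const (a + b) = const a + const b" by (simp add: const_def single_add)
lemma const_mult: "const (a * b) = const a * const b" by (simp add: const_def mult_single)
lemma const_uminus: "const (- a) = - const a" by (simp add: const_def single_uminus)
lemma const_eq_0 [simp]: "const c = 0 \<longleftrightarrow> c = 0"
  unfolding const_def by (metis single_zero lookup_single_eq lookup_zero)

lemma lookup_const_mult [simp]: "lookup (const c * p) m = c * lookup p m"
proof (induction p rule: mpol_induct)
  case (single m' d)
  then show ?case by (simp add: const_def mult_single lookup_single when_def)
qed (auto simp: algebra_simps lookup_add)

lemma Var_power: "Var i ^ k = (single (single i k) 1 :: 'a::field mpol)"
proof (induction k)
  case (Suc k)
  have "Var i ^ Suc k = (Var i * Var i ^ k :: 'a mpol)" by simp
  also have "\<dots> = single (single i (Suc k)) 1"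
    unfolding Suc unfolding Var_def by (simp add: mult_single flip: single_add)
  finally show ?case .
qed simp

lemma single_prod_Var: "single m (c::'a::field) = const c * (\<Prod>i\<in>keys m. Var i ^ lookup m i)"
proof -
  have "(\<Prod>i\<in>A. Var i ^ lookup m i) = (single (\<Sum>i\<in>A. single i (lookup m i)) 1 :: 'a mpol)" if "finite A" for A
    using that by (induction A rule: finite_induct) (auto simp: Var_power mult_single)
  moreover have "(\<Sum>i\<in>keys m. single i (lookup m i)) = m"
    by (rule poly_mapping_eqI)
      (auto simp: lookup_sum lookup_single when_def in_keys_iff sum.delta)
  ultimately have "(\<Prod>i\<in>keys m. Var i ^ lookup m i) = (single m 1 :: 'a mpol)" by simp
  then show ?thesis unfolding const_def by (simp add: mult_single)
qed

lemma PV_induct [consumes 1, case_names const Var add mult]: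
  assumes "p \<in> PV B" "\<And>c. Q (const c)" "\<And>i. i \<in> B \<Longrightarrow> Q (Var i)"
    "\<And>p q. p \<in> PV B \<Longrightarrow> q \<in> PV B \<Longrightarrow> Q p \<Longrightarrow> Q q \<Longrightarrow> Q (p + q)"
    "\<And>p q. p \<in> PV B \<Longrightarrow> q \<in> PV B \<Longrightarrow> Q p \<Longrightarrow> Q q \<Longrightarrow> Q (p * q)"
  shows "Q p"
proof -
  let ?Q = "\<lambda>p. p \<in> PV B \<and> Q p"
  have pow: "?Q (p ^ k)" if "?Q p" for p k
    using that assms(2)[of 1] by (induction k) (auto intro: assms PV_intros)
  have prod: "?Q (prod f A)" if "\<And>i. i \<in> A \<Longrightarrow> ?Q (f i)" for f and A :: "nat set"
    using that assms(2)[of 1] by (induction A rule: infinite_finite_induct) (auto intro: assms PV_intros)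
  have "?Q p"
  proof (induction p rule: mpol_induct)
    case zero
    then show ?case using assms(2)[of 0] by simp
  next
    case (single m c)
    then have "keys m \<subseteq> B" using assms(1) by (auto simp: PV_def)
    then have "?Q (\<Prod>i\<in>keys m. Var i ^ lookup m i)"
      by (intro prod pow) (auto intro: assms)
    then show ?case unfolding single_prod_Var by (auto intro!: assms PV_intros)
  next
    case (add p q)
    then show ?case by (auto intro: assms PV_intros)
  qed
  then show ?thesis by simp
qed

subsection \<open>Evaluation homomorphisms\<close>

definition mon :: "(nat \<Rightarrow> 'b::comm_ring_1) \<Rightarrow> (nat \<Rightarrow>\<^sub>0 nat) \<Rightarrow> 'b" where
  "mon g m = (\<Prod>i\<in>keys m. g i ^ lookup m i)"

definition ev :: "('k::field \<Rightarrow> 'b) \<Rightarrow> (nat \<Rightarrow> 'b) \<Rightarrow> 'k mpol \<Rightarrow> 'b::comm_ring_1" where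
  "ev h g p = (\<Sum>m\<in>keys p. h (lookup p m) * mon g m)"

definition rhom :: "('a::comm_ring_1 \<Rightarrow> 'b::comm_ring_1) \<Rightarrow> bool" where
  "rhom h \<longleftrightarrow> h 0 = 0 \<and> h 1 = 1 \<and> (\<forall>a b. h (a + b) = h a + h b) \<and> (\<forall>a b. h (a * b) = h a * h b)"

lemma rhomD:
  assumes "rhom h"
  shows "h 0 = 0" "h 1 = 1" "h (a + b) = h a + h b" "h (a * b) = h a * h b"
  using assms by (auto simp: rhom_def)

lemma rhom_uminus: "rhom h \<Longrightarrow> h (- a) = - h a"
  using rhomD(1,3)[of h] by (metis add.left_inverse add_eq_0_iff)
lemma rhom_minus: "rhom h \<Longrightarrow> h (a - b) = h a - h b"
  using rhomD(3)[of h a "- b"] rhom_uminus[of h b] by simp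
lemma rhom_sum: "rhom h \<Longrightarrow> h (sum f A) = (\<Sum>x\<in>A. h (f x))"
  by (rule additive_sum) (auto simp: rhomD)
lemma rhom_prod: "rhom h \<Longrightarrow> h (prod f A) = (\<Prod>x\<in>A. h (f x))"
  by (induction A rule: infinite_finite_induct) (auto simp: rhomD)
lemma rhom_power: "rhom h \<Longrightarrow> h (a ^ k) = h a ^ k"
  by (induction k) (auto simp: rhomD)

lemmas rhom_simps = rhomD rhom_uminus rhom_minus rhom_sum rhom_prod rhom_power

lemma rhom_const: "rhom const" by (auto simp: rhom_def const_add const_mult)
lemma rhom_id: "rhom (\<lambda>x. x)" by (auto simp: rhom_def)

lemma mon_add: "mon g (a + b) = mon g a * mon g b"
proof -
  have *: "mon g c = (\<Prod>i\<in>keys a \<union> keys b. g i ^ lookup c i)" if "keys c \<subseteq> keys a \<union> keys b" for c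
    unfolding mon_def using that by (intro prod.mono_neutral_left) (auto simp: in_keys_iff)
  show ?thesis
    using Poly_Mapping.keys_add[of a b]
    by (simp add: * lookup_add power_add prod.distrib)
qed

lemma mon_0 [simp]: "mon g 0 = 1" by (simp add: mon_def)
lemma mon_single [simp]: "mon g (single i k) = g i ^ k" by (cases "k = 0") (auto simp: mon_def)

lemma ev_rhom:
  assumes "rhom h" shows "rhom (ev h g)"
proof -
  note [simp] = rhomD[OF assms]
  have sng: "ev h g (single m c) = h c * mon g m" for m c
    by (cases "c = 0") (auto simp: ev_def)
  have add: "ev h g (p + q) = ev h g p + ev h g q" for p q
  proof -
    have *: "ev h g r = (\<Sum>m\<in>keys p \<union> keys q. h (lookup r m) * mon g m)"
      if "keys r \<subseteq> keys p \<union> keys q" for r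
      unfolding ev_def using that by (intro sum.mono_neutral_left) (auto simp: in_keys_iff)
    show ?thesis using Poly_Mapping.keys_add[of p q]
      by (simp add: * lookup_add algebra_simps sum.distrib)
  qed
  have z: "ev h g 0 = 0" by (simp add: ev_def)
  have mult: "ev h g (p * q) = ev h g p * ev h g q" for p q
  proof (induction p rule: mpol_induct)
    case (single m c)
    show ?case
    proof (induction q rule: mpol_induct)
      case (single m' d)
      show ?case by (simp add: mult_single sng mon_add)
    qed (auto simp: z add distrib_left)
  qed (auto simp: z add distrib_right)
  have "ev h g 1 = 1" using sng[of 0 1] by simp
  then show ?thesis by (auto simp: rhom_def z add mult)
qed

lemma ev_const: "rhom h \<Longrightarrow> ev h g (const c) = h c"
  by (cases "c = 0") (auto simp: ev_def const_def rhomD)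
lemma ev_Var: "rhom h \<Longrightarrow> ev h g (Var i) = g i"
  by (auto simp: ev_def Var_def rhomD)

definition subst :: "(nat \<Rightarrow> 'k mpol) \<Rightarrow> 'k mpol \<Rightarrow> ('k::field) mpol" where "subst = ev const"
definition eval :: "(nat \<Rightarrow> 'k) \<Rightarrow> 'k mpol \<Rightarrow> 'k::field" where "eval = ev (\<lambda>c. c)"

lemma rhom_subst: "rhom (subst g)" and subst_const [simp]: "subst g (const c) = const c"
  and subst_Var [simp]: "subst g (Var i) = g i"
  by (auto simp: subst_def ev_rhom rhom_const ev_const ev_Var)
lemma rhom_eval: "rhom (eval g)" and eval_const [simp]: "eval q (const c) = c"
  and eval_Var [simp]: "eval q (Var i) = q i"
  by (auto simp: eval_def ev_rhom rhom_id ev_const ev_Var)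

lemmas subst_simps [simp] = rhom_simps[OF rhom_subst]
lemmas eval_simps [simp] = rhom_simps[OF rhom_eval]

lemma rhom_eqI:
  assumes "rhom f" "rhom g" "p \<in> PV B" "\<And>c. f (const c) = g (const c)" "\<And>i. i \<in> B \<Longrightarrow> f (Var i) = g (Var i)"
  shows "f p = g p"
  using assms(3) by (induction rule: PV_induct) (auto simp: rhomD[OF assms(1)] rhomD[OF assms(2)] assms)

lemma PV_UNIV [simp]: "p \<in> PV UNIV" by (auto simp: PV_def)

lemma rhom_comp: "rhom f \<Longrightarrow> rhom g \<Longrightarrow> rhom (\<lambda>x. f (g x))" by (auto simp: rhom_def)

lemma subst_subst: "subst g (subst h p) = subst (\<lambda>i. subst g (h i)) p"
  by (rule rhom_eqI[OF rhom_comp[OF rhom_subst rhom_subst] rhom_subst, of _ UNIV]) auto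
lemma eval_subst: "eval q (subst h p) = eval (\<lambda>i. eval q (h i)) p"
  by (rule rhom_eqI[OF rhom_comp[OF rhom_eval rhom_subst] rhom_eval, of _ UNIV]) auto
lemma subst_id: "p \<in> PV B \<Longrightarrow> (\<And>i. i \<in> B \<Longrightarrow> g i = Var i) \<Longrightarrow> subst g p = p"
  by (rule rhom_eqI[OF rhom_subst rhom_id]) auto
lemma subst_cong: "p \<in> PV B \<Longrightarrow> (\<And>i. i \<in> B \<Longrightarrow> g i = h i) \<Longrightarrow> subst g p = subst h p"
  by (rule rhom_eqI[OF rhom_subst rhom_subst]) auto
lemma eval_cong: "p \<in> PV B \<Longrightarrow> (\<And>i. i \<in> B \<Longrightarrow> g i = h i) \<Longrightarrow> eval g p = eval h p"
  by (rule rhom_eqI[OF rhom_eval rhom_eval]) auto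
lemma subst_in_PV: "p \<in> PV B \<Longrightarrow> (\<And>i. i \<in> B \<Longrightarrow> g i \<in> PV A) \<Longrightarrow> subst g p \<in> PV A"
  by (induction rule: PV_induct) (auto intro: PV_intros)

lemma lookup_mult_0:
  fixes p q :: "('k::field) mpol"
  shows "lookup (p * q) 0 = lookup p 0 * lookup q 0"
proof (induction p rule: mpol_induct)
  case (single m c)
  show ?case
  proof (induction q rule: mpol_induct)
    case (single m' d)
    have "m + m' = 0 \<longleftrightarrow> m = 0 \<and> m' = 0"
      by (metis add_eq_0_iff_both_eq_0 lookup_add lookup_zero poly_mapping_eqI add.left_neutral)
    then show ?case by (simp add: mult_single lookup_single when_def)
  qed (auto simp: lookup_add distrib_left)
qed (auto simp: lookup_add distrib_right)

lemma lookup_0_eval: "lookup (p :: 'a::field mpol) 0 = eval (\<lambda>_. 0) p"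
proof -
  have "rhom (\<lambda>p :: 'a mpol. lookup p 0)" by (auto simp: rhom_def lookup_mult_0 lookup_add)
  then show ?thesis
    by (rule rhom_eqI[OF _ rhom_eval, of _ _ UNIV])
      (simp_all, auto simp: const_def Var_def lookup_single when_def dest: arg_cong[of _ _ keys])
qed

subsection \<open>Homogeneous components\<close>

text \<open>\<open>N\<close> counts variables and is one more than the dimension that indexes
  \<open>forms\<close>. This suits the passage from n + 1 to n variables in the lower bound.\<close>

definition hform :: "nat \<Rightarrow> nat \<Rightarrow> ('k::field) mpol set" where
  "hform N d = {f \<in> PV {..<N}. homog d f}"

lemma forms_hform: "forms n d = hform (Suc n) d"
  by (simp add: forms_def hform_def carrier_coord_ring lessThan_Suc_atMost)

lemma mdeg_0 [simp]: "mdeg 0 = 0" by (simp add: mdeg_def)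
lemma mdeg_single [simp]: "mdeg (single i k) = k" by (cases "k = 0") (auto simp: mdeg_def)
lemma mdeg_eq_0 [simp]: "mdeg m = 0 \<longleftrightarrow> m = 0"
  by (auto simp: mdeg_def in_keys_iff intro!: poly_mapping_eqI)

lemma homog_add: "homog d p \<Longrightarrow> homog d q \<Longrightarrow> homog d (p + q)"
  using Poly_Mapping.keys_add[of p q] by (auto simp: homog_def)
lemma homog_uminus: "homog d p \<Longrightarrow> homog d (- p)" by (auto simp: homog_def)
lemma homog_minus: "homog d p \<Longrightarrow> homog d q \<Longrightarrow> homog d (p - q)"
  using homog_add[of d p "- q"] homog_uminus[of d q] by simp
lemma homog_0 [simp]: "homog d 0" by (auto simp: homog_def)
lemma homog_const [simp]: "homog 0 (const c)" by (auto simp: homog_def const_def)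
lemma homog_1 [simp]: "homog 0 1" by (auto simp: homog_def)
lemma homog_Var [simp]: "homog 1 (Var i)" "homog (Suc 0) (Var i)" by (auto simp: homog_def Var_def)
lemma homog_mult: assumes "homog d p" "homog e q" shows "homog (d + e) (p * q)"
  unfolding homog_def
proof
  fix m assume "m \<in> keys (p * q)"
  then obtain a b where "m = a + b" "a \<in> keys p" "b \<in> keys q"
    using Poly_Mapping.keys_mult[of p q] by blast
  then show "mdeg m = d + e" using assms by (auto simp: homog_def mdeg_add)
qed
lemma homog_const_mult: "homog d p \<Longrightarrow> homog d (const c * p)"
  using homog_mult[of 0 "const c" d p] by simp
lemma homog_power: "homog d p \<Longrightarrow> homog (k * d) (p ^ k)"
  by (induction k) (auto dest: homog_mult)
lemma homog_Var_power: "homog k (Var i ^ k)" using homog_power[of 1 "Var i" k] by simp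
lemma homog_sum: "(\<And>x. x \<in> A \<Longrightarrow> homog d (f x)) \<Longrightarrow> homog d (sum f A)"
  by (induction A rule: infinite_finite_induct) (auto intro: homog_add)
lemma homog_prod: "(\<And>x. x \<in> A \<Longrightarrow> homog (d x) (f x)) \<Longrightarrow> homog (sum d A) (prod f A)"
  by (induction A rule: infinite_finite_induct) (auto intro: homog_mult)
lemma homog_unique: "homog d p \<Longrightarrow> homog e p \<Longrightarrow> p \<noteq> 0 \<Longrightarrow> d = e"
  by (metis homog_def keys_eq_empty ex_in_conv)
lemma homog_0_const: "homog 0 p \<Longrightarrow> p = const (lookup p 0)"
  by (rule poly_mapping_eqI) (auto simp: homog_def const_def lookup_single when_def in_keys_iff)

lemma lookup_hom_part [simp]: "lookup (hom_part d p) m = (if mdeg m = d then lookup p m else 0)"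
  by (auto simp: hom_part_def lookup_sum lookup_single when_def in_keys_iff sum.delta')

lemma keys_hom_part: "keys (hom_part d p) = {m \<in> keys p. mdeg m = d}"
  by (auto simp: in_keys_iff split: if_splits)
lemma homog_hom_part [simp]: "homog d (hom_part d p)" by (auto simp: homog_def keys_hom_part)
lemma PV_hom_part: "p \<in> PV B \<Longrightarrow> hom_part d p \<in> PV B" by (auto simp: PV_def keys_hom_part)
lemma hom_part_add [simp]: "hom_part d (p + q) = hom_part d p + hom_part d q"
  by (rule poly_mapping_eqI) (auto simp: lookup_add)
lemma hom_part_uminus [simp]: "hom_part d (- p) = - hom_part d p"
  by (rule poly_mapping_eqI) auto
lemma hom_part_minus [simp]: "hom_part d (p - q) = hom_part d p - hom_part d q"
  by (rule poly_mapping_eqI) (auto simp: lookup_minus)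
lemma hom_part_0 [simp]: "hom_part d 0 = 0"
  by (rule poly_mapping_eqI) auto
lemma hom_part_sum [simp]: "hom_part d (sum f A) = (\<Sum>x\<in>A. hom_part d (f x))"
  by (rule additive_sum) auto
lemma hom_part_homog: "homog e p \<Longrightarrow> hom_part d p = (if d = e then p else 0)"
  by (rule poly_mapping_eqI) (auto simp: homog_def in_keys_iff)
lemma hom_part_hom_part: "hom_part d (hom_part e p) = (if d = e then hom_part e p else 0)"
  by (simp add: hom_part_homog[of e])

lemma hom_part_decomp: "\<exists>D. \<forall>E\<ge>D. p = (\<Sum>d\<le>E. hom_part d p)"
proof -
  let ?D = "Max (insert 0 (mdeg ` keys p))"
  have "p = (\<Sum>d\<le>E. hom_part d p)" if "E \<ge> ?D" for E
  proof (rule poly_mapping_eqI)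
    fix m
    have "m \<in> keys p \<Longrightarrow> mdeg m \<le> E" using that by (auto intro: order_trans[OF Max_ge])
    then show "lookup p m = lookup (\<Sum>d\<le>E. hom_part d p) m"
      by (auto simp: lookup_sum sum.delta in_keys_iff)
  qed
  then show ?thesis by blast
qed

lemma hom_part_homog_mult:
  assumes "homog e q" shows "hom_part d (p * q) = (if e \<le> d then hom_part (d - e) p * q else 0)"
proof (induction p rule: mpol_induct)
  case (single m c)
  have h: "homog (mdeg m) (single m c)" by (auto simp: homog_def split: if_splits)
  show ?case using hom_part_homog[OF homog_mult[OF h assms], of d] hom_part_homog[OF h, of "d - e"] by auto
qed (auto simp: distrib_right)

lemma hom_part_mult: "hom_part d (p * q) = (\<Sum>k\<le>d. hom_part (d - k) p * hom_part k q)"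
proof (induction q rule: mpol_induct)
  case (single m c)
  have h: "homog (mdeg m) (single m c)" by (auto simp: homog_def split: if_splits)
  show ?case
    by (auto simp: hom_part_homog_mult[OF h] hom_part_homog[OF h] if_distrib[of "\<lambda>x. _ * x"] sum.delta' cong: if_cong)
qed (auto simp: distrib_left sum.distrib)

lemma hform_0 [simp]: "0 \<in> hform N d"
  and hform_add: "p \<in> hform N d \<Longrightarrow> q \<in> hform N d \<Longrightarrow> p + q \<in> hform N d"
  and hform_const_mult: "p \<in> hform N d \<Longrightarrow> const c * p \<in> hform N d"
  and hform_mult: "p \<in> hform N d \<Longrightarrow> q \<in> hform N e \<Longrightarrow> p * q \<in> hform N (d + e)"
  by (auto simp: hform_def intro: PV_intros homog_add homog_uminus homog_minus homog_const_mult homog_mult)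

lemma hform_hom_part: "p \<in> PV {..<N} \<Longrightarrow> hom_part d p \<in> hform N d"
  by (auto simp: hform_def PV_hom_part)

lemma homog_subst:
  assumes "homog d p" "p \<in> PV B" "\<And>i. i \<in> B \<Longrightarrow> homog 1 (g i)" shows "homog d (subst g p)"
proof -
  have s: "homog (mdeg m) (subst g (single m c))" if "keys m \<subseteq> B" for m c
  proof -
    have "homog (lookup m i) (g i ^ lookup m i)" if "i \<in> keys m" for i
      using homog_power[OF assms(3), of i "lookup m i"] that \<open>keys m \<subseteq> B\<close> by auto
    then show ?thesis
      unfolding single_prod_Var mdeg_def by (auto intro!: homog_const_mult homog_prod)
  qed
  have "homog d (\<Sum>m\<in>keys p. subst g (single m (lookup p m)))"
    using assms(1,2) s by (intro homog_sum) (auto simp: homog_def[of d p] PV_def)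
  moreover have "subst g p = (\<Sum>m\<in>keys p. subst g (single m (lookup p m)))"
    by (subst mpol_sum) simp
  ultimately show ?thesis by simp
qed

section \<open>Koszul complexes\<close>

text \<open>
  Elements of the exterior algebra on \<open>e\<^sub>0, \<dots>, e\<^bsub>n-1\<^esub>\<close> are functions on sets of indices. Writing
  an element as \<open>u + e\<^sub>n \<and> v\<close>, the contraction with \<open>c\<close> is \<open>\<partial> (u + e\<^sub>n \<and> v) = (\<partial> u + c\<^sub>n v) - e\<^sub>n \<and> \<partial> v\<close>;
  taking this as a recursive definition avoids explicit signs.
\<close>

definition lo :: "nat \<Rightarrow> (nat set \<Rightarrow> 'a::zero) \<Rightarrow> nat set \<Rightarrow> 'a" where
  "lo n z = (\<lambda>A. if n \<in> A then 0 else z A)"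
definition hi :: "nat \<Rightarrow> (nat set \<Rightarrow> 'a::zero) \<Rightarrow> nat set \<Rightarrow> 'a" where
  "hi n z = (\<lambda>A. if n \<in> A then 0 else z (insert n A))"
definition join :: "nat \<Rightarrow> (nat set \<Rightarrow> 'a) \<Rightarrow> (nat set \<Rightarrow> 'a) \<Rightarrow> nat set \<Rightarrow> 'a" where
  "join n u v = (\<lambda>A. if n \<in> A then v (A - {n}) else u A)"
definition smul :: "'a::times \<Rightarrow> ('b \<Rightarrow> 'a) \<Rightarrow> 'b \<Rightarrow> 'a" where
  "smul r z = (\<lambda>A. r * z A)"

primrec bd :: "(nat \<Rightarrow> 'a::comm_ring_1) \<Rightarrow> nat \<Rightarrow> (nat set \<Rightarrow> 'a) \<Rightarrow> nat set \<Rightarrow> 'a" where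
  "bd c 0 z = 0"
| "bd c (Suc n) z = join n (bd c n (lo n z) + smul (c n) (hi n z)) (- bd c n (hi n z))"

text \<open>The number \<open>n\<close> of exterior generators is independent of the variables
  allowed in \<open>V\<close>. Hence Koszul chains on x_0, ..., x_{n-1} with coefficients in a ring
  that also contains x_n are covered.\<close>

definition chain :: "nat \<Rightarrow> nat \<Rightarrow> 'a::zero set \<Rightarrow> (nat set \<Rightarrow> 'a) \<Rightarrow> bool" where
  "chain n i V z \<longleftrightarrow> (\<forall>A. z A \<in> V \<and> (z A \<noteq> 0 \<longrightarrow> A \<subseteq> {..<n} \<and> card A = i))"

lemma chain_iff: "chain n i V z \<longleftrightarrow> (\<forall>A. z A \<in> V) \<and> (\<forall>A. \<not> (A \<subseteq> {..<n} \<and> card A = i) \<longrightarrow> z A = 0)"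
  by (auto simp: chain_def)

definition avoids :: "nat \<Rightarrow> (nat set \<Rightarrow> 'a::zero) \<Rightarrow> bool" where
  "avoids n z \<longleftrightarrow> (\<forall>A. n \<in> A \<longrightarrow> z A = 0)"

lemma join_lo_hi: "join n (lo n z) (hi n z) = z"
  by (auto simp: join_def lo_def hi_def fun_eq_iff insert_absorb)
lemma lo_join [simp]: "lo n (join n u v) = lo n u" by (auto simp: join_def lo_def fun_eq_iff)
lemma hi_join [simp]: "hi n (join n u v) = lo n v"
  by (auto simp: join_def lo_def hi_def fun_eq_iff)
lemma lo_avoids: "avoids n z \<Longrightarrow> lo n z = z" by (auto simp: avoids_def lo_def fun_eq_iff)
lemma avoids_lo [simp]: "avoids n (lo n z)" "avoids n (hi n z)" by (auto simp: avoids_def lo_def hi_def)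
lemma lo_add: "lo n (u + v) = lo n u + lo n v" "hi n (u + v) = hi n u + hi n (v :: _ \<Rightarrow> 'a::comm_ring_1)"
  by (auto simp: lo_def hi_def fun_eq_iff)
lemma lo_smul: "lo n (smul r u) = smul r (lo n u)" "hi n (smul r u) = smul r (hi n (u :: _ \<Rightarrow> 'a::comm_ring_1))"
  by (auto simp: lo_def hi_def fun_eq_iff smul_def)
lemma join_eq_iff: "avoids n u \<Longrightarrow> avoids n v \<Longrightarrow> avoids n u' \<Longrightarrow> avoids n v' \<Longrightarrow>
    join n u v = join n u' v' \<longleftrightarrow> u = u' \<and> v = v'"
  by (metis hi_join lo_avoids lo_join)
lemma join_add: "join n (u + u') (v + v') = join n u v + join n u' (v' :: _ \<Rightarrow> 'a::comm_ring_1)"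
  by (auto simp: join_def fun_eq_iff)
lemma join_uminus: "join n (- u) (- v) = - join n u (v :: _ \<Rightarrow> 'a::comm_ring_1)"
  by (auto simp: join_def fun_eq_iff)
lemma join_smul: "join n (smul r u) (smul r v) = smul r (join n u (v :: _ \<Rightarrow> 'a::comm_ring_1))"
  by (auto simp: join_def fun_eq_iff smul_def)
lemma join_zero: "join n 0 0 = (0 :: _ \<Rightarrow> 'a::comm_ring_1)"
  by (auto simp: join_def fun_eq_iff)

lemma smul_simps:
  fixes u v :: "'b \<Rightarrow> 'a::comm_ring_1"
  shows "smul r (u + v) = smul r u + smul r v" "smul r (u - v) = smul r u - smul r v"
    "smul r (- u) = - smul r u" "smul r (smul s u) = smul (r * s) u" "smul r 0 = 0" "smul 1 u = u"
    "smul 0 u = 0" "smul (r + s) u = smul r u + smul s u" "smul (- r) u = - smul r u"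
  by (auto simp: smul_def fun_eq_iff algebra_simps)

lemma avoids_add: "avoids n u \<Longrightarrow> avoids n v \<Longrightarrow> avoids n (u + (v :: _ \<Rightarrow> 'a::comm_ring_1))"
  and avoids_uminus: "avoids n u \<Longrightarrow> avoids n (- u)"
  and avoids_smul: "avoids n u \<Longrightarrow> avoids n (smul r u)"
  by (auto simp: avoids_def smul_def)

lemma avoids_bd: "avoids k z \<Longrightarrow> n \<le> k \<Longrightarrow> avoids k (bd c n z)"
proof (induction n arbitrary: z)
  case (Suc n)
  have "avoids k (lo n z)" "avoids k (hi n z)"
    using Suc.prems by (auto simp: avoids_def lo_def hi_def)
  then have "avoids k (bd c n (lo n z) + smul (c n) (hi n z))" "avoids k (- bd c n (hi n z))"
    using Suc by (auto intro!: avoids_add avoids_smul avoids_uminus)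
  moreover have "k \<noteq> n" using Suc.prems by simp
  ultimately show ?case by (auto simp: join_def avoids_def)
qed (auto simp: avoids_def)

lemma bd_join:
  assumes "avoids n u" "avoids n v"
  shows "bd c (Suc n) (join n u v) = join n (bd c n u + smul (c n) v) (- bd c n v)"
  using assms by (simp add: lo_avoids)

lemma avoids_bd_intros:
  "avoids n u \<Longrightarrow> avoids n (bd c n u)"
  by (rule avoids_bd) auto

lemma bd_add: "bd c n (u + v) = bd c n u + bd c n v"
  by (induction n arbitrary: u v) (simp_all add: lo_add smul_simps add_ac flip: join_add)
lemma bd_smul: "bd c n (smul r u) = smul r (bd c n u)"
  by (induction n arbitrary: u) (simp_all add: lo_smul smul_simps mult.commute flip: join_smul)
lemma bd_uminus: "bd c n (- u) = - bd c n u"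
  using bd_smul[of c n "-1" u] by (simp add: smul_simps)
lemma bd_minus: "bd c n (u - v) = bd c n u - bd c n v"
  using bd_add[of c n u "- v"] by (simp add: bd_uminus)
lemma bd_zero: "bd c n 0 = 0"
  using bd_smul[of c n 0 0] by (simp add: smul_simps)

lemmas bd_simps = bd_add bd_smul bd_uminus bd_minus bd_zero

text \<open>This is the polarised form of \<open>bd_bd\<close>. It is used for a constant covector
  against the variables, where it controls the change of basis caused by the shear.\<close>

lemma bd_anticomm: "bd c n (bd d n z) = - bd d n (bd c n z)"
proof (induction n arbitrary: z)
  case (Suc n)
  let ?u = "lo n z" and ?v = "hi n z"
  have *: "bd c (Suc n) (bd d (Suc n) z) =
      join n (bd c n (bd d n ?u) + smul (d n) (bd c n ?v) - smul (c n) (bd d n ?v)) (bd c n (bd d n ?v))" for c d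
    by (simp add: lo_avoids avoids_bd_intros avoids_add avoids_uminus avoids_smul bd_simps smul_simps)
  show ?case unfolding * unfolding Suc[of "lo n z"] Suc[of "hi n z"]
    by (simp add: algebra_simps flip: join_uminus)
qed simp

lemma bd_bd: "bd c n (bd c n z) = 0"
proof (induction n arbitrary: z)
  case (Suc n)
  then show ?case
    by (simp add: lo_avoids avoids_bd_intros avoids_add avoids_uminus avoids_smul bd_simps smul_simps
        join_zero zero_fun_def join_zero[unfolded zero_fun_def])
qed simp

lemma bd_add_coeff: "bd (\<lambda>b. c b + r * a b) n z = bd c n z + smul r (bd a n z)"
  by (induction n arbitrary: z)
    (simp_all add: smul_simps algebra_simps flip: join_add join_smul)

lemma bd_rhom:
  assumes "rhom h" shows "(\<lambda>A. h (bd c n z A)) = bd (\<lambda>b. h (c b)) n (\<lambda>A. h (z A))"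
proof (induction n arbitrary: z)
  case 0
  then show ?case by (auto simp: rhomD[OF assms] fun_eq_iff)
next
  case (Suc n)
  have l: "lo n (\<lambda>A. h (z A)) = (\<lambda>A. h (lo n z A))" "hi n (\<lambda>A. h (z A)) = (\<lambda>A. h (hi n z A))"
    by (auto simp: lo_def hi_def fun_eq_iff rhomD[OF assms])
  show ?case unfolding bd.simps l Suc[symmetric]
    by (auto simp: join_def smul_def fun_eq_iff rhom_simps[OF assms])
qed

lemma bd_closed:
  assumes "0 \<in> V" "\<And>x y. x \<in> V \<Longrightarrow> y \<in> V \<Longrightarrow> x + y \<in> V" "\<And>x. x \<in> V \<Longrightarrow> - x \<in> V"
    and "\<And>b x. b < n \<Longrightarrow> x \<in> U \<Longrightarrow> c b * x \<in> V" "\<And>A. z A \<in> U" "0 \<in> U"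
  shows "bd c n z A \<in> V"
  using assms(4-)
proof (induction n arbitrary: z A)
  case (Suc n)
  have l: "lo n z B \<in> U" "hi n z B \<in> U" for B
    using Suc.prems by (auto simp: lo_def hi_def)
  have "bd c n (lo n z) B \<in> V" "bd c n (hi n z) B \<in> V" for B
    using l Suc.prems by (auto intro!: Suc.IH)
  then show ?case using l Suc.prems assms(1-3) by (auto simp: join_def smul_def)
qed (auto simp: assms)

lemma chain_lo: "chain (Suc n) i V z \<Longrightarrow> 0 \<in> V \<Longrightarrow> chain n i V (lo n z)"
  unfolding chain_def lo_def by (auto simp: less_Suc_eq) (metis lessThan_iff less_SucE subsetD)
lemma chain_hi: "chain (Suc n) (Suc i) V z \<Longrightarrow> 0 \<in> V \<Longrightarrow> chain n i V (hi n z)"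
  unfolding chain_def hi_def
proof (intro allI conjI impI)
  fix A assume a: "\<forall>A. z A \<in> V \<and> (z A \<noteq> 0 \<longrightarrow> A \<subseteq> {..<Suc n} \<and> card A = Suc i)" "0 \<in> V"
  show "(if n \<in> A then 0 else z (insert n A)) \<in> V" using a by auto
  assume b: "(if n \<in> A then 0 else z (insert n A)) \<noteq> 0"
  then have "n \<notin> A" "insert n A \<subseteq> {..<Suc n}" "card (insert n A) = Suc i" using a by (auto split: if_splits)
  moreover then have "finite A" by (meson finite_lessThan finite_subset finite_insert)
  ultimately show "A \<subseteq> {..<n}" "card A = i" by (auto simp: less_Suc_eq)
qed
lemma chain_hi_0: "chain (Suc n) 0 V z \<Longrightarrow> hi n z = 0"
proof
  fix A assume c: "chain (Suc n) 0 V z"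
  have "z (insert n A) = 0"
  proof (rule ccontr)
    assume "z (insert n A) \<noteq> 0"
    then have "insert n A \<subseteq> {..<Suc n}" "card (insert n A) = 0" using c by (auto simp: chain_def)
    then show False by (metis card_eq_0_iff finite_lessThan finite_subset insert_not_empty)
  qed
  then show "hi n z A = 0 A" by (auto simp: hi_def)
qed
lemma chain_join: "chain n (Suc i) V u \<Longrightarrow> chain n i V v \<Longrightarrow> chain (Suc n) (Suc i) V (join n u v)"
  unfolding chain_def join_def
proof (intro allI conjI impI)
  fix A assume a: "\<forall>A. u A \<in> V \<and> (u A \<noteq> 0 \<longrightarrow> A \<subseteq> {..<n} \<and> card A = Suc i)"
    "\<forall>A. v A \<in> V \<and> (v A \<noteq> 0 \<longrightarrow> A \<subseteq> {..<n} \<and> card A = i)"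
  show "(if n \<in> A then v (A - {n}) else u A) \<in> V" using a by auto
  assume b: "(if n \<in> A then v (A - {n}) else u A) \<noteq> 0"
  have *: "A \<subseteq> {..<Suc n} \<and> card A = Suc i"
  proof (cases "n \<in> A")
    case True
    then have A: "A - {n} \<subseteq> {..<n}" "card (A - {n}) = i" using a b by auto
    moreover have "finite (A - {n})" using A(1) finite_subset by blast
    ultimately show ?thesis using True card.insert_remove[of "A - {n}" n] by (auto simp: insert_absorb)
  next
    case False
    then have "A \<subseteq> {..<n}" "card A = Suc i" using a b by auto
    then show ?thesis by auto
  qed
  then show "A \<subseteq> {..<Suc n}" "card A = Suc i" by auto
qed
lemma chain_join_0: "chain n 0 V u \<Longrightarrow> 0 \<in> V \<Longrightarrow> chain (Suc n) 0 V (join n u 0)"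
  unfolding chain_def join_def lessThan_Suc by (metis subset_insertI2 zero_fun_apply)
lemma chain_avoids: "chain n i V z \<Longrightarrow> n \<le> k \<Longrightarrow> avoids k z"
  by (force simp: chain_def avoids_def)
lemma chain_add: "chain n i V u \<Longrightarrow> chain n i V v \<Longrightarrow> (\<And>x y. x \<in> V \<Longrightarrow> y \<in> V \<Longrightarrow> x + y \<in> V) \<Longrightarrow>
    chain n i V (u + (v :: _ \<Rightarrow> 'a::comm_ring_1))"
  unfolding chain_iff by simp
lemma chain_uminus: "chain n i V u \<Longrightarrow> (\<And>x. x \<in> V \<Longrightarrow> - x \<in> V) \<Longrightarrow>
    chain n i V (- (u :: _ \<Rightarrow> 'a::comm_ring_1))"
  unfolding chain_iff by simp
lemma chain_minus: "chain n i V u \<Longrightarrow> chain n i V v \<Longrightarrow> (\<And>x y. x \<in> V \<Longrightarrow> y \<in> V \<Longrightarrow> x - y \<in> V) \<Longrightarrow>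
    chain n i V (u - (v :: _ \<Rightarrow> 'a::comm_ring_1))"
  unfolding chain_iff by simp
lemma chain_smul: "chain n i U u \<Longrightarrow> (\<And>x. x \<in> U \<Longrightarrow> r * x \<in> V) \<Longrightarrow>
    chain n i V (smul r (u :: _ \<Rightarrow> 'a::comm_ring_1))"
  unfolding chain_iff smul_def by simp
lemma chain_map: "chain n i U u \<Longrightarrow> (\<And>x. x \<in> U \<Longrightarrow> h x \<in> V) \<Longrightarrow> h 0 = 0 \<Longrightarrow> chain n i V (\<lambda>A. h (u A))"
  unfolding chain_iff by simp
lemma chain_mono: "chain n i U u \<Longrightarrow> U \<subseteq> V \<Longrightarrow> chain n i V u"
  by (auto simp: chain_def)
lemma chain_zero: "0 \<in> V \<Longrightarrow> chain n i V 0" by (auto simp: chain_def)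
lemma chain_0_unit: "v \<in> V \<Longrightarrow> 0 \<in> V \<Longrightarrow> chain n 0 V (\<lambda>A. if A = {} then v else 0)"
  by (auto simp: chain_def)

lemma bd_chain_0: "chain n 0 V z \<Longrightarrow> 0 \<in> V \<Longrightarrow> bd c n z = 0"
proof (induction n arbitrary: z)
  case (Suc n)
  have "bd c n (lo n z) = 0" using Suc.IH chain_lo[OF Suc.prems] Suc.prems by blast
  then show ?case unfolding bd.simps chain_hi_0[OF Suc.prems(1)] by (simp add: bd_zero smul_simps(5) join_zero)
qed simp

lemma chain_bd:
  assumes V: "0 \<in> V" "\<And>x y. x \<in> V \<Longrightarrow> y \<in> V \<Longrightarrow> x + y \<in> V" "\<And>x. x \<in> V \<Longrightarrow> - x \<in> V"
    and c: "\<And>b x. b < n \<Longrightarrow> x \<in> U \<Longrightarrow> c b * x \<in> V" "0 \<in> U" and z: "chain n (Suc i) U z"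
  shows "chain n i V (bd c n z)"
  using c z
proof (induction n arbitrary: z i)
  case (Suc n)
  note l = chain_lo[OF Suc.prems(3,2)] chain_hi[OF Suc.prems(3,2)]
  have a: "chain n i V (bd c n (lo n z) + smul (c n) (hi n z))"
    using Suc.prems l by (auto intro!: chain_add chain_smul V Suc.IH)
  show ?case
  proof (cases i)
    case 0
    then show ?thesis using l(2) a bd_chain_0[of n U "hi n z"] Suc.prems V
      by (auto intro: chain_join_0)
  next
    case (Suc j)
    then have "chain n j V (- bd c n (hi n z))"
      using Suc.prems l by (auto intro!: chain_uminus V Suc.IH)
    then show ?thesis using a Suc by (auto intro: chain_join)
  qed
qed (auto simp: chain_def V)

subsection \<open>Exactness over polynomial rings\<close>

text \<open>Degrees are integers, so that coefficient degrees may drop below zero along a Koszul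
  complex: such components are zero, and \<open>k - 1\<close> is never truncated.\<close>

definition gform :: "nat \<Rightarrow> int \<Rightarrow> ('k::field) mpol set" where
  "gform N k = {f \<in> PV {..<N}. \<forall>m\<in>keys f. int (mdeg m) = k}"

lemma gform_hform: "gform N (int d) = hform N d" by (auto simp: gform_def hform_def homog_def)
lemma gform_neg: "k < 0 \<Longrightarrow> gform N k = {0}"
proof -
  assume "k < 0"
  then have "f = 0" if "f \<in> gform N k" for f :: "'a mpol"
  proof -
    have "m \<notin> keys f" for m using that \<open>k < 0\<close> by (auto simp: gform_def)
    then show ?thesis using keys_eq_empty by blast
  qed
  then show ?thesis by (auto simp: gform_def)
qed
lemma gform_0 [simp]: "0 \<in> gform N k" by (auto simp: gform_def)
lemma gform_add: "p \<in> gform N k \<Longrightarrow> q \<in> gform N k \<Longrightarrow> p + q \<in> gform N k"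
  using Poly_Mapping.keys_add[of p q] by (auto simp: gform_def intro: PV_intros)
lemma gform_uminus: "p \<in> gform N k \<Longrightarrow> - p \<in> gform N k"
  by (auto simp: gform_def intro: PV_intros)
lemma gform_minus: "p \<in> gform N k \<Longrightarrow> q \<in> gform N k \<Longrightarrow> p - q \<in> gform N k"
  using gform_add[of p N k "- q"] gform_uminus[of q N k] by simp
lemma gform_sum: "(\<And>x. x \<in> A \<Longrightarrow> f x \<in> gform N k) \<Longrightarrow> sum f A \<in> gform N k"
  by (induction A rule: infinite_finite_induct) (auto intro: gform_add)
lemma gform_mult:
  assumes "p \<in> gform N k" "q \<in> gform N l" shows "p * q \<in> gform N (k + l)"
proof -
  have "int (mdeg m) = k + l" if "m \<in> keys (p * q)" for m
  proof -
    obtain a b where "m = a + b" "a \<in> keys p" "b \<in> keys q"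
      using \<open>m \<in> keys (p * q)\<close> Poly_Mapping.keys_mult[of p q] by blast
    then show ?thesis using assms by (auto simp: gform_def mdeg_add)
  qed
  then show ?thesis using assms by (auto simp: gform_def intro: PV_intros)
qed
lemma gform_Var: "b < N \<Longrightarrow> Var b \<in> gform N 1"
  by (auto simp: gform_def) (simp add: Var_def)
lemma gform_const: "const c \<in> gform N 0"
  by (auto simp: gform_def) (auto simp: const_def split: if_splits)
lemma gform_Var_mult: "b < N \<Longrightarrow> p \<in> gform N (k - 1) \<Longrightarrow> Var b * p \<in> gform N k"
  using gform_mult[OF gform_Var, of b N p "k - 1"] by simp
lemma gform_const_mult: "p \<in> gform N k \<Longrightarrow> const c * p \<in> gform N k"
  using gform_mult[OF gform_const, of p N k c] by simp
lemma gform_PV: "p \<in> gform N k \<Longrightarrow> p \<in> PV {..<N}" by (auto simp: gform_def)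

lemmas gform_intros = gform_add gform_minus gform_uminus gform_sum gform_0

lemma chain_bd_gform:
  assumes "\<And>b. b < n \<Longrightarrow> c b \<in> gform N 1" "chain n (Suc i) (gform N (k - 1)) z"
  shows "chain n i (gform N k) (bd c n z)"
  by (rule chain_bd[OF _ _ _ _ _ assms(2)])
    (auto intro: gform_intros dest: gform_mult[OF assms(1)])

lemma keys_single_mult: "keys (single m 1 * p) = (\<lambda>a. m + a) ` keys (p :: 'a::field mpol)"
proof -
  have "lookup (single m 1 * p) x = (if x = m + (x - m) then lookup p (x - m) else 0)" for x
  proof (induction p rule: mpol_induct)
    case (single m' c)
    have "x = m + (x - m) \<and> m' = x - m \<longleftrightarrow> m + m' = x" by (metis add_diff_cancel_left')
    then show ?case by (simp add: mult_single lookup_single when_def) metis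
  qed (auto simp: distrib_left lookup_add)
  then have "x \<in> keys (single m 1 * p) \<longleftrightarrow> x = m + (x - m) \<and> x - m \<in> keys p" for x
    by (simp add: in_keys_iff)
  moreover have "x = m + (x - m) \<and> x - m \<in> keys p \<longleftrightarrow> x \<in> (\<lambda>a. m + a) ` keys p" for x
  proof
    assume "x = m + (x - m) \<and> x - m \<in> keys p"
    then show "x \<in> (\<lambda>a. m + a) ` keys p" by blast
  next
    assume "x \<in> (\<lambda>a. m + a) ` keys p"
    then obtain a where "x = m + a" "a \<in> keys p" by blast
    then show "x = m + (x - m) \<and> x - m \<in> keys p" by simp
  qed
  ultimately show ?thesis by blast
qed

lemma keys_Var_mult: "keys (Var i * p) = (\<lambda>a. single i 1 + a) ` keys (p :: 'a::field mpol)"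
  by (simp add: Var_def keys_single_mult)

lemma keys_plus_nat: "keys (a + b) = keys a \<union> keys (b :: nat \<Rightarrow>\<^sub>0 nat)"
  by (auto simp: in_keys_iff lookup_add)

lemma bd_Var_keys: "m \<in> keys (bd Var n w A) \<Longrightarrow> keys m \<inter> {..<n} \<noteq> {}"
proof (induction n arbitrary: w A m)
  case (Suc n)
  consider "m \<in> keys (bd Var n (lo n w) A)" | "m \<in> keys (Var n * hi n w A)"
    | "m \<in> keys (bd Var n (hi n w) (A - {n}))"
    using Suc.prems Poly_Mapping.keys_add[of "bd Var n (lo n w) A" "Var n * hi n w A"]
    by (auto simp: join_def smul_def split: if_splits)
  then show ?case
  proof cases
    case 2
    then show ?thesis by (auto simp: keys_Var_mult keys_plus_nat)
  qed (use Suc.IH in \<open>fastforce simp: less_Suc_eq\<close>)+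
qed simp

lemma Var_divides:
  assumes f: "f \<in> gform N k" and n: "\<And>m. m \<in> keys f \<Longrightarrow> n \<in> keys m"
  shows "\<exists>g\<in>gform N (k - 1). f = Var n * g"
proof -
  define g where "g = (\<Sum>m\<in>keys f. single (m - single n 1) (lookup f m))"
  have "m = single n 1 + (m - single n 1)" if "m \<in> keys f" for m
    using n[OF that] by (intro poly_mapping_eqI) (auto simp: lookup_add lookup_minus lookup_single when_def in_keys_iff)
  note m = this
  have "Var n * g = (\<Sum>m\<in>keys f. single m (lookup f m))"
    unfolding g_def sum_distrib_left
    by (rule sum.cong[OF refl]) (metis Var_def m mult.left_neutral mult_single)
  then have fg: "f = Var n * g" using mpol_sum[of f] by simp
  have "g \<in> gform N (k - 1)"
    unfolding g_def
  proof (rule gform_sum)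
    fix m assume mf: "m \<in> keys f"
    have "mdeg m = Suc (mdeg (m - single n 1))"
      using m[OF mf] mdeg_add[of "single n 1" "m - single n 1"] by simp
    moreover have "keys (m - single n 1) \<subseteq> keys m" using m[OF mf] keys_plus_nat by (metis Un_upper2)
    ultimately show "single (m - single n 1) (lookup f m) \<in> gform N (k - 1)"
      using mf f by (auto simp: gform_def PV_def)
  qed
  with fg show ?thesis by blast
qed

lemma split_set:
  fixes f :: "('k::field) mpol"
  obtains f1 f2 where "f = f1 + f2" "keys f1 = {m \<in> keys f. Q m}" "keys f2 = {m \<in> keys f. \<not> Q m}"
proof -
  define f1 where "f1 = (\<Sum>m\<in>{m \<in> keys f. Q m}. single m (lookup f m))"
  have l: "lookup f1 m = (if Q m then lookup f m else 0)" for m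
    by (auto simp: f1_def lookup_sum lookup_single when_def in_keys_iff sum.delta')
  show ?thesis
    by (rule that[of f1 "f - f1"]) (auto simp: in_keys_iff l lookup_minus split: if_splits)
qed

text \<open>Splitting off the monomials divisible by the last variable and dividing them by it
  leaves a form in the ideal of the remaining variables. This is exactness of the Koszul complex
  next to its augmentation.\<close>

lemma in_span_Var:
  assumes "f \<in> gform N k" "\<And>m. m \<in> keys f \<Longrightarrow> keys m \<inter> {..<n} \<noteq> {}" "n \<le> N"
  shows "\<exists>w. chain n 1 (gform N (k - 1)) w \<and> bd Var n w = (\<lambda>A. if A = {} then f else 0)"
  using assms
proof (induction n arbitrary: f)
  case 0
  then have "keys f = {}" by fastforce
  then have "f = 0" by (metis keys_eq_empty)
  then show ?case by (intro exI[of _ 0] conjI chain_zero gform_0) (simp add: fun_eq_iff)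
next
  case (Suc n)
  obtain f1 f2 where f: "f = f1 + f2" "keys f1 = {m \<in> keys f. n \<in> keys m}" "keys f2 = {m \<in> keys f. n \<notin> keys m}"
    by (rule split_set)
  have f12: "f1 \<in> gform N k" "f2 \<in> gform N k" using Suc.prems(1) f(2,3) by (auto simp: gform_def PV_def)
  obtain g where g: "g \<in> gform N (k - 1)" "f1 = Var n * g"
    using Var_divides[OF f12(1), of n] f(2) by auto
  have "keys m \<inter> {..<n} \<noteq> {}" if "m \<in> keys f2" for m
    using that f(3) Suc.prems(2)[of m] by (auto simp: less_Suc_eq)
  then obtain w where w: "chain n 1 (gform N (k - 1)) w" "bd Var n w = (\<lambda>A. if A = {} then f2 else 0)"
    using Suc.IH[OF f12(2)] Suc.prems by auto
  let ?v = "\<lambda>A. if A = {} then g else (0::'a mpol)"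
  have v: "chain n 0 (gform N (k - 1)) ?v" using g by (auto simp: chain_0_unit)
  have "chain (Suc n) 1 (gform N (k - 1)) (join n w ?v)"
    using chain_join[of n 0] w v by simp
  moreover have "bd Var (Suc n) (join n w ?v) = (\<lambda>A. if A = {} then f else 0)"
    unfolding bd_join[OF chain_avoids[OF w(1) order_refl] chain_avoids[OF v order_refl]] w
    using bd_chain_0[OF v, of Var] by (auto simp: f g(2) join_def smul_def fun_eq_iff)
  ultimately show ?case by blast
qed

text \<open>The Koszul complex on one more variable is the mapping cone of multiplication by x_n.
  Writing z = u + e_n \<and> v, the part v is a cycle and bounds some \<open>w2\<close>; then u +
  x_n w2 is a cycle and bounds some \<open>w1\<close>, and \<open>join n w1 (- w2)\<close> bounds z.
  If v has exterior degree 0, being a cycle says nothing, and x_n must be a nonzerodivisor modulo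
  the smaller variables.\<close>

lemma koszul_exact:
  assumes "chain n (Suc i) (gform N k) z" "bd Var n z = 0" "n \<le> N"
  shows "\<exists>w. chain n (Suc (Suc i)) (gform N (k - 1)) w \<and> bd Var n w = z"
  using assms
proof (induction n arbitrary: i k z)
  case 0
  have "z A = 0" for A
  proof (rule ccontr)
    assume "z A \<noteq> 0"
    then have "A \<subseteq> {..<0}" "card A = Suc i" using 0 unfolding chain_def by blast+
    then have "A = {}" "card A = Suc i" by auto
    then show False by simp
  qed
  then have "z = 0" by (simp add: fun_eq_iff)
  then show ?case using chain_zero[OF gform_0] by (metis bd.simps(1))
next
  case (Suc n)
  let ?u = "lo n z" and ?v = "hi n z"
  note u = chain_lo[OF Suc.prems(1) gform_0] and v = chain_hi[OF Suc.prems(1) gform_0]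
  have "join n (bd Var n ?u + smul (Var n) ?v) (- bd Var n ?v) = join n 0 0"
    using Suc.prems(2) unfolding bd.simps join_zero .
  then have "bd Var n ?u + smul (Var n) ?v = 0 \<and> - bd Var n ?v = 0"
    by (subst (asm) join_eq_iff)
      (auto intro!: avoids_add avoids_smul avoids_uminus avoids_bd_intros simp: avoids_def[of n 0])
  then have eq: "bd Var n ?u + smul (Var n) ?v = 0" "bd Var n ?v = 0" by auto
  have "\<exists>w2. chain n (Suc i) (gform N (k - 1)) w2 \<and> bd Var n w2 = ?v"
  proof (cases i)
    case 0
    \<comment> \<open>Here v is a scalar with x_n v in the ideal of x_0, ..., x_{n-1}. Multiplying a
      monomial by x_n does not change which of these variables occur in it, so v lies in that ideal
      too.\<close>
    have "m \<in> keys (?v {}) \<Longrightarrow> keys m \<inter> {..<n} \<noteq> {}" for m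
    proof -
      assume m: "m \<in> keys (?v {})"
      have "Var n * ?v {} = - bd Var n ?u {}"
        using fun_cong[OF eq(1), of "{}"] by (simp add: smul_def add_eq_0_iff2)
      then have "single n 1 + m \<in> keys (bd Var n ?u {})" using m keys_Var_mult[of n "?v {}"] by auto
      from bd_Var_keys[OF this] show ?thesis by (auto simp: keys_plus_nat)
    qed
    moreover have "?v {} \<in> gform N k" using v by (auto simp: chain_def)
    ultimately obtain w where w: "chain n 1 (gform N (k - 1)) w" "bd Var n w = (\<lambda>A. if A = {} then ?v {} else 0)"
      using in_span_Var Suc.prems(3) by (metis Suc_leD)
    have "?v A = 0" if "A \<noteq> {}" for A
    proof (rule ccontr)
      assume "?v A \<noteq> 0"
      then have "A \<subseteq> {..<n}" "card A = 0" using v 0 by (auto simp: chain_def)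
      then show False using that finite_subset by fastforce
    qed
    then have "bd Var n w = ?v" using w(2) by (auto simp: fun_eq_iff)
    then show ?thesis using w 0 by auto
  next
    case (Suc j)
    then show ?thesis using Suc.IH[of j k ?v] v eq(2) \<open>Suc n \<le> N\<close> by auto
  qed
  then obtain w2 where w2: "chain n (Suc i) (gform N (k - 1)) w2" "bd Var n w2 = ?v" by blast
  have "bd Var n (?u + smul (Var n) w2) = 0"
    using eq(1) by (simp add: bd_simps w2)
  moreover have "chain n (Suc i) (gform N k) (?u + smul (Var n) w2)"
    using u w2(1) Suc.prems(3) by (auto intro!: chain_add chain_smul[OF w2(1)] gform_add gform_Var_mult)
  ultimately obtain w1 where w1: "chain n (Suc (Suc i)) (gform N (k - 1)) w1" "bd Var n w1 = ?u + smul (Var n) w2"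
    using Suc.IH Suc.prems(3) by (metis Suc_leD)
  have "bd Var (Suc n) (join n w1 (- w2)) = join n ?u ?v"
    by (simp add: bd_join chain_avoids[OF w1(1)] chain_avoids[OF w2(1)] avoids_uminus w1 w2 bd_simps smul_simps
        del: bd.simps)
  moreover have "chain (Suc n) (Suc (Suc i)) (gform N (k - 1)) (join n w1 (- w2))"
    by (intro chain_join w1 chain_uminus w2 gform_uminus)
  ultimately show ?case by (metis join_lo_hi)
qed

section \<open>Noetherianity and the existence of resolutions\<close>

definition hideal :: "nat \<Rightarrow> ('k::field) mpol set \<Rightarrow> bool" where
  "hideal N I \<longleftrightarrow> I \<subseteq> PV {..<N} \<and> 0 \<in> I \<and> (\<forall>f\<in>I. \<forall>g\<in>I. f + g \<in> I) \<and>
     (\<forall>r\<in>PV {..<N}. \<forall>f\<in>I. r * f \<in> I) \<and> (\<forall>f\<in>I. \<forall>d. hom_part d f \<in> I)"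

lemma hidealD:
  assumes "hideal N I"
  shows "f \<in> I \<Longrightarrow> f \<in> PV {..<N}" "0 \<in> I" "f \<in> I \<Longrightarrow> g \<in> I \<Longrightarrow> f + g \<in> I"
    "r \<in> PV {..<N} \<Longrightarrow> f \<in> I \<Longrightarrow> r * f \<in> I" "f \<in> I \<Longrightarrow> hom_part d f \<in> I"
  using assms by (auto simp: hideal_def)

lemma hideal_uminus: "hideal N I \<Longrightarrow> f \<in> I \<Longrightarrow> - f \<in> I"
  using hidealD(4)[of N I "-1" f] PV_uminus[of 1 "{..<N}"] by simp
lemma hideal_minus: "hideal N I \<Longrightarrow> f \<in> I \<Longrightarrow> g \<in> I \<Longrightarrow> f - g \<in> I"
  using hidealD(3)[of N I f "- g"] hideal_uminus[of N I g] by simp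
lemma hideal_sum: "hideal N I \<Longrightarrow> (\<And>x. x \<in> A \<Longrightarrow> f x \<in> I) \<Longrightarrow> sum f A \<in> I"
  by (induction A rule: infinite_finite_induct) (auto intro: hidealD)
lemma hideal_PV: "hideal N (PV {..<N})"
  by (auto simp: hideal_def intro: PV_intros PV_hom_part)
lemma hideal_0: "hideal N {0}" by (auto simp: hideal_def)

lemma monotone_subsequence_nat:
  fixes a :: "nat \<Rightarrow> nat"
  shows "\<exists>r :: nat \<Rightarrow> nat. strict_mono r \<and> (\<forall>i j. i \<le> j \<longrightarrow> a (r i) \<le> a (r j))"
proof -
  obtain f :: "nat \<Rightarrow> nat" where f: "strict_mono f" "monoseq (\<lambda>n. a (f n))"
    using seq_monosub[of a] by blast
  show ?thesis
  proof (cases "\<forall>i j. i \<le> j \<longrightarrow> a (f i) \<le> a (f j)")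
    case True
    then show ?thesis using f(1) by (intro exI[of _ f]) simp
  next
    case False
    then have dec: "a (f j) \<le> a (f i)" if "i \<le> j" for i j
      using f(2) that by (auto simp: monoseq_def)
    obtain K where K: "\<And>k. a (f K) \<le> a (f k)"
      using ex_has_least_nat[of "\<lambda>_. True" 0 "\<lambda>k. a (f k)"] by auto
    then have c: "a (f (K + i)) = a (f K)" for i using dec[of K "K + i"] by (simp add: antisym)
    have "strict_mono (\<lambda>i. f (K + i))" using f(1) by (auto simp: strict_mono_def)
    then show ?thesis using c by (intro exI[of _ "\<lambda>i. f (K + i)"]) auto
  qed
qed

lemma monotone_subsequence_tuples:
  fixes s :: "nat \<Rightarrow> nat \<Rightarrow> nat"
  shows "\<exists>r :: nat \<Rightarrow> nat. strict_mono r \<and> (\<forall>v<n. \<forall>i j. i \<le> j \<longrightarrow> s (r i) v \<le> s (r j) v)"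
proof (induction n)
  case 0
  show ?case by (intro exI[of _ id]) (auto simp: strict_mono_def)
next
  case (Suc n)
  then obtain r :: "nat \<Rightarrow> nat" where r: "strict_mono r" "\<And>v i j. v < n \<Longrightarrow> i \<le> j \<Longrightarrow> s (r i) v \<le> s (r j) v" by metis
  obtain t :: "nat \<Rightarrow> nat" where t: "strict_mono t" "\<And>i j. i \<le> j \<Longrightarrow> s (r (t i)) n \<le> s (r (t j)) n"
    using monotone_subsequence_nat[of "\<lambda>i. s (r i) n"] by metis
  have "s (r (t i)) v \<le> s (r (t j)) v" if "v < Suc n" "i \<le> j" for v i j
    using that t(2)[of i j] r(2)[of v "t i" "t j"] strict_mono_less_eq[OF t(1)] by (cases "v = n") auto
  moreover have "strict_mono (\<lambda>i. r (t i))" using r(1) t(1) by (auto simp: strict_mono_def)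
  ultimately show ?case by blast
qed

text \<open>A failure would give an infinite sequence of exponents, none of them divisible by an
  earlier one. A subsequence monotone in all \<open>N\<close> coordinates contradicts this with its
  first two terms.\<close>

lemma dickson:
  fixes M :: "(nat \<Rightarrow>\<^sub>0 nat) set"
  assumes "\<And>m. m \<in> M \<Longrightarrow> keys m \<subseteq> {..<N}"
  shows "\<exists>F\<subseteq>M. finite F \<and> (\<forall>m\<in>M. \<exists>f\<in>F. \<exists>t. m = f + t)"
proof (rule ccontr)
  assume no: "\<not> ?thesis"
  let ?P = "\<lambda>f x r. r \<in> M \<and> (\<forall>y<x. \<not> (\<exists>t. r = f y + t))"
  have "\<exists>f. \<forall>x::nat. ?P f x (f x)"
  proof (rule dependent_wellorder_choice)
    fix x and f :: "nat \<Rightarrow> (nat \<Rightarrow>\<^sub>0 nat)"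
    assume a: "\<And>y. y < x \<Longrightarrow> f y \<in> M \<and> (\<forall>ya<y. \<not> (\<exists>t. f y = f ya + t))"
    then have "f ` {..<x} \<subseteq> M" "finite (f ` {..<x})" by auto
    then obtain m where "m \<in> M" "\<not> (\<exists>g\<in>f ` {..<x}. \<exists>t. m = g + t)" using no by blast
    then show "\<exists>r. r \<in> M \<and> (\<forall>y<x. \<not> (\<exists>t. r = f y + t))" by blast
  qed auto
  then obtain f where f0: "\<forall>x::nat. ?P f x (f x)" ..
  then have f: "\<And>x. f x \<in> M" "\<And>x y. y < x \<Longrightarrow> \<not> (\<exists>t. f x = f y + t)" by simp_all
  obtain r :: "nat \<Rightarrow> nat" where r: "strict_mono r" "\<And>v i j. v < N \<Longrightarrow> i \<le> j \<Longrightarrow> lookup (f (r i)) v \<le> lookup (f (r j)) v"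
    using monotone_subsequence_tuples[of N "\<lambda>i. lookup (f i)"] by metis
  have "lookup (f (r 0)) v \<le> lookup (f (r 1)) v" for v
  proof (cases "v < N")
    case False
    then have "v \<notin> keys (f (r 0))" using assms[OF f(1)] by blast
    then show ?thesis by (simp add: in_keys_iff)
  qed (use r(2) in auto)
  then have "f (r 1) = f (r 0) + (f (r 1) - f (r 0))"
    by (intro poly_mapping_eqI) (simp add: lookup_add lookup_minus)
  then show False using f(2)[of "r 0" "r 1"] r(1) by (metis less_one strict_monoD)
qed

lemma finite_monomials: "finite {m. keys m \<subseteq> {..<N::nat} \<and> mdeg m \<le> d}"
proof -
  let ?h = "\<lambda>m :: nat \<Rightarrow>\<^sub>0 nat. map (lookup m) [0..<N]"
  let ?M = "{m. keys m \<subseteq> {..<N} \<and> mdeg m \<le> d}"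
  have "inj_on ?h ?M"
  proof (rule inj_onI)
    fix a b :: "nat \<Rightarrow>\<^sub>0 nat" assume a: "a \<in> ?M" "b \<in> ?M" "?h a = ?h b"
    show "a = b"
    proof (rule poly_mapping_eqI)
      fix v show "lookup a v = lookup b v"
      proof (cases "v < N")
        case False
        then have "v \<notin> keys a" "v \<notin> keys b" using a by auto
        then show ?thesis by (simp add: in_keys_iff)
      qed (use a in auto)
    qed
  qed
  moreover have "?h ` ?M \<subseteq> {xs. set xs \<subseteq> {..d} \<and> length xs = N}"
  proof -
    have "lookup m v \<le> mdeg m" for m :: "nat \<Rightarrow>\<^sub>0 nat" and v
      by (cases "v \<in> keys m") (auto simp: mdeg_def in_keys_iff intro: member_le_sum)
    then have "lookup m v \<le> d" if "mdeg m \<le> d" for m :: "nat \<Rightarrow>\<^sub>0 nat" and v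
      using that le_trans by blast
    then show ?thesis by auto
  qed
  moreover have "finite {xs. set xs \<subseteq> {..d} \<and> length xs = N}" by (rule finite_lists_length_eq) simp
  ultimately show ?thesis by (meson finite_imageD finite_subset)
qed

text \<open>Division with remainder by finitely many homogeneous elements whose leading monomials
  divide all leading monomials of homogeneous elements. The leading monomial is the maximum for the
  linear order on exponents, which is compatible with addition.\<close>

lemma hideal_fg:
  assumes I: "hideal N I"
  shows "\<exists>F\<subseteq>I. finite F \<and> (\<forall>f\<in>F. \<exists>d. homog d f) \<and>
    (\<forall>g\<in>I. \<exists>a. (\<forall>f\<in>F. a f \<in> PV {..<N}) \<and> g = (\<Sum>f\<in>F. a f * f))"
proof -
  note id = hidealD[OF I]
  define lm where "lm f = Max (keys f)" for f :: "'a mpol"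
  let ?H = "{f \<in> I. f \<noteq> 0 \<and> (\<exists>d. homog d f)}"
  have lm_in: "lm f \<in> keys f" if "f \<noteq> 0" for f :: "'a mpol"
    unfolding lm_def using that by (intro Max_in) auto
  have "keys m \<subseteq> {..<N}" if "m \<in> lm ` ?H" for m
  proof -
    obtain f where f: "f \<in> I" "f \<noteq> 0" "m = lm f" using \<open>m \<in> lm ` ?H\<close> by blast
    then show ?thesis using lm_in[OF f(2)] id(1)[OF f(1)] by (auto simp: PV_def)
  qed
  from dickson[of "lm ` ?H", OF this] obtain L where L0: "L \<subseteq> lm ` ?H \<and> finite L \<and> (\<forall>m\<in>lm ` ?H. \<exists>f\<in>L. \<exists>t. m = f + t)" ..
  then have L: "L \<subseteq> lm ` ?H" "finite L" "\<And>m. m \<in> lm ` ?H \<Longrightarrow> \<exists>f\<in>L. \<exists>t. m = f + t" by blast+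
  obtain F where F: "F \<subseteq> ?H" "finite F" "L = lm ` F" using L by (meson finite_subset_image)
  let ?G = "{g. \<exists>a. (\<forall>f\<in>F. a f \<in> PV {..<N}) \<and> g = (\<Sum>f\<in>F. a f * f)}"
  have G0: "0 \<in> ?G" by (auto intro!: exI[of _ "\<lambda>_. 0"])
  have Gadd: "g + h \<in> ?G" if gh: "g \<in> ?G" "h \<in> ?G" for g h
  proof -
    obtain a b where "\<forall>f\<in>F. a f \<in> PV {..<N}" "g = (\<Sum>f\<in>F. a f * f)"
      "\<forall>f\<in>F. b f \<in> PV {..<N}" "h = (\<Sum>f\<in>F. b f * f)" using gh by blast
    then show ?thesis
      by (auto intro!: exI[of _ "\<lambda>f. a f + b f"] PV_add simp: distrib_right sum.distrib)
  qed
  have Ggen: "r * f \<in> ?G" if "f \<in> F" "r \<in> PV {..<N}" for f r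
    using that F(2) by (auto intro!: exI[of _ "\<lambda>g. if g = f then r else 0"] simp: if_distrib[of "\<lambda>x. x * _"] sum.delta' cong: if_cong)
  have hom: "g \<in> ?G" if "g \<in> I" "homog d g" for g d
    using that
  \<comment> \<open>The measure counts the monomials of bounded degree below the leading one. It is
    finite because the degree is fixed, so termination does not rest on well-foundedness of the
    monomial order.\<close>
  proof (induction "card {m. keys m \<subseteq> {..<N} \<and> mdeg m \<le> d \<and> m < lm g}" arbitrary: g rule: less_induct)
    case less
    show ?case
    proof (cases "g = 0")
      case False
      then have "lm g \<in> lm ` ?H" using less.prems by blast
      then obtain f t where f: "f \<in> F" "lm g = lm f + t" using L(3) F(3) by blast
      have fH: "f \<in> I" "f \<noteq> 0" using F f by auto
      define c where "c = lookup g (lm g) / lookup f (lm f)"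
      define h where "h = single t c * f"
      have lf: "lookup f (lm f) \<noteq> 0" using lm_in[OF fH(2)] by (simp add: in_keys_iff)
      have lg: "lookup g (lm g) \<noteq> 0" using lm_in[OF False] by (simp add: in_keys_iff)
      have c0: "c \<noteq> 0" using lf lg by (simp add: c_def)
      have sp: "single t c = const c * single t 1" by (simp add: const_def mult_single)
      have lh: "lookup h (t + m) = c * lookup f m" for m
        unfolding h_def sp mult.assoc lookup_const_mult
      proof (induction f rule: mpol_induct)
        case (single m' d)
        then show ?case by (simp add: mult_single lookup_single when_def)
      qed (auto simp: distrib_left lookup_add)
      have kh: "keys h \<subseteq> (\<lambda>m. t + m) ` keys f"
        using Poly_Mapping.keys_mult[of "single t c" f] by (auto simp: h_def split: if_splits)
      obtain e where e: "homog e f" using F f by auto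
      have lgk: "keys (lm g) \<subseteq> {..<N}" "mdeg (lm g) = d"
        using lm_in[OF False] less.prems id(1) by (auto simp: PV_def homog_def)
      have tk: "keys t \<subseteq> {..<N}" using lgk(1) f(2) keys_plus_nat[of "lm f" t] by simp
      have tP: "single t c \<in> PV {..<N}" using tk by (auto simp: PV_def split: if_splits)
      have hI: "h \<in> I" unfolding h_def using tP fH id by blast
      have hd: "homog d h"
      proof -
        have "mdeg (lm f) = e" using e lm_in[OF fH(2)] by (simp add: homog_def)
        then have "d = mdeg t + e" using lgk(2) f(2) by (simp add: mdeg_add)
        moreover have "homog (mdeg t) (single t c)" by (simp add: homog_def)
        ultimately show ?thesis using homog_mult e by (simp add: h_def)
      qed
      have smaller: "m < lm g" if "m \<in> keys (g - h)" for m
      proof -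
        have "m \<in> keys g \<or> m \<in> keys h" using that by (auto simp: in_keys_iff lookup_minus)
        moreover have "m \<le> lm g" if "m \<in> keys g" using that by (simp add: lm_def)
        moreover have "m \<le> lm g" if mh: "m \<in> keys h"
        proof -
          obtain m' where "m = t + m'" "m' \<in> keys f" using kh mh by blast
          moreover then have "m' \<le> lm f" by (simp add: lm_def)
          ultimately show ?thesis unfolding f(2)
            using add_right_mono[of m' "lm f" t] by (simp add: add.commute)
        qed
        ultimately have "m \<le> lm g" by blast
        moreover have "lookup h (lm g) = lookup g (lm g)"
          using lh[of "lm f"] lf by (simp add: f(2) add.commute c_def)
        then have "m \<noteq> lm g" using that by (auto simp: in_keys_iff lookup_minus)
        ultimately show ?thesis by simp
      qed
      have ghI: "g - h \<in> I" "homog d (g - h)"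
        using hideal_minus[OF I] less.prems hI hd homog_minus by auto
      have "g - h \<in> ?G"
      proof (cases "g - h = 0")
        case False
        let ?S = "\<lambda>g. {m. keys m \<subseteq> {..<N} \<and> mdeg m \<le> d \<and> m < lm g}"
        have "lm (g - h) < lm g" using smaller lm_in[OF False] by blast
        then have "?S (g - h) \<subseteq> ?S g" "lm (g - h) \<in> ?S g" "lm (g - h) \<notin> ?S (g - h)"
          using lm_in[OF False] ghI id(1)[OF ghI(1)] by (auto simp: PV_def homog_def)
        then have "?S (g - h) \<subset> ?S g" by blast
        moreover have "finite (?S g)" by (rule finite_subset[OF _ finite_monomials[of N d]]) auto
        ultimately have "card (?S (g - h)) < card (?S g)" by (rule psubset_card_mono[rotated])
        then show ?thesis using less.hyps ghI by blast
      qed (use G0 in simp)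
      moreover have "h \<in> ?G" unfolding h_def using Ggen[OF f(1) tP] .
      ultimately show ?thesis using Gadd[of "g - h" h] by simp
    qed (use G0 in simp)
  qed
  have "g \<in> ?G" if "g \<in> I" for g
  proof -
    obtain D where D: "g = (\<Sum>d\<le>D. hom_part d g)" using hom_part_decomp[of g] by blast
    have "(\<Sum>d\<in>A. hom_part d g) \<in> ?G" if "finite A" for A
      using that
    proof (induction A rule: finite_induct)
      case empty
      then show ?case using G0 by simp
    next
      case (insert x A)
      have "hom_part x g \<in> ?G" using hom[OF id(5)[OF \<open>g \<in> I\<close>, of x] homog_hom_part] .
      from Gadd[OF this insert.IH] show ?case using insert.hyps by simp
    qed
    from this[of "{..D}"] show ?thesis unfolding D[symmetric] by simp
  qed
  moreover have "F \<subseteq> I" "\<forall>f\<in>F. \<exists>d. homog d f" using F(1) by auto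
  ultimately show ?thesis using F(2) by (intro exI[of _ F]) simp
qed

subsection \<open>Graded submodules of free modules\<close>

definition gpart :: "int \<Rightarrow> ('k::field) mpol \<Rightarrow> 'k mpol" where
  "gpart k p = (if k < 0 then 0 else hom_part (nat k) p)"

lemma lookup_gpart [simp]: "lookup (gpart k p) m = (if int (mdeg m) = k then lookup p m else 0)"
  by (auto simp: gpart_def)
lemma gpart_in_gform: "p \<in> PV {..<N} \<Longrightarrow> gpart k p \<in> gform N k"
  by (auto simp: gform_def PV_def in_keys_iff split: if_splits)
lemma gpart_0 [simp]: "gpart k 0 = 0" by (auto simp: gpart_def)
lemma gpart_add: "gpart k (p + q) = gpart k p + gpart k q" by (auto simp: gpart_def)
lemma gpart_minus: "gpart k (p - q) = gpart k p - gpart k q" by (auto simp: gpart_def)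
lemma gpart_sum: "gpart k (sum f A) = (\<Sum>x\<in>A. gpart k (f x))"
  by (rule additive_sum) (auto simp: gpart_add)
lemma gpart_gform: "p \<in> gform N l \<Longrightarrow> gpart k p = (if k = l then p else 0)"
  by (rule poly_mapping_eqI) (auto simp: gform_def in_keys_iff)
lemma gpart_mult_left:
  assumes "q \<in> gform N e" shows "gpart k (q * p) = q * gpart (k - e) p"
proof (induction p rule: mpol_induct)
  case (single m c)
  let ?N = "N + Suc (Max (insert 0 (keys m)))"

  have "v < ?N" if "v \<in> keys m" for v
  proof -
    have "v \<le> Max (insert 0 (keys m))" using that by (intro Max_ge) auto
    then show ?thesis by linarith
  qed
  then have s: "single m c \<in> gform ?N (int (mdeg m))" by (auto simp: gform_def PV_def split: if_splits)
  have "q \<in> gform ?N e" using assms by (auto simp: gform_def intro: PV_mono)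
  from gform_mult[OF this s] show ?case
    using gpart_gform[OF s] gpart_gform by fastforce
qed (auto simp: distrib_left gpart_add)
lemma hideal_gpart: "hideal N I \<Longrightarrow> f \<in> I \<Longrightarrow> gpart k f \<in> I"
  by (auto simp: gpart_def intro: hidealD)

definition mpart :: "(nat \<Rightarrow> nat) \<Rightarrow> int \<Rightarrow> (nat \<Rightarrow> ('k::field) mpol) \<Rightarrow> nat \<Rightarrow> 'k mpol" where
  "mpart s d v = (\<lambda>j. gpart (d - int (s j)) (v j))"

definition gsub :: "nat \<Rightarrow> nat \<Rightarrow> (nat \<Rightarrow> nat) \<Rightarrow> (nat \<Rightarrow> ('k::field) mpol) set \<Rightarrow> bool" where
  "gsub N b s U \<longleftrightarrow> (\<forall>v\<in>U. (\<forall>j. v j \<in> PV {..<N}) \<and> (\<forall>j\<ge>b. v j = 0)) \<and> 0 \<in> U \<and>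
     (\<forall>v\<in>U. \<forall>w\<in>U. v + w \<in> U) \<and> (\<forall>r\<in>PV {..<N}. \<forall>v\<in>U. smul r v \<in> U) \<and> (\<forall>v\<in>U. \<forall>d. mpart s d v \<in> U)"

text \<open>A generator is stored together with its degree, since the zero vector is homogeneous of
  every degree and a free module mapping onto the span needs definite shifts.\<close>

definition mspan :: "nat \<Rightarrow> ((nat \<Rightarrow> ('k::field) mpol) \<times> nat) set \<Rightarrow> (nat \<Rightarrow> 'k mpol) set" where
  "mspan N W = {v. \<exists>a. (\<forall>w\<in>W. a w \<in> PV {..<N}) \<and> v = (\<lambda>j. \<Sum>w\<in>W. a w * fst w j)}"

lemma mspan_add:
  assumes "v \<in> mspan N W" "u \<in> mspan N W" shows "v + u \<in> mspan N W"
proof -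
  obtain a b where "\<forall>f\<in>W. a f \<in> PV {..<N}" "v = (\<lambda>j. \<Sum>w\<in>W. a w * fst w j)"
    "\<forall>f\<in>W. b f \<in> PV {..<N}" "u = (\<lambda>j. \<Sum>w\<in>W. b w * fst w j)" using assms by (auto simp: mspan_def)
  then show ?thesis unfolding mspan_def
    by (auto intro!: exI[of _ "\<lambda>f. a f + b f"] PV_add simp: distrib_right sum.distrib fun_eq_iff)
qed

lemma mspan_mono:
  assumes "v \<in> mspan N W" "W \<subseteq> W'" "finite W'" shows "v \<in> mspan N W'"
proof -
  obtain a where a: "\<forall>f\<in>W. a f \<in> PV {..<N}" "v = (\<lambda>j. \<Sum>w\<in>W. a w * fst w j)"
    using assms(1) by (auto simp: mspan_def)
  have "(\<Sum>w\<in>W'. (if w \<in> W then a w else 0) * fst w j) = (\<Sum>w\<in>W. a w * fst w j)" for j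
    using assms(2,3) by (intro sum.mono_neutral_cong_right) auto
  then show ?thesis using a unfolding mspan_def
    by (auto intro!: exI[of _ "\<lambda>w. if w \<in> W then a w else 0"])
qed

text \<open>Induction on the rank. The last coordinates form a homogeneous ideal; homogeneous lifts
  of its generators reduce any element to one with vanishing last coordinate, that is, to a graded
  submodule of smaller rank.\<close>

lemma gsub_fg:
  assumes "gsub N b s U"
  shows "\<exists>W. finite W \<and> (\<forall>x\<in>W. fst x \<in> U \<and> (\<forall>j. fst x j \<in> gform N (int (snd x) - int (s j)))) \<and> U \<subseteq> mspan N W"
  using assms
proof (induction b arbitrary: U)
  case 0
  then have "v = 0" if "v \<in> U" for v using that by (auto simp: gsub_def fun_eq_iff)
  then show ?case by (intro exI[of _ "{}"]) (auto simp: mspan_def fun_eq_iff)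
next
  case (Suc b)
  note U = Suc.prems[unfolded gsub_def]
  let ?A = "(\<lambda>v. v b) ` U"
  have "hideal N ?A" unfolding hideal_def
  proof (intro conjI ballI allI)
    show "?A \<subseteq> PV {..<N}" using U by auto
    show "0 \<in> ?A" using U by (auto simp: image_iff intro!: bexI[of _ 0])
    fix f assume "f \<in> ?A"
    then obtain v where v: "v \<in> U" "f = v b" by blast
    show "f + g \<in> ?A" if g: "g \<in> ?A" for g
    proof -
      obtain w where "w \<in> U" "g = w b" using g by blast
      then have "v + w \<in> U" "f + g = (v + w) b" using v U by auto
      then show ?thesis by blast
    qed
    show "r * f \<in> ?A" if "r \<in> PV {..<N}" for r
    proof -
      have "smul r v \<in> U" "r * f = smul r v b" using v U that by (auto simp: smul_def)
      then show ?thesis by blast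
    qed
    fix d
    have "mpart s (int (d + s b)) v \<in> U" "hom_part d f = mpart s (int (d + s b)) v b"
      using v U by (auto simp: mpart_def gpart_def)
    then show "hom_part d f \<in> ?A" by blast
  qed
  from hideal_fg[OF this] obtain F where F0: "F \<subseteq> ?A \<and> finite F \<and> (\<forall>f\<in>F. \<exists>d. homog d f) \<and>
    (\<forall>g\<in>?A. \<exists>a. (\<forall>f\<in>F. a f \<in> PV {..<N}) \<and> g = (\<Sum>f\<in>F. a f * f))" ..
  then have F: "F \<subseteq> ?A" "finite F" "\<forall>f\<in>F. \<exists>d. homog d f"
    "\<And>g. g \<in> ?A \<Longrightarrow> \<exists>a. (\<forall>f\<in>F. a f \<in> PV {..<N}) \<and> g = (\<Sum>f\<in>F. a f * f)" by blast+
  have "\<exists>w t. w \<in> U \<and> (\<forall>j. w j \<in> gform N (int t - int (s j))) \<and> w b = f" if f: "f \<in> F" for f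
  proof -
    obtain v where v: "v \<in> U" "f = v b" using f F(1) by blast
    obtain d where d: "homog d f" using f F(3) by blast
    have "mpart s (int (d + s b)) v \<in> U" "mpart s (int (d + s b)) v b = f"
      using v U hom_part_homog[OF d, of d] by (auto simp: mpart_def gpart_def)
    moreover have "mpart s (int (d + s b)) v j \<in> gform N (int (d + s b) - int (s j))" for j
      unfolding mpart_def using v U by (intro gpart_in_gform) auto
    ultimately show ?thesis by blast
  qed
  then obtain lw lt where l: "\<And>f. f \<in> F \<Longrightarrow> lw f \<in> U \<and> (\<forall>j. lw f j \<in> gform N (int (lt f) - int (s j))) \<and> lw f b = f"
    by metis
  let ?U' = "{v \<in> U. v b = 0}"
  have "gsub N b s ?U'"
    unfolding gsub_def using U le_less_Suc_eq[of b]
    by (auto simp: smul_def mpart_def) (metis Suc_leI le_neq_implies_less)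
  from Suc.IH[OF this] obtain W where W0: "finite W \<and>
    (\<forall>x\<in>W. fst x \<in> ?U' \<and> (\<forall>j. fst x j \<in> gform N (int (snd x) - int (s j)))) \<and> ?U' \<subseteq> mspan N W" ..
  note W = conjunct1[OF W0] conjunct1[OF conjunct2[OF W0]] conjunct2[OF conjunct2[OF W0]]
  let ?L = "(\<lambda>f. (lw f, lt f)) ` F"
  have inj: "inj_on (\<lambda>f. (lw f, lt f)) F"
    by (rule inj_on_inverseI[of _ "\<lambda>x. fst x b"]) (simp add: l)
  have "v \<in> mspan N (W \<union> ?L)" if v: "v \<in> U" for v
  proof -
    obtain a where a: "\<forall>f\<in>F. a f \<in> PV {..<N}" "v b = (\<Sum>f\<in>F. a f * f)" using F(4)[of "v b"] v by blast
    define u where "u = (\<Sum>f\<in>F. smul (a f) (lw f))"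
    have uU: "u \<in> U"
      unfolding u_def using F(2) a(1) l
    proof (induction F rule: finite_induct)
      case (insert x G)
      have "smul (a x) (lw x) \<in> U" using U insert.prems by blast
      moreover have "(\<Sum>f\<in>G. smul (a f) (lw f)) \<in> U" using insert by blast
      ultimately have "smul (a x) (lw x) + (\<Sum>f\<in>G. smul (a f) (lw f)) \<in> U" using U by blast
      then show ?case by (subst sum.insert[OF insert.hyps])
    qed (use U in auto)
    have uj: "u j = (\<Sum>f\<in>F. a f * lw f j)" for j
      unfolding u_def using F(2) by (induction F rule: finite_induct) (auto simp: smul_def)
    have "u \<in> mspan N ?L"
      unfolding mspan_def mem_Collect_eq
      by (rule exI[of _ "\<lambda>w. a (fst w b)"])
        (use a inj l in \<open>auto simp: fun_eq_iff uj sum.reindex intro!: sum.cong\<close>)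
    moreover have "v - u \<in> ?U'"
    proof -
      have "- u = smul (-1) u" by (simp add: smul_def fun_eq_iff)
      then have "- u \<in> U" using U uU PV_uminus[OF PV_one] by metis
      then have "v + - u \<in> U" using U that by blast
      moreover have "u b = v b" using l a(2) by (simp add: uj)
      ultimately show ?thesis by simp
    qed
    then have "v - u \<in> mspan N W" using W(3) by blast
    ultimately have "(v - u) + u \<in> mspan N (W \<union> ?L)"
      using mspan_mono W(1) F(2) by (intro mspan_add) (auto intro: mspan_mono)
    then show ?thesis by simp
  qed
  then show ?case
    using W F(2) l by (intro exI[of _ "W \<union> ?L"]) auto
qed

lemma free_mod_PV: "v \<in> free_mod n b \<longleftrightarrow> (\<forall>j. v j \<in> PV {..<Suc n}) \<and> (\<forall>j\<ge>b. v j = 0)"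
  unfolding free_mod_def carrier_coord_ring lessThan_Suc_atMost
  by auto (metis PV_zero linorder_not_less)

definition graded_matrix :: "nat \<Rightarrow> nat \<Rightarrow> (nat \<Rightarrow> nat) \<Rightarrow> nat \<Rightarrow> (nat \<Rightarrow> nat) \<Rightarrow> (nat \<Rightarrow> nat \<Rightarrow> ('k::field) mpol) \<Rightarrow> bool" where
  "graded_matrix N a s b t D \<longleftrightarrow> (\<forall>l<a. \<forall>j<b. D l j \<in> gform N (int (t j) - int (s l)))"

lemma mat_app_add: "mat_app a b D (u + v) = mat_app a b D u + mat_app a b D v"
  by (auto simp: mat_app_def fun_eq_iff distrib_left sum.distrib)
lemma mat_app_smul: "mat_app a b D (smul r u) = smul r (mat_app a b D u)"
  by (auto simp: mat_app_def fun_eq_iff smul_def sum_distrib_left mult_ac)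
lemma mat_app_zero: "mat_app a b D 0 = 0"
  by (auto simp: mat_app_def fun_eq_iff)
lemma mat_app_mpart:
  assumes "graded_matrix N a s b t D"
  shows "mat_app a b D (mpart t d v) = mpart s d (mat_app a b D v)"
proof
  fix l
  have "D l j * gpart (d - int (t j)) (v j) = gpart (d - int (s l)) (D l j * v j)" if "l < a" "j < b" for j
    using assms that gpart_mult_left[of "D l j" N "int (t j) - int (s l)" "d - int (s l)"]
    by (auto simp: graded_matrix_def)
  then show "mat_app a b D (mpart t d v) l = mpart s d (mat_app a b D v) l"
    by (auto simp: mat_app_def mpart_def gpart_sum)
qed

lemma mat_app_free_mod:
  assumes "\<And>l j. l < a \<Longrightarrow> j < b \<Longrightarrow> D l j \<in> PV {..<Suc n}" "v \<in> free_mod n b"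
  shows "mat_app a b D v \<in> free_mod n a"
  using assms by (auto simp: free_mod_PV mat_app_def intro!: PV_sum PV_mult)

lemma gsub_image:
  assumes "gsub (Suc n) a s U"
  shows "\<exists>b t D. graded_matrix (Suc n) a s b t D \<and> mat_app a b D ` free_mod n b = U"
proof -
  from gsub_fg[OF assms] obtain W where W0: "finite W \<and>
    (\<forall>x\<in>W. fst x \<in> U \<and> (\<forall>j. fst x j \<in> gform (Suc n) (int (snd x) - int (s j)))) \<and> U \<subseteq> mspan (Suc n) W" ..
  note W = conjunct1[OF W0] conjunct1[OF conjunct2[OF W0]] conjunct2[OF conjunct2[OF W0]]
  note U = assms[unfolded gsub_def]
  obtain h where h: "bij_betw h {..<card W} W" using ex_bij_betw_nat_finite[OF W(1)] by (auto simp: atLeast0LessThan)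
  have hW: "h j \<in> W" if "j < card W" for j using h that by (auto simp: bij_betw_def)
  let ?D = "\<lambda>l j. fst (h j) l" and ?t = "\<lambda>j. snd (h j)"
  have 1: "graded_matrix (Suc n) a s (card W) ?t ?D"
    unfolding graded_matrix_def using W(2) hW by blast
  have app: "mat_app a (card W) ?D v = (\<Sum>j<card W. smul (v j) (fst (h j)))" for v
  proof
    fix l
    have s: "(\<Sum>j<k. smul (v j) (fst (h j))) l = (\<Sum>j<k. fst (h j) l * v j)" for k
      by (induction k) (auto simp: smul_def mult.commute)
    have "fst (h j) l = 0" if "j < card W" "\<not> l < a" for j
      using W(2) hW[OF that(1)] U that(2) by (meson linorder_not_less)
    then show "mat_app a (card W) ?D v l = (\<Sum>j<card W. smul (v j) (fst (h j))) l"
      by (auto simp: mat_app_def s)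
  qed
  have "mat_app a (card W) ?D v \<in> U" if "v \<in> free_mod n (card W)" for v
  proof -
    have "(\<Sum>j<k. smul (v j) (fst (h j))) \<in> U" if "k \<le> card W" for k
      using that
    proof (induction k)
      case (Suc k)
      have "fst (h k) \<in> U" using W(2) hW Suc.prems by auto
      then have "smul (v k) (fst (h k)) \<in> U" using U \<open>v \<in> _\<close> by (auto simp: free_mod_PV)
      then have "(\<Sum>j<k. smul (v j) (fst (h j))) + smul (v k) (fst (h k)) \<in> U" using U Suc by auto
      then show ?case by (simp only: sum.lessThan_Suc)
    qed (use U in auto)
    then show ?thesis by (simp add: app)
  qed
  moreover have "u \<in> mat_app a (card W) ?D ` free_mod n (card W)" if "u \<in> U" for u
  proof -
    obtain c where c: "\<forall>w\<in>W. c w \<in> PV {..<Suc n}" "u = (\<lambda>j. \<Sum>w\<in>W. c w * fst w j)"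
      using W(3) \<open>u \<in> U\<close> by (auto simp: mspan_def)
    let ?v = "\<lambda>j. if j < card W then c (h j) else 0"
    have "u l = 0" if "\<not> l < a" for l using U \<open>u \<in> U\<close> that by auto
    moreover have "u l = (\<Sum>j<card W. fst (h j) l * c (h j))" for l
      unfolding c(2) using sum.reindex_bij_betw[OF h, of "\<lambda>w. c w * fst w l"] by (simp add: mult.commute)
    ultimately have "mat_app a (card W) ?D ?v = u" by (auto simp: mat_app_def fun_eq_iff)
    moreover have "?v \<in> free_mod n (card W)" using c(1) hW by (auto simp: free_mod_PV)
    ultimately show ?thesis by blast
  qed
  ultimately show ?thesis using 1 by blast
qed

lemma gsub_kernel:
  fixes D :: "nat \<Rightarrow> nat \<Rightarrow> 'a::field mpol"
  assumes "graded_matrix (Suc n) a s b t D"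
  shows "gsub (Suc n) b t {v \<in> free_mod n b. mat_app a b D v = 0}"
  unfolding gsub_def
proof (intro conjI ballI allI)
  fix v :: "nat \<Rightarrow> 'a mpol" and d assume v: "v \<in> {v \<in> free_mod n b. mat_app a b D v = 0}"
  show "mpart t d v \<in> {v \<in> free_mod n b. mat_app a b D v = 0}"
    using v mat_app_mpart[OF assms, of d v]
    by (auto simp: free_mod_PV mpart_def fun_eq_iff intro!: gform_PV[OF gpart_in_gform])
next
  fix r :: "'a mpol" and v :: "nat \<Rightarrow> 'a mpol" assume "r \<in> PV {..<Suc n}" "v \<in> {v \<in> free_mod n b. mat_app a b D v = 0}"
  then show "smul r v \<in> {v \<in> free_mod n b. mat_app a b D v = 0}"
    using mat_app_smul[of a b D r v] by (auto simp: free_mod_PV smul_def fun_eq_iff PV_mult)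
next
  show "0 \<in> {v \<in> free_mod n b. mat_app a b D v = 0}" using mat_app_zero[of a b D] by (auto simp: free_mod_PV)
next
  fix v w :: "nat \<Rightarrow> 'a mpol" assume "v \<in> {v \<in> free_mod n b. mat_app a b D v = 0}" "w \<in> {v \<in> free_mod n b. mat_app a b D v = 0}"
  then show "v + w \<in> {v \<in> free_mod n b. mat_app a b D v = 0}"
    using mat_app_add[of a b D v w] by (auto simp: free_mod_PV PV_add)
qed (auto simp: free_mod_PV)

text \<open>Each syzygy module is a graded submodule of a finitely generated free module, so some
  graded matrix maps onto it; dependent choice strings the matrices together.\<close>

lemma resolution_exists:
  assumes A: "hideal (Suc n) A" and B: "hideal (Suc n) (B :: 'k::field mpol set)"
  shows "\<exists>F. graded_free_resolution n A B F"
proof -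
  obtain F where F: "F \<subseteq> A" "finite F" "\<forall>f\<in>F. \<exists>d. homog d f"
    "\<And>g. g \<in> A \<Longrightarrow> \<exists>a. (\<forall>f\<in>F. a f \<in> PV {..<Suc n}) \<and> g = (\<Sum>f\<in>F. a f * f)"
    using hideal_fg[OF A] by blast
  obtain h where h: "bij_betw h {..<card F} F" using ex_bij_betw_nat_finite[OF F(2)] by (auto simp: atLeast0LessThan)
  have hF: "h j \<in> F" if "j < card F" for j using h that by (auto simp: bij_betw_def)
  let ?b = "card F"
  have "\<forall>j. \<exists>d. j < ?b \<longrightarrow> homog d (h j)" using F(3) hF by blast
  then obtain s0 where s0: "\<And>j. j < ?b \<Longrightarrow> homog (s0 j) (h j)" by metis
  have g0: "graded_matrix (Suc n) 1 (\<lambda>_. 0) ?b s0 (\<lambda>_. h)"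
    using s0 hF F(1) hidealD(1)[OF A] by (auto simp: graded_matrix_def gform_hform hform_def)
  let ?aug = "\<lambda>v. \<Sum>j<?b. h j * v j"
  let ?U = "{v \<in> free_mod n ?b. ?aug v \<in> B}"
  have aug: "?aug v = mat_app 1 ?b (\<lambda>_. h) v 0" for v by (simp add: mat_app_def)
  have U: "gsub (Suc n) ?b s0 ?U"
    unfolding gsub_def aug
  proof (intro conjI ballI allI)
    fix v :: "nat \<Rightarrow> 'k mpol" and d assume v: "v \<in> {v \<in> free_mod n ?b. mat_app 1 ?b (\<lambda>_. h) v 0 \<in> B}"
    show "mpart s0 d v \<in> {v \<in> free_mod n ?b. mat_app 1 ?b (\<lambda>_. h) v 0 \<in> B}"
      using v mat_app_mpart[OF g0, of d v] hideal_gpart[OF B]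
      by (auto simp: free_mod_PV mpart_def fun_eq_iff intro!: gform_PV[OF gpart_in_gform])
  next
    fix r :: "'k mpol" and v :: "nat \<Rightarrow> 'k mpol" assume "r \<in> PV {..<Suc n}" "v \<in> {v \<in> free_mod n ?b. mat_app 1 ?b (\<lambda>_. h) v 0 \<in> B}"
    then show "smul r v \<in> {v \<in> free_mod n ?b. mat_app 1 ?b (\<lambda>_. h) v 0 \<in> B}"
      using mat_app_smul[of 1 ?b "\<lambda>_. h" r v] hidealD[OF B] by (auto simp: free_mod_PV smul_def fun_eq_iff PV_mult)
  next
    show "0 \<in> {v \<in> free_mod n ?b. mat_app 1 ?b (\<lambda>_. h) v 0 \<in> B}"
      using mat_app_zero[of 1 ?b "\<lambda>_. h"] hidealD(2)[OF B] by (auto simp: free_mod_PV fun_eq_iff)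
  next
    fix v w :: "nat \<Rightarrow> 'k mpol" assume "v \<in> {v \<in> free_mod n ?b. mat_app 1 ?b (\<lambda>_. h) v 0 \<in> B}" "w \<in> {v \<in> free_mod n ?b. mat_app 1 ?b (\<lambda>_. h) v 0 \<in> B}"
    then show "v + w \<in> {v \<in> free_mod n ?b. mat_app 1 ?b (\<lambda>_. h) v 0 \<in> B}"
      using mat_app_add[of 1 ?b "\<lambda>_. h" v w] hidealD(3)[OF B] by (auto simp: free_mod_PV PV_add)
  qed (auto simp: free_mod_PV)
  \<comment> \<open>A stage is a graded matrix with the ranks and shifts of its target and source.
    The next stage has the present source as target and the present kernel as image.\<close>
  define good where "good = (\<lambda>(a, s, b, t, D :: nat \<Rightarrow> nat \<Rightarrow> 'k mpol). graded_matrix (Suc n) a s b t D)"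
  define next_ok where "next_ok = (\<lambda>(a, s :: nat \<Rightarrow> nat, b, t :: nat \<Rightarrow> nat, D :: nat \<Rightarrow> nat \<Rightarrow> 'k mpol) (a', s', b', t' :: nat \<Rightarrow> nat, D').
     a' = b \<and> s' = t \<and> {v \<in> free_mod n b. mat_app a b D v = 0} = mat_app a' b' D' ` free_mod n b')"
  obtain b1 t1 D1 where D1: "graded_matrix (Suc n) ?b s0 b1 t1 D1" "mat_app ?b b1 D1 ` free_mod n b1 = ?U"
    using gsub_image[OF U] by blast
  have "\<exists>f. \<forall>i. (good (f i) \<and> (i = 0 \<longrightarrow> f i = (?b, s0, b1, t1, D1))) \<and> next_ok (f i) (f (Suc i))"
  proof (rule dependent_nat_choice)
    show "\<exists>x. good x \<and> (0 = 0 \<longrightarrow> x = (?b, s0, b1, t1, D1))" using D1 by (auto simp: good_def)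
    fix x and i :: nat assume x: "good x \<and> (i = 0 \<longrightarrow> x = (?b, s0, b1, t1, D1))"
    obtain a s b t D where xe: "x = (a, s, b, t, D)" by (cases x)
    then have "graded_matrix (Suc n) a s b t D" using x by (auto simp: good_def)
    from gsub_image[OF gsub_kernel[OF this]] obtain b' t' D' where
      "graded_matrix (Suc n) b t b' t' D'" "mat_app b b' D' ` free_mod n b' = {v \<in> free_mod n b. mat_app a b D v = 0}"
      by blast
    then show "\<exists>y. (good y \<and> (Suc i = 0 \<longrightarrow> y = (?b, s0, b1, t1, D1))) \<and> next_ok x y"
      by (intro exI[of _ "(b, t, b', t', D')"]) (auto simp: xe good_def next_ok_def)
  qed
  then obtain f where f: "\<And>i. good (f i)" "f 0 = (?b, s0, b1, t1, D1)" "\<And>i. next_ok (f i) (f (Suc i))" by blast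
  define r where "r i = fst (f i)" for i
  define sh where "sh i = fst (snd (f i))" for i
  define D where "D i = snd (snd (snd (snd (f i))))" for i
  have step: "fst (snd (snd (f i))) = r (Suc i)" "fst (snd (snd (snd (f i)))) = sh (Suc i)" for i
    using f(3)[of i] by (auto simp: next_ok_def r_def sh_def split: prod.splits)
  have fi: "f i = (r i, sh i, r (Suc i), sh (Suc i), D i)" for i
    using step(1)[of i] step(2)[of i] by (simp add: prod_eq_iff r_def sh_def D_def)
  have gr: "graded_matrix (Suc n) (r i) (sh i) (r (Suc i)) (sh (Suc i)) (D i)" for i
    using f(1)[of i] by (auto simp: good_def fi)
  have ex: "{v \<in> free_mod n (r (Suc i)). mat_app (r i) (r (Suc i)) (D i) v = 0} =
      mat_app (r (Suc i)) (r (Suc (Suc i))) (D (Suc i)) ` free_mod n (r (Suc (Suc i)))" for i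
    using f(3)[of i] by (auto simp: next_ok_def fi)
  have z: "r 0 = ?b" "sh 0 = s0" "r 1 = b1" "D 0 = D1"
    using f(2) fi[of 0] by auto
  let ?F = "\<lparr>rk = r, shift = sh, diff = D, aug = h\<rparr>"
  have "graded_free_resolution n A B ?F"
    unfolding graded_free_resolution_def
  proof (intro conjI allI impI ballI)
    fix j assume "j < rk ?F 0"
    then show "aug ?F j \<in> A" "homog (shift ?F 0 j) (aug ?F j)" using hF F(1) s0 z by auto
  next
    fix i l j assume "l < rk ?F i" "j < rk ?F (Suc i)"
    then have D: "D i l j \<in> gform (Suc n) (int (sh (Suc i) j) - int (sh i l))"
      using gr[of i] by (auto simp: graded_matrix_def)
    then show "diff ?F i l j \<in> carrier (coord_ring n)"
      by (simp add: carrier_coord_ring lessThan_Suc_atMost gform_def)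
    show "shift ?F i l + mdeg m = shift ?F (Suc i) j" if "m \<in> keys (diff ?F i l j)" for m
      using D that by (auto simp: gform_def)
  next
    fix x assume "x \<in> A"
    then obtain c where c: "\<forall>f\<in>F. c f \<in> PV {..<Suc n}" "x = (\<Sum>f\<in>F. c f * f)" using F(4) by blast
    let ?v = "\<lambda>j. if j < ?b then c (h j) else 0"
    have "?aug ?v = x"
      unfolding c(2) using sum.reindex_bij_betw[OF h, of "\<lambda>f. c f * f"] by (simp add: mult.commute)
    moreover have "?v \<in> free_mod n ?b" using c(1) hF by (auto simp: free_mod_PV)
    ultimately show "\<exists>v\<in>free_mod n (rk ?F 0). x - aug_map ?F v \<in> B"
      using hidealD(2)[OF B] z by (auto simp: aug_map_def intro!: bexI[of _ ?v])
  next
    show "{v \<in> free_mod n (rk ?F 0). aug_map ?F v \<in> B} = diff_map ?F 0 ` free_mod n (rk ?F 1)"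
      using D1(2) z by (simp add: aug_map_def diff_map_def)
  next
    fix i show "{v \<in> free_mod n (rk ?F (Suc i)). diff_map ?F i v = 0} =
        diff_map ?F (Suc i) ` free_mod n (rk ?F (Suc (Suc i)))"
      using ex[of i] by (simp add: diff_map_def)
  qed
  then show ?thesis by blast
qed

section \<open>Linear algebra\<close>

context vector_space
begin

lemma independent_card_le:
  assumes "finite B0" "V \<subseteq> span B0" "B \<subseteq> V" "independent B"
  shows "finite B \<and> card B \<le> dim V"
proof -
  obtain B1 where B1: "B1 \<subseteq> V" "independent B1" "V \<subseteq> span B1" "card B1 = dim V"
    using basis_exists[of V] by blast
  have "finite B1" using independent_span_bound[OF assms(1) B1(2)] B1(1) assms(2) by blast
  from independent_span_bound[OF this assms(4)] show ?thesis using B1 assms(3) by auto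
qed

lemma dim_mono_finite:
  assumes "finite B0" "V \<subseteq> span B0" "U \<subseteq> V" shows "dim U \<le> dim V"
proof -
  obtain B1 where B1: "B1 \<subseteq> U" "independent B1" "card B1 = dim U" using basis_exists[of U] by metis
  then show ?thesis using independent_card_le[OF assms(1,2), of B1] assms(3) by auto
qed

lemma dim_eq_imp_subset:
  assumes "finite B0" "V \<subseteq> span B0" "U \<subseteq> V" "subspace U" "dim V \<le> dim U" shows "V \<subseteq> U"
proof
  fix v assume v: "v \<in> V"
  obtain B1 where B1: "B1 \<subseteq> U" "independent B1" "U \<subseteq> span B1" "card B1 = dim U"
    using basis_exists[of U] by metis
  have f: "finite B1" using independent_card_le[OF assms(1,2), of B1] B1 assms(3) by auto
  have "v \<in> span B1"
  proof (rule ccontr)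
    assume n: "v \<notin> span B1"
    then have "independent (insert v B1)" using B1(2) by (rule independent_insertI)
    then have "card (insert v B1) \<le> dim V"
      using independent_card_le[OF assms(1,2), of "insert v B1"] B1(1) assms(3) v by auto
    moreover have "v \<notin> B1" using n span_base by blast
    ultimately show False using f B1(4) assms(5) by simp
  qed
  then show "v \<in> U" using B1(1) assms(4) span_minimal by blast
qed

end

text \<open>A basis of the kernel is extended to a basis of \<open>V\<close>, and the added vectors
  span a complement on which \<open>T\<close> is injective. The ambient space may be infinite
  dimensional.\<close>

lemma rank_nullity:
  assumes lin: "Vector_Spaces.linear s1 s2 T"
    and V: "module.subspace s1 V" "finite B0" "V \<subseteq> module.span s1 B0"
  shows "vector_space.dim s1 V = vector_space.dim s1 {v \<in> V. T v = 0} + vector_space.dim s2 (T ` V)"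
proof -
  interpret Vector_Spaces.linear s1 s2 T by (rule lin)
  let ?K = "{v \<in> V. T v = 0}"
  obtain B where B: "B \<subseteq> ?K" "vs1.independent B" "?K \<subseteq> vs1.span B" "card B = vs1.dim ?K"
    using vs1.basis_exists[of ?K] by blast
  have "B \<subseteq> V" using B by auto
  from vs1.maximal_independent_subset_extend[OF this B(2)] obtain B' where
    B': "B \<subseteq> B'" "B' \<subseteq> V" "vs1.independent B'" "V \<subseteq> vs1.span B'" by blast
  have fB': "finite B'" using vs1.independent_card_le[OF V(2,3) B'(2,3)] by simp
  have dV: "vs1.dim V = card B'" using vs1.basis_card_eq_dim[OF B'(2,4,3)] by simp
  let ?C = "B' - B"
  have fin: "finite B" "finite ?C" using fB' B'(1) finite_subset by auto
  have iC: "vs1.independent ?C" using B'(3) vs1.independent_mono by blast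
  have disj: "v = 0" if v: "v \<in> vs1.span ?C" "T v = 0" for v
  proof -
    have "vs1.span ?C \<subseteq> V" using B'(2) V(1) by (intro vs1.span_minimal) auto
    then have "v \<in> vs1.span B" using v B(3) by blast
    then obtain f where f: "v = (\<Sum>b\<in>B. s1 (f b) b)" using vs1.span_finite[OF fin(1)] by auto
    obtain g where g: "v = (\<Sum>c\<in>?C. s1 (g c) c)" using v(1) vs1.span_finite[OF fin(2)] by auto
    let ?h = "\<lambda>b. if b \<in> B then - f b else g b"
    have "(\<Sum>b\<in>B'. s1 (?h b) b) = (\<Sum>b\<in>?C. s1 (?h b) b) + (\<Sum>b\<in>B. s1 (?h b) b)"
      by (rule sum.subset_diff[OF B'(1) fB'])
    also have "\<dots> = v + - v"
    proof -
      have "(\<Sum>b\<in>?C. s1 (?h b) b) = v" unfolding g by (rule sum.cong) auto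
      moreover have "(\<Sum>b\<in>B. s1 (?h b) b) = - v" unfolding f sum_negf[symmetric] by (rule sum.cong) auto
      ultimately show ?thesis by simp
    qed
    finally have "(\<Sum>b\<in>B'. s1 (?h b) b) = 0" by simp
    then have "\<forall>b\<in>B'. ?h b = 0"
    proof -
      have "\<forall>u. (\<Sum>v\<in>B'. s1 (u v) v) = 0 \<longrightarrow> (\<forall>v\<in>B'. u v = 0)"
        using B'(3)[unfolded vs1.independent_explicit_finite_subsets, THEN spec, of B'] fB' by simp
      from this[THEN spec, of ?h] \<open>(\<Sum>b\<in>B'. s1 (?h b) b) = 0\<close> show ?thesis by (rule mp)
    qed
    then have "\<forall>b\<in>?C. g b = 0" by (auto split: if_splits)
    then show ?thesis unfolding g by (intro sum.neutral) auto
  qed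
  then have inj: "inj_on T (vs1.span ?C)" by (subst inj_on_iff_eq_0) auto
  have "vs2.independent (T ` ?C)" by (rule independent_injective_image[OF iC inj])
  moreover have "T ` V \<subseteq> vs2.span (T ` ?C)"
  proof
    fix w assume "w \<in> T ` V"
    then obtain v where v: "v \<in> V" "w = T v" by blast
    then have "v \<in> vs1.span (B \<union> ?C)" using B' by (metis Un_Diff_cancel Un_absorb1 subsetD)
    then obtain x y where "x \<in> vs1.span B" "y \<in> vs1.span ?C" "v = x + y"
      unfolding vs1.span_Un by auto
    moreover then have "T x = 0" using B(1) by (intro eq_0_on_span[of B x]) auto
    ultimately show "w \<in> vs2.span (T ` ?C)" using v by (auto simp: add span_image)
  qed
  moreover have "T ` ?C \<subseteq> T ` V" using B'(2) by auto
  ultimately have "vs2.dim (T ` V) = card (T ` ?C)" using vs2.basis_card_eq_dim by metis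
  also have "\<dots> = card ?C" using inj_on_subset[OF inj, of ?C] vs1.span_superset by (intro card_image) blast
  also have "\<dots> = card B' - card B" using fin(1) B'(1) by (rule card_Diff_subset)
  finally show ?thesis using dV B(4) card_mono[OF fB' B'(1)] by simp
qed

definition cmul :: "'k \<Rightarrow> 'k mpol \<Rightarrow> ('k::field) mpol" where "cmul c f = const c * f"

interpretation mpol: vector_space "cmul :: 'k::field \<Rightarrow> _"
  by standard (auto simp: cmul_def algebra_simps const_add const_mult)

interpretation vec: vector_space "scale_vec :: 'k::field \<Rightarrow> (nat \<Rightarrow> 'k) \<Rightarrow> _"
  by (rule vector_space_scale_vec)

lemma finite_span_hform: "\<exists>B. finite B \<and> hform N d \<subseteq> mpol.span B"
proof (intro exI conjI subsetI)
  let ?M = "{m. keys m \<subseteq> {..<N} \<and> mdeg m \<le> d}"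
  show "finite ((\<lambda>m. single m (1::'a)) ` ?M)" using finite_monomials by blast
  fix f :: "'a mpol" assume f: "f \<in> hform N d"
  have "(\<Sum>m\<in>keys f. cmul (lookup f m) (single m 1)) \<in> mpol.span ((\<lambda>m. single m (1::'a)) ` ?M)"
    using f by (intro mpol.span_sum mpol.span_scale mpol.span_base) (auto simp: hform_def PV_def homog_def)
  moreover have "f = (\<Sum>m\<in>keys f. cmul (lookup f m) (single m 1))"
    by (subst mpol_sum) (simp add: cmul_def const_def mult_single)
  ultimately show "f \<in> mpol.span ((\<lambda>m. single m (1::'a)) ` ?M)" by simp
qed

section \<open>Tor and Koszul homology\<close>

declare bd.simps [simp del]

text \<open>Vanishing of Tor_i(R/I, k) in degree i + j, computed from the Koszul resolution of k.
  Cycles and boundaries modulo \<open>I\<close> are represented by chains over R, so that no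
  quotient ring occurs.\<close>

definition kexact :: "nat \<Rightarrow> ('k::field) mpol set \<Rightarrow> nat \<Rightarrow> int \<Rightarrow> bool" where
  "kexact N I i j \<longleftrightarrow> (\<forall>z. chain N i (gform N j) z \<longrightarrow> (\<forall>A. bd Var N z A \<in> I) \<longrightarrow>
     (\<exists>w. chain N (Suc i) (gform N (j - 1)) w \<and> (\<forall>A. z A - bd Var N w A \<in> I)))"

lemma bd_sum:
  "finite J \<Longrightarrow> bd c n (\<lambda>A. \<Sum>j\<in>J. r j * z j A) = (\<lambda>A. \<Sum>j\<in>J. r j * bd c n (z j) A)"
proof (induction J rule: finite_induct)
  case empty
  then show ?case using bd_zero[of c n] by (simp add: zero_fun_def)
next
  case (insert j J)
  have "(\<lambda>A. \<Sum>j\<in>insert j J. r j * z j A) = smul (r j) (z j) + (\<lambda>A. \<Sum>j\<in>J. r j * z j A)"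
    using insert.hyps by (auto simp: smul_def fun_eq_iff)
  then show ?case unfolding \<open>_ = _ + _\<close> bd_add bd_smul insert.IH
    using insert.hyps by (auto simp: smul_def fun_eq_iff)
qed

lemma chain_0D: "chain N 0 V z \<Longrightarrow> A \<noteq> {} \<Longrightarrow> z A = 0"
  unfolding chain_def by (metis card_eq_0_iff finite_lessThan finite_subset)

locale resolution =
  fixes n :: nat and A0 B0 :: "('k::field) mpol set" and F :: "'k mpol free_complex"
  assumes res: "graded_free_resolution n A0 B0 F"
    and A0: "hideal (Suc n) A0" and B0: "hideal (Suc n) B0"
begin

abbreviation N where "N \<equiv> Suc n"

lemma diff_graded: "graded_matrix N (rk F i) (shift F i) (rk F (Suc i)) (shift F (Suc i)) (diff F i)"
proof -
  have "\<forall>l<rk F i. \<forall>j<rk F (Suc i). diff F i l j \<in> PV {..n} \<and>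
        (\<forall>m\<in>keys (diff F i l j). shift F i l + mdeg m = shift F (Suc i) j)"
    using res[unfolded graded_free_resolution_def carrier_coord_ring, THEN conjunct2, THEN conjunct1]
    by (rule spec)
  then show ?thesis unfolding graded_matrix_def gform_def lessThan_Suc_atMost
    by (auto simp: eq_diff_eq add.commute simp flip: of_nat_add)
qed

lemma res_exact:
  "{v \<in> free_mod n (rk F (Suc i)). diff_map F i v = 0} = diff_map F (Suc i) ` free_mod n (rk F (Suc (Suc i)))"
  "{v \<in> free_mod n (rk F 0). aug_map F v \<in> B0} = diff_map F 0 ` free_mod n (rk F 1)"
  "a \<in> A0 \<Longrightarrow> \<exists>v\<in>free_mod n (rk F 0). a - aug_map F v \<in> B0"
  using res[unfolded graded_free_resolution_def, THEN conjunct2, THEN conjunct2] by (elim conjE, auto)+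

lemma diff_gform: "l < rk F i \<Longrightarrow> j < rk F (Suc i) \<Longrightarrow>
    diff F i l j \<in> gform N (int (shift F (Suc i) j) - int (shift F i l))"
  using diff_graded unfolding graded_matrix_def by blast

lemma aug_graded: "graded_matrix N 1 (\<lambda>_. 0) (rk F 0) (shift F 0) (\<lambda>_. aug F)"
  and aug_in: "j < rk F 0 \<Longrightarrow> aug F j \<in> A0"
  using res hidealD(1)[OF A0]
  by (auto simp: graded_free_resolution_def graded_matrix_def gform_hform hform_def)

lemma aug_map_app: "aug_map F v = mat_app 1 (rk F 0) (\<lambda>_. aug F) v 0"
  by (simp add: aug_map_def mat_app_def)

lemma aug_mpart: "aug_map F (mpart (shift F 0) d v) = gpart d (aug_map F v)"
  unfolding aug_map_app mat_app_mpart[OF aug_graded] by (simp add: mpart_def)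

lemma diff_diff: "u \<in> free_mod n (rk F (Suc (Suc i))) \<Longrightarrow> diff_map F i (diff_map F (Suc i) u) = 0"
  using equalityD2[OF res_exact(1)[of i]] by blast

lemma aug_diff: "u \<in> free_mod n (rk F 1) \<Longrightarrow> aug_map F (diff_map F 0 u) \<in> B0"
  using equalityD2[OF res_exact(2)] by blast

definition gmod :: "nat \<Rightarrow> int \<Rightarrow> (nat \<Rightarrow> 'k mpol) set" where
  "gmod s d = {v. (\<forall>j. v j \<in> gform N (d - int (shift F s j))) \<and> (\<forall>j\<ge>rk F s. v j = 0)}"

lemma gmod_free_mod: "v \<in> gmod s d \<Longrightarrow> v \<in> free_mod n (rk F s)"
  by (auto simp: gmod_def free_mod_PV dest: gform_PV)
lemma mpart_gmod: "v \<in> free_mod n (rk F s) \<Longrightarrow> mpart (shift F s) d v \<in> gmod s d"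
  by (auto simp: gmod_def free_mod_PV mpart_def intro: gpart_in_gform)
lemma gmod_mpart: "v \<in> gmod s d \<Longrightarrow> mpart (shift F s) d v = v"
  unfolding mpart_def gmod_def by (rule ext) (metis (no_types, lifting) gpart_gform mem_Collect_eq)

lemma diff_exact:
  assumes "v \<in> gmod (Suc i) d" "diff_map F i v = 0"
  shows "\<exists>u\<in>gmod (Suc (Suc i)) d. diff_map F (Suc i) u = v"
proof -
  have "v \<in> {v \<in> free_mod n (rk F (Suc i)). diff_map F i v = 0}"
    using gmod_free_mod[OF assms(1)] assms(2) by simp
  then have "v \<in> diff_map F (Suc i) ` free_mod n (rk F (Suc (Suc i)))" by (simp only: res_exact)
  then obtain u where u: "u \<in> free_mod n (rk F (Suc (Suc i)))" "diff_map F (Suc i) u = v" by blast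
  have "diff_map F (Suc i) (mpart (shift F (Suc (Suc i))) d u) = v"
    unfolding diff_map_def mat_app_mpart[OF diff_graded]
    using u(2) gmod_mpart[OF assms(1)] by (simp add: diff_map_def)
  then show ?thesis using mpart_gmod[OF u(1)] by blast
qed

lemma aug_exact:
  assumes "v \<in> gmod 0 d" "aug_map F v \<in> B0"
  shows "\<exists>u\<in>gmod 1 d. diff_map F 0 u = v"
proof -
  have "v \<in> {v \<in> free_mod n (rk F 0). aug_map F v \<in> B0}"
    using gmod_free_mod[OF assms(1)] assms(2) by simp
  then have "v \<in> diff_map F 0 ` free_mod n (rk F 1)" by (simp only: res_exact)
  then obtain u where u: "u \<in> free_mod n (rk F 1)" "diff_map F 0 u = v" by blast
  have "diff_map F 0 (mpart (shift F 1) d u) = v"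
    unfolding diff_map_def using mat_app_mpart[OF diff_graded, of 0 d u]
    using u(2) gmod_mpart[OF assms(1)] by (simp add: diff_map_def)
  then show ?thesis using mpart_gmod[OF u(1)] by blast
qed

lemma aug_surj:
  assumes "a \<in> A0" "a \<in> gform N d"
  shows "\<exists>v\<in>gmod 0 d. a - aug_map F v \<in> B0"
proof -
  obtain v where v: "v \<in> free_mod n (rk F 0)" "a - aug_map F v \<in> B0"
    using res_exact(3)[OF assms(1)] by blast
  have "gpart d (a - aug_map F v) = a - aug_map F (mpart (shift F 0) d v)"
    using assms(2) by (simp add: gpart_minus gpart_gform aug_mpart)
  then show ?thesis using hideal_gpart[OF B0 v(2), of d] mpart_gmod[OF v(1)] by metis
qed

lemma bd_zero0: "bd Var N (\<lambda>A. 0 :: 'k mpol) A = 0"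
  using fun_cong[OF bd_zero[of "Var :: nat \<Rightarrow> 'k mpol" N], of A] by (simp add: zero_fun_def)

text \<open>Chains of the Koszul complex with values in \<open>F\<^sub>s\<close>, of exterior degree \<open>m\<close> and total degree \<open>d\<close>.\<close>

definition FC :: "nat \<Rightarrow> nat \<Rightarrow> nat \<Rightarrow> (nat set \<Rightarrow> nat \<Rightarrow> 'k mpol) \<Rightarrow> bool" where
  "FC d s m z \<longleftrightarrow> (\<forall>A. z A \<in> gmod s (int d - int m) \<and> (\<not> (A \<subseteq> {..<N} \<and> card A = m) \<longrightarrow> z A = 0))"

lemma FC_chain: "FC d s m z \<Longrightarrow> chain N m (gform N (int d - int m - int (shift F s j))) (\<lambda>A. z A j)"
  unfolding FC_def chain_iff by (auto simp: gmod_def)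

lemma FC_I:
  assumes "\<And>j. j < rk F s \<Longrightarrow> chain N m (gform N (int d - int m - int (shift F s j))) (\<lambda>A. z A j)"
    "\<And>A j. j \<ge> rk F s \<Longrightarrow> z A j = 0"
  shows "FC d s m z"
  unfolding FC_def gmod_def
proof (intro allI conjI impI CollectI)
  fix A j
  show "z A j \<in> gform N (int d - int m - int (shift F s j))"
    using assms(1)[of j] assms(2)[of j A] by (cases "j < rk F s") (auto simp: chain_iff)
  show "z A j = 0" if "rk F s \<le> j" using assms(2) that by simp
next
  fix A assume a: "\<not> (A \<subseteq> {..<N} \<and> card A = m)"
  have "z A j = 0" for j
    using assms(1)[of j] assms(2)[of j A] a by (cases "j < rk F s") (auto simp: chain_iff)
  then show "z A = 0" by (simp add: fun_eq_iff)
qed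

definition bdF :: "(nat set \<Rightarrow> nat \<Rightarrow> 'k mpol) \<Rightarrow> nat set \<Rightarrow> nat \<Rightarrow> 'k mpol" where
  "bdF z A j = bd Var N (\<lambda>A. z A j) A"

lemma FC_bdF:
  assumes "FC d s (Suc m) z" shows "FC d s m (bdF z)"
proof (rule FC_I)
  fix j
  have "chain N (Suc m) (gform N (int d - int m - int (shift F s j) - 1)) (\<lambda>A. z A j)"
    using FC_chain[OF assms, of j] by (simp add: algebra_simps)
  from chain_bd_gform[OF _ this] show "chain N m (gform N (int d - int m - int (shift F s j))) (\<lambda>A. bdF z A j)"
    unfolding bdF_def by (auto intro: gform_Var)
next
  fix A j assume "rk F s \<le> j"
  then have "(\<lambda>A. z A j) = 0" using assms by (auto simp: FC_def gmod_def fun_eq_iff)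
  then show "bdF z A j = 0" by (simp add: bdF_def bd_zero)
qed

lemma bdF_bdF: "bdF (bdF z) = 0"
  using bd_bd[of Var N] by (auto simp: bdF_def fun_eq_iff)

lemma bdF_diff: "bdF (\<lambda>A. diff_map F s (z A)) A = diff_map F s (bdF z A)"
proof
  fix l
  show "bdF (\<lambda>A. diff_map F s (z A)) A l = diff_map F s (bdF z A) l"
    using bd_sum[of "{..<rk F (Suc s)}" Var N "diff F s l" "\<lambda>j A. z A j"] bd_zero[of Var N]
    by (auto simp: bdF_def diff_map_def mat_app_def fun_eq_iff zero_fun_def)
qed

lemma bdF_minus: "bdF (\<lambda>A. z A - w A) A = bdF z A - bdF w A"
  using bd_minus[of Var N "\<lambda>A. z A j" "\<lambda>A. w A j" for j] by (auto simp: bdF_def fun_eq_iff fun_diff_def)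

lemma diff_gmod: "v \<in> gmod (Suc s) d \<Longrightarrow> diff_map F s v \<in> gmod s d"
proof -
  assume v: "v \<in> gmod (Suc s) d"
  have "diff_map F s v \<in> free_mod n (rk F s)"
    unfolding diff_map_def using diff_gform gmod_free_mod[OF v] by (intro mat_app_free_mod) (auto dest: gform_PV)
  from mpart_gmod[OF this, of d] show ?thesis
    using mat_app_mpart[OF diff_graded, of s d v] gmod_mpart[OF v] by (simp add: diff_map_def)
qed

lemma diff_zero: "diff_map F s 0 = 0" by (simp add: diff_map_def mat_app_zero)
lemma diff_add: "diff_map F s (u + v) = diff_map F s u + diff_map F s v"
  by (simp add: diff_map_def mat_app_add)

lemma FC_diff: "FC d (Suc s) m z \<Longrightarrow> FC d s m (\<lambda>A. diff_map F s (z A))"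
  unfolding FC_def by (auto simp: diff_gmod diff_zero)
lemma FC_minus: "FC d s m z \<Longrightarrow> FC d s m w \<Longrightarrow> FC d s m (\<lambda>A. z A - w A)"
  unfolding FC_def by (auto simp: gmod_def intro: gform_minus)

lemma FC_lift:
  assumes "FC d (Suc s) m z" "\<And>A. diff_map F s (z A) = 0"
  shows "\<exists>y. FC d (Suc (Suc s)) m y \<and> (\<forall>A. diff_map F (Suc s) (y A) = z A)"
proof -
  have "\<exists>u. u \<in> gmod (Suc (Suc s)) (int d - int m) \<and> diff_map F (Suc s) u = z A \<and>
      (\<not> (A \<subseteq> {..<N} \<and> card A = m) \<longrightarrow> u = 0)" for A
  proof (cases "A \<subseteq> {..<N} \<and> card A = m")
    case True
    then show ?thesis using diff_exact[of "z A" s "int d - int m"] assms by (auto simp: FC_def)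
  next
    case False
    then show ?thesis using assms(1) by (intro exI[of _ 0]) (auto simp: FC_def gmod_def diff_zero)
  qed
  then obtain y where "\<And>A. y A \<in> gmod (Suc (Suc s)) (int d - int m) \<and> diff_map F (Suc s) (y A) = z A \<and>
      (\<not> (A \<subseteq> {..<N} \<and> card A = m) \<longrightarrow> y A = 0)" by metis
  then show ?thesis unfolding FC_def by blast
qed

lemma lookup_diff: "lookup (diff_map F i v j) 0 = fibre_map F i (\<lambda>j. lookup (v j) 0) j"
  by (auto simp: diff_map_def fibre_map_def mat_app_def lookup_sum lookup_mult_0)

lemma lookup_0_bd: "lookup (bd Var m z A) 0 = 0"
  using bd_Var_keys[of 0 m z A] by (auto simp: in_keys_iff)

lemma fibre_const:
  "u \<in> fibre F i d \<Longrightarrow> (\<lambda>j. const (u j)) \<in> gmod i (int d)"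
  unfolding fibre_def gmod_def
proof (clarsimp, intro conjI allI impI)
  fix j assume u: "\<forall>j. u j \<noteq> 0 \<longrightarrow> j < rk F i \<and> shift F i j = d"
  show "const (u j) \<in> gform N (int d - int (shift F i j))"
    using u gform_const by (cases "u j = 0") auto
  show "rk F i \<le> j \<Longrightarrow> u j = 0" using u by (meson linorder_not_less)
qed

lemma lookup_const: "lookup (const c) 0 = c" by (simp add: const_def)


text \<open>Zigzag in the double complex formed by \<open>F\<close> and the Koszul complex, along
  the total homological degree m + s = i. The hypothesis says that the Koszul boundary of
  \<open>z\<close> comes from the next module of \<open>F\<close>; for m = 0, where there is no
  Koszul boundary, it asks that the constant terms form a cycle of F \<otimes> k. The assumption
  \<open>cyc\<close> enters at the corner m = 0, and Koszul exactness at all other places.\<close>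

lemma koszul_lift:
  assumes cyc: "cycles F i d \<subseteq> boundaries F i d"
  shows "m + s = i \<Longrightarrow> FC d s m z \<Longrightarrow>
    (case m of 0 \<Rightarrow> \<forall>i'. s = Suc i' \<longrightarrow> fibre_map F i' (\<lambda>j. lookup (z {} j) 0) = 0
      | Suc k \<Rightarrow> \<exists>y. FC d (Suc s) k y \<and> (\<forall>A. bdF z A = diff_map F s (y A))) \<Longrightarrow>
    \<exists>w w'. FC d s (Suc m) w \<and> FC d (Suc s) m w' \<and> (\<forall>A. z A = bdF w A + diff_map F s (w' A))"
proof (induction m arbitrary: s z)
  case 0
  then have s: "s = i" by simp
  note z = 0(2)[unfolded s]
  have z0: "z {} \<in> gmod i (int d)" using z by (simp add: FC_def)
  let ?wv = "\<lambda>j. lookup (z {} j) 0"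
  have "?wv \<in> cycles F i d"
    unfolding cycles_def fibre_def
  proof (safe)
    fix j assume j: "lookup (z {} j) 0 \<noteq> 0"
    show "j < rk F i" using j z0 by (auto simp: gmod_def) (metis linorder_not_less lookup_zero)
    have "0 \<in> keys (z {} j)" using j by (simp add: in_keys_iff)
    moreover have "z {} j \<in> gform N (int d - int (shift F i j))" using z0 by (simp add: gmod_def)
    ultimately have "int (mdeg 0) = int d - int (shift F i j)" by (auto simp: gform_def simp del: mdeg_0)
    then show "shift F i j = d" by simp
  next
    fix i' assume "i = Suc i'"
    then show "fibre_map F i' ?wv = 0" using 0(3) s by simp
  qed
  then have "?wv \<in> boundaries F i d" using cyc by blast
  then obtain u where u: "u \<in> fibre F (Suc i) d" "?wv = fibre_map F i u" by (auto simp: boundaries_def)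
  let ?u = "\<lambda>j. const (u j)"
  let ?w' = "\<lambda>A. if A = {} then ?u else 0"
  have w': "FC d (Suc i) 0 ?w'"
    using fibre_const[OF u(1)] unfolding FC_def by (auto simp: gmod_def)
  \<comment> \<open>Subtracting the lifted boundary removes all constant terms, and a polynomial
    without constant term is a Koszul boundary.\<close>
  let ?r = "\<lambda>j. z {} j - diff_map F i ?u j"
  have rg: "?r j \<in> gform N (int d - int (shift F i j))" for j
    using z0 diff_gmod[OF fibre_const[OF u(1)]] by (auto simp: gmod_def intro: gform_minus)
  have r0: "lookup (?r j) 0 = 0" for j
    using fun_cong[OF u(2), of j] by (simp add: lookup_minus lookup_diff lookup_const)
  have rk: "keys m \<inter> {..<N} \<noteq> {}" if "m \<in> keys (?r j)" for m j
  proof -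
    have "m \<noteq> 0" using that r0[of j] by (auto simp: in_keys_iff)
    then have "keys m \<noteq> {}" by (metis mdeg_def mdeg_eq_0 sum.empty)
    moreover have "keys m \<subseteq> {..<N}" using rg[of j] that by (auto simp: gform_def PV_def)
    ultimately show ?thesis by blast
  qed
  have "\<exists>w. chain N 1 (gform N (int d - int (shift F i j) - 1)) w \<and> bd Var N w = (\<lambda>A. if A = {} then ?r j else 0)" for j
    by (rule in_span_Var[OF rg[of j] _ order_refl]) (rule rk)
  then obtain w where w: "\<And>j. chain N 1 (gform N (int d - int (shift F i j) - 1)) (w j)"
    "\<And>j. bd Var N (w j) = (\<lambda>A. if A = {} then ?r j else 0)" by metis
  let ?w = "\<lambda>A j. if j < rk F i then w j A else 0"
  have "FC d i (Suc 0) ?w"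
  proof (rule FC_I)
    fix j assume "j < rk F i"
    then show "chain N (Suc 0) (gform N (int d - int (Suc 0) - int (shift F i j))) (\<lambda>A. ?w A j)"
      using w(1)[of j] by (simp add: algebra_simps)
  qed auto
  moreover have "z A = bdF ?w A + diff_map F i (?w' A)" for A
  proof
    fix j
    have "z A = 0" if "A \<noteq> {}" using chain_0D[OF FC_chain[OF z]] that by (simp add: fun_eq_iff)
    moreover have "diff_map F i ?u j = 0" "z A j = 0" if "j \<ge> rk F i"
      using diff_gmod[OF fibre_const[OF u(1)]] z that by (auto simp: gmod_def FC_def)
    moreover note bd_zero0[of A]
    ultimately show "z A j = (bdF ?w A + diff_map F i (?w' A)) j"
      using w(2)[of j] by (cases "j < rk F i") (auto simp: bdF_def diff_zero)
  qed
  ultimately show ?case using w' s by blast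
next
  case (Suc m)
  then obtain y where y: "FC d (Suc s) m y" "\<And>A. bdF z A = diff_map F s (y A)" by auto
  have ms: "m + Suc s = i" using Suc.prems(1) by simp
  \<comment> \<open>\<open>y\<close> satisfies the same hypothesis one step along the diagonal: its
    Koszul boundary maps to the double boundary of \<open>z\<close>, which is zero, and for m = 0
    the constant terms of a Koszul boundary vanish.\<close>
  have "case m of 0 \<Rightarrow> \<forall>i'. Suc s = Suc i' \<longrightarrow> fibre_map F i' (\<lambda>j. lookup (y {} j) 0) = 0
      | Suc k \<Rightarrow> \<exists>y'. FC d (Suc (Suc s)) k y' \<and> (\<forall>A. bdF y A = diff_map F (Suc s) (y' A))"
  proof (cases m)
    case 0
    have "fibre_map F s (\<lambda>j. lookup (y {} j) 0) l = 0" for l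
      unfolding lookup_diff[symmetric] y(2)[symmetric] bdF_def by (rule lookup_0_bd)
    then show ?thesis using 0 by (auto simp: fun_eq_iff)
  next
    case (Suc k)
    have "diff_map F s (bdF y A) = 0" for A
      unfolding bdF_diff[symmetric] y(2)[symmetric] using bdF_bdF[of z] by (simp add: fun_eq_iff)
    from FC_lift[OF FC_bdF[OF y(1)[unfolded Suc]] this] show ?thesis unfolding Suc by auto
  qed
  from Suc.IH[OF ms y(1) this] obtain w w' where
    w: "FC d (Suc s) (Suc m) w" "FC d (Suc (Suc s)) m w'" "\<And>A. y A = bdF w A + diff_map F (Suc s) (w' A)"
    by blast
  \<comment> \<open>Subtracting the image of \<open>w\<close> turns \<open>z\<close> into an honest
    Koszul cycle in every coordinate of F_s, because two consecutive differentials of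
    \<open>F\<close> compose to zero.\<close>
  define z1 where "z1 A = z A - diff_map F s (w A)" for A
  have z1: "FC d s (Suc m) z1" unfolding z1_def by (rule FC_minus[OF Suc.prems(2) FC_diff[OF w(1)]])
  have "w' A \<in> free_mod n (rk F (Suc (Suc s)))" for A using w(2) gmod_free_mod[of "w' A" "Suc (Suc s)"] by (auto simp: FC_def)
  then have "bdF z1 A = 0" for A
    unfolding z1_def bdF_minus bdF_diff y(2) w(3) by (simp add: diff_add diff_diff)
  then have b: "bd Var N (\<lambda>A. z1 A j) = 0" for j by (auto simp: bdF_def fun_eq_iff)
  have "\<exists>w. chain N (Suc (Suc m)) (gform N (int d - int (Suc m) - int (shift F s j) - 1)) w \<and> bd Var N w = (\<lambda>A. z1 A j)" for j
    using koszul_exact[OF FC_chain[OF z1] b order_refl] by blast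
  then obtain v where v: "\<And>j. chain N (Suc (Suc m)) (gform N (int d - int (Suc m) - int (shift F s j) - 1)) (v j)"
    "\<And>j. bd Var N (v j) = (\<lambda>A. z1 A j)" by metis
  let ?v = "\<lambda>A j. if j < rk F s then v j A else 0"
  have "FC d s (Suc (Suc m)) ?v"
  proof (rule FC_I)
    fix j assume "j < rk F s"
    then show "chain N (Suc (Suc m)) (gform N (int d - int (Suc (Suc m)) - int (shift F s j))) (\<lambda>A. ?v A j)"
      using v(1)[of j] by (simp add: algebra_simps)
  qed auto
  moreover have "z A = bdF ?v A + diff_map F s (w A)" for A
  proof
    fix j
    have "z1 A j = 0" if "j \<ge> rk F s" using z1 that by (auto simp: gmod_def FC_def)
    moreover note bd_zero0[of A]
    ultimately have "bdF ?v A j = z1 A j" using v(2)[of j] by (cases "j < rk F s") (auto simp: bdF_def)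
    then show "z A j = (bdF ?v A + diff_map F s (w A)) j" by (simp add: z1_def)
  qed
  ultimately show ?case using w(1) by blast
qed

lemma boundaries_subset_cycles: "boundaries F i d \<subseteq> cycles F i d"
proof
  fix w assume "w \<in> boundaries F i d"
  then obtain u where u: "u \<in> fibre F (Suc i) d" "w = fibre_map F i u" by (auto simp: boundaries_def)
  note cu = fibre_const[OF u(1)]
  have w: "w j = lookup (diff_map F i (\<lambda>j. const (u j)) j) 0" for j
    by (simp add: u(2) lookup_diff lookup_const)
  have g: "diff_map F i (\<lambda>j. const (u j)) j \<in> gform N (int d - int (shift F i j))"
    "j \<ge> rk F i \<Longrightarrow> diff_map F i (\<lambda>j. const (u j)) j = 0" for j
    using diff_gmod[OF cu] by (auto simp: gmod_def)
  show "w \<in> cycles F i d" unfolding cycles_def fibre_def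
  proof safe
    fix j assume j: "w j \<noteq> 0"
    then show "j < rk F i" using g(2)[of j] by (auto simp: w) (metis linorder_not_less lookup_zero)
    have "int (mdeg 0) = int d - int (shift F i j)"
      using g(1)[of j] j by (auto simp: w gform_def in_keys_iff simp del: mdeg_0)
    then show "shift F i j = d" by simp
  next
    fix i' assume i: "i = Suc i'"
    have "w = (\<lambda>j. lookup (diff_map F i (\<lambda>j. const (u j)) j) 0)" using w by (simp add: fun_eq_iff)
    then have "fibre_map F i' w j = lookup (diff_map F i' (diff_map F i (\<lambda>j. const (u j))) j) 0" for j
      unfolding lookup_diff[of i'] by simp
    then show "fibre_map F i' w = 0"
      using diff_diff[of "\<lambda>j. const (u j)" i'] gmod_free_mod[OF cu] i by (auto simp: fun_eq_iff)
  qed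
qed

lemma fibre_span: "fibre F i d \<subseteq> vec.span ((\<lambda>j l. if l = j then 1 else 0) ` {..<rk F i})"
proof
  fix w assume w: "w \<in> fibre F i d"
  let ?e = "\<lambda>j l. if l = j then (1::'k) else 0"
  have "(\<Sum>j<rk F i. scale_vec (w j) (?e j)) \<in> vec.span (?e ` {..<rk F i})"
    by (intro vec.span_sum vec.span_scale vec.span_base) auto
  moreover have "(\<Sum>j<k. scale_vec (w j) (?e j)) l = (if l < k then w l else 0)" for k l
    by (induction k) (auto simp: scale_vec_def less_Suc_eq)
  then have "(\<Sum>j<rk F i. scale_vec (w j) (?e j)) = w"
    using w by (auto simp: fun_eq_iff fibre_def)
  ultimately show "w \<in> vec.span (?e ` {..<rk F i})" by simp
qed

lemma subspace_fibre: "vec.subspace (fibre F i d)"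
proof (rule vec.subspaceI)
  fix x y assume "x \<in> fibre F i d" "y \<in> fibre F i d"
  moreover have "x j \<noteq> 0 \<or> y j \<noteq> 0" if "x j + y j \<noteq> 0" for j using that by auto
  ultimately show "x + y \<in> fibre F i d" unfolding fibre_def by (auto; meson)
qed (auto simp: fibre_def scale_vec_def)

lemma linear_fibre_map: "Vector_Spaces.linear scale_vec scale_vec (fibre_map F i)"
proof unfold_locales
  fix b1 b2 and r :: 'k
  show "fibre_map F i (b1 + b2) = fibre_map F i b1 + fibre_map F i b2"
    by (auto simp: fibre_map_def mat_app_def fun_eq_iff distrib_left sum.distrib)
  show "fibre_map F i (scale_vec r b1) = scale_vec r (fibre_map F i b1)"
    by (auto simp: fibre_map_def mat_app_def scale_vec_def fun_eq_iff sum_distrib_left mult_ac)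
qed

lemma subspace_boundaries: "vec.subspace (boundaries F i d)"
proof -
  interpret Vector_Spaces.linear scale_vec scale_vec "fibre_map F i" by (rule linear_fibre_map)
  show ?thesis unfolding boundaries_def by (rule subspace_image[OF subspace_fibre])
qed

text \<open>The homology dimension is a truncated difference, so its vanishing bounds the dimension
  of the cycles by that of the boundaries. Boundaries are cycles and everything is finite
  dimensional, so the two agree.\<close>

lemma homology_dim_0:
  assumes "homology_dim F i d = 0" shows "cycles F i d \<subseteq> boundaries F i d"
proof (rule vec.dim_eq_imp_subset[OF _ _ boundaries_subset_cycles subspace_boundaries])
  show "cycles F i d \<subseteq> vec.span ((\<lambda>j l. if l = j then 1 else 0) ` {..<rk F i})"
    using fibre_span unfolding cycles_def by blast
  show "vec.dim (cycles F i d) \<le> vec.dim (boundaries F i d)"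
    using assms unfolding homology_dim_def by simp
qed auto

text \<open>F_i has finitely many generators, so F_i \<otimes> k is zero beyond the largest
  shift.\<close>

lemma cycles_large_degree: "\<exists>D. \<forall>d\<ge>D. cycles F i d \<subseteq> boundaries F i d"
proof -
  have "cycles F i d \<subseteq> boundaries F i d" if d: "d \<ge> Suc (Max (insert 0 (shift F i ` {..<rk F i})))" for d
  proof
    fix w assume w: "w \<in> cycles F i d"
    have "w j = 0" for j
    proof (rule ccontr)
      assume "w j \<noteq> 0"
      then have "j < rk F i" "shift F i j = d" using w by (auto simp: cycles_def fibre_def)
      then have "d \<le> Max (insert 0 (shift F i ` {..<rk F i}))" by (intro Max_ge) auto
      then show False using d by simp
    qed
    then have "w = 0" by (simp add: fun_eq_iff)
    then show "w \<in> boundaries F i d" using vec.subspace_0[OF subspace_boundaries] by simp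
  qed
  then show ?thesis by blast
qed

end

text \<open>A cycle modulo \<open>I\<close> is lifted to F_0 through the augmentation, and the
  boundary of the lift to F_1; this is the starting position of \<open>koszul_lift\<close>. Applying
  the augmentation to its outcome leaves a Koszul boundary, since the part coming from F_1 falls
  into \<open>I\<close>.\<close>

lemma resolution_kexact:
  assumes res: "graded_free_resolution n (PV {..<Suc n}) I F" and I: "hideal (Suc n) I"
    and cyc: "cycles F i d \<subseteq> boundaries F i d" and i: "i = Suc i'"
  shows "kexact (Suc n) I i (int d - int i)"
  unfolding kexact_def
proof (intro allI impI)
  interpret resolution n "PV {..<Suc n}" I F
    by standard (use res I hideal_PV in auto)
  fix z assume z: "chain N i (gform N (int d - int i)) z" and bz: "\<forall>A. bd Var N z A \<in> I"
  have "\<exists>v. v \<in> gmod 0 (int d - int i) \<and> z A - aug_map F v \<in> I \<and> (\<not> (A \<subseteq> {..<N} \<and> card A = i) \<longrightarrow> v = 0)" for A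
  proof (cases "A \<subseteq> {..<N} \<and> card A = i")
    case True
    have "z A \<in> gform N (int d - int i)" using z by (simp add: chain_def)
    from aug_surj[OF gform_PV[OF this] this] show ?thesis using True by blast
  next
    case False
    then have "z A = 0" using z by (auto simp: chain_def)
    then show ?thesis using hidealD(2)[OF I]
      by (intro exI[of _ 0]) (auto simp: gmod_def aug_map_def)
  qed
  then obtain z0 where z0: "\<And>A. z0 A \<in> gmod 0 (int d - int i) \<and> z A - aug_map F (z0 A) \<in> I \<and>
    (\<not> (A \<subseteq> {..<N} \<and> card A = i) \<longrightarrow> z0 A = 0)" by metis
  have fc: "FC d 0 i z0" using z0 by (auto simp: FC_def)
  have bda: "bd Var N (\<lambda>A. aug_map F (y A)) A = aug_map F (bdF y A)" for y A
    using bd_sum[of "{..<rk F 0}" Var N "aug F" "\<lambda>j A. y A j"]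
    by (auto simp: aug_map_def bdF_def fun_eq_iff)
  have ideal_bd: "bd Var N g A \<in> I" if "\<And>A. g A \<in> I" for g A
    by (rule bd_closed[where U = I]) (use that hidealD[OF I] hideal_uminus[OF I] in auto)
  have "bd Var N z A - aug_map F (bdF z0 A) = bd Var N (\<lambda>A. z A - aug_map F (z0 A)) A" for A
    using bd_minus[of Var N z "\<lambda>A. aug_map F (z0 A)"] unfolding bda[symmetric] by (simp add: fun_eq_iff fun_diff_def)
  then have "bd Var N z A - aug_map F (bdF z0 A) \<in> I" for A using ideal_bd[of "\<lambda>A. z A - aug_map F (z0 A)"] z0 by metis
  then have az: "aug_map F (bdF z0 A) \<in> I" for A
    using hideal_minus[OF I bz[rule_format, of A], of "bd Var N z A - aug_map F (bdF z0 A)"] by simp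
  have fb: "FC d 0 i' (bdF z0)" using FC_bdF fc i by blast
  have "\<exists>u. u \<in> gmod 1 (int d - int i') \<and> diff_map F 0 u = bdF z0 A \<and> (\<not> (A \<subseteq> {..<N} \<and> card A = i') \<longrightarrow> u = 0)" for A
  proof (cases "A \<subseteq> {..<N} \<and> card A = i'")
    case True
    have "bdF z0 A \<in> gmod 0 (int d - int i')" using fb by (simp add: FC_def)
    from aug_exact[OF this az] show ?thesis using True by blast
  next
    case False
    then show ?thesis using fb by (intro exI[of _ 0]) (auto simp: FC_def gmod_def diff_zero)
  qed
  then obtain y where y: "\<And>A. y A \<in> gmod 1 (int d - int i') \<and> diff_map F 0 (y A) = bdF z0 A \<and>
    (\<not> (A \<subseteq> {..<N} \<and> card A = i') \<longrightarrow> y A = 0)" by metis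
  then have "FC d (Suc 0) i' y" "\<And>A. bdF z0 A = diff_map F 0 (y A)" by (auto simp: FC_def)
  then have "case i of 0 \<Rightarrow> \<forall>i'. 0 = Suc i' \<longrightarrow> fibre_map F i' (\<lambda>j. lookup (z0 {} j) 0) = 0
      | Suc k \<Rightarrow> \<exists>y. FC d (Suc 0) k y \<and> (\<forall>A. bdF z0 A = diff_map F 0 (y A))" using i by auto
  from koszul_lift[OF cyc _ fc this] obtain w w' where
    w: "FC d 0 (Suc i) w" "FC d (Suc 0) i w'" "\<And>A. z0 A = bdF w A + diff_map F 0 (w' A)" by auto
  let ?w = "\<lambda>A. aug_map F (w A)"
  have aug_add: "aug_map F (u + v) = aug_map F u + aug_map F v" for u v
    by (simp add: aug_map_app mat_app_add)
  have "aug_map F v \<in> gform N k" if "v \<in> gmod 0 k" for v k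
  proof -
    have "gpart k (aug_map F v) = aug_map F v"
      using aug_mpart[of k v] gmod_mpart[OF that] by simp
    moreover have "aug_map F v \<in> PV {..<N}"
      using gmod_free_mod[OF that] aug_in by (auto simp: aug_map_def free_mod_PV intro!: PV_sum PV_mult)
    ultimately show ?thesis using gpart_in_gform by metis
  qed
  then have "chain N (Suc i) (gform N (int d - int i - 1)) ?w"
    using w(1) unfolding FC_def chain_iff by (auto simp: algebra_simps) (simp_all add: aug_map_def)
  moreover have "z A - bd Var N ?w A \<in> I" for A
  proof -
    have "w' A \<in> free_mod n (rk F 1)" using w(2) gmod_free_mod[of "w' A" 1] by (auto simp: FC_def)
    then have "aug_map F (z0 A) - bd Var N ?w A \<in> I"
      unfolding w(3) aug_add bda using aug_diff[of "w' A"] by simp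
    then have "(z A - aug_map F (z0 A)) + (aug_map F (z0 A) - bd Var N ?w A) \<in> I"
      using z0 hidealD(3)[OF I] by blast
    then show ?thesis by simp
  qed
  ultimately show "\<exists>w. chain N (Suc i) (gform N (int d - int i - 1)) w \<and> (\<forall>A. z A - bd Var N w A \<in> I)"
    by blast
qed

text \<open>This supplies the base in large degree for an elimination ideal, as it assumes nothing
  about \<open>I\<close> beyond homogeneity. The bound depends on the exterior degree.\<close>

lemma kexact_large_degree:
  assumes I: "hideal (Suc n) I"
  shows "\<exists>J. \<forall>j\<ge>J. kexact (Suc n) I (Suc i) j"
proof -
  obtain F where F: "graded_free_resolution n (PV {..<Suc n}) I F"
    using resolution_exists[OF hideal_PV I] by blast
  interpret resolution n "PV {..<Suc n}" I F
    by standard (use F I hideal_PV in auto)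
  obtain D where D: "\<And>d. d \<ge> D \<Longrightarrow> cycles F (Suc i) d \<subseteq> boundaries F (Suc i) d"
    using cycles_large_degree[of "Suc i"] by blast
  have "kexact (Suc n) I (Suc i) j" if "j \<ge> int D" for j
  proof -
    have "nat (j + int (Suc i)) \<ge> D" using that by simp
    from resolution_kexact[OF F I D[OF this] refl] show ?thesis using that by simp
  qed
  then show ?thesis by blast
qed

lemma property_N2_kexact:
  assumes I: "hideal (Suc n) I" and N2: "property_N2 n p I" and i: "Suc i \<le> p" and j: "j \<ge> 2"
  shows "kexact (Suc n) I (Suc i) (int j)"
proof -
  let ?F = "SOME F. graded_free_resolution n (carrier (coord_ring n)) I F"
  have c: "carrier (coord_ring n) = PV {..<Suc n}" by (simp add: carrier_coord_ring lessThan_Suc_atMost)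
  have F: "graded_free_resolution n (PV {..<Suc n}) I ?F"
    using someI_ex[OF resolution_exists[OF hideal_PV I]] by (simp add: c)
  interpret resolution n "PV {..<Suc n}" I ?F
    by standard (use F I hideal_PV in auto)
  have "homology_dim ?F (Suc i) (Suc i + j) = 0"
    using N2 i j unfolding property_N2_def tor_dim_def by blast
  from resolution_kexact[OF F I homology_dim_0[OF this] refl] show ?thesis by simp
qed

text \<open>Without forms of degree below 2 in \<open>I\<close>, multiples of its elements by forms
  of positive degree start in degree 3, so every quadric of \<open>I\<close> is a minimal generator.
  The chosen resolution need not be minimal: generators of degree below 2 may occur, but the
  augmentation sends them to zero.\<close>

lemma betti02_eq_dim:
  assumes I: "hideal (Suc n) I" and low: "\<And>f d. f \<in> I \<Longrightarrow> homog d f \<Longrightarrow> d < 2 \<Longrightarrow> f = 0"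
  shows "betti02 n I = mpol.dim (I \<inter> hform (Suc n) 2)"
proof -
  define G where "G = (SOME F. graded_free_resolution n I {0} F)"
  have F: "graded_free_resolution n I {0} G"
    unfolding G_def using someI_ex[OF resolution_exists[OF I hideal_0]] .
  interpret resolution n I "{0}" G
    by standard (use F I hideal_0 in auto)
  define T where "T w = aug_map G (\<lambda>j. const (w j))" for w
  have lin: "Vector_Spaces.linear scale_vec cmul T"
  proof (unfold_locales)
    fix b1 b2 and r :: 'a
    show "T (b1 + b2) = T b1 + T b2"
      by (simp add: T_def aug_map_def const_add distrib_left sum.distrib)
    show "T (scale_vec r b1) = cmul r (T b1)"
      by (simp add: T_def aug_map_def const_mult scale_vec_def cmul_def sum_distrib_left mult_ac)
  qed
  have aug_homog: "homog (shift G 0 j) (aug G j)" if "j < rk G 0" for j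
    using F that by (auto simp: graded_free_resolution_def)
  have aug0: "aug G j = 0" if "j < rk G 0" "shift G 0 j < 2" for j
    using low[OF aug_in aug_homog] that by auto
  \<comment> \<open>Only generators of degree exactly 2 contribute in degree 2: those of smaller
    degree map to zero, and those of larger degree have zero coefficients.\<close>
  have T_eq: "aug_map G v = T (\<lambda>j. if shift G 0 j = 2 then lookup (v j) 0 else 0)" if v: "v \<in> gmod 0 2" for v
    unfolding T_def aug_map_def
  proof (rule sum.cong[OF refl])
    fix j assume j: "j \<in> {..<rk G 0}"
    have vj: "v j \<in> gform N (2 - int (shift G 0 j))" using v by (auto simp: gmod_def)
    consider "shift G 0 j < 2" | "shift G 0 j = 2" | "shift G 0 j > 2" by linarith
    then show "aug G j * v j = aug G j * const (if shift G 0 j = 2 then lookup (v j) 0 else 0)"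
    proof cases
      case 1
      then show ?thesis using aug0 j by simp
    next
      case 2
      then have "v j \<in> hform N 0" using vj by (simp flip: gform_hform)
      then have "v j = const (lookup (v j) 0)" using homog_0_const by (auto simp: hform_def)
      then show ?thesis using 2 by simp
    next
      case 3
      then have "2 - int (shift G 0 j) < 0" by simp
      from vj[unfolded gform_neg[OF this]] show ?thesis using 3 by simp
    qed
  qed
  have im: "T ` fibre G 0 2 = I \<inter> hform N 2"
  proof safe
    fix w assume w: "w \<in> fibre G 0 2"
    show "T w \<in> I" unfolding T_def aug_map_def
      using aug_in hidealD(4)[OF I] by (intro hideal_sum[OF I]) (metis PV_const lessThan_iff mult.commute)
    have "homog 2 (aug G j * const (w j))" if "j < rk G 0" for j
      using w homog_mult[OF aug_homog[OF that] homog_const[of "w j"]] by (cases "w j = 0") (auto simp: fibre_def)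
    then have "homog 2 (T w)" unfolding T_def aug_map_def by (intro homog_sum) auto
    then show "T w \<in> hform N 2" using \<open>T w \<in> I\<close> hidealD(1)[OF I] by (auto simp: hform_def)
  next
    fix f assume f: "f \<in> I" "f \<in> hform N 2"
    then have "f \<in> gform N 2" by (simp flip: gform_hform)
    from aug_surj[OF f(1) this] obtain v where v: "v \<in> gmod 0 2" "f = aug_map G v" by auto
    have "(\<lambda>j. if shift G 0 j = 2 then lookup (v j) 0 else 0) \<in> fibre G 0 2"
      using v(1) by (auto simp: fibre_def gmod_def split: if_splits) (metis linorder_not_less lookup_zero)
    then show "f \<in> T ` fibre G 0 2" using T_eq[OF v(1)] v(2) by blast
  qed
  have ker: "{w \<in> fibre G 0 2. T w = 0} = boundaries G 0 2"
  proof safe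
    fix w assume w: "w \<in> fibre G 0 2" "T w = 0"
    have cw: "(\<lambda>j. const (w j)) \<in> gmod 0 2" using fibre_const[OF w(1)] by simp
    from aug_exact[OF this] w(2) obtain u where u: "u \<in> gmod 1 2" "diff_map G 0 u = (\<lambda>j. const (w j))"
      unfolding T_def by auto
    let ?u = "\<lambda>j. if shift G 1 j = 2 then lookup (u j) 0 else 0"
    have l0: "lookup (u j) 0 = 0" if "shift G 1 j \<noteq> 2" for j
    proof (rule ccontr)
      assume "lookup (u j) 0 \<noteq> 0"
      then have "0 \<in> keys (u j)" by (simp add: in_keys_iff)
      then have "int (mdeg 0) = 2 - int (shift G 1 j)" using u(1) by (auto simp: gmod_def gform_def simp del: mdeg_0)
      then show False using that by simp
    qed
    then have "?u = (\<lambda>j. lookup (u j) 0)" by auto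
    moreover have "fibre_map G 0 (\<lambda>j. lookup (u j) 0) = w"
      using lookup_diff[of 0 u] by (auto simp: u(2) lookup_const fun_eq_iff)
    moreover have "?u \<in> fibre G 1 2"
      using u(1) by (auto simp: fibre_def gmod_def split: if_splits) (metis linorder_not_less lookup_zero)
    ultimately show "w \<in> boundaries G 0 2" by (auto simp: boundaries_def)
  next
    fix w assume w: "w \<in> boundaries G 0 2"
    then show wf: "w \<in> fibre G 0 2" using boundaries_subset_cycles by (auto simp: cycles_def)
    obtain u where u: "u \<in> fibre G 1 2" "w = fibre_map G 0 u" using w by (auto simp: boundaries_def)
    have cu: "(\<lambda>j. const (u j)) \<in> gmod 1 2" using fibre_const[OF u(1)] by simp
    let ?v = "diff_map G 0 (\<lambda>j. const (u j))"
    have v: "?v \<in> gmod 0 2" using diff_gmod[of _ 0 2] cu by simp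
    have "w = (\<lambda>j. lookup (?v j) 0)" by (simp add: u(2) lookup_diff lookup_const)
    then have "T w = aug_map G ?v" unfolding T_eq[OF v] using wf
      by (intro arg_cong[of _ _ T]) (auto simp: fibre_def fun_eq_iff)
    then show "T w = 0" using aug_diff[of "\<lambda>j. const (u j)"] gmod_free_mod[OF cu] by simp
  qed
  have "vec.dim (fibre G 0 2) = vec.dim (boundaries G 0 2) + mpol.dim (I \<inter> hform N 2)"
    using rank_nullity[OF lin subspace_fibre _ fibre_span, of 0 2] unfolding im ker by simp
  moreover have "cycles G 0 2 = fibre G 0 2" by (auto simp: cycles_def)
  ultimately show ?thesis unfolding betti02_def tor_dim_def homology_dim_def G_def[symmetric] by simp
qed

section \<open>Homogeneous prime ideals\<close>

definition hprime :: "nat \<Rightarrow> ('k::field) mpol set \<Rightarrow> bool" where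
  "hprime N P \<longleftrightarrow> hideal N P \<and> 1 \<notin> P \<and>
     (\<forall>f\<in>PV {..<N}. \<forall>g\<in>PV {..<N}. f * g \<in> P \<longrightarrow> f \<in> P \<or> g \<in> P)"

lemma hprimeD:
  assumes "hprime N P"
  shows "hideal N P" "1 \<notin> P" "f \<in> PV {..<N} \<Longrightarrow> g \<in> PV {..<N} \<Longrightarrow> f * g \<in> P \<Longrightarrow> f \<in> P \<or> g \<in> P"
  using assms by (auto simp: hprime_def)

lemma hprime_power:
  assumes "hprime N P" "f \<in> PV {..<N}" "f ^ k \<in> P" shows "f \<in> P"
  using assms(3) hprimeD[OF assms(1)] assms(2) by (induction k) (auto intro: PV_power)

lemma hprime_prod:
  assumes "hprime N P" "finite A" "\<And>x. x \<in> A \<Longrightarrow> f x \<in> PV {..<N} \<and> f x \<notin> P"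
  shows "prod f A \<in> PV {..<N} \<and> prod f A \<notin> P"
  using assms(2,3) hprimeD[OF assms(1)]
  by (induction A rule: finite_induct) (auto intro: PV_mult)

lemma hideal_Union_chain:
  assumes "C \<noteq> {}" "\<And>J. J \<in> C \<Longrightarrow> hideal N J" "\<And>J K. J \<in> C \<Longrightarrow> K \<in> C \<Longrightarrow> J \<subseteq> K \<or> K \<subseteq> J"
  shows "hideal N (\<Union>C)"
  unfolding hideal_def
proof (intro conjI ballI allI)
  show "\<Union>C \<subseteq> PV {..<N}" "0 \<in> \<Union>C" using assms(1,2) hidealD by blast+
  fix f assume "f \<in> \<Union>C"
  then obtain J where J: "J \<in> C" "f \<in> J" by blast
  note id = hidealD[OF assms(2)[OF J(1)]]
  show "f + g \<in> \<Union>C" if "g \<in> \<Union>C" for g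
  proof -
    from that obtain K where K: "K \<in> C" "g \<in> K" by blast
    then have "f + g \<in> J \<or> f + g \<in> K"
      using assms(3)[OF J(1) K(1)] J(2) id(3) hidealD(3)[OF assms(2)[OF K(1)]] by blast
    then show ?thesis using J K by blast
  qed
  show "r * f \<in> \<Union>C" if "r \<in> PV {..<N}" for r using that id(4) J by blast
  show "hom_part d f \<in> \<Union>C" for d using id(5) J by blast
qed

lemma hideal_insert:
  assumes J: "hideal N J" and f: "f \<in> hform N e"
  shows "hideal N {p + a * f | p a. p \<in> J \<and> a \<in> PV {..<N}}"
    "J \<subseteq> {p + a * f | p a. p \<in> J \<and> a \<in> PV {..<N}}" "f \<in> {p + a * f | p a. p \<in> J \<and> a \<in> PV {..<N}}"
proof -
  let ?K = "{p + a * f | p a. p \<in> J \<and> a \<in> PV {..<N}}"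
  note id = hidealD[OF J]
  have fP: "f \<in> PV {..<N}" "homog e f" using f by (auto simp: hform_def)
  show "hideal N ?K"
    unfolding hideal_def
  proof (intro conjI ballI allI)
    show "?K \<subseteq> PV {..<N}" using id(1) fP by (auto intro!: PV_add PV_mult)
    show "0 \<in> ?K" using id(2) by (auto intro!: exI[of _ 0])
    fix x assume "x \<in> ?K"
    then obtain p a where x: "x = p + a * f" "p \<in> J" "a \<in> PV {..<N}" by blast
    show "x + y \<in> ?K" if "y \<in> ?K" for y
    proof -
      from that obtain p' a' where "y = p' + a' * f" "p' \<in> J" "a' \<in> PV {..<N}" by blast
      then have "x + y = (p + p') + (a + a') * f" "p + p' \<in> J" "a + a' \<in> PV {..<N}"
        using x id(3) by (auto simp: algebra_simps intro: PV_add)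
      then show ?thesis by blast
    qed
    show "r * x \<in> ?K" if "r \<in> PV {..<N}" for r
    proof -
      have "r * x = r * p + (r * a) * f" "r * p \<in> J" "r * a \<in> PV {..<N}"
        using x that id(4)[of r p] by (simp_all add: distrib_left mult.assoc PV_mult)
      then show ?thesis by blast
    qed
    fix d
    have "hom_part d x = hom_part d p + (if e \<le> d then hom_part (d - e) a else 0) * f"
      by (simp add: x(1) hom_part_homog_mult[OF fP(2)])
    moreover have "hom_part d p \<in> J" "(if e \<le> d then hom_part (d - e) a else 0) \<in> PV {..<N}"
      using x id(5) by (auto intro: PV_hom_part)
    ultimately show "hom_part d x \<in> ?K" by blast
  qed
  show "J \<subseteq> ?K"
  proof
    fix x assume "x \<in> J"
    then show "x \<in> ?K" by (intro CollectI exI[of _ x] exI[of _ 0]) auto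
  qed
  show "f \<in> ?K" using id(2) by (intro CollectI exI[of _ 0] exI[of _ 1]) auto
qed

text \<open>The lowest components of f and g outside \<open>P\<close> multiply to a component of f g
  up to terms in \<open>P\<close>. Hence primality may be tested on forms.\<close>

lemma homog_prime_imp_prime:
  assumes P: "hideal N P"
    and hp: "\<And>f g d e. f \<in> hform N d \<Longrightarrow> g \<in> hform N e \<Longrightarrow> f * g \<in> P \<Longrightarrow> f \<in> P \<or> g \<in> P"
    and fg: "f \<in> PV {..<N}" "g \<in> PV {..<N}" "f * g \<in> P"
  shows "f \<in> P \<or> g \<in> P"
proof (rule ccontr)
  assume n: "\<not> (f \<in> P \<or> g \<in> P)"
  have ex: "\<exists>d. hom_part d h \<notin> P \<and> (\<forall>k<d. hom_part k h \<in> P)" if h: "h \<notin> P" for h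
  proof -
    obtain D where D: "h = (\<Sum>d\<le>D. hom_part d h)" using hom_part_decomp by blast
    have "\<exists>d. hom_part d h \<notin> P"
    proof (rule ccontr)
      assume "\<not> (\<exists>d. hom_part d h \<notin> P)"
      then have "(\<Sum>d\<le>D. hom_part d h) \<in> P" by (intro hideal_sum[OF P]) auto
      then show False using h unfolding D[symmetric] by simp
    qed
    then obtain d where "hom_part d h \<notin> P" "\<forall>k<d. \<not> (hom_part k h \<notin> P)"
      using exists_least_iff[of "\<lambda>d. hom_part d h \<notin> P"] by blast
    then show ?thesis by blast
  qed
  obtain d where d: "hom_part d f \<notin> P" "\<forall>k<d. hom_part k f \<in> P" using ex n by blast
  obtain e where e: "hom_part e g \<notin> P" "\<forall>k<e. hom_part k g \<in> P" using ex n by blast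
  have "hom_part (d + e) (f * g) = (\<Sum>k\<le>d+e. hom_part (d + e - k) f * hom_part k g)"
    by (rule hom_part_mult)
  also have "\<dots> = hom_part d f * hom_part e g + (\<Sum>k\<in>{..d+e} - {e}. hom_part (d + e - k) f * hom_part k g)"
    by (subst sum.remove[of _ e]) auto
  finally have eq: "hom_part d f * hom_part e g =
      hom_part (d + e) (f * g) - (\<Sum>k\<in>{..d+e} - {e}. hom_part (d + e - k) f * hom_part k g)" by simp
  have "hom_part (d + e - k) f * hom_part k g \<in> P" if "k \<in> {..d+e} - {e}" for k
  proof (cases "k < e")
    case True
    then show ?thesis using e(2) hidealD(4)[OF P] fg(1) PV_hom_part by blast
  next
    case False
    then have "d + e - k < d" using that by auto
    then have "hom_part k g * hom_part (d + e - k) f \<in> P"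
      using d(2) hidealD(4)[OF P] fg(2) PV_hom_part by blast
    then show ?thesis by (simp add: mult.commute)
  qed
  then have "hom_part d f * hom_part e g \<in> P"
    unfolding eq using hidealD(5)[OF P fg(3)] by (intro hideal_minus[OF P] hideal_sum[OF P]) auto
  then show False using hp[OF hform_hom_part[OF fg(1)] hform_hom_part[OF fg(2)]] d e by blast
qed

section \<open>Multiplicative sets of forms and primes avoiding them\<close>

definition hmult :: "nat \<Rightarrow> ('k::field) mpol set \<Rightarrow> bool" where
  "hmult N T \<longleftrightarrow> 1 \<in> T \<and> (\<forall>s\<in>T. \<exists>d. s \<in> hform N d) \<and> (\<forall>s\<in>T. \<forall>t\<in>T. s * t \<in> T)"

text \<open>A homogeneous ideal that is maximal among those containing \<open>I\<close> and missing
  \<open>T\<close> is prime. Primality is needed for forms only, and enlarging an ideal by a form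
  keeps it homogeneous.\<close>

lemma hprime_avoiding:
  assumes I: "hideal N I" and T: "hmult N T" "T \<inter> I = {}"
  shows "\<exists>P. hprime N P \<and> I \<subseteq> P \<and> P \<inter> T = {}"
proof -
  let ?A = "{J. hideal N J \<and> I \<subseteq> J \<and> J \<inter> T = {}}"
  have "\<exists>M\<in>?A. \<forall>X\<in>?A. M \<subseteq> X \<longrightarrow> X = M"
  proof (rule subset_Zorn_nonempty)
    show "?A \<noteq> {}" using I T(2) by blast
    fix C assume C: "C \<noteq> {}" "subset.chain ?A C"
    then have "hideal N (\<Union>C)"
      unfolding subset_chain_def by (intro hideal_Union_chain) blast+
    then show "\<Union>C \<in> ?A" using C unfolding subset_chain_def by blast
  qed
  then obtain P where P0: "P \<in> ?A" "\<forall>X\<in>?A. P \<subseteq> X \<longrightarrow> X = P" ..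
  then have P: "hideal N P" "I \<subseteq> P" "P \<inter> T = {}"
    "\<And>X. hideal N X \<Longrightarrow> I \<subseteq> X \<Longrightarrow> X \<inter> T = {} \<Longrightarrow> P \<subseteq> X \<Longrightarrow> X = P" by simp_all
  note id = hidealD[OF P(1)]
  have meets: "\<exists>p a t. t \<in> T \<and> t = p + a * f \<and> p \<in> P \<and> a \<in> PV {..<N}" if f: "f \<in> hform N e" "f \<notin> P" for f e
  proof (rule ccontr)
    assume "\<not> ?thesis"
    then have "{p + a * f | p a. p \<in> P \<and> a \<in> PV {..<N}} \<inter> T = {}" by blast
    from P(4)[OF hideal_insert(1)[OF P(1) f(1)] _ this] have "{p + a * f | p a. p \<in> P \<and> a \<in> PV {..<N}} = P"
      using hideal_insert(2)[OF P(1) f(1)] P(2) by blast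
    then show False using hideal_insert(3)[OF P(1) f(1)] f(2) by blast
  qed
  have "f \<in> P \<or> g \<in> P" if fg: "f \<in> hform N d" "g \<in> hform N e" "f * g \<in> P" for f g d e
  proof (rule ccontr)
    assume n: "\<not> (f \<in> P \<or> g \<in> P)"
    obtain p a t where 1: "t \<in> T" "t = p + a * f" "p \<in> P" "a \<in> PV {..<N}" using meets fg(1) n by blast
    obtain p' a' t' where 2: "t' \<in> T" "t' = p' + a' * g" "p' \<in> P" "a' \<in> PV {..<N}" using meets fg(2) n by blast
    have PV: "f \<in> PV {..<N}" "g \<in> PV {..<N}" using fg by (auto simp: hform_def)
    have "t * t' = (p' + a' * g) * p + (a * f) * p' + (a * a') * (f * g)"
      unfolding 1(2) 2(2) by (simp add: algebra_simps)
    also have "\<dots> \<in> P"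
      using id(4)[of "p' + a' * g" p] id(4)[of "a * f" p'] id(4)[of "a * a'" "f * g"] id(1) PV 1 2 fg(3)
      by (intro id(3)) (auto intro: PV_add PV_mult)
    finally show False using T P(3) 1 2 by (auto simp: hmult_def)
  qed
  from homog_prime_imp_prime[OF P(1) this] have "hprime N P"
    unfolding hprime_def using P(1,3) T(1) by (auto simp: hmult_def)
  then show ?thesis using P by blast
qed

lemma hmult_powers: "f \<in> hform N d \<Longrightarrow> hmult N (range (\<lambda>k. f ^ k))"
  unfolding hmult_def
proof (intro conjI ballI)
  assume f: "f \<in> hform N d"
  show "1 \<in> range (\<lambda>k. f ^ k)" by (rule range_eqI[of _ _ 0]) simp
  show "\<exists>d. s \<in> hform N d" if "s \<in> range (\<lambda>k. f ^ k)" for s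
    using that f by (auto simp: hform_def intro: PV_power homog_power)
  show "s * t \<in> range (\<lambda>k. f ^ k)" if "s \<in> range (\<lambda>k. f ^ k)" "t \<in> range (\<lambda>k. f ^ k)" for s t
    using that by (auto simp flip: power_add)
qed

lemma Var_hform: "n < N \<Longrightarrow> Var n \<in> hform N 1" by (auto simp: hform_def)

lemma power_in_hideal:
  assumes "hideal N J" "n < N" "\<And>P. hprime N P \<Longrightarrow> J \<subseteq> P \<Longrightarrow> Var n \<in> P"
  shows "\<exists>k. Var n ^ k \<in> J"
proof (rule ccontr)
  assume "\<not> ?thesis"
  then have "range (\<lambda>k. Var n ^ k) \<inter> J = {}" by auto
  from hprime_avoiding[OF assms(1) hmult_powers[OF Var_hform[OF assms(2)]] this]
  obtain P where P: "hprime N P" "J \<subseteq> P" "P \<inter> range (\<lambda>k. Var n ^ k) = {}" by blast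
  moreover have "Var n ^ 1 \<in> range (\<lambda>k. Var n ^ k :: 'a mpol)" by (rule rangeI)
  ultimately show False using assms(3)[OF P(1,2)] by auto
qed

text \<open>
  A maximal multiplicative set of homogeneous elements disjoint from \<open>I\<close> is the set of homogeneous
  elements outside a minimal prime of \<open>I\<close>.
\<close>

lemma minimal_hprime:
  assumes I: "hideal N I" and T0: "hmult N T0" "T0 \<inter> I = {}"
  shows "\<exists>P. hprime N P \<and> I \<subseteq> P \<and> P \<inter> T0 = {} \<and>
    (\<forall>f\<in>P. \<forall>d. homog d f \<longrightarrow> (\<exists>s e k. s \<in> hform N e \<and> s \<notin> P \<and> s * f ^ k \<in> I))"
proof -
  let ?A = "{T. hmult N T \<and> T \<inter> I = {} \<and> T0 \<subseteq> T}"
  have "\<exists>M\<in>?A. \<forall>X\<in>?A. M \<subseteq> X \<longrightarrow> X = M"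
  proof (rule subset_Zorn_nonempty)
    show "?A \<noteq> {}" using T0 by blast
    fix C assume C: "C \<noteq> {}" "subset.chain ?A C"
    have ch: "J \<subseteq> K \<or> K \<subseteq> J" if "J \<in> C" "K \<in> C" for J K
      by (rule bspec[OF bspec[OF conjunct2[OF C(2)[unfolded subset_chain_def]] that(1)] that(2)])
    have el: "hmult N J" "J \<inter> I = {}" "T0 \<subseteq> J" if "J \<in> C" for J
      using C(2) that unfolding subset_chain_def by auto
    have "hmult N (\<Union>C)"
      unfolding hmult_def
    proof (intro conjI ballI)
      show "1 \<in> \<Union>C" using C(1) el(1) by (auto simp: hmult_def)
      show "\<exists>d. s \<in> hform N d" if "s \<in> \<Union>C" for s using that el(1) unfolding hmult_def by blast
      show "s * t \<in> \<Union>C" if "s \<in> \<Union>C" "t \<in> \<Union>C" for s t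
      proof -
        from that obtain J K where "J \<in> C" "s \<in> J" "K \<in> C" "t \<in> K" by blast
        moreover from this have "J \<subseteq> K \<or> K \<subseteq> J" by (intro ch)
        ultimately have "s * t \<in> J \<or> s * t \<in> K" using el(1)[of J] el(1)[of K] unfolding hmult_def by blast
        then show ?thesis using \<open>J \<in> C\<close> \<open>K \<in> C\<close> by blast
      qed
    qed
    moreover have "\<Union>C \<inter> I = {}" using el(2) by blast
    moreover have "T0 \<subseteq> \<Union>C" using C(1) el(3) by blast
    ultimately show "\<Union>C \<in> ?A" by simp
  qed
  then obtain T where T1: "T \<in> ?A" "\<forall>X\<in>?A. T \<subseteq> X \<longrightarrow> X = T" ..
  then have T: "hmult N T" "T \<inter> I = {}" "T0 \<subseteq> T" by simp_all
  have Tmax: "X = T" if "hmult N X" "X \<inter> I = {}" "T \<subseteq> X" for X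
  proof -
    have "X \<in> ?A" using that T(3) by auto
    then show ?thesis using T1(2) that(3) by simp
  qed
  obtain P where P: "hprime N P" "I \<subseteq> P" "P \<inter> T = {}" using hprime_avoiding[OF I T(1,2)] by blast
  have "\<exists>s e k. s \<in> hform N e \<and> s \<notin> P \<and> s * f ^ k \<in> I" if f: "f \<in> P" "homog d f" for f d
  proof -
    let ?X = "{s * f ^ k | s k. s \<in> T}"
    have ff: "f \<in> hform N d" using f hidealD(1)[OF hprimeD(1)[OF P(1)]] by (auto simp: hform_def)
    have 1: "1 \<in> T" using T(1) by (simp add: hmult_def)
    have "hmult N ?X"
      unfolding hmult_def
    proof (intro conjI ballI)
      show "1 \<in> ?X" using 1 by (intro CollectI exI[of _ 1] exI[of _ 0]) auto
      fix x assume "x \<in> ?X"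
      then obtain s k where x: "x = s * f ^ k" "s \<in> T" by blast
      obtain e where "s \<in> hform N e" using T(1) x(2) by (auto simp: hmult_def)
      then show "\<exists>d. x \<in> hform N d" unfolding x(1) using ff
        by (auto simp: hform_def intro!: PV_mult PV_power homog_mult homog_power)
      show "x * y \<in> ?X" if "y \<in> ?X" for y
      proof -
        from that obtain s' k' where y: "y = s' * f ^ k'" "s' \<in> T" by blast
        have "x * y = (s * s') * f ^ (k + k')" unfolding x y by (simp add: power_add mult_ac)
        moreover have "s * s' \<in> T" using T(1) x y by (auto simp: hmult_def)
        ultimately show ?thesis by blast
      qed
    qed
    moreover have "T \<subseteq> ?X" 
    proof
      fix s assume "s \<in> T"
      then show "s \<in> ?X" by (intro CollectI exI[of _ s] exI[of _ 0]) auto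
    qed
    moreover have "f \<in> ?X" using 1 by (intro CollectI exI[of _ 1] exI[of _ 1]) auto
    moreover have "f \<notin> T" using f(1) P(3) by blast
    ultimately have "?X \<inter> I \<noteq> {}" using Tmax[of ?X] by blast
    then obtain s k where "s \<in> T" "s * f ^ k \<in> I" by blast
    moreover then have "s \<notin> P" "\<exists>e. s \<in> hform N e" using P(3) T(1) by (auto simp: hmult_def)
    ultimately show ?thesis by blast
  qed
  then show ?thesis using P T(3) by blast
qed

text \<open>Reducedness of the scheme of \<open>I\<close> without assuming \<open>I\<close>
  saturated: a form that is nilpotent modulo \<open>I\<close> need only be multiplied into
  \<open>I\<close> by all forms of some degree.\<close>

definition Red :: "nat \<Rightarrow> ('k::field) mpol set \<Rightarrow> bool" where
  "Red N I \<longleftrightarrow> (\<forall>f d m. f \<in> hform N d \<longrightarrow> f ^ m \<in> I \<longrightarrow> (\<exists>M. \<forall>g\<in>hform N M. g * f \<in> I))"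

text \<open>At a minimal prime \<open>P\<close> the localization of a reduced ring is a field, so
  \<open>P\<close> and \<open>I\<close> agree after inverting one element \<open>s\<close>.
  Minimality gives for each generator f of \<open>P\<close> a multiplier taking a power of f into
  \<open>I\<close>; reducedness removes the exponent at the cost of a power of x_n; the product of
  the multipliers serves for all of \<open>P\<close>.\<close>

lemma reduced_component:
  assumes I: "hideal N I" and red: "Red N I" and n: "n < N" "\<And>k. Var n ^ k \<notin> I"
  shows "\<exists>P s. hprime N P \<and> I \<subseteq> P \<and> Var n \<notin> P \<and> s \<in> PV {..<N} \<and> s \<notin> P \<and> (\<forall>f\<in>P. s * f \<in> I)"
proof -
  have "range (\<lambda>k. Var n ^ k) \<inter> I = {}" using n(2) by auto
  from minimal_hprime[OF I hmult_powers[OF Var_hform[OF n(1)]] this]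
  obtain P where P: "hprime N P" "I \<subseteq> P" "P \<inter> range (\<lambda>k. Var n ^ k) = {}"
    "\<And>f d. f \<in> P \<Longrightarrow> homog d f \<Longrightarrow> \<exists>s e k. s \<in> hform N e \<and> s \<notin> P \<and> s * f ^ k \<in> I" by blast
  note id = hidealD[OF hprimeD(1)[OF P(1)]]
  have "Var n ^ 1 \<in> range (\<lambda>k. Var n ^ k :: 'a mpol)" by (rule rangeI)
  then have nP: "Var n \<notin> P" using P(3) by auto
  have ex: "\<exists>s. s \<in> PV {..<N} \<and> s \<notin> P \<and> s * f \<in> I" if f: "f \<in> P" "homog d f" for f d
  proof -
    obtain s e k where s: "s \<in> hform N e" "s \<notin> P" "s * f ^ k \<in> I" using P(4)[OF f] by blast
    have k: "k \<noteq> 0" using s P(2) by (metis mult.right_neutral power_0 subsetD)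
    have sf: "s * f \<in> hform N (e + d)" using s(1) f id(1) by (auto simp: hform_def intro: PV_mult homog_mult)
    \<comment> \<open>With enough factors \<open>s\<close> the nilpotence is that of the form s f,
      to which \<open>Red\<close> applies.\<close>
    have "(s * f) ^ k = s ^ (k - 1) * (s * f ^ k)"
      using k by (cases k) (auto simp: power_mult_distrib mult_ac)
    moreover have "s ^ (k - 1) \<in> PV {..<N}" using s(1) by (auto simp: hform_def intro: PV_power)
    ultimately have "(s * f) ^ k \<in> I" using s(3) hidealD(4)[OF I] by simp
    then obtain M where M: "\<And>g. g \<in> hform N M \<Longrightarrow> g * (s * f) \<in> I" using red sf unfolding Red_def by blast
    have V: "Var n ^ M \<in> PV {..<N}" "Var n ^ M \<notin> P"
      using n(1) nP hprime_power[OF P(1)] by (auto intro: PV_power)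
    then have "Var n ^ M * (s * f) \<in> I" by (intro M) (auto simp: hform_def homog_Var_power)
    moreover have "Var n ^ M * s \<in> PV {..<N}" "Var n ^ M * s \<notin> P"
      using V s hprimeD(3)[OF P(1) V(1), of s] by (auto simp: hform_def intro: PV_mult)
    ultimately show ?thesis by (auto simp: mult.assoc intro!: exI[of _ "Var n ^ M * s"])
  qed
  from hideal_fg[OF hprimeD(1)[OF P(1)]] obtain F where F0: "F \<subseteq> P \<and> finite F \<and> (\<forall>f\<in>F. \<exists>d. homog d f) \<and>
    (\<forall>g\<in>P. \<exists>a. (\<forall>f\<in>F. a f \<in> PV {..<N}) \<and> g = (\<Sum>f\<in>F. a f * f))" ..
  then have F: "F \<subseteq> P" "finite F" "\<forall>f\<in>F. \<exists>d. homog d f"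
    "\<And>g. g \<in> P \<Longrightarrow> \<exists>a. (\<forall>f\<in>F. a f \<in> PV {..<N}) \<and> g = (\<Sum>f\<in>F. a f * f)" by blast+
  have "\<forall>f\<in>F. \<exists>s. s \<in> PV {..<N} \<and> s \<notin> P \<and> s * f \<in> I" using F ex by blast
  then obtain s where s: "\<And>f. f \<in> F \<Longrightarrow> s f \<in> PV {..<N} \<and> s f \<notin> P \<and> s f * f \<in> I" by metis
  let ?s = "prod s F"
  have sP: "?s \<in> PV {..<N} \<and> ?s \<notin> P" by (rule hprime_prod[OF P(1) F(2)]) (use s in blast)
  have "?s * g \<in> I" if g: "g \<in> P" for g
  proof -
    obtain a where a: "\<forall>f\<in>F. a f \<in> PV {..<N}" "g = (\<Sum>f\<in>F. a f * f)" using F(4)[OF g] by blast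
    have "?s * (a f * f) \<in> I" if f: "f \<in> F" for f
    proof -
      have "?s = s f * prod s (F - {f})" using F(2) f by (simp add: prod.remove)
      then have "?s * (a f * f) = (prod s (F - {f}) * a f) * (s f * f)" by (simp add: mult_ac)
      moreover have "prod s (F - {f}) * a f \<in> PV {..<N}" using s a(1) f by (intro PV_mult PV_prod) auto
      ultimately show ?thesis using s[OF f] hidealD(4)[OF I] by (simp only:)
    qed
    then show ?thesis unfolding a(2) sum_distrib_left by (intro hideal_sum[OF I])
  qed
  then show ?thesis using P nP sP by blast
qed

section \<open>Points on a prime\<close>

lemma eval_poly_Var:
  assumes "\<And>k. coeff F k \<in> PV {..<i}"
  shows "eval (q(i := t)) (poly F (Var i)) = poly (map_poly (eval q) F) t"
  using assms
proof (induction F)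
  case (pCons a F)
  have a: "a \<in> PV {..<i}" using pCons.prems[of 0] by simp
  have F: "coeff F k \<in> PV {..<i}" for k using pCons.prems[of "Suc k"] by simp
  define q' where "q' = q(i := t)"
  have "eval q' a = eval q a" unfolding q'_def by (rule eval_cong[OF a]) auto
  moreover have "eval q' (poly F (Var i)) = poly (map_poly (eval q) F) t" using pCons.IH[OF F] by (simp only: q'_def)
  moreover have "q' i = t" by (simp add: q'_def)
  ultimately have "eval q' (poly (pCons a F) (Var i)) = poly (map_poly (eval q) (pCons a F)) t"
    using pCons.hyps by (simp add: map_poly_pCons)
  then show ?case by (simp only: q'_def)
qed simp

lemma PV_poly_Var: "(\<And>k. coeff F k \<in> PV {..<i}) \<Longrightarrow> poly F (Var i) \<in> PV {..<Suc i}"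
proof (induction F)
  case (pCons a F)
  have a: "a \<in> PV {..<i}" using pCons.prems[of 0] by simp
  have F: "coeff F k \<in> PV {..<i}" for k using pCons.prems[of "Suc k"] by simp
  show ?case using pCons.IH[OF F] PV_mono[OF a, of "{..<Suc i}"] by (auto intro!: PV_intros)
qed simp

lemma PV_Suc_poly:
  assumes "f \<in> PV {..<Suc i}"
  shows "\<exists>F. (\<forall>k. coeff F k \<in> PV {..<i}) \<and> poly F (Var i) = f"
  using assms
proof (induction rule: PV_induct)
  case (const c)
  show ?case by (intro exI[of _ "[:const c:]"]) (auto simp: coeff_pCons split: nat.split)
next
  case (Var j)
  show ?case
  proof (cases "j = i")
    case True
    then show ?thesis by (intro exI[of _ "[:0, 1:]"]) (auto simp: coeff_pCons split: nat.split)
  next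
    case False
    then show ?thesis using Var by (intro exI[of _ "[:Var j:]"]) (auto simp: coeff_pCons split: nat.split)
  qed
next
  case (add p q)
  then obtain F G where "\<forall>k. coeff F k \<in> PV {..<i}" "poly F (Var i) = p"
    "\<forall>k. coeff G k \<in> PV {..<i}" "poly G (Var i) = q" by auto
  then show ?case by (intro exI[of _ "F + G"]) (auto intro: PV_add)
next
  case (mult p q)
  then obtain F G where "\<forall>k. coeff F k \<in> PV {..<i}" "poly F (Var i) = p"
    "\<forall>k. coeff G k \<in> PV {..<i}" "poly G (Var i) = q" by auto
  then show ?case by (intro exI[of _ "F * G"]) (auto simp: coeff_mult intro!: PV_sum PV_mult)
qed

text \<open>Multiplying by a power of the leading coefficient replaces division, so quotient and
  remainder have coefficients in the subring \<open>K\<close>, which will consist of the polynomials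
  in fewer variables.\<close>

lemma pseudo_division:
  fixes H :: "'a::idom poly"
  assumes K: "\<And>x y. x \<in> K \<Longrightarrow> y \<in> K \<Longrightarrow> x + y \<in> K" "\<And>x y. x \<in> K \<Longrightarrow> y \<in> K \<Longrightarrow> x - y \<in> K"
    "\<And>x y. x \<in> K \<Longrightarrow> y \<in> K \<Longrightarrow> x * y \<in> K" "0 \<in> K" "1 \<in> K"
    and H: "\<And>k. coeff H k \<in> K"
  shows "(\<And>k. coeff G k \<in> K) \<Longrightarrow>
    \<exists>k A R. (\<forall>k. coeff A k \<in> K) \<and> (\<forall>k. coeff R k \<in> K) \<and> smult (lead_coeff H ^ k) G = A * H + R \<and>
      (R = 0 \<or> degree R < degree H)"
proof (induction "degree G" arbitrary: G rule: less_induct)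
  case less
  have sumK: "sum f S \<in> K" if "\<And>x. x \<in> S \<Longrightarrow> f x \<in> K" for f and S :: "nat set"
    using that K by (induction S rule: infinite_finite_induct) auto
  have lcK: "lead_coeff H ^ k \<in> K" for k using K H by (induction k) auto
  have mulK: "coeff (A * B) k \<in> K" if "\<And>k. coeff A k \<in> K" "\<And>k. coeff B k \<in> K" for A B :: "'a poly" and k
    using that K by (auto simp: coeff_mult intro!: sumK)
  show ?case
  proof (cases "G = 0 \<or> degree G < degree H")
    case True
    then show ?thesis using less.prems K by (intro exI[of _ 0] exI[of _ 0] exI[of _ G]) auto
  next
    case False
    define M where "M = monom (lead_coeff G) (degree G - degree H)"
    define G1 where "G1 = smult (lead_coeff H) G - M * H"
    have MK: "coeff M k \<in> K" for k using less.prems K by (auto simp: M_def)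
    have G1K: "coeff G1 k \<in> K" for k
      unfolding G1_def coeff_diff coeff_smult using mulK[OF MK H] less.prems H K by auto
    have dMH: "degree (M * H) \<le> degree G"
      using degree_mult_le[of M H] degree_monom_le[of "lead_coeff G" "degree G - degree H"] False
      unfolding M_def by linarith
    have "coeff (M * H) (degree G) = lead_coeff G * lead_coeff H"
      using coeff_monom_mult[of "lead_coeff G" "degree G - degree H" H "degree G"] False by (auto simp: M_def)
    then have c0: "coeff G1 (degree G) = 0" by (simp add: G1_def)
    have dG1: "degree G1 \<le> degree G" unfolding G1_def using dMH by (intro degree_diff_le) auto
    have "\<exists>k A R. (\<forall>k. coeff A k \<in> K) \<and> (\<forall>k. coeff R k \<in> K) \<and> smult (lead_coeff H ^ k) G1 = A * H + R \<and>
      (R = 0 \<or> degree R < degree H)"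
    proof (cases "G1 = 0")
      case True
      then show ?thesis using K by (intro exI[of _ 0]) auto
    next
      case False
      then have "degree G1 \<noteq> degree G" using c0 by (metis leading_coeff_0_iff)
      then show ?thesis using dG1 G1K by (intro less.hyps) auto
    qed
    then obtain k A R where kAR: "\<And>k. coeff A k \<in> K" "\<And>k. coeff R k \<in> K"
      "smult (lead_coeff H ^ k) G1 = A * H + R" "R = 0 \<or> degree R < degree H" by blast
    have "smult (lead_coeff H ^ Suc k) G = smult (lead_coeff H ^ k) G1 + smult (lead_coeff H ^ k) M * H"
      by (simp add: G1_def smult_diff_right mult.commute)
    also have "\<dots> = (A + smult (lead_coeff H ^ k) M) * H + R" unfolding kAR(3) by (simp add: algebra_simps)
    finally show ?thesis using kAR lcK MK K
      by (intro exI[of _ "Suc k"] exI[of _ "A + smult (lead_coeff H ^ k) M"] exI[of _ R]) auto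
  qed
qed

text \<open>If a member of least degree among those with a coefficient outside \<open>P\<close> had
  its leading coefficient in \<open>P\<close>, dropping the leading term would give a smaller such
  member.\<close>

lemma min_lead:
  fixes Q :: "'a::comm_ring_1 poly set"
  assumes F: "F \<in> Q" "coeff F k \<notin> P"
    and closed: "\<And>G k. G \<in> Q \<Longrightarrow> lead_coeff G \<in> P \<Longrightarrow> G - monom (lead_coeff G) (degree G) \<in> Q"
    and P0: "0 \<in> P"
  shows "\<exists>H\<in>Q. lead_coeff H \<notin> P \<and> (\<forall>G\<in>Q. degree G < degree H \<longrightarrow> (\<forall>k. coeff G k \<in> P))"
proof -
  let ?bad = "\<lambda>G. G \<in> Q \<and> (\<exists>k. coeff G k \<notin> P)"
  have "?bad F" using F by blast
  then obtain H where H: "?bad H" "\<And>G. ?bad G \<Longrightarrow> degree H \<le> degree G"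
    using ex_has_least_nat[of ?bad F degree] by blast
  have "lead_coeff H \<notin> P"
  proof
    assume l: "lead_coeff H \<in> P"
    let ?G = "H - monom (lead_coeff H) (degree H)"
    obtain j where j: "coeff H j \<notin> P" using H(1) by blast
    then have "j \<noteq> degree H" using l by auto
    then have "coeff ?G j \<notin> P" using j by simp
    then have "?bad ?G" using closed[OF _ l] H(1) by blast
    moreover have "degree ?G \<le> degree H" by (intro degree_diff_le degree_monom_le) auto
    moreover have "coeff ?G (degree H) = 0" by simp
    moreover have "?G \<noteq> 0" using \<open>coeff ?G j \<notin> P\<close> P0 by (metis coeff_0)
    ultimately show False using H(2)[of ?G] by (metis antisym leading_coeff_0_iff)
  qed
  then show ?thesis using H by (intro bexI[of _ H]) (auto simp: linorder_not_less[symmetric])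
qed

text \<open>Induction on the number of variables, reading elements of k[x_0, ..., x_i] as
  polynomials in x_i over the previous ring. The claim about a nonvanishing element \<open>u\<close>
  is what passes through the induction: it keeps the relevant coefficients nonzero at the point
  already found.\<close>

lemma nullstellensatz:
  fixes P :: "'k::{alg_closed_field, field_char_0} mpol set"
  assumes P: "hprime N P" and u: "u \<in> PV {..<N}" "u \<notin> P"
  shows "\<exists>q. (\<forall>f\<in>P. eval q f = 0) \<and> eval q u \<noteq> 0"
proof -
  note id = hidealD[OF hprimeD(1)[OF P]]
  have main: "i \<le> N \<Longrightarrow> u \<in> PV {..<i} \<Longrightarrow> u \<notin> P \<Longrightarrow> \<exists>q. (\<forall>f\<in>P \<inter> PV {..<i}. eval q f = 0) \<and> eval q u \<noteq> 0" for i u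
  proof (induction i arbitrary: u)
    case 0
    have PV0: "\<exists>c. f = const c" if "f \<in> PV {..<0}" for f :: "'k mpol"
    proof -
      have "m = 0" if "m \<in> keys f" for m using that \<open>f \<in> _\<close> by (auto simp: PV_def)
      then have "homog 0 f" by (auto simp: homog_def)
      then show ?thesis using homog_0_const by blast
    qed
    have "f = 0" if f: "f \<in> P \<inter> PV {..<0}" for f
    proof (rule ccontr)
      assume "f \<noteq> 0"
      then obtain c where c: "f = const c" "c \<noteq> 0" using PV0 f by fastforce
      then have "const (inverse c) * f = 1" by (simp flip: const_mult)
      then show False using id(4)[of "const (inverse c)" f] f hprimeD(2)[OF P] by simp
    qed
    moreover obtain c where "u = const c" using PV0 0 by blast
    moreover have "c \<noteq> 0" using 0 id(2) calculation(2) by auto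
    ultimately have "\<forall>f\<in>P \<inter> PV {..<0}. eval (\<lambda>_. 0) f = 0" "eval (\<lambda>_. 0) u \<noteq> 0"
      by (metis eval_simps(1), simp)
    then show ?case by blast
  next
    case (Suc i)
    let ?K = "PV {..<i} :: 'k mpol set"
    have KN: "f \<in> PV {..<N}" if "f \<in> ?K" for f using PV_mono[OF that] Suc.prems(1) by auto
    have KS: "f \<in> PV {..<Suc i}" if "f \<in> ?K" for f using PV_mono[OF that] by auto
    have SN: "f \<in> PV {..<N}" if "f \<in> PV {..<Suc i}" for f :: "'k mpol" using PV_mono[OF that] Suc.prems(1) by auto
    define \<Phi> where "\<Phi> F = poly F (Var i)" for F :: "'k mpol poly"
    define FF where "FF = {F :: 'k mpol poly. \<forall>k. coeff F k \<in> ?K}"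
    have \<Phi>PV: "\<Phi> F \<in> PV {..<Suc i}" if "F \<in> FF" for F using that PV_poly_Var by (auto simp: \<Phi>_def FF_def)
    have surj: "\<exists>F\<in>FF. \<Phi> F = f" if "f \<in> PV {..<Suc i}" for f
      using PV_Suc_poly[OF that] by (auto simp: \<Phi>_def FF_def)
    have Vi: "Var i ^ k \<in> PV {..<Suc i}" for k by (auto intro: PV_power)
    have \<Phi>P: "\<Phi> F \<in> P" if "\<And>k. coeff F k \<in> P" for F
      unfolding \<Phi>_def poly_altdef
    proof (rule hideal_sum[OF hprimeD(1)[OF P]])
      fix k show "coeff F k * Var i ^ k \<in> P"
        using id(4)[OF SN[OF Vi] that, of k k] by (simp add: mult.commute)
    qed
    have \<Phi>monom: "\<Phi> (monom c k) = c * Var i ^ k" for c k by (simp add: \<Phi>_def poly_monom)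
    have pdiv: "\<exists>k A R. A \<in> FF \<and> R \<in> FF \<and> smult (lead_coeff H ^ k) G = A * H + R \<and> (R = 0 \<or> degree R < degree H)"
      if HG: "H \<in> FF" "G \<in> FF" for H G
      using pseudo_division[of ?K H G] HG unfolding FF_def
      by (simp add: PV_add PV_minus PV_mult)
    define QP where "QP = {F \<in> FF. \<Phi> F \<in> P}"
    have eval\<Phi>: "eval (q(i := t)) (\<Phi> F) = poly (map_poly (eval q) F) t" if "F \<in> FF" for F q t
      using eval_poly_Var that by (auto simp: \<Phi>_def FF_def)
    have closedP: "G - monom (lead_coeff G) (degree G) \<in> QP" if "G \<in> QP" "lead_coeff G \<in> P" for G
      using that id(4)[OF SN[OF Vi] that(2), of "degree G"] hideal_minus[OF hprimeD(1)[OF P], of "\<Phi> G"]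
      by (auto simp: QP_def FF_def \<Phi>_def poly_monom mult.commute intro: PV_minus)
    show ?case
    proof (cases "\<exists>F\<in>QP. \<exists>k. coeff F k \<notin> P")
      \<comment> \<open>There is no relation for x_i: a polynomial in \<open>P\<close> has all its
        coefficients in \<open>P\<close>. The value of x_i may be any t that is not a root of
        \<open>U\<close> at q, and such t exists since the field is infinite.\<close>
      case False
      obtain U where U: "U \<in> FF" "\<Phi> U = u" using surj[OF Suc.prems(2)] by blast
      obtain k where k: "coeff U k \<notin> P" using \<Phi>P[of U] U(2) Suc.prems(3) by auto
      obtain q where q: "\<forall>f\<in>P \<inter> ?K. eval q f = 0" "eval q (coeff U k) \<noteq> 0"
        using Suc.IH[of "coeff U k"] k U(1) Suc.prems(1) by (auto simp: FF_def)
      have "coeff (map_poly (eval q) U) k \<noteq> 0" using q(2) by (simp add: coeff_map_poly)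
      then have "finite {t. poly (map_poly (eval q) U) t = 0}" by (intro poly_roots_finite) auto
      then obtain t where t: "poly (map_poly (eval q) U) t \<noteq> 0"
        using infinite_UNIV_char_0[where 'a = 'k] by (metis (mono_tags, lifting) UNIV_eq_I mem_Collect_eq)
      have "eval (q(i := t)) f = 0" if f: "f \<in> P \<inter> PV {..<Suc i}" for f
      proof -
        obtain F where F: "F \<in> FF" "\<Phi> F = f" using surj f by blast
        then have "coeff F k \<in> P \<inter> ?K" for k using False f by (auto simp: QP_def FF_def)
        then have "map_poly (eval q) F = 0" using q(1) by (intro poly_eqI) (simp add: coeff_map_poly)
        then show ?thesis using eval\<Phi>[OF F(1), of q t] F(2) by simp
      qed
      moreover have "eval (q(i := t)) u \<noteq> 0" using eval\<Phi>[OF U(1), of q t] U(2) t by simp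
      ultimately show ?thesis by blast
    next
      \<comment> \<open>Now x_i is algebraic modulo \<open>P\<close>. The value of x_i has to be a
        root of a least-degree relation \<open>H\<close>, and u must be kept from vanishing
        there.\<close>
      case True
      then obtain H0 k0 where "H0 \<in> QP" "coeff H0 k0 \<notin> P" by blast
      from min_lead[OF this closedP id(2)] obtain H where H0:
        "H \<in> QP \<and> lead_coeff H \<notin> P \<and> (\<forall>G\<in>QP. degree G < degree H \<longrightarrow> (\<forall>k. coeff G k \<in> P))"
        by blast
      then have H: "H \<in> QP" "lead_coeff H \<notin> P" "\<And>G k. G \<in> QP \<Longrightarrow> degree G < degree H \<Longrightarrow> coeff G k \<in> P"
        by blast+
      have HF: "H \<in> FF" "\<Phi> H \<in> P" using H(1) by (auto simp: QP_def)
      have dH: "degree H > 0"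
      proof (rule ccontr)
        assume "\<not> degree H > 0"
        then obtain c where "H = [:c:]" using degree_eq_zeroE[of H] by auto
        then show False using HF(2) H(2) by (simp add: \<Phi>_def)
      qed
      \<comment> \<open>The ideal generated by \<open>P\<close> and \<open>u\<close>, in terms of
        polynomials in x_i. Its member \<open>G\<close> of least degree turns out to be an element c
        of the smaller ring, which plays the role of a norm of u.\<close>
      define Qu where "Qu = {F \<in> FF. \<exists>a\<in>PV {..<Suc i}. \<Phi> F - a * u \<in> P}"
      have closedu: "G - monom (lead_coeff G) (degree G) \<in> Qu" if G: "G \<in> Qu" "lead_coeff G \<in> P" for G
      proof -
        obtain a where a: "a \<in> PV {..<Suc i}" "\<Phi> G - a * u \<in> P" using G(1) by (auto simp: Qu_def)
        have "lead_coeff G * Var i ^ degree G \<in> P"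
          using id(4)[OF SN[OF Vi] G(2), of "degree G"] by (simp add: mult.commute)
        from hideal_minus[OF hprimeD(1)[OF P] a(2) this]
        have "\<Phi> (G - monom (lead_coeff G) (degree G)) - a * u \<in> P"
          by (simp add: \<Phi>_def poly_monom algebra_simps)
        then show ?thesis using G(1) a(1) by (auto simp: Qu_def FF_def intro: PV_minus)
      qed
      obtain U where U: "U \<in> FF" "\<Phi> U = u" using surj[OF Suc.prems(2)] by blast
      have UQ: "U \<in> Qu" using U id(2) by (auto simp: Qu_def intro!: bexI[of _ 1])
      obtain k where "coeff U k \<notin> P" using \<Phi>P[of U] U(2) Suc.prems(3) by auto
      from min_lead[OF UQ this closedu id(2)] obtain G where G0:
        "G \<in> Qu \<and> lead_coeff G \<notin> P \<and> (\<forall>F\<in>Qu. degree F < degree G \<longrightarrow> (\<forall>k. coeff F k \<in> P))"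
        by blast
      then have G: "G \<in> Qu" "lead_coeff G \<notin> P" "\<And>F k. F \<in> Qu \<Longrightarrow> degree F < degree G \<Longrightarrow> coeff F k \<in> P"
        by blast+
      have GF: "G \<in> FF" using G(1) by (simp add: Qu_def)
      have lG: "lead_coeff G ^ k \<in> PV {..<Suc i}" "lead_coeff G ^ k \<notin> P" for k
        using GF G(2) KS hprime_power[OF P KN, of "lead_coeff G" k] by (auto simp: FF_def intro!: PV_power)
      have lH: "lead_coeff H ^ k \<in> PV {..<Suc i}" "lead_coeff H ^ k \<notin> P" for k
        using HF H(2) KS hprime_power[OF P KN, of "lead_coeff H" k] by (auto simp: FF_def intro!: PV_power)
      have Quq: "R \<in> Qu" if R: "R \<in> FF" "B \<in> FF" "A \<in> FF" "smult c B = A * G + R" "c \<in> PV {..<Suc i}" "B \<in> Qu" for R A B c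
      proof -
        obtain a where a: "a \<in> PV {..<Suc i}" "\<Phi> G - a * u \<in> P" using G(1) by (auto simp: Qu_def)
        obtain b where b: "b \<in> PV {..<Suc i}" "\<Phi> B - b * u \<in> P" using R(6) by (auto simp: Qu_def)
        have "c * \<Phi> B = \<Phi> A * \<Phi> G + \<Phi> R"
          using arg_cong[OF R(4), of \<Phi>] by (simp add: \<Phi>_def)
        then have "\<Phi> R - (c * b - \<Phi> A * a) * u = c * (\<Phi> B - b * u) - \<Phi> A * (\<Phi> G - a * u)"
          by (simp add: algebra_simps)
        also have "\<dots> \<in> P"
          using id(4)[OF SN[OF R(5)] b(2)] id(4)[OF SN[OF \<Phi>PV[OF R(3)]] a(2)] by (rule hideal_minus[OF hprimeD(1)[OF P]])
        finally show ?thesis using R(1,3,5) a b \<Phi>PV unfolding Qu_def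
          by (auto intro!: bexI[of _ "c * b - \<Phi> A * a"] PV_minus PV_mult)
      qed
      have QPu: "B \<in> Qu" if "B \<in> QP" for B using that by (auto simp: QP_def Qu_def intro!: bexI[of _ 0])
      \<comment> \<open>Otherwise pseudo-division of \<open>H\<close> by \<open>G\<close> leaves a
        remainder in \<open>P\<close>, so the quotient or \<open>G\<close> itself lies in
        \<open>P\<close>. The quotient has degree below that of \<open>H\<close>, so its
        coefficients would lie in \<open>P\<close>, and with them the leading coefficient of
        \<open>H\<close>. If \<open>G\<close> is in \<open>P\<close>, pseudo-division of
        \<open>U\<close> by \<open>G\<close> puts u into \<open>P\<close>.\<close>
      have dG: "degree G = 0"
      proof (rule ccontr)
        assume d: "degree G \<noteq> 0"
        obtain k A R where kAR: "A \<in> FF" "R \<in> FF" "smult (lead_coeff G ^ k) H = A * G + R" "R = 0 \<or> degree R < degree G"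
          using pdiv[OF GF HF(1)] by blast
        have "R \<in> Qu" using Quq[OF kAR(2) HF(1) kAR(1,3) lG(1) QPu[OF H(1)]] .
        then have RP: "coeff R k \<in> P" for k using kAR(4) G(3) id(2) by auto
        have "\<Phi> A * \<Phi> G = lead_coeff G ^ k * \<Phi> H - \<Phi> R"
          using arg_cong[OF kAR(3), of \<Phi>] by (simp add: \<Phi>_def)
        then have "\<Phi> A * \<Phi> G \<in> P"
          using id(4)[OF SN[OF lG(1)] HF(2)] \<Phi>P[OF RP] hideal_minus[OF hprimeD(1)[OF P]] by metis
        then consider "\<Phi> A \<in> P" | "\<Phi> G \<in> P"
          using hprimeD(3)[OF P SN[OF \<Phi>PV[OF kAR(1)]] SN[OF \<Phi>PV[OF GF]]] by blast
        then show False
        proof cases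
          case 1
          have lG0: "lead_coeff G ^ k \<noteq> 0" using lG(2)[of k] id(2) by metis
          have "coeff A j \<in> P" for j
          proof (cases "A = 0")
            case False
            have Gn: "G \<noteq> 0" using d by auto
            have "degree (A * G) = degree A + degree G" using False Gn by (rule degree_mult_eq)
            then have "degree (A * G + R) = degree A + degree G" using kAR(4) d
              by (auto simp: degree_add_eq_left)
            then have "degree H = degree A + degree G" using kAR(3) lG0 by (metis degree_smult_eq)
            then show ?thesis using H(3)[of A j] kAR(1) 1 d by (auto simp: QP_def)
          qed (use id(2) in simp)
          moreover have "coeff G j \<in> PV {..<N}" for j using GF KN by (auto simp: FF_def)
          ultimately have "coeff A i * coeff G j \<in> P" for i j
            using id(4)[of "coeff G j" "coeff A i"] by (simp add: mult.commute)
          then have "coeff (A * G) j \<in> P" for j unfolding coeff_mult by (intro hideal_sum[OF hprimeD(1)[OF P]])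
          then have "coeff (smult (lead_coeff G ^ k) H) (degree H) \<in> P"
            unfolding kAR(3) coeff_add using RP id(3) by blast
          then have "lead_coeff G ^ k * lead_coeff H \<in> P" by simp
          then show False
            using hprimeD(3)[OF P SN[OF lG(1)], of "lead_coeff H" k] lG(2) H(2) HF(1) KN by (auto simp: FF_def)
        next
          case 2
          obtain k A R where kAR: "A \<in> FF" "R \<in> FF" "smult (lead_coeff G ^ k) U = A * G + R" "R = 0 \<or> degree R < degree G"
            using pdiv[OF GF U(1)] by blast
          have "R \<in> Qu" using Quq[OF kAR(2) U(1) kAR(1,3) lG(1) UQ] .
          then have RP: "coeff R k \<in> P" for k using kAR(4) G(3) id(2) by auto
          have "lead_coeff G ^ k * u = \<Phi> A * \<Phi> G + \<Phi> R"
            using arg_cong[OF kAR(3), of \<Phi>] U(2) by (simp add: \<Phi>_def)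
          then have "lead_coeff G ^ k * u \<in> P"
            using id(4)[OF SN[OF \<Phi>PV[OF kAR(1)]] 2] \<Phi>P[OF RP] id(3) by metis
          then show False
            using hprimeD(3)[OF P SN[OF lG(1)] SN[OF Suc.prems(2)]] lG(2) Suc.prems(3) by blast
        qed
      qed
      then obtain c where c: "G = [:c:]" using degree_eq_zeroE by blast
      have "coeff G 0 \<in> ?K" using GF by (simp add: FF_def)
      then have cK: "c \<in> ?K" by (simp add: c)
      have cP: "c \<notin> P" using G(2) c by simp
      obtain a where a: "a \<in> PV {..<Suc i}" "c - a * u \<in> P" using G(1) by (auto simp: Qu_def c \<Phi>_def)
      have lHK: "lead_coeff H \<in> ?K" using HF(1) by (auto simp: FF_def)
      \<comment> \<open>Modulo \<open>P\<close> the element c is a multiple of u, so c nonzero at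
        the point forces u nonzero. The nonzero leading coefficient keeps \<open>H\<close>
        nonconstant at q, so that it has a root.\<close>
      have "c * lead_coeff H \<notin> P" using hprimeD(3)[OF P KN[OF cK] KN[OF lHK]] cP H(2) by blast
      then obtain q where q: "\<And>f. f \<in> P \<Longrightarrow> f \<in> ?K \<Longrightarrow> eval q f = 0" "eval q (c * lead_coeff H) \<noteq> 0"
        using Suc.IH[of "c * lead_coeff H"] PV_mult[OF cK lHK] Suc.prems(1) by auto
      have lne: "eval q (lead_coeff H) \<noteq> 0" "eval q c \<noteq> 0" using q(2) by auto
      have "coeff (map_poly (eval q) H) (degree H) \<noteq> 0" using lne by (simp add: coeff_map_poly)
      then have "degree (map_poly (eval q) H) > 0" using le_degree dH by (metis less_le_trans)
      then obtain t where t: "poly (map_poly (eval q) H) t = 0" using alg_closed_imp_poly_has_root by blast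
      let ?q = "q(i := t)"
      have van: "eval ?q f = 0" if f: "f \<in> P" "f \<in> PV {..<Suc i}" for f
      proof -
        obtain F where F: "F \<in> FF" "\<Phi> F = f" using surj f by blast
        obtain k A R where kAR: "A \<in> FF" "R \<in> FF" "smult (lead_coeff H ^ k) F = A * H + R" "R = 0 \<or> degree R < degree H"
          using pdiv[OF HF(1) F(1)] by blast
        have eq: "lead_coeff H ^ k * f = \<Phi> A * \<Phi> H + \<Phi> R"
          using arg_cong[OF kAR(3), of \<Phi>] F(2) by (simp add: \<Phi>_def)
        then have "\<Phi> R = lead_coeff H ^ k * f - \<Phi> A * \<Phi> H" by simp
        then have "\<Phi> R \<in> P"
          using id(4)[OF SN[OF lH(1)] f(1)] id(4)[OF SN[OF \<Phi>PV[OF kAR(1)]] HF(2)] hideal_minus[OF hprimeD(1)[OF P]] by metis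
        then have "coeff R k \<in> P" for k using kAR(2,4) H(3)[of R k] id(2) by (auto simp: QP_def)
        then have "map_poly (eval q) R = 0" using q(1) kAR(2) by (intro poly_eqI) (simp add: coeff_map_poly FF_def)
        then have "eval ?q (\<Phi> R) = 0" using eval\<Phi>[OF kAR(2), of q t] by simp
        moreover have "eval ?q (\<Phi> H) = 0" using eval\<Phi>[OF HF(1), of q t] t by simp
        ultimately have "eval ?q (lead_coeff H) ^ k * eval ?q f = 0"
          using arg_cong[OF eq, of "eval ?q"] by simp
        moreover have "eval ?q (lead_coeff H) = eval q (lead_coeff H)" by (rule eval_cong[OF lHK]) auto
        ultimately show ?thesis using lne by simp
      qed
      have "eval ?q c = eval q c" by (rule eval_cong[OF cK]) auto
      moreover have "eval ?q (c - a * u) = 0"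
        by (rule van[OF a(2)]) (intro PV_minus PV_mult KS[OF cK] a(1) Suc.prems(2))
      ultimately have "eval ?q u \<noteq> 0" using lne by auto
      then show ?thesis using van by blast
    qed
  qed
  show ?thesis using main[OF order_refl u] id(1) by blast
qed

section \<open>Partial derivatives\<close>

definition pd :: "nat \<Rightarrow> 'k mpol \<Rightarrow> ('k::field) mpol" where
  "pd i p = (\<Sum>m\<in>keys p. single (m - single i 1) (of_nat (lookup m i) * lookup p m))"

lemma pd_single: "pd i (single m c) = single (m - single i 1) (of_nat (lookup m i) * c)"
  by (cases "c = 0") (auto simp: pd_def)

lemma pd_zero [simp]: "pd i 0 = 0" by (simp add: pd_def)

lemma pd_add [simp]: "pd i (p + q) = pd i p + pd i q"
proof -
  have *: "pd i r = (\<Sum>m\<in>keys p \<union> keys q. single (m - single i 1) (of_nat (lookup m i) * lookup r m))"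
    if "keys r \<subseteq> keys p \<union> keys q" for r
    unfolding pd_def using that by (intro sum.mono_neutral_left) (auto simp: in_keys_iff)
  show ?thesis using Poly_Mapping.keys_add[of p q]
    by (simp add: * lookup_add distrib_left single_add sum.distrib)
qed

lemma add_minus_single: "lookup m i \<noteq> 0 \<Longrightarrow> (m - single i 1) + m' = m + m' - single i (1::nat)"
  by (rule poly_mapping_eqI) (auto simp: lookup_add lookup_minus lookup_single when_def)

lemma minus_single_eq_iff: "lookup m i \<noteq> 0 \<Longrightarrow> m - single i (1::nat) = m' \<longleftrightarrow> m = m' + single i 1"
  by (metis add_diff_cancel_right' add_minus_single diff_add_zero add.commute add_0 diff_zero
      add_diff_cancel_left')

lemma lookup_pd: "lookup (pd i p) m = of_nat (Suc (lookup m i)) * lookup p (m + single i 1)"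
proof (induction p rule: mpol_induct)
  case (single m' c)
  show ?case
  proof (cases "lookup m' i = 0")
    case True
    then have "m' \<noteq> m + single i 1" by (auto simp: lookup_add)
    then show ?thesis using True by (simp add: pd_single lookup_single when_def)
  next
    case False
    then show ?thesis using minus_single_eq_iff[OF False, of m]
      by (auto simp: pd_single lookup_single when_def lookup_add)
  qed
qed (auto simp: lookup_add distrib_left)

lemma pd_mult: "pd i (p * q) = pd i p * q + p * pd i q"
proof (induction p rule: mpol_induct)
  case (single m c)
  show ?case
  proof (induction q rule: mpol_induct)
    case (single m' d)
    have 1: "pd i (single m c) * single m' d = single (m + m' - single i 1) (of_nat (lookup m i) * (c * d))"
      using add_minus_single[of m i m']
      by (cases "lookup m i = 0") (auto simp: pd_single mult_single add.commute mult_ac)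
    have 2: "single m c * pd i (single m' d) = single (m + m' - single i 1) (of_nat (lookup m' i) * (c * d))"
      using add_minus_single[of m' i m]
      by (cases "lookup m' i = 0") (auto simp: pd_single mult_single add.commute mult_ac)
    show ?case unfolding 1 2 by (simp add: mult_single pd_single lookup_add distrib_right flip: single_add)
  qed (auto simp: algebra_simps)
qed (auto simp: algebra_simps)

lemma pd_const [simp]: "pd i (const c) = 0" by (simp add: const_def pd_single)
lemma pd_const_mult [simp]: "pd i (const c * p) = const c * pd i p" by (simp add: pd_mult)
lemma pd_uminus [simp]: "pd i (- p) = - pd i p" using pd_const_mult[of i "-1" p] by (simp add: const_uminus)
lemma pd_minus [simp]: "pd i (p - q) = pd i p - pd i q" using pd_add[of i p "- q"] by simp
lemma pd_sum [simp]: "pd i (sum f A) = (\<Sum>x\<in>A. pd i (f x))" by (rule additive_sum) auto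
lemma pd_Var [simp]: "pd i (Var j) = (if i = j then 1 else 0)"
  by (auto simp: Var_def pd_single lookup_single)

lemma keys_pd: "m \<in> keys (pd i p) \<Longrightarrow> m + single i 1 \<in> keys p"
  by (auto simp: in_keys_iff lookup_pd)

lemma PV_pd: "p \<in> PV B \<Longrightarrow> pd i p \<in> PV B"
  using keys_pd keys_plus_nat by (fastforce simp: PV_def)

lemma pd_eq_0: assumes "p \<in> PV B" "i \<notin> B" shows "pd i p = 0"
proof -
  have "keys (pd i p) = {}" using keys_pd[of _ i p] keys_plus_nat assms by (fastforce simp: PV_def)
  then show ?thesis by simp
qed

lemma hom_part_pd: "hom_part d (pd i p) = pd i (hom_part (Suc d) p)"
  by (rule poly_mapping_eqI) (auto simp: lookup_pd mdeg_add)

text \<open>A monomial containing x_i survives differentiation by x_i, because its exponent is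
  nonzero in characteristic 0.\<close>

lemma pd_eq_0_imp_const:
  fixes p :: "'k::field_char_0 mpol"
  assumes "p \<in> PV B" "\<And>i. i \<in> B \<Longrightarrow> pd i p = 0" shows "homog 0 p"
  unfolding homog_def
proof (rule ballI, rule ccontr)
  fix m assume m: "m \<in> keys p" "mdeg m \<noteq> 0"
  then obtain i where i: "i \<in> keys m" by (auto simp: mdeg_def)
  then have "lookup m i \<noteq> 0" by (simp add: in_keys_iff)
  then have "m = (m - single i 1) + single i 1" using minus_single_eq_iff by metis
  then have "lookup (pd i p) (m - single i 1) \<noteq> 0"
    using m(1) unfolding lookup_pd by (simp add: in_keys_iff del: of_nat_Suc)
  moreover have "i \<in> B" using assms(1) i m(1) by (auto simp: PV_def)
  ultimately show False using assms(2) by simp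
qed

lemma pd_subst:
  assumes "p \<in> PV A" "finite A"
  shows "pd i (subst g p) = (\<Sum>a\<in>A. subst g (pd a p) * pd i (g a))"
  using assms(1)
proof (induction rule: PV_induct)
  case (Var j)
  then have "(\<Sum>a\<in>A. subst g (pd a (Var j)) * pd i (g a)) = (\<Sum>a\<in>A. if a = j then pd i (g a) else 0)"
    by (intro sum.cong) auto
  then show ?case using Var assms(2) by (simp add: sum.delta')
qed (auto simp: pd_mult algebra_simps sum.distrib sum_distrib_left sum_distrib_right)

lemma hom_part_1:
  assumes "F \<in> PV {..<n}"
  shows "hom_part 1 F = (\<Sum>a<n. const (lookup (pd a F) 0) * Var a)"
proof (rule poly_mapping_eqI)
  fix m
  have l: "lookup (\<Sum>a<n. const (lookup (pd a F) 0) * Var a) m = (\<Sum>a<n. if m = single a 1 then lookup F m else 0)"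
    by (auto simp: lookup_sum lookup_pd Var_def lookup_single when_def intro!: sum.cong)
  show "lookup (hom_part 1 F) m = lookup (\<Sum>a<n. const (lookup (pd a F) 0) * Var a) m"
  proof (cases "\<exists>a<n. m = single a 1")
    case True
    then obtain a where a: "a < n" "m = single a 1" by blast
    have "single a 1 = single b (1::nat) \<longleftrightarrow> a = b" for b by (metis lookup_single_eq lookup_single_not_eq zero_neq_one)
    then have "(\<Sum>a<n. if m = single a 1 then lookup F m else 0) = (\<Sum>b<n. if b = a then lookup F m else 0)"
      unfolding a(2) by (intro sum.cong) auto
    then show ?thesis unfolding l using a by (simp add: sum.delta')
  next
    case False
    have "lookup F m = 0" if "mdeg m = 1"
    proof (rule ccontr)
      assume "lookup F m \<noteq> 0"
      then have k: "keys m \<subseteq> {..<n}" using assms by (auto simp: PV_def in_keys_iff)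
      have "keys m \<noteq> {}" using that by (auto simp: mdeg_def)
      then obtain a where a: "a \<in> keys m" by blast
      have "sum (lookup m) (keys m) = lookup m a + sum (lookup m) (keys m - {a})"
        using a by (simp add: sum.remove)
      moreover have "lookup m a \<ge> 1" using a by (simp add: in_keys_iff)
      ultimately have e: "lookup m a = 1" "sum (lookup m) (keys m - {a}) = 0" using that unfolding mdeg_def by auto
      then have "m = single a 1"
        by (intro poly_mapping_eqI) (auto simp: lookup_single when_def in_keys_iff)
      then show False using False a k by blast
    qed
    moreover have "(\<Sum>a<n. if m = single a 1 then lookup F m else 0) = 0" using False by (intro sum.neutral) auto
    ultimately show ?thesis unfolding l by simp
  qed
qed

lemma hom_part_mult_low:
  assumes "\<And>k. k < m \<Longrightarrow> hom_part k q = 0"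
  shows "k < m \<Longrightarrow> hom_part k (p * q) = 0" "hom_part m (p * q) = hom_part 0 p * hom_part m q"
proof -
  show "hom_part k (p * q) = 0" if "k < m" using that assms by (simp add: hom_part_mult)
  have "hom_part m (p * q) = hom_part 0 p * hom_part m q + (\<Sum>k\<in>{..m}-{m}. hom_part (m - k) p * hom_part k q)"
    unfolding hom_part_mult by (subst sum.remove[of _ m]) auto
  moreover have "(\<Sum>k\<in>{..m}-{m}. hom_part (m - k) p * hom_part k q) = 0"
    using assms by (intro sum.neutral) auto
  ultimately show "hom_part m (p * q) = hom_part 0 p * hom_part m q" by simp
qed

lemma hom_part_0_eval: "hom_part 0 p = const (eval (\<lambda>_. 0) p)"
  using homog_0_const[OF homog_hom_part[of 0 p]] by (simp flip: lookup_0_eval)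

section \<open>Algebraic independence modulo a prime\<close>

definition indep_mod :: "('k::field) mpol set \<Rightarrow> nat set \<Rightarrow> (nat \<Rightarrow> 'k mpol) \<Rightarrow> bool" where
  "indep_mod P B g \<longleftrightarrow> (\<forall>h\<in>PV B. subst g h \<in> P \<longrightarrow> h = 0)"

text \<open>\<open>dim R/P \<le> N - e\<close>, phrased by means of algebraically independent families.\<close>

definition codim_ge :: "nat \<Rightarrow> nat \<Rightarrow> ('k::field) mpol set \<Rightarrow> bool" where
  "codim_ge N e P \<longleftrightarrow> (\<forall>B g. finite B \<longrightarrow> (\<forall>b\<in>B. g b \<in> PV {..<N}) \<longrightarrow> indep_mod P B g \<longrightarrow> card B + e \<le> N)"

lemma indep_Var: "indep_mod P B Var \<longleftrightarrow> P \<inter> PV B \<subseteq> {0}"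
proof -
  have "subst Var h = h" for h :: "'a mpol" by (rule subst_id[of _ UNIV]) auto
  then show ?thesis unfolding indep_mod_def by auto
qed

definition vdeg :: "nat \<Rightarrow> ('k::field) mpol \<Rightarrow> nat" where
  "vdeg i p = Max (insert 0 ((\<lambda>m. lookup m i) ` keys p))"

lemma vdeg_le_iff: "vdeg i p \<le> D \<longleftrightarrow> (\<forall>m\<in>keys p. lookup m i \<le> D)"
  unfolding vdeg_def by (subst Max_le_iff) auto

lemma vdeg_0_PV: "p \<in> PV (insert c B) \<Longrightarrow> vdeg c p = 0 \<Longrightarrow> p \<in> PV B"
proof -
  assume p: "p \<in> PV (insert c B)" "vdeg c p = 0"
  have "lookup m c = 0" if "m \<in> keys p" for m using vdeg_le_iff[of c p 0] p(2) that by simp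
  then have "c \<notin> keys m" if "m \<in> keys p" for m using that by (simp add: in_keys_iff)
  then show ?thesis using p(1) unfolding PV_def by blast
qed

lemma vdeg_attained: "vdeg c p \<noteq> 0 \<Longrightarrow> \<exists>m\<in>keys p. lookup m c = vdeg c p"
proof -
  assume "vdeg c p \<noteq> 0"
  moreover have "vdeg c p \<in> insert 0 ((\<lambda>m. lookup m c) ` keys p)"
    unfolding vdeg_def by (rule Max_in) auto
  ultimately show ?thesis by auto
qed

text \<open>A nonzero relation of least degree in x_c really involves x_c, and in characteristic 0
  its derivative is nonzero. The derivative has smaller degree in x_c, hence lies outside
  \<open>P\<close>.\<close>

lemma separable_relation:
  fixes P :: "'k::field_char_0 mpol set"
  assumes "0 \<in> P" "P \<inter> PV B \<subseteq> {0}" "\<not> P \<inter> PV (insert c B) \<subseteq> {0}"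
  shows "\<exists>F\<in>P \<inter> PV (insert c B). pd c F \<notin> P"
proof -
  let ?Q = "\<lambda>F. F \<in> P \<inter> PV (insert c B) \<and> F \<noteq> 0"
  obtain F where F: "?Q F" "\<And>G. ?Q G \<Longrightarrow> vdeg c F \<le> vdeg c G"
    using ex_has_least_nat[of ?Q _ "vdeg c"] assms(3) by blast
  have v: "vdeg c F \<noteq> 0" using F(1) vdeg_0_PV[of F c B] assms(2) by auto
  then obtain m where m: "m \<in> keys F" "lookup m c = vdeg c F" using vdeg_attained by blast
  then have "m = (m - single c 1) + single c 1" using minus_single_eq_iff[of m c "m - single c 1"] v by simp
  then have "lookup (pd c F) (m - single c 1) \<noteq> 0"
    using m(1) unfolding lookup_pd by (simp add: in_keys_iff del: of_nat_Suc)
  then have nz: "pd c F \<noteq> 0" by auto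
  have "vdeg c (pd c F) \<le> vdeg c F - 1"
    unfolding vdeg_le_iff
  proof
    fix m' assume "m' \<in> keys (pd c F)"
    then have "lookup (m' + single c 1) c \<le> vdeg c F" using vdeg_le_iff[of c F "vdeg c F"] keys_pd by blast
    then show "lookup m' c \<le> vdeg c F - 1" by (simp add: lookup_add)
  qed
  then have "\<not> vdeg c F \<le> vdeg c (pd c F)" using v by simp
  then have "pd c F \<notin> P" using F nz PV_pd by blast
  then show ?thesis using F(1) by blast
qed

text \<open>\<open>P\<close> is homogeneous, so a relation for x_n alone would put a single power of
  x_n into \<open>P\<close>.\<close>

lemma Var_independent:
  assumes P: "hprime N P" and n: "n < N" "Var n \<notin> P"
  shows "P \<inter> PV {n} \<subseteq> {0}"
proof (rule subsetI, rule ccontr)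
  fix h assume h: "h \<in> P \<inter> PV {n}" "h \<notin> {0}"
  then obtain m where m: "m \<in> keys h" by (metis Int_iff keys_eq_empty all_not_in_conv singleton_iff)
  have sn: "m' = single n (mdeg m')" if "m' \<in> keys h" for m'
  proof -
    have k: "keys m' \<subseteq> {n}" using that h(1) by (auto simp: PV_def)
    then have "mdeg m' = sum (lookup m') {n}" unfolding mdeg_def
      by (intro sum.mono_neutral_left) (auto simp: in_keys_iff)
    then show ?thesis using k by (intro poly_mapping_eqI) (auto simp: lookup_single when_def in_keys_iff)
  qed
  let ?d = "mdeg m"
  have "hom_part ?d h = single m (lookup h m)"
  proof (rule poly_mapping_eqI)
    fix m'
    show "lookup (hom_part ?d h) m' = lookup (single m (lookup h m)) m'"
      using sn[OF m] sn[of m'] by (cases "m' \<in> keys h") (auto simp: lookup_single when_def in_keys_iff)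
  qed
  then have "single m (lookup h m) \<in> P" using h(1) hidealD(5)[OF hprimeD(1)[OF P], of h ?d] by simp
  then have "const (inverse (lookup h m)) * single m (lookup h m) \<in> P"
    using hidealD(4)[OF hprimeD(1)[OF P]] by simp
  moreover have "const (inverse (lookup h m)) * single m (lookup h m) = Var n ^ ?d"
    using m sn[OF m] by (simp add: const_def mult_single Var_power in_keys_iff)
  ultimately show False using hprime_power[OF P, of "Var n" ?d] n by simp
qed

section \<open>Generic tangent spaces\<close>

text \<open>The Jacobian matrix of \<open>I\<close> at the generic point of \<open>P\<close> is
  brought to reduced form: rows \<open>F c\<close> with u times the identity in the columns
  \<open>C\<close>, and every other row of \<open>I\<close> a combination of these. So |C| is its
  rank. It is at least e, because the variables outside a transcendence basis satisfy separable
  relations with independent gradients.\<close>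

lemma generic_jacobian:
  fixes P :: "'k::field_char_0 mpol set"
  assumes P: "hprime (Suc n) P" and n: "Var n \<notin> P" and cd: "codim_ge (Suc n) e P"
    and I: "hideal (Suc n) I" "I \<subseteq> P" and s: "s \<in> PV {..<Suc n}" "s \<notin> P" "\<forall>f\<in>P. s * f \<in> I"
  shows "\<exists>C u F. C \<subseteq> {..<n} \<and> e \<le> card C \<and> u \<in> PV {..<Suc n} \<and> u \<notin> P \<and> (\<forall>c\<in>C. F c \<in> I) \<and>
    (\<forall>c\<in>C. \<forall>c'\<in>C. pd c' (F c) - (if c = c' then u else 0) \<in> P) \<and>
    (\<forall>f\<in>I. \<forall>b<n. b \<notin> C \<longrightarrow> u * pd b f - (\<Sum>c\<in>C. pd b (F c) * pd c f) \<in> P)"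
proof -
  note id = hidealD[OF hprimeD(1)[OF P]]
  note mi = hideal_minus[OF hprimeD(1)[OF P]]
  let ?R = "PV {..<Suc n} :: 'k mpol set"
  define Sys where "Sys C u F \<longleftrightarrow> C \<subseteq> {..<n} \<and> e \<le> card C \<and> u \<in> ?R \<and> u \<notin> P \<and> (\<forall>c\<in>C. F c \<in> I) \<and>
    (\<forall>c\<in>C. \<forall>c'\<in>C. pd c' (F c) - (if c = c' then u else 0) \<in> P)" for C u F
  have ex: "\<exists>C u F. Sys C u F"
  proof -
    \<comment> \<open>x_n is put into the transcendence basis, so that no equation is solved for it;
      it will define the affine chart around the point.\<close>
    let ?Q = "\<lambda>B. n \<in> B \<and> B \<subseteq> {..n} \<and> P \<inter> PV B \<subseteq> {0}"
    have Qn: "?Q {n}" using Var_independent[OF P _ n] by auto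
    have Qb: "\<forall>B. ?Q B \<longrightarrow> card B < Suc (Suc n)" using card_mono[of "{..n}"] by (simp add: less_Suc_eq_le)
    from ex_has_greatest_nat[of ?Q, OF Qn Qb]
    obtain B where "?Q B \<and> (\<forall>B'. ?Q B' \<longrightarrow> card B' \<le> card B)" ..
    then have B: "?Q B" "\<And>B'. ?Q B' \<Longrightarrow> card B' \<le> card B" by simp_all
    have fB: "finite B" using B(1) finite_subset by blast
    let ?C = "{..n} - B"
    have "indep_mod P B Var" using B(1) by (simp add: indep_Var)
    moreover have "Var b \<in> ?R" if "b \<in> B" for b using B(1) that by auto
    ultimately have "card B + e \<le> Suc n" using cd fB unfolding codim_ge_def by blast
    moreover have "card ?C = Suc n - card B" using fB B(1) by (simp add: card_Diff_subset)
    ultimately have eC: "e \<le> card ?C" by simp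
    have Cn: "?C \<subseteq> {..<n}" using B(1) by (auto simp: order.strict_iff_order)
    have "\<exists>G\<in>P \<inter> PV (insert c B). pd c G \<notin> P" if c: "c \<in> ?C" for c
    proof (rule separable_relation)
      show "0 \<in> P" "P \<inter> PV B \<subseteq> {0}" using id B by auto
      show "\<not> P \<inter> PV (insert c B) \<subseteq> {0}"
      proof
        assume "P \<inter> PV (insert c B) \<subseteq> {0}"
        then have "?Q (insert c B)" using B(1) c by auto
        then have "card (insert c B) \<le> card B" by (rule B(2))
        then show False using c fB by simp
      qed
    qed
    then have "\<forall>c\<in>?C. \<exists>G. G \<in> P \<inter> PV (insert c B) \<and> pd c G \<notin> P" by blast
    then obtain G where G: "\<And>c. c \<in> ?C \<Longrightarrow> G c \<in> P \<inter> PV (insert c B) \<and> pd c (G c) \<notin> P" by metis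
    have GR: "G c \<in> ?R" "pd c' (G c) \<in> ?R" if "c \<in> ?C" for c c'
      using G[OF that] id(1) PV_pd by auto
    define v where "v c = s * pd c (G c)" for c
    have v: "v c \<in> ?R \<and> v c \<notin> P" if "c \<in> ?C" for c
      using hprimeD(3)[OF P s(1) GR(2)[OF that]] G[OF that] s GR(2)[OF that] unfolding v_def by (auto intro: PV_mult)
    define u where "u = prod v ?C"
    \<comment> \<open>The factor \<open>s\<close> moves the relation \<open>G c\<close> from
      \<open>P\<close> into \<open>I\<close>, and the product over the other columns makes all
      diagonal entries equal to the same \<open>u\<close>.\<close>
    define F where "F c = prod v (?C - {c}) * (s * G c)" for c
    have "u \<in> ?R \<and> u \<notin> P" unfolding u_def by (rule hprime_prod[OF P _ v]) auto
    moreover have "F c \<in> I" if "c \<in> ?C" for c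
    proof -
      have "prod v (?C - {c}) \<in> ?R" using v by (intro PV_prod) auto
      moreover have "s * G c \<in> I" using G[OF that] s(3) by blast
      ultimately show ?thesis unfolding F_def by (rule hidealD(4)[OF I(1)])
    qed
    moreover have "pd c' (F c) - (if c = c' then u else 0) \<in> P" if c: "c \<in> ?C" "c' \<in> ?C" for c c'
    proof -
      let ?p = "prod v (?C - {c})"
      have pR: "?p \<in> ?R" using v by (intro PV_prod) auto
      have "pd c' (F c) = (pd c' ?p * s + ?p * pd c' s) * G c + ?p * (s * pd c' (G c))"
        by (simp add: F_def pd_mult algebra_simps)
      moreover have "(pd c' ?p * s + ?p * pd c' s) * G c \<in> P"
        using G[OF c(1)] pR s(1) by (intro id(4) PV_add PV_mult[of "pd c' ?p"] PV_mult[of ?p] PV_pd) auto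
      moreover have "?p * (s * pd c' (G c)) = (if c = c' then u else 0)"
      proof (cases "c = c'")
        case True
        have "u = v c * ?p" unfolding u_def using c(1) by (intro prod.remove) auto
        then show ?thesis using True by (simp add: v_def mult_ac)
      next
        case False
        then have "c' \<notin> insert c B" using c by auto
        then have "pd c' (G c) = 0" using G[OF c(1)] pd_eq_0[of "G c" "insert c B" c'] by blast
        then show ?thesis using False by simp
      qed
      ultimately show ?thesis by simp
    qed
    ultimately show ?thesis using Cn eC unfolding Sys_def by blast
  qed
  \<comment> \<open>A system with \<open>C\<close> as large as possible is taken. Maximality yields
    the rank statement, since a row not spanned by the \<open>F c\<close> would allow one more
    column.\<close>
  let ?SC = "\<lambda>C. \<exists>u F. Sys C u F"
  have SCb: "\<forall>C. ?SC C \<longrightarrow> card C < Suc n"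
    using card_mono[of "{..<n}"] by (auto simp: Sys_def less_Suc_eq_le)
  obtain C0 where "?SC C0" using ex by blast
  from ex_has_greatest_nat[of ?SC, OF this SCb]
  obtain C where "?SC C \<and> (\<forall>C'. ?SC C' \<longrightarrow> card C' \<le> card C)" ..
  then have C: "?SC C" "\<And>C'. ?SC C' \<Longrightarrow> card C' \<le> card C" by simp_all
  then obtain u F where S: "Sys C u F" by blast
  note S' = S[unfolded Sys_def]
  have fC: "finite C" using S' finite_subset by blast
  have FR: "F c \<in> ?R" "F c \<in> P" if "c \<in> C" for c using S' that I hidealD(1)[OF I(1)] by auto
  have "u * pd b f - (\<Sum>c\<in>C. pd b (F c) * pd c f) \<in> P" if f: "f \<in> I" and b: "b < n" "b \<notin> C" for f b
  proof (rule ccontr)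
    assume nP: "u * pd b f - (\<Sum>c\<in>C. pd b (F c) * pd c f) \<notin> P"
    have fR: "f \<in> ?R" "f \<in> P" using f I hidealD(1)[OF I(1)] by auto
    \<comment> \<open>Row reduction of f: modulo \<open>P\<close> its derivatives in the columns
      \<open>C\<close> vanish, while the one in column \<open>b\<close> does not.\<close>
    define f' where "f' = u * f - (\<Sum>c\<in>C. pd c f * F c)"
    have f'I: "f' \<in> I" unfolding f'_def
      using S' f fR(1) by (intro hideal_minus[OF I(1)] hideal_sum[OF I(1)] hidealD(4)[OF I(1)] PV_pd) auto
    have pdf': "pd a f' - (u * pd a f - (\<Sum>c\<in>C. pd c f * pd a (F c))) \<in> P" for a
    proof -
      have "pd a f' - (u * pd a f - (\<Sum>c\<in>C. pd c f * pd a (F c))) = pd a u * f - (\<Sum>c\<in>C. pd a (pd c f) * F c)"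
        by (simp add: f'_def pd_mult sum.distrib)
      also have "\<dots> \<in> P" using S' fR FR by (intro mi hideal_sum[OF hprimeD(1)[OF P]] id(4) PV_pd) auto
      finally show ?thesis .
    qed
    have f'c: "pd a f' \<in> P" if a: "a \<in> C" for a
    proof -
      have "(\<Sum>c\<in>C. pd c f * (if c = a then u else 0)) = u * pd a f"
        using fC a by (simp add: if_distrib[of "\<lambda>x. _ * x"] sum.delta' mult.commute cong: if_cong)
      then have "pd a f' = (pd a f' - (u * pd a f - (\<Sum>c\<in>C. pd c f * pd a (F c)))) -
          (\<Sum>c\<in>C. pd c f * (pd a (F c) - (if c = a then u else 0)))"
        by (simp add: right_diff_distrib sum_subtractf)
      also have "\<dots> \<in> P"
      proof (rule mi[OF pdf' hideal_sum[OF hprimeD(1)[OF P]]])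
        fix c assume "c \<in> C"
        then have "pd a (F c) - (if c = a then u else 0) \<in> P" using S' a by blast
        then show "pd c f * (pd a (F c) - (if c = a then u else 0)) \<in> P" by (rule id(4)[OF PV_pd[OF fR(1)]])
      qed
      finally show ?thesis .
    qed
    define v where "v = pd b f'"
    have vR: "v \<in> ?R" unfolding v_def using f'I hidealD(1)[OF I(1)] by (intro PV_pd) auto
    have vP: "v \<notin> P"
    proof
      assume "v \<in> P"
      from mi[OF this pdf'[of b]] have "u * pd b f - (\<Sum>c\<in>C. pd c f * pd b (F c)) \<in> P" by (simp add: v_def)
      then show False using nP by (simp add: mult.commute)
    qed
    \<comment> \<open>The new row f' is scaled by u, and the old rows are scaled by v and cleared in
      column \<open>b\<close>; the common diagonal entry becomes u v.\<close>
    define F' where "F' c = (if c = b then u * f' else v * F c - pd b (F c) * f')" for c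
    have f'P: "f' \<in> P" using f'I I(2) by blast
    have 1: "F' c \<in> I" if "c \<in> insert b C" for c
      using that S' f'I vR FR(1) unfolding F'_def
      by (auto intro!: hideal_minus[OF I(1)] hidealD(4)[OF I(1)] PV_pd)
    have 2: "pd c' (F' c) - (if c = c' then u * v else 0) \<in> P" if c: "c \<in> insert b C" "c' \<in> insert b C" for c c'
    proof (cases "c = b")
      case True
      have "pd c' (F' c) - (if c = c' then u * v else 0) = pd c' u * f' + u * (pd c' f' - (if c' = b then v else 0))"
        using True by (auto simp: F'_def pd_mult algebra_simps)
      moreover have "pd c' f' - (if c' = b then v else 0) \<in> P" using c(2) f'c id(2) by (auto simp: v_def)
      ultimately show ?thesis using S' f'P by (auto intro!: id(3) id(4) PV_pd)
    next
      case False
      then have cC: "c \<in> C" using c(1) by simp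
      have eq: "pd c' (F' c) = (pd c' v * F c - pd c' (pd b (F c)) * f') + (v * pd c' (F c) - pd b (F c) * pd c' f')"
        using False by (auto simp: F'_def pd_mult algebra_simps)
      have A: "pd c' v * F c - pd c' (pd b (F c)) * f' \<in> P"
        using FR[OF cC] f'P vR by (intro mi id(4) PV_pd)
      have "v * pd c' (F c) - pd b (F c) * pd c' f' - (if c = c' then u * v else 0) \<in> P"
      proof (cases "c' = b")
        case True
        then show ?thesis using False id(2) by (simp add: v_def mult.commute)
      next
        case False
        then have c'C: "c' \<in> C" using c(2) by simp
        have "v * (pd c' (F c) - (if c = c' then u else 0)) - pd b (F c) * pd c' f' \<in> P"
        proof (rule mi)
          have "pd c' (F c) - (if c = c' then u else 0) \<in> P" using S' cC c'C by blast
          then show "v * (pd c' (F c) - (if c = c' then u else 0)) \<in> P" by (rule id(4)[OF vR])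
          show "pd b (F c) * pd c' f' \<in> P" by (rule id(4)[OF PV_pd[OF FR(1)[OF cC]] f'c[OF c'C]])
        qed
        then show ?thesis by (auto simp: algebra_simps split: if_splits)
      qed
      from id(3)[OF A this] show ?thesis unfolding eq by (simp add: algebra_simps)
    qed
    have "u * v \<in> ?R" "u * v \<notin> P" using hprimeD(3)[OF P] S' vR vP by (auto intro: PV_mult)
    moreover have "card (insert b C) = Suc (card C)" using b(2) fC by simp
    ultimately have "Sys (insert b C) (u * v) F'"
      using 1 2 S' b(1) unfolding Sys_def by auto
    then have "card (insert b C) \<le> card C" using C(2) by blast
    then show False using b(2) fC by simp
  qed
  then show ?thesis using S' by blast
qed

subsection \<open>The tangent cone at a general point\<close>

text \<open>Restriction to the affine chart where x_n has the constant value q_n, with q moved to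
  the origin. The homogeneous parts of \<open>eta n q f\<close> are the Taylor terms of f at q in
  this chart.\<close>

definition eta :: "nat \<Rightarrow> (nat \<Rightarrow> 'k) \<Rightarrow> 'k mpol \<Rightarrow> ('k::field) mpol" where
  "eta n q = subst (\<lambda>a. if a = n then const (q n) else Var a + const (q a))"

lemma rhom_eta: "rhom (eta n q)" unfolding eta_def by (rule rhom_subst)

lemma eta_PV: "f \<in> PV {..<Suc n} \<Longrightarrow> eta n q f \<in> PV {..<n}"
  unfolding eta_def by (rule subst_in_PV) (auto intro!: PV_add)

lemma pd_eta:
  assumes "f \<in> PV {..<Suc n}" "a < n" shows "pd a (eta n q f) = eta n q (pd a f)"
proof -
  have "pd a (eta n q f) = (\<Sum>a'<Suc n. eta n q (pd a' f) * (if a' = a then 1 else 0))"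
    unfolding eta_def using assms by (subst pd_subst[OF assms(1)]) (auto intro!: sum.cong)
  also have "\<dots> = eta n q (pd a f)" using assms(2) by (simp add: sum.delta if_distrib[of "\<lambda>x. _ * x"] cong: if_cong)
  finally show ?thesis .
qed

lemma eval_0_eta: "eval (\<lambda>_. 0) (eta n q f) = eval q f"
proof -
  have "(\<lambda>i. eval (\<lambda>_. 0) (if i = n then const (q n) else Var i + const (q i))) = q" by auto
  then show ?thesis unfolding eta_def eval_subst by simp
qed

lemma hom_part_0_eta: "hom_part 0 (eta n q f) = const (eval q f)"
  by (simp add: hom_part_0_eval eval_0_eta)

text \<open>The point is general in that \<open>s\<close>, \<open>u\<close> and x_n do not vanish at
  it: near q the ideals \<open>I\<close> and \<open>P\<close> agree because of \<open>s\<close>, and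
  the Jacobian keeps its generic rank because of \<open>u\<close>.\<close>

locale general_point =
  fixes n :: nat and I P :: "('k::field_char_0) mpol set" and s u :: "'k mpol" and C :: "nat set"
    and F :: "nat \<Rightarrow> 'k mpol" and q :: "nat \<Rightarrow> 'k"
  assumes I: "hideal (Suc n) I" "I \<subseteq> P" and s: "s \<in> PV {..<Suc n}" "\<And>f. f \<in> P \<Longrightarrow> s * f \<in> I"
    and C: "C \<subseteq> {..<n}" and u: "u \<in> PV {..<Suc n}" and F: "\<And>c. c \<in> C \<Longrightarrow> F c \<in> I"
    and jac: "\<And>c c'. c \<in> C \<Longrightarrow> c' \<in> C \<Longrightarrow> pd c' (F c) - (if c = c' then u else 0) \<in> P"
    and rank: "\<And>f b. f \<in> I \<Longrightarrow> b < n \<Longrightarrow> b \<notin> C \<Longrightarrow> u * pd b f - (\<Sum>c\<in>C. pd b (F c) * pd c f) \<in> P"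
    and q: "\<And>f. f \<in> P \<Longrightarrow> eval q f = 0" "eval q s \<noteq> 0" "eval q u \<noteq> 0" "q n \<noteq> 0"
begin

text \<open>Parametrizes the tangent space at q by the coordinates outside \<open>C\<close>: the
  gradient of \<open>F c\<close> at q, divided by u(q), is solved for x_c.\<close>

definition \<sigma> :: "nat \<Rightarrow> 'k mpol" where
  "\<sigma> a = (if a \<in> C then - (\<Sum>b\<in>{..<n} - C. const (eval q (pd b (F a)) / eval q u) * Var b) else Var a)"

lemma \<sigma>_PV: "a < n \<Longrightarrow> \<sigma> a \<in> PV ({..<n} - C)"
  unfolding \<sigma>_def by (auto intro!: PV_uminus PV_sum PV_mult)
lemma \<sigma>_homog: "homog 1 (\<sigma> a)"
  unfolding \<sigma>_def by (auto intro!: homog_uminus homog_sum homog_const_mult)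

lemma finC: "finite C" using C finite_subset by blast

lemma pd_\<sigma>: "c \<in> C \<Longrightarrow> b < n \<Longrightarrow> b \<notin> C \<Longrightarrow> pd b (\<sigma> c) = - const (eval q (pd b (F c)) / eval q u)"
  by (simp add: \<sigma>_def if_distrib[of "\<lambda>x. _ * x"] sum.delta' cong: if_cong)

text \<open>Induction on the order of f at q. A derivative of the restricted initial form is, up to
  the nonzero factors s(q) and u(q), the restricted initial form of an element of \<open>I\<close>
  of one order less, hence zero. A form of positive degree all of whose derivatives vanish is zero
  in characteristic 0. So initial forms vanish on the whole tangent space, and the tangent cone is
  linear.\<close>

lemma tangent_cone:
  "f \<in> I \<Longrightarrow> (\<And>k. k < m \<Longrightarrow> hom_part k (eta n q f) = 0) \<Longrightarrow> subst \<sigma> (hom_part m (eta n q f)) = 0"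
proof (induction m arbitrary: f)
  case 0
  then have "eval q f = 0" using I(2) q(1) by blast
  then show ?case by (simp add: hom_part_0_eta)
next
  case (Suc m)
  note fR = hidealD(1)[OF I(1) Suc.prems(1)]
  let ?G' = "eta n q f"
  let ?G = "hom_part (Suc m) ?G'"
  have GP: "?G \<in> PV {..<n}" by (intro PV_hom_part eta_PV fR)
  have low: "hom_part k (pd a ?G') = 0" if "k < m" for k a
    using Suc.prems(2)[of "Suc k"] that by (simp add: hom_part_pd)
  have deriv: "pd b (subst \<sigma> ?G) = 0" if b: "b < n" "b \<notin> C" for b
  proof -
    \<comment> \<open>The rank relation places the bracket only in \<open>P\<close>; the factor
      \<open>s\<close> brings it into \<open>I\<close>, where the induction hypothesis applies. Its
      order at q is at least m because it is built from first derivatives of f.\<close>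
    let ?D = "s * (u * pd b f - (\<Sum>c\<in>C. pd b (F c) * pd c f))"
    have DI: "?D \<in> I" using s(2) rank[OF Suc.prems(1) b] by blast
    let ?B = "eta n q u * pd b ?G' - (\<Sum>c\<in>C. eta n q (pd b (F c)) * pd c ?G')"
    have pdc: "eta n q (pd c f) = pd c ?G'" if "c \<in> C" for c using that C pd_eta[OF fR, of c q] by auto
    have eD: "eta n q ?D = eta n q s * ?B"
      using pdc pd_eta[OF fR b(1), of q] by (simp add: rhom_simps[OF rhom_eta])
    note ml = hom_part_mult_low[OF low]
    have B0: "hom_part k ?B = 0" if "k < m" for k
      using ml(1)[OF _ that] that by (simp add: sum.neutral)
    have Bm: "hom_part m ?B = const (eval q u) * pd b ?G - (\<Sum>c\<in>C. const (eval q (pd b (F c))) * pd c ?G)"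
      using ml(2) by (simp add: hom_part_0_eta hom_part_pd)
    have "subst \<sigma> (hom_part m (eta n q ?D)) = 0"
    proof (rule Suc.IH[OF DI])
      fix k assume "k < m"
      then show "hom_part k (eta n q ?D) = 0" unfolding eD using hom_part_mult_low(1)[OF B0] by blast
    qed
    moreover have "hom_part m (eta n q s * ?B) = hom_part 0 (eta n q s) * hom_part m ?B"
      by (rule hom_part_mult_low(2)) (rule B0)
    ultimately have "const (eval q s) * subst \<sigma> (hom_part m ?B) = 0"
      unfolding eD hom_part_0_eta by (simp only: subst_simps subst_const)
    then have "subst \<sigma> (hom_part m ?B) = 0" using q(2) by simp
    then have z: "const (eval q u) * subst \<sigma> (pd b ?G) - (\<Sum>c\<in>C. const (eval q (pd b (F c))) * subst \<sigma> (pd c ?G)) = 0"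
      unfolding Bm by simp
    have "pd b (subst \<sigma> ?G) = (\<Sum>a<n. subst \<sigma> (pd a ?G) * pd b (\<sigma> a))"
      by (rule pd_subst[OF GP]) simp
    also have "\<dots> = (\<Sum>a\<in>{..<n} - C. subst \<sigma> (pd a ?G) * pd b (\<sigma> a)) + (\<Sum>a\<in>C. subst \<sigma> (pd a ?G) * pd b (\<sigma> a))"
      using C by (intro sum.subset_diff) auto
    also have "(\<Sum>a\<in>{..<n} - C. subst \<sigma> (pd a ?G) * pd b (\<sigma> a)) = (\<Sum>a\<in>{..<n} - C. if a = b then subst \<sigma> (pd a ?G) else 0)"
      by (intro sum.cong) (auto simp: \<sigma>_def)
    also have "\<dots> = subst \<sigma> (pd b ?G)" using b by simp
    also have "(\<Sum>a\<in>C. subst \<sigma> (pd a ?G) * pd b (\<sigma> a)) = - (\<Sum>c\<in>C. const (eval q (pd b (F c)) / eval q u) * subst \<sigma> (pd c ?G))"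
      unfolding sum_negf[symmetric] using b by (intro sum.cong) (auto simp: pd_\<sigma>)
    finally have e: "pd b (subst \<sigma> ?G) = subst \<sigma> (pd b ?G) - (\<Sum>c\<in>C. const (eval q (pd b (F c)) / eval q u) * subst \<sigma> (pd c ?G))"
      by simp
    have "const (eval q u) * pd b (subst \<sigma> ?G) = 0"
      unfolding e right_diff_distrib sum_distrib_left using z q(3) by (simp flip: mult.assoc const_mult)
    then show ?thesis using q(3) by simp
  qed
  have "subst \<sigma> ?G \<in> PV ({..<n} - C)" using GP \<sigma>_PV by (auto intro: subst_in_PV)
  then have "homog 0 (subst \<sigma> ?G)" using deriv by (intro pd_eq_0_imp_const) auto
  moreover have "homog (Suc m) (subst \<sigma> ?G)" by (rule homog_subst[OF homog_hom_part GP \<sigma>_homog])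
  ultimately show ?case using homog_unique by blast
qed

end

subsection \<open>Coefficients with respect to the last variable\<close>

definition xc :: "nat \<Rightarrow> nat \<Rightarrow> ('k::field) mpol \<Rightarrow> 'k mpol" where
  "xc n d f = (\<Sum>m\<in>{m\<in>keys f. lookup m n = d}. single (m - single n d) (lookup f m))"

lemma minus_single_eq_iff': "lookup m n = d \<Longrightarrow> m - single n d = m' \<longleftrightarrow> lookup m' n = 0 \<and> m = m' + single n (d::nat)"
proof
  assume "lookup m n = d"
  then show "lookup m' n = 0 \<and> m = m' + single n d" if "m - single n d = m'"
    using that by (auto simp: lookup_minus lookup_add lookup_single when_def intro!: poly_mapping_eqI)
  show "m - single n d = m'" if "lookup m' n = 0 \<and> m = m' + single n d" using that by simp
qed

lemma lookup_xc: "lookup (xc n d f) m = (if lookup m n = 0 then lookup f (m + single n d) else 0)"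
proof -
  have "lookup (xc n d f) m = (\<Sum>m'\<in>{m'\<in>keys f. lookup m' n = d}. if lookup m n = 0 \<and> m' = m + single n d then lookup f m' else 0)"
    unfolding xc_def lookup_sum lookup_single when_def by (intro sum.cong) (auto simp: minus_single_eq_iff')
  also have "\<dots> = (if lookup m n = 0 then lookup f (m + single n d) else 0)"
  proof (cases "lookup m n = 0")
    case True
    then show ?thesis by (auto simp: sum.delta' in_keys_iff lookup_add)
  qed (simp add: sum.neutral)
  finally show ?thesis .
qed

lemma xc_add [simp]: "xc n d (p + q) = xc n d p + xc n d q"
  and xc_const_mult [simp]: "xc n d (const c * p) = const c * xc n d p"
  and xc_zero [simp]: "xc n d 0 = 0"
  and xc_uminus [simp]: "xc n d (- p) = - xc n d p"
  and xc_minus [simp]: "xc n d (p - q) = xc n d p - xc n d q"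
  by (auto simp: lookup_xc lookup_add lookup_minus intro!: poly_mapping_eqI)

lemma keys_xc: "m \<in> keys (xc n d f) \<longleftrightarrow> lookup m n = 0 \<and> m + single n d \<in> keys f"
  by (auto simp: in_keys_iff lookup_xc)

lemma xc_PV: "f \<in> PV {..<Suc n} \<Longrightarrow> xc n d f \<in> PV {..<n}"
  unfolding PV_def mem_Collect_eq
proof
  fix m assume f: "\<forall>m\<in>keys f. keys m \<subseteq> {..<Suc n}" and m: "m \<in> keys (xc n d f)"
  then have "m + single n d \<in> keys f" "lookup m n = 0" using keys_xc by blast+
  then have "keys (m + single n d) \<subseteq> {..<Suc n}" "n \<notin> keys m" using f by (blast, simp add: in_keys_iff)
  then have "keys m \<subseteq> {..<Suc n}" "n \<notin> keys m" by (auto simp: keys_plus_nat)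
  then show "keys m \<subseteq> {..<n}" by (auto simp: less_Suc_eq)
qed

lemma xc_homog: "homog j f \<Longrightarrow> homog (j - d) (xc n d f)"
  unfolding homog_def by (auto simp: keys_xc) (metis add_diff_cancel_right' mdeg_add mdeg_single)
lemma xc_hform: "f \<in> hform (Suc n) j \<Longrightarrow> xc n d f \<in> hform n (j - d)"
  by (auto simp: hform_def xc_PV xc_homog)

lemma xc_eq_0: "vdeg n f < d \<Longrightarrow> xc n d f = 0"
proof -
  assume v: "vdeg n f < d"
  have "m \<notin> keys (xc n d f)" for m
  proof
    assume "m \<in> keys (xc n d f)"
    then have "lookup (m + single n d) n \<le> vdeg n f" using vdeg_le_iff[of n f "vdeg n f"] by (auto simp: keys_xc)
    then show False using v by (simp add: lookup_add)
  qed
  then show ?thesis using keys_eq_empty by blast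
qed

lemma vdeg_less: "vdeg n f \<le> D \<Longrightarrow> xc n D f = 0 \<Longrightarrow> D \<noteq> 0 \<Longrightarrow> vdeg n f \<le> D - 1"
  unfolding vdeg_le_iff
proof
  fix m assume a: "\<forall>m\<in>keys f. lookup m n \<le> D" "xc n D f = 0" "D \<noteq> 0" and m: "m \<in> keys f"
  have "lookup m n \<noteq> D"
  proof
    assume "lookup m n = D"
    then have "m - single n D \<in> keys (xc n D f)" using m minus_single_eq_iff'[of m n D "m - single n D"]
      by (auto simp: keys_xc)
    then show False using a(2) by simp
  qed
  then show "lookup m n \<le> D - 1" using a(1) m by (metis Suc_pred' a(3) less_Suc_eq_le bot_nat_0.not_eq_extremum le_neq_implies_less)
qed

lemma xc_Var_power_mult:
  assumes "g \<in> PV {..<n}" shows "xc n d (Var n ^ k * g) = (if d = k then g else 0)"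
proof -
  have l: "lookup (Var n ^ k * g) m = (if lookup m n = k then lookup g (m - single n k) else 0)" for m
  proof -
    have "keys (Var n ^ k * g) = (\<lambda>a. single n k + a) ` keys g" unfolding Var_power keys_single_mult ..
    have *: "lookup (single a 1 * p) (a + b) = lookup p b" for a b and p :: "'a mpol"
    proof (induction p rule: mpol_induct)
      case (single m c)
      then show ?case by (simp add: mult_single lookup_single when_def)
    qed (auto simp: distrib_left lookup_add)
    show ?thesis
    proof (cases "lookup m n = k")
      case True
      then have "m = single n k + (m - single n k)" using minus_single_eq_iff'[of m n k "m - single n k"] by (simp add: add.commute)
      then have "lookup (Var n ^ k * g) m = lookup g (m - single n k)" using * unfolding Var_power by metis
      then show ?thesis using True by simp
    next
      case False
      have "m \<notin> keys (Var n ^ k * g)"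
      proof
        assume "m \<in> keys (Var n ^ k * g)"
        then obtain a where a: "a \<in> keys g" "m = single n k + a" unfolding Var_power keys_single_mult by blast
        then have "n \<notin> keys a" using assms by (auto simp: PV_def)
        then show False using a(2) False by (simp add: lookup_add in_keys_iff)
      qed
      then show ?thesis using False by (simp add: in_keys_iff)
    qed
  qed
  show ?thesis
  proof (rule poly_mapping_eqI)
    fix m
    have "lookup g m = 0" if "lookup m n \<noteq> 0"
    proof (rule ccontr)
      assume "lookup g m \<noteq> 0"
      then have "keys m \<subseteq> {..<n}" using assms by (simp add: PV_def in_keys_iff)
      moreover have "n \<in> keys m" using that by (simp add: in_keys_iff)
      ultimately show False by blast
    qed
    then show "lookup (xc n d (Var n ^ k * g)) m = lookup (if d = k then g else 0) m"
      by (auto simp: lookup_xc l lookup_add)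
  qed
qed

lemma xc_of_PV: "g \<in> PV {..<n} \<Longrightarrow> xc n d g = (if d = 0 then g else 0)"
  using xc_Var_power_mult[of g n d 0] by simp

lemma vdeg_PV: "g \<in> PV {..<n} \<Longrightarrow> vdeg n g = 0"
  using vdeg_le_iff[of n g 0] by (auto simp: PV_def in_keys_iff subset_iff)

lemma vdeg_homog: "homog j f \<Longrightarrow> vdeg n f \<le> j"
  unfolding vdeg_le_iff homog_def
proof
  fix m assume "\<forall>m\<in>keys f. mdeg m = j" "m \<in> keys f"
  then have "mdeg m = j" by simp
  moreover have "lookup m n \<le> mdeg m"
    by (cases "n \<in> keys m") (auto simp: mdeg_def in_keys_iff intro: member_le_sum)
  ultimately show "lookup m n \<le> j" by simp
qed

lemma vdeg_add: "vdeg n f \<le> D \<Longrightarrow> vdeg n g \<le> D \<Longrightarrow> vdeg n (f + g) \<le> D"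
  unfolding vdeg_le_iff using Poly_Mapping.keys_add[of f g] by blast
lemma vdeg_uminus: "vdeg n (- f) = vdeg n f"
  unfolding vdeg_def by simp
lemma vdeg_minus: "vdeg n f \<le> D \<Longrightarrow> vdeg n g \<le> D \<Longrightarrow> vdeg n (f - g) \<le> D"
  using vdeg_add[of n f D "- g"] vdeg_uminus[of n g] by simp
lemma vdeg_Var_power_mult:
  assumes "g \<in> PV {..<n}" shows "vdeg n (Var n ^ k * g) \<le> k"
  unfolding vdeg_le_iff
proof
  fix m assume "m \<in> keys (Var n ^ k * g)"
  then obtain a where a: "a \<in> keys g" "m = single n k + a" unfolding Var_power keys_single_mult by blast
  then have "n \<notin> keys a" using assms by (auto simp: PV_def)
  then show "lookup m n \<le> k" using a(2) by (simp add: lookup_add in_keys_iff)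
qed

lemma vdeg_0_imp_PV: "f \<in> PV {..<Suc n} \<Longrightarrow> vdeg n f = 0 \<Longrightarrow> f \<in> PV {..<n}"
  using vdeg_0_PV[of f n "{..<n}"] by (simp add: lessThan_Suc)

lemma vdeg_top:
  assumes "f \<in> PV {..<Suc n}" "vdeg n f \<le> Suc D"
  shows "vdeg n (f - Var n ^ Suc D * xc n (Suc D) f) \<le> D"
proof -
  let ?t = "Var n ^ Suc D * xc n (Suc D) f"
  have "vdeg n (f - ?t) \<le> Suc D" using assms xc_PV by (intro vdeg_minus vdeg_Var_power_mult) auto
  moreover have "xc n (Suc D) (f - ?t) = 0"
    unfolding xc_minus xc_Var_power_mult[OF xc_PV[OF assms(1)]] by simp
  ultimately show ?thesis using vdeg_less[of n "f - ?t" "Suc D"] by simp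
qed

lemma xc_expand:
  assumes "f \<in> PV {..<Suc n}" "vdeg n f \<le> D" shows "f = (\<Sum>d\<le>D. Var n ^ d * xc n d f)"
  using assms
proof (induction D arbitrary: f)
  case 0
  then show ?case using vdeg_0_imp_PV[of f n] by (simp add: xc_of_PV)
next
  case (Suc D)
  let ?g = "f - Var n ^ Suc D * xc n (Suc D) f"
  have "xc n d ?g = xc n d f" if "d \<le> D" for d
    unfolding xc_minus xc_Var_power_mult[OF xc_PV[OF Suc.prems(1)]] using that by simp
  then have "(\<Sum>d\<le>D. Var n ^ d * xc n d ?g) = (\<Sum>d\<le>D. Var n ^ d * xc n d f)" by (intro sum.cong) auto
  moreover have "?g \<in> PV {..<Suc n}"
    using Suc.prems(1) PV_mono[OF xc_PV[OF Suc.prems(1)], of "{..<Suc n}"] by (intro PV_minus PV_mult PV_power) auto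
  then have "?g = (\<Sum>d\<le>D. Var n ^ d * xc n d ?g)" using Suc.IH vdeg_top[OF Suc.prems] by blast
  ultimately have "?g = (\<Sum>d\<le>D. Var n ^ d * xc n d f)" by simp
  then show ?case by (simp add: algebra_simps)
qed

section \<open>Generation by quadrics and the equations of the tangent space\<close>

text \<open>Exactness in exterior degree 1 allows the expansion of f in the variables to be
  corrected so that its coefficients lie in \<open>I\<close>. This is the vanishing of Tor_1 read as
  the absence of generators of degree j + 1.\<close>

lemma kexact_generators:
  assumes I: "hideal N I" and k: "kexact N I 1 (int j)" and f: "f \<in> I" "f \<in> hform N (Suc j)"
  shows "\<exists>w. (\<forall>A. w A \<in> I \<inter> hform N j) \<and> f = bd Var N w {}"
proof -
  have "f \<in> gform N (int (Suc j))" using f(2) by (simp only: gform_hform)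
  moreover have "keys m \<inter> {..<N} \<noteq> {}" if "m \<in> keys f" for m
  proof -
    have "keys m \<subseteq> {..<N}" "mdeg m \<noteq> 0" using f(2) that by (auto simp: hform_def PV_def homog_def)
    then show ?thesis by (auto simp: mdeg_def)
  qed
  ultimately obtain w where "chain N 1 (gform N (int (Suc j) - 1)) w \<and> bd Var N w = (\<lambda>A. if A = {} then f else 0)"
    using in_span_Var[of f N "int (Suc j)" N] by blast
  then have w: "chain N 1 (gform N (int j)) w" "bd Var N w = (\<lambda>A. if A = {} then f else 0)" by auto
  have "\<forall>A. bd Var N w A \<in> I" using w(2) f(1) hidealD(2)[OF I] by simp
  with k w(1) obtain v where v: "chain N (Suc 1) (gform N (int j - 1)) v" "\<forall>A. w A - bd Var N v A \<in> I"
    unfolding kexact_def by blast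
  let ?w = "w - bd Var N v"
  have "chain N 1 (gform N (int j)) (bd Var N v)"
    by (rule chain_bd_gform) (use v(1) gform_Var in auto)
  then have "chain N 1 (gform N (int j)) ?w" using w(1) by (intro chain_minus gform_minus)
  then have "?w A \<in> I \<inter> hform N j" for A using v(2) unfolding chain_def gform_hform by simp
  moreover have "bd Var N ?w {} = f" by (simp add: bd_minus bd_bd w(2))
  ultimately show ?thesis by metis
qed

text \<open>At a zero q of \<open>I\<close> the product rule makes the gradient of r f equal to r(q)
  times that of f, and \<open>I\<close> is generated by quadrics. So quadrics alone account for all
  gradients at q.\<close>

lemma quadric_gradients:
  assumes I: "hideal (Suc n) I" and low: "\<forall>f\<in>I. \<forall>d<2. homog d f \<longrightarrow> f = 0"
    and k: "\<forall>j\<ge>2. kexact (Suc n) I 1 (int j)"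
    and q: "\<forall>f\<in>I. eval q f = 0" and f: "f \<in> I"
  shows "\<exists>G\<in>I \<inter> hform (Suc n) 2. \<forall>a. eval q (pd a f) = eval q (pd a G)"
proof -
  let ?V = "{f \<in> I. \<exists>G\<in>I \<inter> hform (Suc n) 2. \<forall>a. eval q (pd a f) = eval q (pd a G)}"
  note id = hidealD[OF I]
  have V0: "0 \<in> ?V" using id(2) by (auto intro!: bexI[of _ 0])
  have Vadd: "x + y \<in> ?V" if xy: "x \<in> ?V" "y \<in> ?V" for x y
  proof -
    obtain G H where "G \<in> I \<inter> hform (Suc n) 2" "\<forall>a. eval q (pd a x) = eval q (pd a G)"
      "H \<in> I \<inter> hform (Suc n) 2" "\<forall>a. eval q (pd a y) = eval q (pd a H)" using xy by blast
    then show ?thesis using xy id(3) by (auto intro!: bexI[of _ "G + H"] hform_add)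
  qed
  have Vmult: "r * x \<in> ?V" if xr: "x \<in> ?V" "r \<in> PV {..<Suc n}" for x r
  proof -
    obtain G where "G \<in> I \<inter> hform (Suc n) 2" "\<forall>a. eval q (pd a x) = eval q (pd a G)" using xr by blast
    then show ?thesis using xr id(4) q
      by (auto intro!: bexI[of _ "const (eval q r) * G"] hform_const_mult simp: pd_mult)
  qed
  have "f \<in> ?V" if "f \<in> I" "f \<in> hform (Suc n) d" for f d
    using that
  proof (induction d arbitrary: f rule: less_induct)
    case (less d)
    have "d < 2 \<or> d = 2 \<or> (\<exists>j. d = Suc j \<and> j \<ge> 2)" by presburger
    then consider "d < 2" | "d = 2" | j where "d = Suc j" "j \<ge> 2" by blast
    then show ?case
    proof cases
      case 1
      then have "f = 0" using low less.prems by (auto simp: hform_def)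
      then show ?thesis using V0 by (simp only:)
    next
      case 2
      then show ?thesis using less.prems by blast
    next
      case 3
      obtain w where w: "\<And>A. w A \<in> I \<inter> hform (Suc n) j" "f = bd Var (Suc n) w {}"
        using kexact_generators[OF I k[rule_format, OF 3(2)] less.prems(1)] less.prems(2) 3(1) by blast
      have "w A \<in> ?V" for A using less.IH[of j "w A"] w(1)[of A] 3(1) by auto
      then have "bd Var (Suc n) w {} \<in> ?V"
      proof (rule bd_closed[where U = ?V, rotated 4])
        show "- x \<in> ?V" if "x \<in> ?V" for x           using Vmult[OF that PV_uminus[OF PV_one]] by simp
      qed (use V0 Vadd Vmult in auto)
      then show ?thesis using w(2) by simp
    qed
  qed
  then have hp: "hom_part d f \<in> ?V" for d using f id(1,5) hform_hom_part by blast
  obtain D where D: "f = (\<Sum>d\<le>D. hom_part d f)" using hom_part_decomp by blast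
  have "(\<Sum>d\<le>D. hom_part d f) \<in> ?V" for D
  proof (induction D)
    case (Suc D)
    then show ?case using Vadd[OF Suc hp[of "Suc D"]] by simp
  qed (use hp in simp)
  from this[of D] show ?thesis unfolding D[symmetric] by blast
qed

text \<open>The situation after the general point has been moved to (0 : ... : 0 : 1). By
  \<open>top\<close>, the coefficient of the highest power of x_n, which is the initial form at the
  point, vanishes on a linear space; by \<open>quad\<close>, every equation of that space is the
  leading coefficient of a quadric in the ideal.\<close>

locale elimination =
  fixes n :: nat and I :: "('k::field) mpol set" and C :: "nat set" and \<sigma> :: "nat \<Rightarrow> 'k mpol"
  assumes hid: "hideal (Suc n) I" and C: "C \<subseteq> {..<n}"
    and \<sigma>_C: "\<And>c. c \<in> C \<Longrightarrow> \<sigma> c \<in> PV ({..<n} - C)" and \<sigma>_notC: "\<And>a. a \<notin> C \<Longrightarrow> \<sigma> a = Var a"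
    and \<sigma>_homog: "\<And>a. homog 1 (\<sigma> a)"
    and top: "\<And>f j D. f \<in> I \<Longrightarrow> homog j f \<Longrightarrow> vdeg n f \<le> D \<Longrightarrow> D \<le> j \<Longrightarrow> subst \<sigma> (xc n D f) = 0"
    and quad: "\<And>c. c \<in> C \<Longrightarrow> \<exists>G\<in>I \<inter> hform (Suc n) 2. vdeg n G \<le> 1 \<and> xc n 1 G = Var c - \<sigma> c"

section \<open>Moving the general point to a coordinate point\<close>

text \<open>For a_i = q_i / q_n the values of these linear forms at q are 0, ..., 0, q_n. Since x_n
  is fixed, a shear is enough and its inverse is the shear with -a.\<close>

definition shear :: "nat \<Rightarrow> (nat \<Rightarrow> 'k) \<Rightarrow> nat \<Rightarrow> ('k::field) mpol" where
  "shear n a i = (if i < n then Var i - const (a i) * Var n else Var i)"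

lemma shear_homog: "homog 1 (shear n a i)"
  unfolding shear_def by (auto intro!: homog_minus homog_const_mult)
lemma shear_PV: "i \<in> {..<Suc n} \<Longrightarrow> shear n a i \<in> PV {..<Suc n}"
  unfolding shear_def by (auto intro!: PV_minus PV_mult)
lemma subst_shear_PV: "f \<in> PV {..<Suc n} \<Longrightarrow> subst (shear n a) f \<in> PV {..<Suc n}"
  by (rule subst_in_PV[OF _ shear_PV])
lemma subst_shear_hform: "f \<in> hform (Suc n) d \<Longrightarrow> subst (shear n a) f \<in> hform (Suc n) d"
  using homog_subst[of d f "{..<Suc n}" "shear n a", OF _ _ shear_homog] subst_shear_PV[of f n a]
  by (simp add: hform_def)
lemma subst_shear_inverse: "subst (shear n a) (subst (shear n (\<lambda>i. - a i)) f) = f"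
proof -
  have "subst (shear n a) (shear n (\<lambda>i. - a i) i) = Var i" for i
    by (auto simp: shear_def const_uminus)
  then show ?thesis unfolding subst_subst by (simp add: subst_id[of f UNIV])
qed

lemma hideal_vimage_shear:
  assumes "hideal (Suc n) I" shows "hideal (Suc n) {f \<in> PV {..<Suc n}. subst (shear n a) f \<in> I}"
  unfolding hideal_def
proof (intro conjI ballI allI)
  fix f d assume f: "f \<in> {f \<in> PV {..<Suc n}. subst (shear n a) f \<in> I}"
  have "subst (shear n a) (hom_part d f) = hom_part d (subst (shear n a) f)"
  proof -
    obtain D where D: "f = (\<Sum>d\<le>D. hom_part d f)" using hom_part_decomp by blast
    have h: "homog k (subst (shear n a) (hom_part k f))" for k
      using f by (intro homog_subst[OF homog_hom_part _ shear_homog, of _ _ UNIV]) auto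
    have "hom_part d (subst (shear n a) f) = (\<Sum>k\<le>D. hom_part d (subst (shear n a) (hom_part k f)))"
      by (subst D) simp
    also have "\<dots> = (\<Sum>k\<le>D. if d = k then subst (shear n a) (hom_part k f) else 0)"
      by (intro sum.cong refl hom_part_homog h)
    also have "\<dots> = subst (shear n a) (hom_part d f)"
    proof (cases "d \<le> D")
      case False
      have "hom_part d f = hom_part d (\<Sum>k\<le>D. hom_part k f)" using D by simp
      also have "\<dots> = 0" using False by (auto simp: hom_part_hom_part intro!: sum.neutral)
      finally show ?thesis using False by simp
    qed simp
    finally show ?thesis by simp
  qed
  then show "hom_part d f \<in> {f \<in> PV {..<Suc n}. subst (shear n a) f \<in> I}"
    using f hidealD(5)[OF assms] PV_hom_part by auto
next
  fix r f :: "'a mpol" assume "r \<in> PV {..<Suc n}" "f \<in> {f \<in> PV {..<Suc n}. subst (shear n a) f \<in> I}"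
  then show "r * f \<in> {f \<in> PV {..<Suc n}. subst (shear n a) f \<in> I}"
    using hidealD(4)[OF assms subst_shear_PV[of r n a]] by (auto intro: PV_mult)
qed (use hidealD(2,3)[OF assms] in \<open>auto intro: PV_add\<close>)

lemma generic_position:
  fixes I :: "'k::{alg_closed_field, field_char_0} mpol set"
  assumes P: "hprime (Suc n) P" and n: "Var n \<notin> P" and cd: "codim_ge (Suc n) e P"
    and I: "hideal (Suc n) I" "I \<subseteq> P" and s: "s \<in> PV {..<Suc n}" "s \<notin> P" "\<forall>f\<in>P. s * f \<in> I"
    and low: "\<forall>f\<in>I. \<forall>d<2. homog d f \<longrightarrow> f = 0"
    and k: "\<forall>j\<ge>2. kexact (Suc n) I 1 (int j)"
  shows "\<exists>a C \<sigma>. elimination n {f \<in> PV {..<Suc n}. subst (shear n a) f \<in> I} C \<sigma> \<and> e \<le> card C"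
proof -
  obtain C u F where J: "C \<subseteq> {..<n} \<and> e \<le> card C \<and> u \<in> PV {..<Suc n} \<and> u \<notin> P \<and> (\<forall>c\<in>C. F c \<in> I) \<and>
    (\<forall>c\<in>C. \<forall>c'\<in>C. pd c' (F c) - (if c = c' then u else 0) \<in> P) \<and>
    (\<forall>f\<in>I. \<forall>b<n. b \<notin> C \<longrightarrow> u * pd b f - (\<Sum>c\<in>C. pd b (F c) * pd c f) \<in> P)"
    using generic_jacobian[OF P n cd I s] by (elim exE)
  have "s * u * Var n \<in> PV {..<Suc n}" "s * u * Var n \<notin> P"
    using J s n hprimeD(3)[OF P, of "s * u" "Var n"] hprimeD(3)[OF P, of s u] by (auto intro!: PV_mult)
  from nullstellensatz[OF P this] obtain q where q: "\<forall>f\<in>P. eval q f = 0" "eval q (s * u * Var n) \<noteq> 0" by blast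
  interpret general_point n I P s u C F q
    by unfold_locales (use I s J q in auto)
  define a where "a i = q i / q n" for i
  let ?I1 = "{f \<in> PV {..<Suc n}. subst (shear n a) f \<in> I}"
  have I1: "hideal (Suc n) ?I1" by (rule hideal_vimage_shear[OF I(1)])
  \<comment> \<open>The shear cancels the translation in \<open>eta\<close>, so Taylor terms at q
    become coefficients of powers of x_n: a high order at q means that the top powers of x_n are
    missing.\<close>
  have eta1: "eta n q (subst (shear n a) f) = (\<Sum>d\<le>j. const (q n ^ d) * xc n d f)" if f: "f \<in> hform (Suc n) j" for f j
  proof -
    have fR: "f \<in> PV {..<Suc n}" "vdeg n f \<le> j" using f vdeg_homog by (auto simp: hform_def)
    let ?e = "\<lambda>i. if i = n then const (q n) else Var i :: 'k mpol"
    have "eta n q (subst (shear n a) f) = subst ?e f"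
      unfolding eta_def subst_subst
    proof (rule subst_cong[OF fR(1)])
      fix i assume i: "i \<in> {..<Suc n}"
      show "subst (\<lambda>a. if a = n then const (q n) else Var a + const (q a)) (shear n a i) = ?e i"
        using i q(4) by (auto simp: shear_def a_def simp flip: const_mult)
    qed
    also have "\<dots> = (\<Sum>d\<le>j. subst ?e (Var n ^ d * xc n d f))"
      by (subst xc_expand[OF fR]) simp
    also have "\<dots> = (\<Sum>d\<le>j. const (q n ^ d) * xc n d f)"
    proof (rule sum.cong[OF refl])
      fix d
      have "subst ?e (xc n d f) = xc n d f" by (rule subst_id[OF xc_PV[OF fR(1)]]) auto
      then show "subst ?e (Var n ^ d * xc n d f) = const (q n ^ d) * xc n d f"
        by (simp add: rhom_power[OF rhom_const])
    qed
    finally show ?thesis .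
  qed
  have etah: "hom_part k (eta n q (subst (shear n a) f)) = const (q n ^ (j - k)) * xc n (j - k) f"
    if f: "f \<in> hform (Suc n) j" and k: "k \<le> j" for f j k
  proof -
    have h: "homog (j - d) (const (q n ^ d) * xc n d f)" for d
      using xc_homog[of j f d n] f by (auto simp: hform_def intro: homog_const_mult)
    have "hom_part k (eta n q (subst (shear n a) f)) = (\<Sum>d\<le>j. if k = j - d then const (q n ^ d) * xc n d f else 0)"
      unfolding eta1[OF f] hom_part_sum by (intro sum.cong refl hom_part_homog h)
    also have "\<dots> = (\<Sum>d\<le>j. if d = j - k then const (q n ^ d) * xc n d f else 0)"
      using k by (intro sum.cong) auto
    finally show ?thesis by simp
  qed
  have "elimination n ?I1 C \<sigma>"
  proof
    show "hideal (Suc n) ?I1" "C \<subseteq> {..<n}" using I1 C by auto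
    show "\<sigma> c \<in> PV ({..<n} - C)" if "c \<in> C" for c using \<sigma>_PV C that by blast
    show "\<sigma> a = Var a" if "a \<notin> C" for a using that by (simp add: \<sigma>_def)
    show "homog 1 (\<sigma> a)" for a by (rule \<sigma>_homog)
    fix f j D assume f: "f \<in> ?I1" "homog j f" "vdeg n f \<le> D" "D \<le> j"
    then have fh: "f \<in> hform (Suc n) j" by (auto simp: hform_def)
    have "hom_part k (eta n q (subst (shear n a) f)) = 0" if "k < j - D" for k
    proof -
      have "xc n (j - k) f = 0" using that f(3) by (intro xc_eq_0) auto
      then show ?thesis using etah[OF fh, of k] that by simp
    qed
    from tangent_cone[OF _ this] f(1) have "subst \<sigma> (hom_part (j - D) (eta n q (subst (shear n a) f))) = 0" by auto
    then show "subst \<sigma> (xc n D f) = 0" using etah[OF fh, of "j - D"] f(4) q(4) by simp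
  next
    fix c assume c: "c \<in> C"
    have q0: "\<forall>f\<in>I. eval q f = 0" using I(2) q(1) by blast
    obtain G0 where G0: "G0 \<in> I \<inter> hform (Suc n) 2" "\<And>a. eval q (pd a (F c)) = eval q (pd a G0)"
      using quadric_gradients[OF I(1) low k q0 F[OF c]] by metis
    define G1 where "G1 = subst (shear n (\<lambda>i. - a i)) G0"
    have G1: "G1 \<in> hform (Suc n) 2" "subst (shear n a) G1 = G0"
      unfolding G1_def using G0(1) by (auto simp: subst_shear_hform subst_shear_inverse)
    have G1I: "G1 \<in> ?I1" using G1 G0(1) by (auto simp: hform_def)
    \<comment> \<open>Up to the factor q_n^2, the coefficient of x_n^2 is the value of the quadric
      at q, hence zero.\<close>
    have "const (q n ^ 2) * xc n 2 G1 = const (eval q G0)"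
      using etah[OF G1(1), of 0] by (simp add: G1(2) hom_part_0_eta)
    then have x2: "xc n 2 G1 = 0" using q0 G0(1) q(4) by simp
    have v: "vdeg n G1 \<le> 1"
      using vdeg_less[of n G1 2] vdeg_homog[of 2 G1 n] x2 G1(1) by (auto simp: hform_def)
    have G0R: "G0 \<in> PV {..<Suc n}" using G0(1) by (auto simp: hform_def)
    have "hom_part 1 (eta n q G0) = (\<Sum>a<n. const (eval q (pd a (F c))) * Var a)"
      unfolding hom_part_1[OF eta_PV[OF G0R]]
      by (intro sum.cong refl) (simp add: pd_eta[OF G0R] lookup_0_eval eval_0_eta G0(2))
    also have "\<dots> = (\<Sum>a\<in>{..<n} - C. const (eval q (pd a (F c))) * Var a) + (\<Sum>a\<in>C. const (eval q (pd a (F c))) * Var a)"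
      using C by (intro sum.subset_diff) auto
    also have "(\<Sum>a\<in>C. const (eval q (pd a (F c))) * Var a) = (\<Sum>a\<in>C. if a = c then const (eval q u) * Var a else 0)"
    proof (rule sum.cong[OF refl])
      fix a assume a: "a \<in> C"
      have "eval q (pd a (F c) - (if c = a then u else 0)) = 0" using jac[OF c a] q(1) by blast
      then show "const (eval q (pd a (F c))) * Var a = (if a = c then const (eval q u) * Var a else 0)"
        by (auto split: if_splits)
    qed
    also have "\<dots> = const (eval q u) * Var c" using c finC by simp
    also have "(\<Sum>a\<in>{..<n} - C. const (eval q (pd a (F c))) * Var a) = - (const (eval q u) * \<sigma> c)"
      using c q(3) by (auto simp: \<sigma>_def sum_distrib_left simp flip: mult.assoc const_mult)
    finally have "const (q n) * xc n 1 G1 = const (eval q u) * (Var c - \<sigma> c)"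
      using etah[OF G1(1), of 1] by (simp add: G1(2) algebra_simps)
    then have "const (inverse (eval q u)) * (const (q n) * xc n 1 G1) = Var c - \<sigma> c"
      using q(3) by (simp flip: mult.assoc const_mult)
    then have x1: "xc n 1 (const (inverse (eval q u) * q n) * G1) = Var c - \<sigma> c"
      by (simp add: const_mult mult.assoc)
    have "vdeg n (const (inverse (eval q u) * q n) * G1) \<le> 1"
      using v unfolding vdeg_le_iff by (auto simp: in_keys_iff)
    moreover have "const (inverse (eval q u) * q n) * G1 \<in> ?I1 \<inter> hform (Suc n) 2"
      using hidealD(4)[OF I1 PV_const G1I] G1(1) by (auto intro: hform_const_mult)
    ultimately show "\<exists>G\<in>?I1 \<inter> hform (Suc n) 2. vdeg n G \<le> 1 \<and> xc n 1 G = Var c - \<sigma> c"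
      using x1 by blast
  qed
  then show ?thesis using J by blast
qed

section \<open>Koszul homology over the smaller polynomial ring\<close>

lemma bd_coeff_cong: "(\<And>b. b < n \<Longrightarrow> c b = d b) \<Longrightarrow> bd c n z = bd d n z"
  by (induction n arbitrary: z) (simp_all add: bd.simps)

lemma hideal_bd:
  assumes "hideal N I" "\<And>b. b < n \<Longrightarrow> c b \<in> PV {..<N}" "\<And>A. z A \<in> I"
  shows "bd c n z A \<in> I"
  by (rule bd_closed[where U = I]) (use hidealD[OF assms(1)] hideal_uminus[OF assms(1)] assms in auto)

lemma bd_smul_apply: "bd c n (smul r z) A = r * bd c n z A"
  unfolding bd_smul by (simp add: smul_def)

lemma chain_PV: "chain n i (gform N j) z \<Longrightarrow> z A \<in> PV {..<N}"
  by (auto simp: chain_def dest: gform_PV)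

text \<open>
  The Koszul homology of \<open>R/I\<close> with respect to \<open>y\<^sub>0, \<dots>, y\<^bsub>n-1\<^esub>\<close>, in exterior degree \<open>i\<close> and coefficient
  degree \<open>j\<close>: multiplication by \<open>x\<^sub>n\<close> into it is surjective, respectively out of it is injective.
\<close>

definition surj_at :: "(nat \<Rightarrow> 'k mpol) \<Rightarrow> nat \<Rightarrow> ('k::field) mpol set \<Rightarrow> nat \<Rightarrow> int \<Rightarrow> bool" where
  "surj_at y n I i j \<longleftrightarrow> (\<forall>z. chain n i (gform (Suc n) j) z \<longrightarrow> (\<forall>A. bd y n z A \<in> I) \<longrightarrow>
     (\<exists>b w. chain n i (gform (Suc n) (j - 1)) b \<and> chain n (Suc i) (gform (Suc n) (j - 1)) w \<and>
        (\<forall>A. bd y n b A \<in> I) \<and> (\<forall>A. z A - Var n * b A - bd y n w A \<in> I)))"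

definition inj_at :: "(nat \<Rightarrow> 'k mpol) \<Rightarrow> nat \<Rightarrow> ('k::field) mpol set \<Rightarrow> nat \<Rightarrow> int \<Rightarrow> bool" where
  "inj_at y n I i j \<longleftrightarrow> (\<forall>z w. chain n i (gform (Suc n) j) z \<longrightarrow> (\<forall>A. bd y n z A \<in> I) \<longrightarrow>
     chain n (Suc i) (gform (Suc n) j) w \<longrightarrow> (\<forall>A. Var n * z A - bd y n w A \<in> I) \<longrightarrow>
     (\<exists>w. chain n (Suc i) (gform (Suc n) (j - 1)) w \<and> (\<forall>A. z A - bd y n w A \<in> I)))"

context
  fixes n :: nat and I :: "('k::field) mpol set" and a :: "nat \<Rightarrow> 'k"
  assumes I: "hideal (Suc n) I"
begin

private abbreviation (input) "y \<equiv> shear n a"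
private abbreviation (input) "kap \<equiv> (\<lambda>b. const (a b) :: 'k mpol)"

text \<open>From x_b = y_b + a_b x_n: the two Koszul differentials differ by x_n times the
  contraction with the constants a_b.\<close>

lemma bd_Var_shear: "bd Var n z = bd y n z + smul (Var n) (bd kap n z)"
  unfolding bd_add_coeff[symmetric] by (rule bd_coeff_cong) (simp add: shear_def)

lemma kap_bd_I: "(\<And>A. z A \<in> I) \<Longrightarrow> bd kap n z A \<in> I"
  by (rule hideal_bd[OF I]) auto

lemma kap_chain: "chain n (Suc i) (gform N j) z \<Longrightarrow> chain n i (gform N j) (bd kap n z)"
  by (rule chain_bd[where U = "gform N j"]) (auto intro: gform_intros gform_const_mult)

lemma kap_bd_Var: "bd kap n (bd Var n z) = bd kap n (bd y n z)"
  unfolding bd_Var_shear by (simp only: bd_simps bd_bd smul_simps add_0_right)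

text \<open>\<open>V + bd kap n U\<close> is the e_n-component of U + e_n \<and> V in the exterior
  basis adapted to y_0, ..., y_{n-1}, x_n. The formula expresses its boundary through the two
  components of the boundary in the original basis.\<close>

lemma bd_y_corrected:
  "bd y n (V + bd kap n U) = bd Var n V - bd kap n (bd Var n U + smul (Var n) V)"
proof -
  have "bd y n (V + bd kap n U) = bd Var n (V + bd kap n U) - smul (Var n) (bd kap n (V + bd kap n U))"
    by (simp add: bd_Var_shear)
  also have "\<dots> = bd Var n V + bd Var n (bd kap n U) - smul (Var n) (bd kap n V)"
    by (simp only: bd_simps bd_bd add_0_right)
  also have "bd Var n (bd kap n U) = - bd kap n (bd Var n U)" by (rule bd_anticomm)
  finally have E: "bd y n (V + bd kap n U) = bd Var n V + - bd kap n (bd Var n U) - smul (Var n) (bd kap n V)" .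
  have "bd kap n (bd Var n U + smul (Var n) V) = bd kap n (bd Var n U) + smul (Var n) (bd kap n V)"
    by (simp only: bd_simps)
  then show ?thesis unfolding E by (simp only: diff_diff_eq[symmetric] add_uminus_conv_diff)
qed

lemma split_Koszul:
  assumes W: "chain (Suc n) (Suc i) (gform (Suc n) j) W"
    and uv: "avoids n u" "avoids n v" and h: "\<And>A. join n u v A - bd Var (Suc n) W A \<in> I"
  shows "\<And>A. u A - (bd Var n (lo n W) + smul (Var n) (hi n W)) A \<in> I"
    "\<And>A. v A + bd Var n (hi n W) A \<in> I"
proof -
  let ?U = "lo n W" and ?V = "hi n W"
  have bW: "bd Var (Suc n) W = join n (bd Var n ?U + smul (Var n) ?V) (- bd Var n ?V)" by (simp add: bd.simps)
  have av: "avoids n (bd Var n ?U + smul (Var n) ?V)" "avoids n (bd Var n ?V)"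
    by (auto intro!: avoids_add avoids_smul avoids_bd_intros)
  fix A
  show "u A - (bd Var n ?U + smul (Var n) ?V) A \<in> I"
  proof (cases "n \<in> A")
    case True
    then show ?thesis using uv(1) av(1) hidealD(2)[OF I] unfolding avoids_def by auto
  next
    case False
    then show ?thesis using h[of A] unfolding bW by (simp add: join_def)
  qed
  show "v A + bd Var n ?V A \<in> I"
  proof (cases "n \<in> A")
    case True
    then show ?thesis using uv(2) av(2) hidealD(2)[OF I] unfolding avoids_def by auto
  next
    case False
    then show ?thesis using h[of "insert n A"] unfolding bW by (simp add: join_def)
  qed
qed

text \<open>The Koszul complex on y_0, ..., y_{n-1}, x_n is the mapping cone of x_n on the complex
  of the y's. Exactness of the cone in degree i makes x_n surjective on the homology of the y's in
  degree i.\<close>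

lemma shear_surj_at:
  assumes k: "kexact (Suc n) I i j"
  shows "surj_at y n I i j"
  unfolding surj_at_def
proof (intro allI impI)
  fix z assume z: "chain n i (gform (Suc n) j) z" and bz: "\<forall>A. bd y n z A \<in> I"
  \<comment> \<open>The cycle z rewritten in the exterior basis belonging to x_0, ..., x_n; the
    contraction with a compensates the difference between y_b and x_b.\<close>
  let ?Z = "join n z (- bd kap n z)"
  have az: "avoids n z" "avoids n (- bd kap n z)"
    using chain_avoids[OF z] by (auto intro: avoids_uminus avoids_bd_intros)
  have Z: "chain (Suc n) i (gform (Suc n) j) ?Z"
  proof (cases i)
    case 0
    then show ?thesis using chain_join_0[of n "gform (Suc n) j" z] bd_chain_0[of n "gform (Suc n) j" z kap] z by simp
  next
    case (Suc i')
    have "chain n i' (gform (Suc n) j) (- bd kap n z)"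
      using kap_chain z Suc by (intro chain_uminus gform_uminus) auto
    then show ?thesis using z Suc by (auto intro: chain_join)
  qed
  have "bd Var (Suc n) ?Z = join n (bd Var n z + smul (Var n) (- bd kap n z)) (- bd Var n (- bd kap n z))"
    by (rule bd_join[OF az])
  also have "bd Var n z + smul (Var n) (- bd kap n z) = bd y n z"
    unfolding bd_Var_shear by (simp add: smul_simps)
  also have "- bd Var n (- bd kap n z) = - bd kap n (bd y n z)"
    unfolding bd_uminus bd_anticomm[of Var n kap] kap_bd_Var by simp
  finally have eq: "bd Var (Suc n) ?Z = join n (bd y n z) (- bd kap n (bd y n z))" .
  have "join n (bd y n z) (- bd kap n (bd y n z)) A \<in> I" for A
    using bz kap_bd_I[of "bd y n z"] hideal_uminus[OF I] by (auto simp: join_def)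
  then have "bd Var (Suc n) ?Z A \<in> I" for A unfolding eq .
  with k Z obtain W where W: "chain (Suc n) (Suc i) (gform (Suc n) (j - 1)) W" "\<And>A. ?Z A - bd Var (Suc n) W A \<in> I"
    unfolding kexact_def by blast
  let ?U = "lo n W" and ?V = "hi n W"
  note UV = chain_lo[OF W(1) gform_0] chain_hi[OF W(1) gform_0]
  note E = split_Koszul[OF W(1) az W(2)]
  let ?V' = "?V + bd kap n ?U"
  have "chain n i (gform (Suc n) (j - 1)) ?V'"
    using UV kap_chain by (intro chain_add gform_add) auto
  moreover have "bd y n ?V' A \<in> I" for A
  proof -
    have "bd y n ?V' = (- bd kap n z + bd Var n ?V) + bd kap n (z - (bd Var n ?U + smul (Var n) ?V))"
      unfolding bd_y_corrected by (simp add: bd_simps)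
    moreover have "(- bd kap n z + bd Var n ?V) A \<in> I" using E(2)[of A] by simp
    moreover have "bd kap n (z - (bd Var n ?U + smul (Var n) ?V)) A \<in> I"
      using E(1) by (intro kap_bd_I) simp
    ultimately show ?thesis using hidealD(3)[OF I] by simp
  qed
  moreover have "z A - Var n * ?V' A - bd y n ?U A \<in> I" for A
  proof -
    have "bd Var n ?U + smul (Var n) ?V = bd y n ?U + smul (Var n) ?V'"
      unfolding bd_Var_shear by (simp add: smul_simps)
    then have "z A - (bd y n ?U A + Var n * ?V' A) \<in> I" using E(1)[of A] by (simp add: smul_def)
    then show ?thesis by (simp add: algebra_simps)
  qed
  ultimately show "\<exists>b w. chain n i (gform (Suc n) (j - 1)) b \<and> chain n (Suc i) (gform (Suc n) (j - 1)) w \<and>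
        (\<forall>A. bd y n b A \<in> I) \<and> (\<forall>A. z A - Var n * b A - bd y n w A \<in> I)"
    using UV(1) by blast
qed

text \<open>The kernel of x_n on homology in degree i is the image of the homology of the cone in
  degree i + 1, which vanishes. A relation x_n z = \<partial>w modulo \<open>I\<close> is the cone
  cycle -w + e_n \<and> z, up to the change of basis.\<close>

lemma shear_inj_at:
  assumes k: "kexact (Suc n) I (Suc i) j"
  shows "inj_at y n I i j"
  unfolding inj_at_def
proof (intro allI impI)
  fix z w assume z: "chain n i (gform (Suc n) j) z" and bz: "\<forall>A. bd y n z A \<in> I"
    and w: "chain n (Suc i) (gform (Suc n) j) w" and zw: "\<forall>A. Var n * z A - bd y n w A \<in> I"
  let ?v = "z + bd kap n w"
  let ?Z = "join n (- w) ?v"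
  have v: "chain n i (gform (Suc n) j) ?v" using z kap_chain[OF w] by (intro chain_add gform_add) auto
  have mw: "chain n (Suc i) (gform (Suc n) j) (- w)" using w by (intro chain_uminus gform_uminus)
  have az: "avoids n (- w)" "avoids n ?v" using chain_avoids[OF v] chain_avoids[OF mw] by auto
  have Z: "chain (Suc n) (Suc i) (gform (Suc n) j) ?Z" using mw v by (rule chain_join)
  have zw': "(smul (Var n) z - bd y n w) A \<in> I" for A using zw by (simp add: smul_def)
  have "bd Var (Suc n) ?Z = join n (bd Var n (- w) + smul (Var n) ?v) (- bd Var n ?v)" by (rule bd_join[OF az])
  also have "bd Var n (- w) + smul (Var n) ?v = smul (Var n) z - bd y n w"
    unfolding bd_uminus bd_Var_shear smul_simps by simp
  also have "- bd Var n ?v = - bd y n z - bd kap n (smul (Var n) z - bd y n w)"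
    unfolding bd_add bd_anticomm[of Var n kap w] kap_bd_Var
    unfolding bd_Var_shear by (simp add: bd_simps)
  finally have eq: "bd Var (Suc n) ?Z = join n (smul (Var n) z - bd y n w)
      (- bd y n z - bd kap n (smul (Var n) z - bd y n w))" .
  have "(- bd y n z - bd kap n (smul (Var n) z - bd y n w)) A \<in> I" for A
    unfolding fun_diff_def fun_Compl_def
    using bz kap_bd_I[OF zw', unfolded fun_diff_def] by (intro hideal_minus[OF I] hideal_uminus[OF I]) auto
  then have "join n (smul (Var n) z - bd y n w) (- bd y n z - bd kap n (smul (Var n) z - bd y n w)) A \<in> I" for A
    unfolding join_def using zw' by presburger
  then have "bd Var (Suc n) ?Z A \<in> I" for A unfolding eq .
  with k Z obtain W where W: "chain (Suc n) (Suc (Suc i)) (gform (Suc n) (j - 1)) W" "\<And>A. ?Z A - bd Var (Suc n) W A \<in> I"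
    unfolding kexact_def by blast
  let ?U = "lo n W" and ?V = "hi n W"
  note UV = chain_lo[OF W(1) gform_0] chain_hi[OF W(1) gform_0]
  note E = split_Koszul[OF W(1) az W(2)]
  let ?V' = "?V + bd kap n ?U"
  have "chain n (Suc i) (gform (Suc n) (j - 1)) (- ?V')"
    using UV kap_chain by (intro chain_uminus chain_add gform_add gform_uminus) auto
  moreover have "z A - bd y n (- ?V') A \<in> I" for A
  proof -
    have eq: "z - bd y n (- ?V') = (z + bd kap n w + bd Var n ?V) + bd kap n (- w - (bd Var n ?U + smul (Var n) ?V))"
      unfolding bd_uminus[of y] bd_y_corrected by (simp add: bd_simps algebra_simps)
    have "z A - bd y n (- ?V') A = (z + bd kap n w + bd Var n ?V) A + bd kap n (- w - (bd Var n ?U + smul (Var n) ?V)) A"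
      using fun_cong[OF eq, of A] by (simp only: minus_apply plus_fun_apply)
    moreover have "(z + bd kap n w + bd Var n ?V) A \<in> I" using E(2)[of A] by simp
    moreover have "bd kap n (- w - (bd Var n ?U + smul (Var n) ?V)) A \<in> I"
      using E(1) by (intro kap_bd_I) simp
    ultimately show ?thesis using hidealD(3)[OF I] by (simp only:)
  qed
  ultimately show "\<exists>w. chain n (Suc i) (gform (Suc n) (j - 1)) w \<and> (\<forall>A. z A - bd y n w A \<in> I)" by blast
qed

end

section \<open>Transport of Koszul homology along the shear\<close>

lemma shear_n [simp]: "shear n a n = Var n" by (simp add: shear_def)

lemma subst_shear_cancel:
  "subst (shear n a) (subst (shear n (\<lambda>i. - a i)) f) = f" "subst (shear n (\<lambda>i. - a i)) (subst (shear n a) f) = f"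
  using subst_shear_inverse[of n a] subst_shear_inverse[of n "\<lambda>i. - a i"] by auto

lemma subst_shear_gform: "f \<in> gform (Suc n) d \<Longrightarrow> subst (shear n a) f \<in> gform (Suc n) d"
proof (cases "d < 0")
  case False
  assume f: "f \<in> gform (Suc n) d"
  obtain d' where d: "d = int d'" using False by (metis int_nat_eq linorder_not_less)
  show ?thesis using f subst_shear_hform[of f n d' a] unfolding d gform_hform by simp
qed (auto simp: gform_neg)

context
  fixes n :: nat and I :: "('k::field) mpol set" and a :: "nat \<Rightarrow> 'k" and I1 :: "'k mpol set"
  assumes I: "hideal (Suc n) I" and I1: "I1 = {f \<in> PV {..<Suc n}. subst (shear n a) f \<in> I}"
begin

private abbreviation (input) "S \<equiv> subst (shear n a)"
private abbreviation (input) "T \<equiv> subst (shear n (\<lambda>i. - a i))"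

lemma bd_S: "S (bd Var n z A) = bd (shear n a) n (\<lambda>A. S (z A)) A"
  using fun_cong[OF bd_rhom[OF rhom_subst, of "shear n a" Var n z], of A] by simp

lemma bd_T: "bd Var n (\<lambda>A. T (z A)) A = T (bd (shear n a) n z A)"
proof -
  have "T (shear n a b) = Var b" if "b < n" for b
    using that by (auto simp: shear_def const_uminus)
  then have "bd Var n (\<lambda>A. T (z A)) = bd (\<lambda>b. T (shear n a b)) n (\<lambda>A. T (z A))"
    by (intro bd_coeff_cong) simp
  then show ?thesis using fun_cong[OF bd_rhom[OF rhom_subst, of "shear n (\<lambda>i. - a i)" "shear n a" n z], of A] by simp
qed

lemma T_I: "f \<in> I \<Longrightarrow> T f \<in> I1"
  unfolding I1 using hidealD(1)[OF I] subst_shear_PV by (auto simp: subst_shear_cancel)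
lemma S_I: "f \<in> I1 \<Longrightarrow> S f \<in> I" by (simp add: I1)
lemma T_Var [simp]: "T (Var n) = Var n" "S (Var n) = Var n" by (auto simp: shear_def)

lemma chain_S: "chain n i (gform (Suc n) j) z \<Longrightarrow> chain n i (gform (Suc n) j) (\<lambda>A. subst (shear n c) (z A))"
  by (rule chain_map) (auto intro: subst_shear_gform)

lemma surj_at_transport:
  assumes "surj_at (shear n a) n I i j" shows "surj_at Var n I1 i j"
  unfolding surj_at_def
proof (intro allI impI)
  fix z assume z: "chain n i (gform (Suc n) j) z" "\<forall>A. bd Var n z A \<in> I1"
  have "\<forall>A. bd (shear n a) n (\<lambda>A. S (z A)) A \<in> I" using z(2) S_I by (simp flip: bd_S)
  with assms chain_S[OF z(1)] obtain b w where bw: "chain n i (gform (Suc n) (j - 1)) b"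
    "chain n (Suc i) (gform (Suc n) (j - 1)) w" "\<And>A. bd (shear n a) n b A \<in> I"
    "\<And>A. S (z A) - Var n * b A - bd (shear n a) n w A \<in> I" unfolding surj_at_def by meson
  have "z A - Var n * T (b A) - bd Var n (\<lambda>A. T (w A)) A \<in> I1" for A
    using T_I[OF bw(4)[of A]] by (simp add: bd_T subst_shear_cancel)
  moreover have "bd Var n (\<lambda>A. T (b A)) A \<in> I1" for A using T_I[OF bw(3)[of A]] by (simp add: bd_T)
  ultimately show "\<exists>b w. chain n i (gform (Suc n) (j - 1)) b \<and> chain n (Suc i) (gform (Suc n) (j - 1)) w \<and>
        (\<forall>A. bd Var n b A \<in> I1) \<and> (\<forall>A. z A - Var n * b A - bd Var n w A \<in> I1)"
    using chain_S[OF bw(1)] chain_S[OF bw(2)] by blast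
qed

lemma inj_at_transport:
  assumes "inj_at (shear n a) n I i j" shows "inj_at Var n I1 i j"
  unfolding inj_at_def
proof (intro allI impI)
  fix z w assume z: "chain n i (gform (Suc n) j) z" "\<forall>A. bd Var n z A \<in> I1"
    and w: "chain n (Suc i) (gform (Suc n) j) w" "\<forall>A. Var n * z A - bd Var n w A \<in> I1"
  have 1: "\<forall>A. bd (shear n a) n (\<lambda>A. S (z A)) A \<in> I" using z(2) S_I by (simp flip: bd_S)
  have "S (Var n * z A - bd Var n w A) = Var n * S (z A) - bd (shear n a) n (\<lambda>A. S (w A)) A" for A
    by (simp add: bd_S)
  then have 2: "\<forall>A. Var n * S (z A) - bd (shear n a) n (\<lambda>A. S (w A)) A \<in> I" using w(2) S_I by metis
  from assms[unfolded inj_at_def, rule_format, OF chain_S[OF z(1)] 1[rule_format] chain_S[OF w(1)] 2[rule_format]]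
  obtain v where v: "chain n (Suc i) (gform (Suc n) (j - 1)) v" "\<And>A. S (z A) - bd (shear n a) n v A \<in> I" by blast
  have "z A - bd Var n (\<lambda>A. T (v A)) A \<in> I1" for A
    using T_I[OF v(2)[of A]] by (simp add: bd_T subst_shear_cancel)
  then show "\<exists>w. chain n (Suc i) (gform (Suc n) (j - 1)) w \<and> (\<forall>A. z A - bd Var n w A \<in> I1)"
    using chain_S[OF v(1)] by blast
qed

end

section \<open>Coefficients of powers of the last variable in Koszul chains\<close>

lemma xc_Var_mult: "b \<noteq> n \<Longrightarrow> xc n d (Var b * p) = Var b * xc n d p"
proof (induction p rule: mpol_induct)
  case (single m c)
  assume b: "b \<noteq> n"
  have xs: "xc n d (single m c) = (if lookup m n = d then single (m - single n d) c else 0)" for m and c :: 'a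
  proof (rule poly_mapping_eqI)
    fix m'
    show "lookup (xc n d (single m c)) m' = lookup (if lookup m n = d then single (m - single n d) c else 0) m'"
      using minus_single_eq_iff'[of m n d m'] by (auto simp: lookup_xc lookup_single when_def lookup_add)
  qed
  have "Var b * single m c = single (single b 1 + m) c" by (simp add: Var_def mult_single)
  moreover have "lookup (single b 1 + m) n = lookup m n" using b by (simp add: lookup_add lookup_single)
  moreover have "single b 1 + m - single n d = single b 1 + (m - single n d)" if "lookup m n = d"
    using that b by (intro poly_mapping_eqI) (auto simp: lookup_add lookup_minus lookup_single when_def)
  ultimately show ?case by (simp add: xs) (simp add: Var_def mult_single)
qed (auto simp: distrib_left)

lemma xc_bd: "xc n d (bd Var n z A) = bd Var n (\<lambda>A. xc n d (z A)) A"
proof -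
  have "k \<le> n \<Longrightarrow> xc n d (bd Var k z A) = bd Var k (\<lambda>A. xc n d (z A)) A" for k
  proof (induction k arbitrary: z A)
    case (Suc k)
    have l: "lo k (\<lambda>A. xc n d (z A)) = (\<lambda>A. xc n d (lo k z A))" "hi k (\<lambda>A. xc n d (z A)) = (\<lambda>A. xc n d (hi k z A))"
      by (auto simp: lo_def hi_def)
    show ?case using Suc by (auto simp: bd.simps l join_def smul_def xc_Var_mult)
  qed (simp add: bd.simps)
  then show ?thesis by simp
qed

lemma xc_Var_power_shift: "xc n (M + d) (Var n ^ M * f) = xc n d (f :: 'a::field mpol)"
proof (rule poly_mapping_eqI)
  fix m
  have *: "lookup (single a 1 * p) (a + b) = lookup p b" for a b and p :: "'a mpol"
  proof (induction p rule: mpol_induct)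
    case (single m c)
    then show ?case by (simp add: mult_single lookup_single when_def)
  qed (auto simp: distrib_left lookup_add)
  have "m + single n (M + d) = single n M + (m + single n d)" by (simp add: single_add add_ac)
  then show "lookup (xc n (M + d) (Var n ^ M * f)) m = lookup (xc n d f) m"
    by (simp add: lookup_xc Var_power *)
qed

lemma xc_gform: "f \<in> gform (Suc n) j \<Longrightarrow> xc n d f \<in> gform n (j - int d)"
  unfolding gform_def using xc_PV[of f n d]
  by (fastforce simp: keys_xc mdeg_add)

lemma vdeg_gform: "f \<in> gform (Suc n) (int j) \<Longrightarrow> vdeg n f \<le> j"
  unfolding gform_hform by (auto simp: hform_def intro: vdeg_homog)

lemma gform_mono: "f \<in> gform n j \<Longrightarrow> f \<in> gform (Suc n) j"
  using PV_mono[of f "{..<n}" "{..<Suc n}"] by (auto simp: gform_def)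

lemma chain_gform_mono: "chain n i (gform n j) z \<Longrightarrow> chain n i (gform (Suc n) j) z"
  by (rule chain_mono) (auto intro: gform_mono)

lemma chain_xc: "chain n i (gform (Suc n) j) z \<Longrightarrow> chain n i (gform n (j - int d)) (\<lambda>A. xc n d (z A))"
  by (rule chain_map) (auto intro: xc_gform)

lemma chain_Var_power: "chain n i (gform (Suc n) j) z \<Longrightarrow> chain n i (gform (Suc n) (j + int d)) (smul (Var n ^ d) z)"
proof (rule chain_smul)
  fix x :: "'a mpol" assume "x \<in> gform (Suc n) j"
  moreover have "Var n ^ d \<in> gform (Suc n) (int d)"
    unfolding gform_hform by (auto simp: hform_def homog_Var_power intro: PV_power)
  ultimately show "Var n ^ d * x \<in> gform (Suc n) (j + int d)" using gform_mult by (metis add.commute)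
qed

lemma vdeg_bd:
  assumes "\<And>A. vdeg n (z A) \<le> D" shows "vdeg n (bd Var n z A) \<le> D"
proof -
  have "bd Var n z A \<in> {f. vdeg n f \<le> D}"
  proof (rule bd_closed[where U = "{f. vdeg n f \<le> D}"])
    fix b and x :: "'a mpol" assume b: "b < n" "x \<in> {f. vdeg n f \<le> D}"
    show "Var b * x \<in> {f. vdeg n f \<le> D}"
      using b unfolding vdeg_le_iff mem_Collect_eq keys_Var_mult
      by (auto simp: lookup_add lookup_single)
  qed (use assms vdeg_add vdeg_le_iff[of n 0 D] in \<open>auto simp: vdeg_uminus\<close>)
  then show ?thesis by simp
qed

text \<open>A form of positive degree lies in the ideal of the variables, so it is a Koszul boundary
  before any reduction modulo \<open>I\<close>.\<close>

lemma kexact_0: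
  fixes I :: "('k::field) mpol set"
  assumes "j \<ge> 1" "hideal N I" shows "kexact N I 0 j"
  unfolding kexact_def
proof (intro allI impI)
  fix z :: "nat set \<Rightarrow> 'k mpol" assume z: "chain N 0 (gform N j) z"
  have "keys m \<inter> {..<N} \<noteq> {}" if "m \<in> keys (z {})" for m
  proof -
    have "z {} \<in> gform N j" using z by (simp add: chain_def)
    then have "keys m \<subseteq> {..<N}" "int (mdeg m) = j" using that by (auto simp: gform_def PV_def)
    moreover from this have "keys m \<noteq> {}" using assms(1) by (auto simp: mdeg_def)
    ultimately show ?thesis by blast
  qed
  then obtain w where w: "chain N 1 (gform N (j - 1)) w" "bd Var N w = (\<lambda>A. if A = {} then z {} else 0)"
    using in_span_Var[of "z {}" N j N] z by (auto simp: chain_def)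
  then have "z A - bd Var N w A = 0" for A using chain_0D[OF z] by auto
  then show "\<exists>w. chain N (Suc 0) (gform N (j - 1)) w \<and> (\<forall>A. z A - bd Var N w A \<in> I)"
    using w(1) hidealD(2)[OF assms(2)] by auto
qed

section \<open>Koszul homology of a linear quotient and lifting into the ideal\<close>

context elimination
begin

lemma finC: "finite C" using C finite_subset by blast

text \<open>Substitution for part of the indices in \<open>C\<close> only, so that the linear
  equations can be divided out one at a time.\<close>

definition \<tau> :: "nat set \<Rightarrow> 'k mpol \<Rightarrow> 'k mpol" where
  "\<tau> C' = subst (\<lambda>a. if a \<in> C' then \<sigma> a else Var a)"

lemma \<tau>_simps [simp]: "\<tau> C' (a + b) = \<tau> C' a + \<tau> C' b" "\<tau> C' (a - b) = \<tau> C' a - \<tau> C' b" "\<tau> C' (a * b) = \<tau> C' a * \<tau> C' b"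
  "\<tau> C' 0 = 0" "\<tau> C' (- a) = - \<tau> C' a" "\<tau> C' (Var i) = (if i \<in> C' then \<sigma> i else Var i)"
  by (simp_all add: \<tau>_def)

lemma \<tau>_full: "\<tau> C = subst \<sigma>"
proof -
  have "(\<lambda>a. if a \<in> C then \<sigma> a else Var a) = \<sigma>" using \<sigma>_notC by auto
  then show ?thesis by (simp add: \<tau>_def)
qed

lemma \<tau>_empty: "\<tau> {} f = f" unfolding \<tau>_def by (rule subst_id[of f UNIV]) auto

lemma \<tau>_fix: "C' \<subseteq> C \<Longrightarrow> f \<in> PV ({..<n} - C) \<Longrightarrow> \<tau> C' f = f"
  unfolding \<tau>_def by (rule subst_id) auto

lemma \<tau>_idem: "C' \<subseteq> C \<Longrightarrow> \<tau> C' (\<tau> C' f) = \<tau> C' f"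
proof -
  assume C': "C' \<subseteq> C"
  have "subst (\<lambda>a. if a \<in> C' then \<sigma> a else Var a) (if i \<in> C' then \<sigma> i else Var i) = (if i \<in> C' then \<sigma> i else Var i)" for i
    using \<tau>_fix[OF C' \<sigma>_C[of i]] C' by (auto simp: \<tau>_def)
  then show ?thesis unfolding \<tau>_def subst_subst by simp
qed

lemma \<tau>_PV: "C' \<subseteq> C \<Longrightarrow> f \<in> PV {..<n} \<Longrightarrow> \<tau> C' f \<in> PV {..<n}"
  unfolding \<tau>_def using \<sigma>_C by (intro subst_in_PV) (auto intro: PV_mono)

lemma \<tau>_gform: "C' \<subseteq> C \<Longrightarrow> f \<in> gform n j \<Longrightarrow> \<tau> C' f \<in> gform n j"
proof (cases "j < 0")
  case False
  assume C': "C' \<subseteq> C" and f: "f \<in> gform n j"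
  have f': "f \<in> hform n (nat j)" using f False by (simp flip: gform_hform)
  have "homog (nat j) (\<tau> C' f)" unfolding \<tau>_def
    using f' \<sigma>_homog by (intro homog_subst[of _ f "{..<n}"]) (auto simp: hform_def)
  then have "\<tau> C' f \<in> hform n (nat j)" using f' \<tau>_PV[OF C'] by (auto simp: hform_def)
  then show ?thesis using False by (simp flip: gform_hform)
qed (auto simp: gform_neg)

abbreviation l where "l c \<equiv> Var c - \<sigma> c"

lemma l_gform: "c \<in> C \<Longrightarrow> l c \<in> gform n 1"
proof -
  assume c: "c \<in> C"
  have "l c \<in> hform n 1"
    using c C \<sigma>_C[OF c] \<sigma>_homog[of c] PV_mono[of "\<sigma> c" "{..<n} - C" "{..<n}"]
    by (auto simp: hform_def intro!: PV_minus homog_minus)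
  then show ?thesis by (simp flip: gform_hform)
qed

lemma l_nonzero: "c \<in> C \<Longrightarrow> l c \<noteq> 0"
proof
  assume c: "c \<in> C" "l c = 0"
  have "Var c = \<sigma> c" using c(2) by simp
  then have "(Var c :: 'k mpol) \<in> PV ({..<n} - C)" using \<sigma>_C[of c] c(1) by metis
  then show False using c(1) by (auto simp: PV_def Var_def)
qed

lemma \<tau>_l: "C' \<subseteq> C \<Longrightarrow> c \<in> C \<Longrightarrow> c \<notin> C' \<Longrightarrow> \<tau> C' (l c) = l c"
  using \<tau>_fix[OF _ \<sigma>_C] by simp

lemma \<tau>_insert:
  assumes C': "C' \<subseteq> C" and c: "c \<in> C" "c \<notin> C'"
  shows "\<tau> (insert c C') f = \<tau> {c} (\<tau> C' f)"
proof -
  have "subst (\<lambda>a. if a \<in> {c} then \<sigma> a else Var a) (if i \<in> C' then \<sigma> i else Var i) = (if i \<in> insert c C' then \<sigma> i else Var i)" for i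
    using \<tau>_fix[of "{c}" "\<sigma> i"] \<sigma>_C[of i] C' c by (auto simp: \<tau>_def)
  then show ?thesis unfolding \<tau>_def subst_subst by simp
qed

text \<open>The difference f - \<tau> f is divisible by \<open>l c\<close>: this holds for variables
  and propagates to products because the difference is a twisted derivation. So the kernel of the
  substitution is generated by \<open>l c\<close>.\<close>

lemma \<tau>_single_divides:
  assumes c: "c \<in> C" and f: "f \<in> gform n j" "\<tau> {c} f = 0"
  shows "\<exists>h\<in>gform n (j - 1). f = l c * h"
proof -
  have "\<exists>h\<in>PV {..<n}. f - \<tau> {c} f = l c * h" if "f \<in> PV {..<n}" for f
    using that
  proof (induction rule: PV_induct)
    case (const d)
    then show ?case by (intro bexI[of _ 0]) (auto simp: \<tau>_def)
  next
    case (Var i)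
    show ?case
    proof (cases "i = c")
      case True
      then show ?thesis by (intro bexI[of _ 1]) auto
    qed (intro bexI[of _ 0], auto)
  next
    case (add p q)
    then obtain h h' where "h \<in> PV {..<n}" "p - \<tau> {c} p = l c * h" "h' \<in> PV {..<n}" "q - \<tau> {c} q = l c * h'" by blast
    moreover have "p + q - \<tau> {c} (p + q) = (p - \<tau> {c} p) + (q - \<tau> {c} q)" by simp
    ultimately show ?case by (intro bexI[of _ "h + h'"]) (auto simp: distrib_left intro: PV_add)
  next
    case (mult p q)
    then obtain h h' where h: "h \<in> PV {..<n}" "p - \<tau> {c} p = l c * h" "h' \<in> PV {..<n}" "q - \<tau> {c} q = l c * h'" by blast
    have "p * q - \<tau> {c} (p * q) = (p - \<tau> {c} p) * q + \<tau> {c} p * (q - \<tau> {c} q)" by (simp add: algebra_simps)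
    also have "\<dots> = l c * (h * q + \<tau> {c} p * h')" unfolding h by (simp add: algebra_simps)
    finally show ?case using h mult.hyps \<tau>_PV[of "{c}" p] c
      by (intro bexI[of _ "h * q + \<tau> {c} p * h'"]) (auto intro!: PV_add PV_mult)
  qed
  from this[OF gform_PV[OF f(1)]] obtain h where h: "h \<in> PV {..<n}" "f = l c * h" unfolding f(2) diff_0_right ..
  have "f = gpart j f" using gpart_gform[OF f(1)] by simp
  also have "\<dots> = l c * gpart (j - 1) h" using gpart_mult_left[OF l_gform[OF c], of j h] h(2) by simp
  finally show ?thesis using gpart_in_gform[OF h(1)] by blast
qed

text \<open>After the substitution for \<open>C'\<close>, f becomes a multiple of the one further
  equation \<open>l c\<close>. The last clause makes h vanish where f does, so that choices made for
  each index set form a chain.\<close>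

lemma \<tau>_split:
  assumes C': "C' \<subseteq> C" and c: "c \<in> C" "c \<notin> C'" and f: "f \<in> gform n j" "\<tau> (insert c C') f = 0"
  shows "\<exists>h\<in>gform n (j - 1). \<tau> C' (f - l c * h) = 0 \<and> (\<tau> C' f = 0 \<longrightarrow> h = 0)"
proof (cases "\<tau> C' f = 0")
  case True
  then show ?thesis by (intro bexI[of _ 0]) auto
next
  case False
  have "\<tau> {c} (\<tau> C' f) = 0" using f(2) \<tau>_insert[OF C' c] by simp
  from \<tau>_single_divides[OF c(1) \<tau>_gform[OF C' f(1)] this]
  obtain h where h: "h \<in> gform n (j - 1)" "\<tau> C' f = l c * h" by blast
  have "l c * \<tau> C' h = l c * h"
  proof -
    have "\<tau> C' (l c * h) = l c * h" using \<tau>_idem[OF C', of f] unfolding h(2) .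
    then show ?thesis unfolding \<tau>_simps(3) \<tau>_l[OF C' c] .
  qed
  then have "\<tau> C' (f - l c * h) = 0" using h(2) \<tau>_l[OF C' c] by (simp only: \<tau>_simps(2,3)) simp
  then show ?thesis using h(1) False by blast
qed

lemma \<tau>_bd_closed:
  assumes "\<And>A. \<tau> C' (z A) = 0" shows "\<tau> C' (bd c n z A) = 0"
proof -
  have "bd c n z A \<in> {f. \<tau> C' f = 0}" by (rule bd_closed[where U = "{f. \<tau> C' f = 0}"]) (use assms in auto)
  then show ?thesis by simp
qed

text \<open>Modulo independent linear forms the ring is again polynomial, and its Koszul homology
  relative to all n variables is the exterior algebra on the forms, concentrated in coefficient
  degree 0; hence the condition j \<ge> 1. Each induction step divides out one form, a
  nonzerodivisor modulo the others.\<close>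

lemma linear_koszul:
  assumes "finite C'" "C' \<subseteq> C"
  shows "chain n i (gform n j) z \<Longrightarrow> j \<ge> 1 \<Longrightarrow> (\<And>A. \<tau> C' (bd Var n z A) = 0) \<Longrightarrow>
    \<exists>w. chain n (Suc i) (gform n (j - 1)) w \<and> (\<forall>A. \<tau> C' (z A - bd Var n w A) = 0)"
  using assms
proof (induction C' arbitrary: i j z rule: finite_induct)
  case empty
  then have b: "bd Var n z = 0" by (simp add: \<tau>_empty fun_eq_iff)
  show ?case
  proof (cases i)
    case 0
    have "kexact n {0 :: 'k mpol} 0 j" by (rule kexact_0[OF empty(2) hideal_0])
    moreover have "\<forall>A. bd Var n z A \<in> {0}" by (simp add: b)
    ultimately obtain w where "chain n (Suc 0) (gform n (j - 1)) w" "\<forall>A. z A - bd Var n w A \<in> {0}"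
      using empty(1) unfolding kexact_def 0 by meson
    then show ?thesis by (auto simp: \<tau>_empty 0)
  next
    case (Suc i')
    then show ?thesis using koszul_exact[of n i' n j z] empty(1) b by (auto simp: \<tau>_empty)
  qed
next
  case (insert c C')
  have C': "C' \<subseteq> C" "c \<in> C" "c \<notin> C'" using insert.prems insert.hyps by auto
  note split = \<tau>_split[OF C']
  show ?case
  proof (cases i)
    case 0
    then have "bd Var n z = 0" using bd_chain_0 insert.prems(1) gform_0 by blast
    then obtain w where w: "chain n (Suc i) (gform n (j - 1)) w" "\<forall>A. \<tau> C' (z A - bd Var n w A) = 0"
      using insert.IH[OF insert.prems(1,2)] C' by auto
    then have "\<tau> (insert c C') (z A - bd Var n w A) = 0" for A unfolding \<tau>_insert[OF C'] by simp
    then show ?thesis using w(1) by blast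
  next
    case (Suc i')
    let ?g = "bd Var n z"
    have g: "chain n i' (gform n (j + 1)) ?g"
      using insert.prems(1) Suc by (intro chain_bd_gform) (auto intro: gform_Var)
    have "\<exists>h\<in>gform n j. \<tau> C' (?g A - l c * h) = 0 \<and> (?g A = 0 \<longrightarrow> h = 0)" for A
    proof -
      have "?g A \<in> gform n (j + 1)" using g by (simp add: chain_def)
      from split[OF this insert.prems(3)] obtain h where
        h: "h \<in> gform n (j + 1 - 1)" "\<tau> C' (?g A - l c * h) = 0 \<and> (\<tau> C' (?g A) = 0 \<longrightarrow> h = 0)" ..
      have "?g A = 0 \<Longrightarrow> \<tau> C' (?g A) = 0" by (simp only: \<tau>_simps(4))
      then show ?thesis using h unfolding add_diff_cancel_right' by blast
    qed
    then obtain h where h: "\<And>A. h A \<in> gform n j" "\<And>A. \<tau> C' (?g A - l c * h A) = 0" "\<And>A. ?g A = 0 \<Longrightarrow> h A = 0"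
      by metis
    have hc: "chain n i' (gform n j) h" using g h unfolding chain_iff by blast
    have "\<tau> C' (bd Var n (\<lambda>A. ?g A - l c * h A) A) = 0" for A using h(2) by (rule \<tau>_bd_closed)
    moreover have "(\<lambda>A. ?g A - l c * h A) = ?g - smul (l c) h" by (simp add: smul_def fun_eq_iff)
    moreover have "bd Var n (?g - smul (l c) h) = - smul (l c) (bd Var n h)"
      unfolding bd_minus bd_bd bd_smul by simp
    ultimately have "\<tau> C' ((- smul (l c) (bd Var n h)) A) = 0" for A by metis
    \<comment> \<open>\<open>l c\<close> is nonzero and fixed by \<open>\<tau> C'\<close>, so it
      cancels. Hence h is itself a cycle modulo the smaller ideal, and subtracting
      \<open>l c\<close> times a chain bounding it makes z a cycle there as well.\<close>
    then have "l c * \<tau> C' (bd Var n h A) = 0" for A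
      unfolding smul_def uminus_apply \<tau>_simps(3,5) \<tau>_l[OF C'] neg_equal_0_iff_equal .
    then have "\<tau> C' (bd Var n h A) = 0" for A using l_nonzero[OF C'(2)] by simp
    from insert.IH[OF hc insert.prems(2) this C'(1)] obtain w1 where
      w1: "chain n (Suc i') (gform n (j - 1)) w1" "\<And>A. \<tau> C' (h A - bd Var n w1 A) = 0" by blast
    let ?z2 = "z - smul (l c) w1"
    have z2: "chain n i (gform n j) ?z2"
    proof (intro chain_minus insert.prems(1) gform_minus chain_smul[of n i "gform n (j - 1)"])
      show "chain n i (gform n (j - 1)) w1" using w1 Suc by simp
      show "x \<in> gform n (j - 1) \<Longrightarrow> l c * x \<in> gform n j" for x
        using gform_mult[OF l_gform[OF C'(2)], of x "j - 1"] by simp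
    qed
    have "\<tau> C' (bd Var n ?z2 A) = 0" for A
    proof -
      have "bd Var n ?z2 A = (?g A - l c * h A) + l c * (h A - bd Var n w1 A)"
        unfolding bd_minus bd_smul by (simp add: smul_def algebra_simps)
      then show ?thesis using h(2)[of A] w1(2)[of A] by (simp only: \<tau>_simps(1,3)) simp
    qed
    from insert.IH[OF z2 insert.prems(2) this C'(1)] obtain w where
      w: "chain n (Suc i) (gform n (j - 1)) w" "\<And>A. \<tau> C' (?z2 A - bd Var n w A) = 0" by blast
    have "\<tau> (insert c C') (z A - bd Var n w A) = 0" for A
    proof -
      have "z A - bd Var n w A = (?z2 A - bd Var n w A) + l c * w1 A" by (simp add: smul_def)
      then have "\<tau> C' (z A - bd Var n w A) = l c * \<tau> C' (w1 A)"
        using w(2)[of A] \<tau>_l[OF C'] by (simp only: \<tau>_simps(1,3)) simp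
      moreover have "\<tau> {c} (l c) = 0" using \<tau>_fix[of "{c}" "\<sigma> c"] \<sigma>_C[OF C'(2)] C'(2) by simp
      ultimately show ?thesis unfolding \<tau>_insert[OF C'] by (simp only: \<tau>_simps(3)) simp
    qed
    then show ?thesis using w(1) by blast
  qed
qed

text \<open>Multiplying the quadric x_n l_c + Q_c by x_n^D h gives the leading coefficient l_c h. So
  each form in the ideal of the l_c is a leading coefficient of an element of \<open>I\<close>, for
  every positive power of x_n.\<close>

lemma lift_top:
  assumes "finite C'" "C' \<subseteq> C"
  shows "f \<in> gform n j \<Longrightarrow> \<tau> C' f = 0 \<Longrightarrow>
    \<exists>g\<in>I \<inter> gform (Suc n) (j + int (Suc D)). vdeg n g \<le> Suc D \<and> xc n (Suc D) g = f"
  using assms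
proof (induction C' arbitrary: f rule: finite_induct)
  case empty
  then show ?case using hidealD(2)[OF hid] by (intro bexI[of _ 0]) (auto simp: \<tau>_empty vdeg_le_iff)
next
  case (insert c C')
  have C': "C' \<subseteq> C" "c \<in> C" "c \<notin> C'" using insert.prems insert.hyps by auto
  obtain h where h: "h \<in> gform n (j - 1)" "\<tau> C' (f - l c * h) = 0"
    using \<tau>_split[OF C' insert.prems(1,2)] by blast
  have lh: "l c * h \<in> gform n j" using gform_mult[OF l_gform[OF C'(2)] h(1)] by simp
  from insert.IH[OF gform_minus[OF insert.prems(1) lh] h(2) C'(1)] obtain g where
    g: "g \<in> I \<inter> gform (Suc n) (j + int (Suc D))" "vdeg n g \<le> Suc D" "xc n (Suc D) g = f - l c * h" by blast
  obtain G where G: "G \<in> I \<inter> hform (Suc n) 2" "vdeg n G \<le> 1" "xc n 1 G = l c" using quad[OF C'(2)] by blast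
  have gh2: "(gform (Suc n) 2 :: 'k mpol set) = hform (Suc n) 2" using gform_hform[of "Suc n" 2] by simp
  have GR: "G \<in> PV {..<Suc n}" "G \<in> gform (Suc n) 2" using G(1) unfolding gh2 by (auto simp: hform_def)
  have hR: "h \<in> PV {..<n}" using gform_PV h(1) by blast
  have x0: "h * xc n 0 G \<in> PV {..<n}" using hR xc_PV[OF GR(1)] by (rule PV_mult)
  have lhR: "h * l c \<in> PV {..<n}" using lh gform_PV by (simp add: mult.commute)
  let ?t = "Var n ^ D * h * G"
  have "?t = Var n ^ D * (h * xc n 0 G) + Var n ^ Suc D * (h * l c)"
  proof -
    have "G = xc n 0 G + Var n * xc n 1 G" using xc_expand[OF GR(1) G(2)] by simp
    then have "?t = Var n ^ D * h * (xc n 0 G + Var n * l c)" using G(3) by simp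
    then show ?thesis by (simp add: algebra_simps)
  qed
  then have t: "vdeg n ?t \<le> Suc D" "xc n (Suc D) ?t = h * l c"
    using vdeg_add[OF order_trans[OF vdeg_Var_power_mult[OF x0, of D]] vdeg_Var_power_mult[OF lhR, of "Suc D"]]
    by (simp_all add: xc_Var_power_mult[OF x0] xc_Var_power_mult[OF lhR] del: power_Suc)
  have VR: "Var n ^ D * h \<in> PV {..<Suc n}" using PV_mono[OF hR, of "{..<Suc n}"] by (auto intro!: PV_mult PV_power)
  have "Var n ^ D \<in> gform (Suc n) (int D)"
    unfolding gform_hform by (auto simp: hform_def homog_Var_power intro: PV_power)
  from gform_mult[OF gform_mult[OF this gform_mono[OF h(1)]] GR(2)]
  have "?t \<in> gform (Suc n) (j + int (Suc D))" by (simp add: algebra_simps)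
  moreover have "?t \<in> I" using hidealD(4)[OF hid VR] G(1) by blast
  ultimately have "g + ?t \<in> I \<inter> gform (Suc n) (j + int (Suc D))"
    using g(1) hidealD(3)[OF hid] gform_add by blast
  moreover have "xc n (Suc D) (g + ?t) = f" unfolding xc_add g(3) t(2) by (simp add: mult.commute)
  ultimately show ?case using vdeg_add[OF g(2) t(1)] by blast
qed

section \<open>Descent of exactness to the elimination ideal\<close>

text \<open>The coefficient of the top power of x_n is a cycle modulo the linear forms, and D < j
  makes its coefficient degree positive. By \<open>linear_koszul\<close> it is a boundary up to the
  ideal of the linear forms; the boundary is lifted by a power of x_n, the rest through
  \<open>lift_top\<close>. Subtracting both lowers the degree in x_n.\<close>

lemma reduce_to_small_ring:
  assumes "chain n i (gform (Suc n) j) z" "\<And>A. vdeg n (z A) \<le> D" "int D < j"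
    "\<And>A. \<exists>s\<in>PV {..<n}. bd Var n z A - s \<in> I"
  shows "\<exists>v s. chain n (Suc i) (gform (Suc n) (j - 1)) v \<and> (\<forall>A. vdeg n (v A) \<le> D) \<and>
    chain n i (gform n j) s \<and> (\<forall>A. z A - bd Var n v A - s A \<in> I)"
  using assms
proof (induction D arbitrary: z)
  case 0
  have "z A \<in> gform n j" for A
    using 0(1) 0(2)[of A] vdeg_0_imp_PV[of "z A" n] by (auto simp: chain_def gform_def)
  then have "chain n i (gform n j) z" using 0(1) by (auto simp: chain_def)
  moreover have "bd Var n 0 A = (0 :: 'k mpol)" for A by (simp add: bd_zero)
  ultimately show ?case using hidealD(2)[OF hid] chain_zero[OF gform_0] vdeg_le_iff[of n 0 0]
    unfolding zero_fun_def by (intro exI[of _ "\<lambda>_. 0"] exI[of _ z]) auto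
next
  case (Suc D)
  let ?m = "j - int (Suc D)"
  let ?t = "\<lambda>A. xc n (Suc D) (z A)"
  have t: "chain n i (gform n ?m) ?t" by (rule chain_xc[OF Suc.prems(1)])
  have zj: "bd Var n z A \<in> gform (Suc n) (j + 1)" for A
  proof (cases i)
    case 0
    then have "bd Var n z = 0" using bd_chain_0[OF _ gform_0] Suc.prems(1) by blast
    then show ?thesis by simp
  next
    case (Suc i')
    have "chain n i' (gform (Suc n) (j + 1)) (bd Var n z)"
      using Suc.prems(1) Suc by (intro chain_bd_gform) (auto intro: gform_Var)
    then show ?thesis by (simp add: chain_def)
  qed
  have "subst \<sigma> (bd Var n ?t A) = 0" for A
  proof -
    obtain s where s: "s \<in> PV {..<n}" "bd Var n z A - s \<in> I" using Suc.prems(4) by blast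
    \<comment> \<open>\<open>top\<close> needs a homogeneous element of \<open>I\<close>, so only
      the component of \<open>s\<close> in the degree of the boundary is subtracted. It is free of
      x_n and leaves the top coefficient unchanged.\<close>
    let ?g = "bd Var n z A - gpart (j + 1) s"
    have "gpart (j + 1) (bd Var n z A - s) = ?g" using gpart_gform[OF zj[of A]] by (simp add: gpart_minus)
    then have gI: "?g \<in> I" using hideal_gpart[OF hid s(2), of "j + 1"] by simp
    have sn: "gpart (j + 1) s \<in> PV {..<n}" using gpart_in_gform[OF s(1)] gform_PV by blast
    have "?g \<in> gform (Suc n) (j + 1)" using zj gform_mono[OF gpart_in_gform[OF s(1)]] by (rule gform_minus)
    then have "homog (nat (j + 1)) ?g" by (auto simp: gform_def homog_def)
    moreover have "vdeg n ?g \<le> Suc D"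
      using vdeg_minus[OF vdeg_bd[of n z "Suc D"]] Suc.prems(2) vdeg_PV[OF sn] by simp
    ultimately have "subst \<sigma> (xc n (Suc D) ?g) = 0" using gI Suc.prems(3) by (intro top) auto
    then show ?thesis by (simp add: xc_of_PV[OF sn] xc_bd)
  qed
  then have "\<tau> C (bd Var n ?t A) = 0" for A by (simp add: \<tau>_full)
  from linear_koszul[OF finC order_refl t _ this] Suc.prems(3) obtain v0 where
    v0: "chain n (Suc i) (gform n (?m - 1)) v0" "\<And>A. \<tau> C (?t A - bd Var n v0 A) = 0" by auto
  let ?r = "?t - bd Var n v0"
  have r: "chain n i (gform n ?m) ?r"
    using t v0(1) by (intro chain_minus gform_minus chain_bd_gform) (auto intro: gform_Var)
  have "\<exists>g. g \<in> I \<and> g \<in> gform (Suc n) j \<and> vdeg n g \<le> Suc D \<and> xc n (Suc D) g = ?r A \<and> (?r A = 0 \<longrightarrow> g = 0)" for A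
  proof (cases "?r A = 0")
    case True
    then show ?thesis using hidealD(2)[OF hid] by (intro exI[of _ 0]) (auto simp: vdeg_le_iff)
  next
    case False
    have "?r A \<in> gform n ?m" using r by (simp add: chain_def)
    from lift_top[OF finC order_refl this, of D] v0(2)[of A] False show ?thesis by auto
  qed
  then obtain g where g: "\<And>A. g A \<in> I \<and> g A \<in> gform (Suc n) j \<and> vdeg n (g A) \<le> Suc D \<and> xc n (Suc D) (g A) = ?r A \<and> (?r A = 0 \<longrightarrow> g A = 0)"
    by metis
  have gc: "chain n i (gform (Suc n) j) g" using r g unfolding chain_iff by blast
  let ?V = "smul (Var n ^ Suc D) v0"
  have V: "chain n (Suc i) (gform (Suc n) (j - 1)) ?V"
    using chain_Var_power[OF chain_gform_mono[OF v0(1)], of "Suc D"] by simp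
  have v0R: "v0 A \<in> PV {..<n}" for A using chain_PV[OF v0(1)] .
  have bVR: "bd Var n v0 A \<in> PV {..<n}" for A
    by (rule bd_closed[where U = "PV {..<n}"]) (use v0R in \<open>auto intro: PV_intros\<close>)
  let ?z1 = "z - bd Var n ?V - g"
  have z1: "chain n i (gform (Suc n) j) ?z1"
    using Suc.prems(1) V gc by (intro chain_minus gform_minus chain_bd_gform) (auto intro: gform_Var)
  have z1v: "vdeg n (?z1 A) \<le> D" for A
  proof -
    have bV: "bd Var n ?V A = Var n ^ Suc D * bd Var n v0 A" by (simp add: bd_smul_apply)
    have "vdeg n (?z1 A) \<le> Suc D"
      using Suc.prems(2) g vdeg_Var_power_mult[OF bVR, of "Suc D"] by (simp add: bV vdeg_minus del: power_Suc)
    moreover have "xc n (Suc D) (?z1 A) = 0"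
      using g[of A] by (simp add: bV xc_Var_power_mult[OF bVR] del: power_Suc)
    ultimately show ?thesis using vdeg_less[of n "?z1 A" "Suc D"] by simp
  qed
  have "\<exists>s\<in>PV {..<n}. bd Var n ?z1 A - s \<in> I" for A
  proof -
    obtain s where s: "s \<in> PV {..<n}" "bd Var n z A - s \<in> I" using Suc.prems(4) by blast
    have "bd Var n g A \<in> I" using g by (intro hideal_bd[OF hid]) auto
    then have "(bd Var n z A - s) - bd Var n g A \<in> I" using s(2) hideal_minus[OF hid] by blast
    moreover have "bd Var n ?z1 A - s = (bd Var n z A - s) - bd Var n g A"
      unfolding bd_minus bd_bd by simp
    ultimately have "bd Var n ?z1 A - s \<in> I" by (simp only:)
    then show ?thesis using s(1) by blast
  qed
  from Suc.IH[OF z1 z1v _ this] Suc.prems(3) obtain v s where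
    vs: "chain n (Suc i) (gform (Suc n) (j - 1)) v" "\<And>A. vdeg n (v A) \<le> D" "chain n i (gform n j) s"
    "\<And>A. ?z1 A - bd Var n v A - s A \<in> I" by auto
  have "chain n (Suc i) (gform (Suc n) (j - 1)) (?V + v)" using V vs(1) by (intro chain_add gform_add)
  moreover have "vdeg n ((?V + v) A) \<le> Suc D" for A
    using vdeg_add[OF vdeg_Var_power_mult[OF v0R, of "Suc D" A] le_SucI[OF vs(2)]] by (simp add: smul_def)
  moreover have "z A - bd Var n (?V + v) A - s A \<in> I" for A
  proof -
    have "z A - bd Var n (?V + v) A - s A = (?z1 A - bd Var n v A - s A) + g A"
      by (simp add: bd_add)
    also have "\<dots> \<in> I" by (rule hidealD(3)[OF hid]) (use vs(4) g in blast)+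
    finally show ?thesis .
  qed
  ultimately show ?case using vs(3) by blast
qed

lemma hideal_small: "hideal n (I \<inter> PV {..<n})"
proof -
  have "f \<in> PV {..<Suc n}" if "f \<in> PV {..<n}" for f :: "'k mpol" using PV_mono[OF that] by auto
  then show ?thesis
    unfolding hideal_def using hidealD[OF hid] by (auto intro: PV_intros PV_hom_part)
qed

lemma small_I: "f \<in> PV {..<n} \<Longrightarrow> g \<in> PV {..<n} \<Longrightarrow> f - g \<in> I \<Longrightarrow> f - g \<in> I \<inter> PV {..<n}"
  by (auto intro: PV_minus)

lemma bd_small: "chain n i (gform n j) z \<Longrightarrow> bd Var n z A \<in> PV {..<n}"
  by (rule bd_closed[where U = "PV {..<n}"]) (auto intro: PV_intros dest: chain_PV)

text \<open>The chain \<open>w\<close> has constant coefficients, the case that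
  \<open>linear_koszul\<close> excludes. The chain x_n^{J+1} w is completed by terms of lower
  x_n-degree to a cycle modulo \<open>I\<close>; what obstructs this is a cycle over the smaller
  ring in coefficient degree J + 2, where exactness is assumed.\<close>

lemma lift_symbol:
  assumes w: "chain n (Suc i) (gform n 0) w" "\<And>A. \<tau> C (bd Var n w A) = 0"
    and k: "kexact n (I \<inter> PV {..<n}) i (int (Suc (Suc J)))"
  shows "\<exists>c. chain n (Suc i) (gform (Suc n) (int (Suc J))) c \<and> (\<forall>A. bd Var n c A \<in> I) \<and> (\<forall>A. xc n (Suc J) (c A) = w A)"
proof -
  let ?l = "bd Var n w"
  have l: "chain n i (gform n 1) ?l" using w(1) by (intro chain_bd_gform) (auto intro: gform_Var)
  have "\<exists>g. g \<in> I \<and> g \<in> gform (Suc n) (int (Suc (Suc J))) \<and> vdeg n g \<le> Suc J \<and> xc n (Suc J) g = ?l A \<and> (?l A = 0 \<longrightarrow> g = 0)" for A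
  proof (cases "?l A = 0")
    case True
    then show ?thesis using hidealD(2)[OF hid] by (intro exI[of _ 0]) (auto simp: vdeg_le_iff)
  next
    case False
    have "?l A \<in> gform n 1" using l by (simp add: chain_def)
    from lift_top[OF finC order_refl this w(2), of J] False show ?thesis by (auto simp: algebra_simps)
  qed
  then obtain g where g: "\<And>A. g A \<in> I \<and> g A \<in> gform (Suc n) (int (Suc (Suc J))) \<and> vdeg n (g A) \<le> Suc J \<and>
    xc n (Suc J) (g A) = ?l A \<and> (?l A = 0 \<longrightarrow> g A = 0)" by metis
  have gc: "chain n i (gform (Suc n) (int (Suc (Suc J)))) g" using l g unfolding chain_iff by blast
  let ?W = "smul (Var n ^ Suc J) w"
  have W: "chain n (Suc i) (gform (Suc n) (int (Suc J))) ?W"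
    using chain_Var_power[OF chain_gform_mono[OF w(1)], of "Suc J"] by simp
  have wR: "w A \<in> PV {..<n}" and lR: "?l A \<in> PV {..<n}" for A using chain_PV[OF w(1)] chain_PV[OF l] by auto
  let ?r = "g - bd Var n ?W"
  have bW: "bd Var n ?W A = Var n ^ Suc J * ?l A" for A by (simp add: bd_smul_apply)
  have r: "chain n i (gform (Suc n) (int (Suc (Suc J)))) ?r"
    using gc W by (intro chain_minus gform_minus chain_bd_gform) (auto intro: gform_Var)
  have rv: "vdeg n (?r A) \<le> J" for A
  proof -
    have "vdeg n (?r A) \<le> Suc J" using g vdeg_Var_power_mult[OF lR, of "Suc J"] by (simp add: bW vdeg_minus del: power_Suc)
    moreover have "xc n (Suc J) (?r A) = 0" using g[of A] by (simp add: bW xc_Var_power_mult[OF lR] del: power_Suc)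
    ultimately show ?thesis using vdeg_less[of n "?r A" "Suc J"] by simp
  qed
  have br: "bd Var n ?r A \<in> I" for A
    using hideal_bd[OF hid, of n Var g A] g by (simp add: bd_minus bd_bd)
  then have "\<exists>s\<in>PV {..<n}. bd Var n ?r A - s \<in> I" for A by (intro bexI[of _ 0]) auto
  from reduce_to_small_ring[OF r rv _ this] obtain v s where
    vs: "chain n (Suc i) (gform (Suc n) (int (Suc J))) v" "\<And>A. vdeg n (v A) \<le> J" "chain n i (gform n (int (Suc (Suc J)))) s"
    "\<And>A. ?r A - bd Var n v A - s A \<in> I" by auto
  have "bd Var n (?r - bd Var n v - s) A \<in> I" for A using vs(4) by (intro hideal_bd[OF hid]) auto
  then have "bd Var n ?r A - bd Var n s A \<in> I" for A by (simp add: bd_minus[of _ _ _ s] bd_minus[of _ _ _ "bd Var n v"] bd_bd)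
  then have "bd Var n s A \<in> I \<inter> PV {..<n}" for A
    using hideal_minus[OF hid br[of A], of "bd Var n ?r A - bd Var n s A"] bd_small[OF vs(3)] by simp
  then obtain v' where v': "chain n (Suc i) (gform n (int (Suc (Suc J)) - 1)) v'" "\<And>A. s A - bd Var n v' A \<in> I \<inter> PV {..<n}"
    using k vs(3) unfolding kexact_def by blast
  then have v'c: "chain n (Suc i) (gform n (int (Suc J))) v'" by simp
  let ?c = "?W + v + v'"
  have "chain n (Suc i) (gform (Suc n) (int (Suc J))) ?c"
    using W vs(1) chain_gform_mono[OF v'c] by (intro chain_add gform_add)
  moreover have "bd Var n ?c A \<in> I" for A
  proof -
    have "bd Var n ?c A = g A - (?r A - bd Var n v A - s A) - (s A - bd Var n v' A)" by (simp add: bd_add)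
    also have "\<dots> \<in> I"
      by (rule hideal_minus[OF hid hideal_minus[OF hid]]) (use g vs(4) v'(2) in blast)+
    finally show ?thesis .
  qed
  moreover have "xc n (Suc J) (?c A) = w A" for A
    using xc_eq_0[of n "v A" "Suc J"] vs(2)[of A] xc_of_PV[OF chain_PV[OF v'c], of "Suc J" A]
    by (simp add: smul_def xc_Var_power_mult[OF wR] del: power_Suc)
  ultimately show ?thesis by blast
qed

text \<open>Surjectivity of x_n applied M times. It is assumed for targets of degree at least 2, so
  the quotient cycle may end up in coefficient degree 1.\<close>

lemma divide_by_Var:
  assumes "\<And>j. j \<ge> 2 \<Longrightarrow> surj_at Var n I i j"
  shows "chain n i (gform (Suc n) (int (Suc d + M))) c \<Longrightarrow> (\<And>A. bd Var n c A \<in> I) \<Longrightarrow>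
    \<exists>c' b. chain n i (gform (Suc n) (int (Suc d))) c' \<and> (\<forall>A. bd Var n c' A \<in> I) \<and>
      chain n (Suc i) (gform (Suc n) (int (d + M))) b \<and> (\<forall>A. c A - Var n ^ M * c' A - bd Var n b A \<in> I)"
proof (induction M arbitrary: c)
  case 0
  have "bd Var n 0 A = (0 :: 'k mpol)" for A by (simp add: bd_zero)
  then show ?case using 0 hidealD(2)[OF hid] chain_zero[OF gform_0]
    unfolding zero_fun_def by (intro exI[of _ c] exI[of _ "\<lambda>_. 0"]) auto
next
  case (Suc M)
  have "surj_at Var n I i (int (Suc d + Suc M))" by (rule assms) simp
  from this[unfolded surj_at_def, rule_format, OF Suc.prems] obtain c1 b1 where
    1: "chain n i (gform (Suc n) (int (Suc d + M))) c1" "chain n (Suc i) (gform (Suc n) (int (Suc d + M))) b1"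
    "\<And>A. bd Var n c1 A \<in> I" "\<And>A. c A - Var n * c1 A - bd Var n b1 A \<in> I" by auto
  from Suc.IH[OF 1(1,3)] obtain c' b where
    2: "chain n i (gform (Suc n) (int (Suc d))) c'" "\<And>A. bd Var n c' A \<in> I"
      "chain n (Suc i) (gform (Suc n) (int (d + M))) b" "\<And>A. c1 A - Var n ^ M * c' A - bd Var n b A \<in> I" by blast
  let ?b = "b1 + smul (Var n ^ 1) b"
  have "chain n (Suc i) (gform (Suc n) (int (d + Suc M))) ?b"
    using 1(2) chain_Var_power[OF 2(3), of 1] by (intro chain_add gform_add) (auto simp: algebra_simps)
  moreover have "c A - Var n ^ Suc M * c' A - bd Var n ?b A \<in> I" for A
  proof -
    have "c A - Var n ^ Suc M * c' A - bd Var n ?b A =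
        (c A - Var n * c1 A - bd Var n b1 A) + Var n * (c1 A - Var n ^ M * c' A - bd Var n b A)"
      unfolding bd_add plus_fun_apply bd_smul_apply by (simp add: algebra_simps)
    also have "\<dots> \<in> I" using 1(4) hidealD(4)[OF hid _ 2(4), of "Var n"] by (intro hidealD(3)[OF hid]) simp_all
    finally show ?thesis .
  qed
  ultimately show ?case using 2(1,2) by blast
qed

text \<open>Over the larger ring a cycle z becomes a boundary: x_n^m z reduces to the smaller ring
  in a degree where exactness is known, and injectivity cancels the power. To free the bounding
  chain from x_n, its constant symbol at x_n^{j-1} is removed by subtracting a cycle with the same
  symbol, and the rest reduces to the smaller ring.\<close>

theorem elimination_kexact:
  assumes inj: "\<And>j. j \<ge> 2 \<Longrightarrow> inj_at Var n I i j" and surj: "\<And>j. j \<ge> 2 \<Longrightarrow> surj_at Var n I (Suc i) j"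
    and fin: "\<exists>J. \<forall>j\<ge>J. kexact n (I \<inter> PV {..<n}) i j" and j: "j \<ge> 2"
  shows "kexact n (I \<inter> PV {..<n}) i (int j)"
  unfolding kexact_def
proof (intro allI impI)
  obtain J0 where J0: "\<And>j. j \<ge> J0 \<Longrightarrow> kexact n (I \<inter> PV {..<n}) i j" using fin by blast
  fix z assume z: "chain n i (gform n (int j)) z" and bz: "\<forall>A. bd Var n z A \<in> I \<inter> PV {..<n}"
  note zN = chain_gform_mono[OF z]
  have zR: "z A \<in> PV {..<n}" for A by (rule chain_PV[OF z])
  have VR: "Var n ^ m \<in> PV {..<Suc n}" for m by (auto intro: PV_power)
  have bVz: "bd Var n (smul (Var n ^ m) z) A \<in> I" for m A
    using bz hidealD(4)[OF hid VR] by (simp add: bd_smul_apply)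
  \<comment> \<open>This exponent makes j + m \<ge> J0, also when J0 is negative.\<close>
  define m where "m = nat J0"
  have "\<exists>w. chain n (Suc i) (gform (Suc n) (int (j + m) - 1)) w \<and> (\<forall>A. Var n ^ m * z A - bd Var n w A \<in> I)"
  proof -
    have c: "chain n i (gform (Suc n) (int (j + m))) (smul (Var n ^ m) z)"
      using chain_Var_power[OF zN, of m] by simp
    have v: "vdeg n (smul (Var n ^ m) z A) \<le> m" for A
      using vdeg_Var_power_mult[OF zR] by (simp add: smul_def)
    have "\<exists>s\<in>PV {..<n}. bd Var n (smul (Var n ^ m) z) A - s \<in> I" for A
      using bVz by (intro bexI[of _ 0]) auto
    from reduce_to_small_ring[OF c v _ this] j obtain v s where
      vs: "chain n (Suc i) (gform (Suc n) (int (j + m) - 1)) v" "chain n i (gform n (int (j + m))) s"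
      "\<And>A. smul (Var n ^ m) z A - bd Var n v A - s A \<in> I" by auto
    have "bd Var n (smul (Var n ^ m) z - bd Var n v - s) A \<in> I" for A
      using vs(3) by (intro hideal_bd[OF hid]) auto
    then have "bd Var n (smul (Var n ^ m) z) A - bd Var n s A \<in> I" for A
      by (simp add: bd_minus[of _ _ _ s] bd_minus[of _ _ _ "bd Var n v"] bd_bd)
    then have "bd Var n s A \<in> I \<inter> PV {..<n}" for A
      using hideal_minus[OF hid bVz[of m A], of "bd Var n (smul (Var n ^ m) z) A - bd Var n s A"] bd_small[OF vs(2)] by simp
    moreover have "kexact n (I \<inter> PV {..<n}) i (int (j + m))" by (rule J0) (simp add: m_def)
    ultimately obtain v' where v': "chain n (Suc i) (gform n (int (j + m) - 1)) v'" "\<And>A. s A - bd Var n v' A \<in> I \<inter> PV {..<n}"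
      using vs(2) unfolding kexact_def by blast
    have "chain n (Suc i) (gform (Suc n) (int (j + m) - 1)) (v + v')"
      using vs(1) chain_gform_mono[OF v'(1)] by (intro chain_add gform_add)
    moreover have "Var n ^ m * z A - bd Var n (v + v') A \<in> I" for A
    proof -
      have "Var n ^ m * z A - bd Var n (v + v') A = (smul (Var n ^ m) z A - bd Var n v A - s A) + (s A - bd Var n v' A)"
        by (simp add: bd_add smul_def)
      also have "\<dots> \<in> I" using vs(3) v'(2) by (intro hidealD(3)[OF hid]) blast+
      finally show ?thesis .
    qed
    ultimately show ?thesis by blast
  qed
  \<comment> \<open>Factors x_n are cancelled one at a time; each use of injectivity is in
    coefficient degree at least j, hence at least 2.\<close>
  moreover have "(\<exists>w. chain n (Suc i) (gform (Suc n) (int (j + m) - 1)) w \<and> (\<forall>A. Var n ^ m * z A - bd Var n w A \<in> I)) \<Longrightarrow>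
    \<exists>w. chain n (Suc i) (gform (Suc n) (int j - 1)) w \<and> (\<forall>A. z A - bd Var n w A \<in> I)" for m
  proof (induction m)
    case (Suc m)
    then obtain w where w: "chain n (Suc i) (gform (Suc n) (int (j + m))) w"
      "\<And>A. Var n * (Var n ^ m * z A) - bd Var n w A \<in> I" by (auto simp: mult.assoc)
    have "inj_at Var n I i (int (j + m))" using j by (intro inj) auto
    moreover have "chain n i (gform (Suc n) (int (j + m))) (smul (Var n ^ m) z)"
      using chain_Var_power[OF zN, of m] by simp
    ultimately have "\<exists>w. chain n (Suc i) (gform (Suc n) (int (j + m) - 1)) w \<and> (\<forall>A. smul (Var n ^ m) z A - bd Var n w A \<in> I)"
      using bVz w unfolding inj_at_def by (simp add: smul_def)
    then show ?case using Suc.IH by (simp add: smul_def)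
  qed simp
  ultimately obtain w where w: "chain n (Suc i) (gform (Suc n) (int j - 1)) w" "\<And>A. z A - bd Var n w A \<in> I" by blast
  define d where "d = j - 2"
  have d: "j = Suc (Suc d)" using j by (simp add: d_def)
  have wc: "chain n (Suc i) (gform (Suc n) (int (Suc d))) w" using w(1) d by simp
  \<comment> \<open>The coefficients of \<open>w\<close> have degree d + 1 = j - 1, so the
    coefficient of x_n^{d+1} is constant: this is the symbol.\<close>
  let ?w = "\<lambda>A. xc n (Suc d) (w A)"
  have om: "chain n (Suc i) (gform n 0) ?w" using chain_xc[OF wc, of "Suc d"] by simp
  have wv: "vdeg n (w A) \<le> Suc d" for A using wc vdeg_gform unfolding chain_def by blast
  have "\<tau> C (bd Var n ?w A) = 0" for A
  proof -
    let ?g = "z A - bd Var n w A"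
    have "chain n i (gform (Suc n) (int j)) (z - bd Var n w)"
      using zN w(1) by (intro chain_minus gform_minus chain_bd_gform) (auto intro: gform_Var)
    then have "?g \<in> gform (Suc n) (int j)" by (simp add: chain_def)
    then have "homog j ?g" unfolding gform_hform by (simp add: hform_def)
    moreover have "vdeg n ?g \<le> Suc d" using vdeg_bd[OF wv] vdeg_PV[OF zR] by (intro vdeg_minus) auto
    ultimately have "subst \<sigma> (xc n (Suc d) ?g) = 0" using w(2) d by (intro top) auto
    then show ?thesis by (simp add: \<tau>_full xc_of_PV[OF zR] xc_bd)
  qed
  \<comment> \<open>The symbol is lifted at x_n^{d+1+M}, with M large enough for exactness, and the
    resulting cycle is then divided by x_n^M.\<close>
  moreover define M where "M = nat J0"
  have "kexact n (I \<inter> PV {..<n}) i (int (Suc (Suc (d + M))))" by (rule J0) (simp add: M_def)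
  ultimately obtain c where c: "chain n (Suc i) (gform (Suc n) (int (Suc (d + M)))) c" "\<And>A. bd Var n c A \<in> I"
    "\<And>A. xc n (Suc (d + M)) (c A) = ?w A" using lift_symbol[OF om] by blast
  from divide_by_Var[OF surj, of d M c] c obtain c' b where
    c': "chain n (Suc i) (gform (Suc n) (int (Suc d))) c'" "\<And>A. bd Var n c' A \<in> I"
      "chain n (Suc (Suc i)) (gform (Suc n) (int (d + M))) b" "\<And>A. c A - Var n ^ M * c' A - bd Var n b A \<in> I" by auto
  \<comment> \<open>Dividing by x_n^M keeps the symbol. The discrepancy \<open>?g\<close> lies in
    \<open>I\<close>, and its top coefficient is a constant killed by \<open>\<sigma>\<close>, hence
    zero; the boundary of b has x_n-degree at most d + M and does not reach the power in
    question.\<close>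
  have xw: "xc n (Suc d) (c' A) = ?w A" for A
  proof -
    let ?g = "c A - Var n ^ M * c' A - bd Var n b A"
    have "chain n (Suc i) (gform (Suc n) (int (Suc (d + M)))) (c - smul (Var n ^ M) c' - bd Var n b)"
    proof (intro chain_minus gform_minus c(1) chain_bd_gform)
      show "chain n (Suc i) (gform (Suc n) (int (Suc (d + M)))) (smul (Var n ^ M) c')"
        using chain_Var_power[OF c'(1), of M] by (simp add: algebra_simps)
    qed (use c'(3) in \<open>auto intro: gform_Var\<close>)
    then have "(c - smul (Var n ^ M) c' - bd Var n b) A \<in> gform (Suc n) (int (Suc (d + M)))" unfolding chain_def by blast
    then have gh: "?g \<in> hform (Suc n) (Suc (d + M))" unfolding gform_hform by (simp add: smul_def)
    then have "subst \<sigma> (xc n (Suc (d + M)) ?g) = 0"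
      using c'(4)[of A] vdeg_homog[of "Suc (d + M)" ?g n] by (intro top) (auto simp: hform_def)
    moreover have "homog 0 (xc n (Suc (d + M)) ?g)" using xc_hform[OF gh, of "Suc (d + M)"] by (simp add: hform_def)
    then have "xc n (Suc (d + M)) ?g = const (lookup (xc n (Suc (d + M)) ?g) 0)" by (rule homog_0_const)
    ultimately have "xc n (Suc (d + M)) ?g = 0" by (metis const_eq_0 const_0 subst_const)
    moreover have "xc n (Suc (d + M)) (Var n ^ M * c' A) = xc n (Suc d) (c' A)"
      using xc_Var_power_shift[of n M "Suc d" "c' A"] by (simp add: add.commute)
    moreover have "xc n (Suc (d + M)) (bd Var n b A) = 0"
    proof (rule xc_eq_0)
      have "vdeg n (b A) \<le> d + M" for A using c'(3) vdeg_gform unfolding chain_def by blast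
      from vdeg_bd[OF this] show "vdeg n (bd Var n b A) < Suc (d + M)" by (simp add: less_Suc_eq_le)
    qed
    ultimately show ?thesis using c(3)[of A] by simp
  qed
  \<comment> \<open>\<open>c'\<close> is a cycle modulo \<open>I\<close>, so \<open>?u\<close> still
    bounds z; the symbols cancel, so its x_n-degree is at most d, as
    \<open>reduce_to_small_ring\<close> requires.\<close>
  let ?u = "w - c'"
  have u: "chain n (Suc i) (gform (Suc n) (int (Suc d))) ?u" using wc c'(1) by (intro chain_minus gform_minus)
  have uv: "vdeg n (?u A) \<le> d" for A
  proof -
    have "vdeg n (?u A) \<le> Suc d" using u vdeg_gform unfolding chain_def by blast
    moreover have "xc n (Suc d) (?u A) = 0" by (simp add: xw)
    ultimately show ?thesis using vdeg_less[of n "?u A" "Suc d"] by simp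
  qed
  have buI: "bd Var n ?u A - z A \<in> I" for A
  proof -
    have "bd Var n ?u A - z A = - (z A - bd Var n w A) - bd Var n c' A" by (simp add: bd_minus)
    also have "\<dots> \<in> I" by (rule hideal_minus[OF hid hideal_uminus[OF hid]]) (use w(2) c'(2) in blast)+
    finally show ?thesis .
  qed
  then have "\<exists>s\<in>PV {..<n}. bd Var n ?u A - s \<in> I" for A using zR by blast
  from reduce_to_small_ring[OF u uv _ this] obtain v s where
    vs: "chain n (Suc i) (gform n (int (Suc d))) s" "\<And>A. ?u A - bd Var n v A - s A \<in> I" by auto
  have "bd Var n (?u - bd Var n v - s) A \<in> I" for A using vs(2) by (intro hideal_bd[OF hid]) auto
  then have bs: "bd Var n ?u A - bd Var n s A \<in> I" for A
    by (simp add: bd_minus[of _ _ _ s] bd_minus[of _ _ _ "bd Var n v"] bd_bd)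
  have "z A - bd Var n s A \<in> I" for A
    using hideal_minus[OF hid bs[of A] buI[of A]] by simp
  then have "z A - bd Var n s A \<in> I \<inter> PV {..<n}" for A
    using small_I[OF zR bd_small[OF vs(1)]] by blast
  then show "\<exists>w. chain n (Suc i) (gform n (int j - 1)) w \<and> (\<forall>A. z A - bd Var n w A \<in> I \<inter> PV {..<n})"
    using vs(1) d by auto
qed

end

section \<open>Algebraic independence and chains of primes\<close>

text \<open>Bounding each exponent instead of the degree makes the number of monomials an exact
  power.\<close>

definition box :: "nat set \<Rightarrow> nat \<Rightarrow> (nat \<Rightarrow>\<^sub>0 nat) set" where
  "box A K = {m. keys m \<subseteq> A \<and> (\<forall>i. lookup m i \<le> K)}"

lemma finite_card_box:
  assumes "finite A" shows "finite (box A K) \<and> card (box A K) = (K + 1) ^ card A"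
  using assms
proof (induction A rule: finite_induct)
  case empty
  have "box {} K = {0}" by (auto simp: box_def)
  then show ?case by simp
next
  case (insert a A)
  let ?h = "\<lambda>(m, k). m + single a k"
  have la: "lookup m a = 0" if "m \<in> box A K" for m
    using that insert.hyps(2) by (auto simp: box_def in_keys_iff)
  have inj: "inj_on ?h (box A K \<times> {..K})"
  proof (rule inj_onI)
    fix x y assume xy: "x \<in> box A K \<times> {..K}" "y \<in> box A K \<times> {..K}" "?h x = ?h y"
    obtain m k m' k' where e: "x = (m, k)" "y = (m', k')" by (cases x; cases y)
    have eq: "m + single a k = m' + single a k'" using xy(3) e by simp
    from arg_cong[OF eq, of "\<lambda>x. lookup x a"] have "k = k'" using la xy e by (simp add: lookup_add)
    then show "x = y" using eq e by simp
  qed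
  have "box (insert a A) K = ?h ` (box A K \<times> {..K})"
  proof (intro equalityI subsetI)
    fix m assume m: "m \<in> box (insert a A) K"
    have e: "m = (m - single a (lookup m a)) + single a (lookup m a)"
      by (rule poly_mapping_eqI) (auto simp: lookup_add lookup_minus lookup_single when_def)
    have "lookup (m - single a (lookup m a)) i = (if i = a then 0 else lookup m i)" for i
      by (simp add: lookup_minus lookup_single when_def)
    then have "m - single a (lookup m a) \<in> box A K"
      using m unfolding box_def by (auto simp: in_keys_iff subset_iff split: if_splits)
    moreover have "lookup m a \<le> K" using m by (simp add: box_def)
    ultimately show "m \<in> ?h ` (box A K \<times> {..K})"
      by (intro image_eqI[of _ _ "(m - single a (lookup m a), lookup m a)"]) (use e in auto)
  next
    fix x assume "x \<in> ?h ` (box A K \<times> {..K})"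
    then obtain m k where x: "x = m + single a k" "m \<in> box A K" "k \<le> K" by auto
    have "keys x \<subseteq> insert a A"
      using Poly_Mapping.keys_add[of m "single a k"] x by (auto simp: box_def split: if_splits)
    moreover have "lookup x i \<le> K" for i
      using x la[OF x(2)] by (cases "i = a") (auto simp: lookup_add lookup_single box_def)
    ultimately show "x \<in> box (insert a A) K" by (simp add: box_def)
  qed
  then show ?case using inj insert by (simp add: card_image card_cartesian_product)
qed

lemma keys_subset_span:
  "{p :: 'k::field mpol. keys p \<subseteq> M} \<subseteq> mpol.span ((\<lambda>m. single m 1) ` M)"
proof
  fix f :: "'k mpol" assume f: "f \<in> {p. keys p \<subseteq> M}"
  have "(\<Sum>m\<in>keys f. cmul (lookup f m) (single m 1)) \<in> mpol.span ((\<lambda>m. single m (1::'k)) ` M)"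
    using f by (intro mpol.span_sum mpol.span_scale mpol.span_base) auto
  moreover have "f = (\<Sum>m\<in>keys f. cmul (lookup f m) (single m 1))"
    by (subst mpol_sum) (simp add: cmul_def const_def mult_single)
  ultimately show "f \<in> mpol.span ((\<lambda>m. single m (1::'k)) ` M)" by simp
qed

lemma subspace_keys: "mpol.subspace {p :: 'k::field mpol. keys p \<subseteq> M}"
proof (rule mpol.subspaceI)
  fix x y :: "'k mpol" and c assume "x \<in> {p. keys p \<subseteq> M}" "y \<in> {p. keys p \<subseteq> M}"
  then show "x + y \<in> {p. keys p \<subseteq> M}" using Poly_Mapping.keys_add[of x y] by blast
next
  fix x :: "'k mpol" and c assume "x \<in> {p. keys p \<subseteq> M}"
  then show "cmul c x \<in> {p. keys p \<subseteq> M}" by (auto simp: cmul_def in_keys_iff subset_iff)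
qed simp

lemma dim_keys:
  assumes "finite M" shows "mpol.dim {p :: 'k::field mpol. keys p \<subseteq> M} = card M"
proof (rule mpol.dim_unique[OF _ keys_subset_span])
  let ?s = "\<lambda>m. single m (1::'k)"
  show "?s ` M \<subseteq> {p. keys p \<subseteq> M}" by auto
  show "\<not> mpol.dependent (?s ` M)"
    unfolding mpol.dependent_def
  proof
    assume "\<exists>a\<in>?s ` M. a \<in> mpol.span (?s ` M - {a})"
    then obtain m where m: "m \<in> M" "?s m \<in> mpol.span (?s ` M - {?s m})" by blast
    have "mpol.span (?s ` M - {?s m}) \<subseteq> {p. lookup p m = 0}"
    proof (rule mpol.span_minimal)
      show "?s ` M - {?s m} \<subseteq> {p. lookup p m = 0}" by (auto simp: lookup_single when_def)
      show "mpol.subspace {p :: 'k mpol. lookup p m = 0}"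
        by (rule mpol.subspaceI) (auto simp: lookup_add cmul_def)
    qed
    then have "lookup (?s m) m = 0" using m(2) by blast
    then show False by simp
  qed
  have "inj_on ?s M"
  proof (rule inj_onI)
    fix x y assume "?s x = ?s y"
    from arg_cong[OF this, of keys] show "x = y" by simp
  qed
  then show "card (?s ` M) = card M" by (rule card_image)
qed

lemma vdeg_mult: "vdeg i (p * q) \<le> vdeg i p + vdeg i q"
  unfolding vdeg_le_iff
proof
  fix m assume "m \<in> keys (p * q)"
  then obtain a b where "m = a + b" "a \<in> keys p" "b \<in> keys q" using Poly_Mapping.keys_mult[of p q] by blast
  moreover from this have "lookup a i \<le> vdeg i p" "lookup b i \<le> vdeg i q"
    using vdeg_le_iff[of i p "vdeg i p"] vdeg_le_iff[of i q "vdeg i q"] by auto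
  ultimately show "lookup m i \<le> vdeg i p + vdeg i q" by (simp add: lookup_add)
qed

lemma vdeg_one [simp]: "vdeg i 1 = 0"
  using vdeg_le_iff[of i 1 0] by simp

lemma vdeg_power_le: "vdeg i p \<le> D \<Longrightarrow> vdeg i (p ^ k) \<le> k * D"
proof (induction k)
  case (Suc k)
  then show ?case using vdeg_mult[of i p "p ^ k"] by (simp add: add_mono order_trans)
qed simp

lemma vdeg_prod_le: "finite A \<Longrightarrow> (\<And>x. x \<in> A \<Longrightarrow> vdeg i (f x) \<le> D) \<Longrightarrow> vdeg i (prod f A) \<le> card A * D"
proof (induction A rule: finite_induct)
  case (insert a A)
  have "vdeg i (f a) \<le> D" "vdeg i (prod f A) \<le> card A * D" using insert by auto
  moreover have "vdeg i (f a * prod f A) \<le> vdeg i (f a) + vdeg i (prod f A)" by (rule vdeg_mult)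
  ultimately show ?case using insert.hyps by simp
qed simp

lemma vdeg_sum: "(\<And>x. x \<in> A \<Longrightarrow> vdeg i (f x) \<le> D) \<Longrightarrow> vdeg i (sum f A) \<le> D"
  by (induction A rule: infinite_finite_induct) (auto intro: vdeg_add simp: vdeg_le_iff[of i 0])

text \<open>Counting: the monomials in the g_b with exponents at most K are linearly independent, (K
  + 1)^|B| in number, and lie in a space of dimension (c K + 1)^N. If |B| > N, this fails for large
  K.\<close>

lemma indep_card_le:
  fixes g :: "nat \<Rightarrow> 'k::field mpol"
  assumes B: "finite B" and g: "\<And>b. b \<in> B \<Longrightarrow> g b \<in> PV {..<N}" and ind: "indep_mod {0} B g"
  shows "card B \<le> N"
proof (rule ccontr)
  assume "\<not> ?thesis"
  then have cB: "Suc N \<le> card B" by simp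
  define E where "E = (\<Sum>b\<in>B. \<Sum>i<N. vdeg i (g b))"
  have E: "vdeg i (g b) \<le> E" if "b \<in> B" "i < N" for b i
    unfolding E_def using that B
    by (intro order_trans[OF member_le_sum[of i "{..<N}" "\<lambda>i. vdeg i (g b)"] member_le_sum[of b B "\<lambda>b. \<Sum>i<N. vdeg i (g b)"]]) auto
  define c where "c = card B * E"
  \<comment> \<open>This K makes ((c + 1) (K + 1))^N equal to K (K + 1)^N, which is smaller than (K
    + 1)^(N+1).\<close>
  define K where "K = (c + 1) ^ N"
  let ?M = "box B K" and ?M' = "box {..<N} (c * K)"
  let ?V = "{p :: 'k mpol. keys p \<subseteq> ?M}" and ?W = "{p :: 'k mpol. keys p \<subseteq> ?M'}"
  note M = finite_card_box[OF B, of K] and M' = finite_card_box[of "{..<N}" "c * K", simplified]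
  have lin: "Vector_Spaces.linear cmul cmul (subst g)"
    by unfold_locales (auto simp: cmul_def)
  have mon: "mon g m \<in> ?W" if m: "m \<in> ?M" for m
  proof -
    have km: "keys m \<subseteq> B" and lm: "\<And>b. lookup m b \<le> K" using m by (auto simp: box_def)
    have PVm: "mon g m \<in> PV {..<N}" unfolding mon_def using km g by (intro PV_prod PV_power) auto
    have v: "vdeg i (mon g m) \<le> c * K" if i: "i < N" for i
    proof -
      have "vdeg i (g b ^ lookup m b) \<le> K * E" if "b \<in> keys m" for b
        using vdeg_power_le[OF E[of b i], of "lookup m b"] lm[of b] km i that
        by (meson mult_le_mono1 order_trans subsetD)
      then have "vdeg i (mon g m) \<le> card (keys m) * (K * E)"
        unfolding mon_def by (intro vdeg_prod_le) auto
      also have "\<dots> \<le> card B * (K * E)" using card_mono[OF B km] by (rule mult_le_mono1)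
      finally show ?thesis by (simp add: c_def mult_ac)
    qed
    have "m' \<in> ?M'" if m': "m' \<in> keys (mon g m)" for m'
    proof -
      have k: "keys m' \<subseteq> {..<N}" using PVm m' by (auto simp: PV_def)
      have "lookup m' i \<le> c * K" for i
      proof (cases "i < N")
        case True
        then show ?thesis using v[OF True] m' unfolding vdeg_le_iff by blast
      next
        case False
        then have "i \<notin> keys m'" using k by auto
        then show ?thesis by (simp add: in_keys_iff)
      qed
      then show ?thesis using k by (simp add: box_def)
    qed
    then show ?thesis by blast
  qed
  have "subst g p \<in> ?W" if "p \<in> ?V" for p
  proof -
    have "(\<Sum>m\<in>keys p. cmul (lookup p m) (mon g m)) \<in> ?W"
      using that mon by (intro mpol.subspace_sum[OF subspace_keys] mpol.subspace_scale[OF subspace_keys]) blast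
    then show ?thesis by (simp add: subst_def ev_def cmul_def)
  qed
  then have img: "subst g ` ?V \<subseteq> ?W" by blast
  have ker: "{v \<in> ?V. subst g v = 0} = {0}"
  proof -
    have "v = 0" if "v \<in> ?V" "subst g v = 0" for v
    proof -
      have "v \<in> PV B" using that(1) by (auto simp: PV_def box_def)
      then show ?thesis using ind that(2) unfolding indep_mod_def by simp
    qed
    then show ?thesis by auto
  qed
  have d0: "mpol.dim {0 :: 'k mpol} = 0"
    by (rule mpol.dim_unique[of "{}"]) (auto simp: mpol.independent_empty)
  have fM: "finite ((\<lambda>m. single m (1::'k)) ` ?M)" "finite ((\<lambda>m. single m (1::'k)) ` ?M')" using M M' by auto
  have "card ?M = mpol.dim (subst g ` ?V)"
    using rank_nullity[OF lin subspace_keys fM(1) keys_subset_span] M dim_keys[of ?M, where 'k = 'k] unfolding ker d0 by simp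
  also have "\<dots> \<le> mpol.dim ?W" by (rule mpol.dim_mono_finite[OF fM(2) keys_subset_span img])
  also have "\<dots> = card ?M'" using M' by (intro dim_keys) simp
  finally have "(K + 1) ^ card B \<le> (c * K + 1) ^ N" using M M' by simp
  moreover have "(K + 1) * (K + 1) ^ N \<le> (K + 1) ^ card B"
    using power_increasing[OF cB, of "K + 1"] by simp
  moreover have "(c * K + 1) ^ N \<le> ((c + 1) * (K + 1)) ^ N" by (rule power_mono) (auto simp: algebra_simps)
  moreover have "((c + 1) * (K + 1)) ^ N = K * (K + 1) ^ N" unfolding power_mult_distrib by (simp only: K_def[symmetric])
  ultimately have "(K + 1) * (K + 1) ^ N \<le> K * (K + 1) ^ N" by linarith
  then show False by simp
qed

lemma split_variable:
  fixes H :: "'k::field mpol"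
  assumes H: "H \<in> PV (insert b B)" "vdeg b H \<le> Suc D"
  shows "\<exists>H0 H1. H0 \<in> PV B \<and> H1 \<in> PV (insert b B) \<and> vdeg b H1 \<le> D \<and> H = H0 + Var b * H1"
proof -
  let ?K0 = "{m \<in> keys H. lookup m b = 0}" and ?K1 = "{m \<in> keys H. lookup m b \<noteq> 0}"
  let ?H0 = "\<Sum>m\<in>?K0. single m (lookup H m)" and ?H1 = "\<Sum>m\<in>?K1. single (m - single b 1) (lookup H m)"
  have PVs: "keys m \<subseteq> A \<Longrightarrow> single m c \<in> PV A" for m A and c :: 'k by (simp add: PV_def)
  have 0: "?H0 \<in> PV B"
  proof (intro PV_sum PVs)
    fix m assume "m \<in> ?K0"
    then have "keys m \<subseteq> insert b B" "b \<notin> keys m" using H(1) by (auto simp: PV_def in_keys_iff)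
    then show "keys m \<subseteq> B" by blast
  qed
  have l: "lookup (m - single b 1) i = (if i = b then lookup m i - 1 else lookup m i)" for m :: "nat \<Rightarrow>\<^sub>0 nat" and i
    by (simp add: lookup_minus lookup_single when_def)
  have 1: "?H1 \<in> PV (insert b B)"
  proof (intro PV_sum PVs)
    fix m assume "m \<in> ?K1"
    then have "keys m \<subseteq> insert b B" using H(1) by (auto simp: PV_def)
    moreover have "keys (m - single b 1) \<subseteq> keys m" using l[of m] by (auto simp: in_keys_iff split: if_splits)
    ultimately show "keys (m - single b 1) \<subseteq> insert b B" by blast
  qed
  have 2: "vdeg b ?H1 \<le> D"
  proof (rule vdeg_sum)
    fix m assume "m \<in> ?K1"
    then have "lookup m b \<le> Suc D" using H(2) unfolding vdeg_le_iff by blast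
    then show "vdeg b (single (m - single b 1) (lookup H m)) \<le> D" unfolding vdeg_le_iff by (auto simp: l[unfolded One_nat_def])
  qed
  have "Var b * single (m - single b 1) (lookup H m) = single m (lookup H m)" if "m \<in> ?K1" for m
  proof -
    have "single b 1 + (m - single b 1) = m"
      using that by (intro poly_mapping_eqI) (simp add: lookup_add l[unfolded One_nat_def] lookup_single when_def)
    then show ?thesis by (simp add: Var_def mult_single)
  qed
  then have "Var b * ?H1 = (\<Sum>m\<in>?K1. single m (lookup H m))"
    unfolding sum_distrib_left by (intro sum.cong) auto
  moreover have "(\<Sum>m\<in>?K0 \<union> ?K1. single m (lookup H m)) = ?H0 + (\<Sum>m\<in>?K1. single m (lookup H m))"
    by (rule sum.union_disjoint) auto
  moreover have "?K0 \<union> ?K1 = keys H" by blast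
  ultimately have "H = ?H0 + Var b * ?H1" using mpol_sum[of H] by simp
  then show ?thesis using 0 1 2 by blast
qed

lemma indep_mod_mono: "P' \<subseteq> P \<Longrightarrow> indep_mod P B g \<Longrightarrow> indep_mod P' B g"
  unfolding indep_mod_def by blast

text \<open>Write a relation as H0 + h H1. Modulo \<open>Q\<close> only H0 remains, a relation among
  the g_b, so it vanishes; then h cancels because \<open>P\<close> is prime and does not contain it,
  and H1 has smaller degree in the new variable.\<close>

lemma indep_extend:
  assumes P: "hprime N P" and Q: "hideal N Q" "P \<subseteq> Q" and h: "h \<in> Q" "h \<notin> P"
    and g: "\<And>b. b \<in> B \<Longrightarrow> g b \<in> PV {..<N}" "indep_mod Q B g" and b: "b \<notin> B"
  shows "indep_mod P (insert b B) (g(b := h))"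
proof -
  let ?g = "g(b := h)"
  have hN: "h \<in> PV {..<N}" by (rule hidealD(1)[OF Q(1) h(1)])
  have sB: "subst ?g H = subst g H" if "H \<in> PV B" for H by (rule subst_cong[OF that]) (use b in auto)
  have B0: "H = 0" if "H \<in> PV B" "subst ?g H \<in> Q" for H
    using g(2) that sB unfolding indep_mod_def by simp
  have sN: "subst ?g H \<in> PV {..<N}" if "H \<in> PV (insert b B)" for H
    by (rule subst_in_PV[OF that]) (use g hN in auto)
  have "H \<in> PV (insert b B) \<Longrightarrow> vdeg b H \<le> D \<Longrightarrow> subst ?g H \<in> P \<Longrightarrow> H = 0" for D H
  proof (induction D arbitrary: H)
    case 0
    then have "H \<in> PV B" using vdeg_0_PV[of H b B] by simp
    then show ?case using B0 0 Q(2) by blast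
  next
    case (Suc D)
    obtain H0 H1 where H: "H0 \<in> PV B" "H1 \<in> PV (insert b B)" "vdeg b H1 \<le> D" "H = H0 + Var b * H1"
      using split_variable[OF Suc.prems(1,2)] by blast
    have e: "subst ?g H = subst ?g H0 + h * subst ?g H1" unfolding H(4) by simp
    have "h * subst ?g H1 \<in> Q" using hidealD(4)[OF Q(1) sN[OF H(2)] h(1)] by (simp add: mult.commute)
    then have "subst ?g H - h * subst ?g H1 \<in> Q" using hideal_minus[OF Q(1)] Suc.prems(3) Q(2) by blast
    then have "subst ?g H0 \<in> Q" unfolding e by simp
    then have "H0 = 0" using B0[OF H(1)] by blast
    moreover from this have "subst ?g H1 \<in> P"
      using hprimeD(3)[OF P hN sN[OF H(2)]] Suc.prems(3) h(2) unfolding e by simp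
    then have "H1 = 0" using Suc.IH[OF H(2,3)] by blast
    ultimately show ?case using H(4) by simp
  qed
  then show ?thesis unfolding indep_mod_def by blast
qed

text \<open>Going down the chain, each strict inclusion contributes one more independent element. At
  the bottom the family is independent over k in a polynomial ring in \<open>N\<close> variables,
  which bounds its size.\<close>

lemma chain_codim_ge:
  assumes hp: "\<And>i. i \<le> m \<Longrightarrow> hprime N (c i)" and sub: "\<And>i. i < m \<Longrightarrow> c i \<subset> c (Suc i)"
  shows "codim_ge N m (c m :: ('k::field) mpol set)"
  unfolding codim_ge_def
proof (intro allI impI)
  fix B and g :: "nat \<Rightarrow> 'k mpol"
  assume B: "finite B" "\<forall>b\<in>B. g b \<in> PV {..<N}" "indep_mod (c m) B g"
  have "k \<le> m \<Longrightarrow> \<exists>B' g'. finite B' \<and> (\<forall>b\<in>B'. g' b \<in> PV {..<N}) \<and> indep_mod (c (m - k)) B' g' \<and> card B' = card B + k" for k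
  proof (induction k)
    case 0
    then show ?case using B by auto
  next
    case (Suc k)
    then obtain B' g' where B': "finite B'" "\<forall>b\<in>B'. g' b \<in> PV {..<N}" "indep_mod (c (m - k)) B' g'" "card B' = card B + k"
      by auto
    let ?i = "m - Suc k"
    have i: "Suc ?i = m - k" "?i < m" using Suc.prems by auto
    obtain h where h: "h \<in> c (m - k)" "h \<notin> c ?i" using sub[OF i(2)] unfolding i(1) by blast
    obtain b where b: "b \<notin> B'" using ex_new_if_finite[OF infinite_UNIV_nat B'(1)] by blast
    have "hprime N (c ?i)" "hideal N (c (m - k))" "c ?i \<subseteq> c (m - k)"
      using hp[of ?i] hprimeD(1)[OF hp[of "m - k"]] sub[OF i(2)] unfolding i(1) by auto
    from indep_extend[OF this h _ B'(3) b] B'(2) have "indep_mod (c ?i) (insert b B') (g'(b := h))" by blast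
    moreover have "h \<in> PV {..<N}" using hidealD(1)[OF hprimeD(1)[OF hp[of "m - k"]] h(1)] by simp
    moreover have "finite (insert b B')" "\<forall>x\<in>insert b B'. (g'(b := h)) x \<in> PV {..<N}"
      "card (insert b B') = card B + Suc k" using B' b calculation(2) by auto
    ultimately show ?case by blast
  qed
  from this[of m] obtain B' g' where B': "finite B'" "\<forall>b\<in>B'. g' b \<in> PV {..<N}" "indep_mod (c 0) B' g'" "card B' = card B + m"
    by auto
  have "indep_mod {0} B' g'"
    using indep_mod_mono[OF _ B'(3), of "{0}"] hidealD(2)[OF hprimeD(1)[OF hp[of 0]]] by simp
  then show "card B + m \<le> N" using indep_card_le[OF B'(1), of g' N] B'(2,4) by simp
qed

section \<open>The lower bound\<close>

text \<open>Powers are allowed because \<open>I\<close> need be neither radical nor saturated; in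
  this form the condition passes to elimination ideals.\<close>

definition nondeg :: "nat \<Rightarrow> ('k::field) mpol set \<Rightarrow> bool" where
  "nondeg N I \<longleftrightarrow> (\<forall>l\<in>hform N 1. \<forall>m. l ^ m \<in> I \<longrightarrow> l = 0)"

text \<open>Primes containing all variables are left out, since they are not points of projective
  space.\<close>

definition codim_cond :: "nat \<Rightarrow> nat \<Rightarrow> ('k::field) mpol set \<Rightarrow> bool" where
  "codim_cond N e I \<longleftrightarrow> (\<forall>P. hprime N P \<longrightarrow> I \<subseteq> P \<longrightarrow> (\<exists>i<N. Var i \<notin> P) \<longrightarrow> codim_ge N e P)"

lemma Var_neq_0: "Var i \<noteq> (0 :: 'k::field mpol)"
proof
  assume "Var i = (0 :: 'k mpol)"
  from arg_cong[OF this, of "\<lambda>p. lookup p (single i 1)"] show False by (simp add: Var_def)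
qed

lemma nondeg_low:
  assumes I: "hideal N I" and N: "0 < N" and nd: "nondeg N I" and f: "f \<in> I" "homog d f" "d < 2"
  shows "f = (0 :: 'k::field mpol)"
proof (cases "d = 1")
  case True
  then have "f \<in> hform N 1" "f ^ 1 \<in> I" using f hidealD(1)[OF I f(1)] by (auto simp: hform_def)
  then show ?thesis using nd unfolding nondeg_def by blast
next
  case False
  \<comment> \<open>A constant in \<open>I\<close> is multiplied by x_0, so that the condition on
    linear forms covers degree 0 as well.\<close>
  have "Var 0 * f \<in> I" using hidealD(4)[OF I _ f(1), of "Var 0"] N by simp
  moreover have "Var 0 * f \<in> hform N 1"
  proof -
    have "d = 0" using f(3) False by simp
    then have "f \<in> hform N 0" using f(2) hidealD(1)[OF I f(1)] by (simp add: hform_def)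
    from hform_mult[OF Var_hform[OF N] this] show ?thesis by simp
  qed
  ultimately have "Var 0 * f = 0" using nd unfolding nondeg_def by (metis power_one_right)
  then show ?thesis by (simp add: Var_neq_0)
qed

context elimination
begin

text \<open>Rank and nullity for the map taking a quadric of \<open>I\<close> to its coefficient at
  x_n: the kernel contains the quadrics of the elimination ideal, the image contains all
  \<open>l c\<close>. The latter are independent, as x_c occurs in \<open>l c\<close> and in no
  other of them.\<close>

lemma dim_quadrics:
  "card C + mpol.dim (I \<inter> PV {..<n} \<inter> hform n 2) \<le> mpol.dim (I \<inter> hform (Suc n) 2)"
proof -
  let ?V = "I \<inter> hform (Suc n) 2"
  obtain D2 where D2: "finite D2" "(hform (Suc n) 2 :: 'k mpol set) \<subseteq> mpol.span D2" using finite_span_hform by blast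
  obtain D1 where D1: "finite D1" "(hform n 1 :: 'k mpol set) \<subseteq> mpol.span D1" using finite_span_hform by blast
  have V: "mpol.subspace ?V"
  proof (rule mpol.subspaceI)
    fix x and c :: 'k assume "x \<in> ?V"
    then show "cmul c x \<in> ?V" using hidealD(4)[OF hid, of "const c" x] by (auto simp: cmul_def hform_const_mult)
  qed (use hidealD(2,3)[OF hid] in \<open>auto intro: hform_add\<close>)
  have lin: "Vector_Spaces.linear cmul cmul (xc n 1 :: 'k mpol \<Rightarrow> 'k mpol)"
    by unfold_locales (auto simp: cmul_def)
  have VD: "?V \<subseteq> mpol.span D2" using D2 by blast
  have rn: "mpol.dim ?V = mpol.dim {v \<in> ?V. xc n 1 v = 0} + mpol.dim (xc n 1 ` ?V)"
    by (rule rank_nullity[OF lin V D2(1) VD])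
  have "I \<inter> PV {..<n} \<inter> hform n 2 \<subseteq> {v \<in> ?V. xc n 1 v = 0}"
    using PV_mono[of _ "{..<n}" "{..<Suc n}"] xc_of_PV[of _ n 1] by (auto simp: hform_def)
  from mpol.dim_mono_finite[OF D2(1) _ this] VD
  have d1: "mpol.dim (I \<inter> PV {..<n} \<inter> hform n 2) \<le> mpol.dim {v \<in> ?V. xc n 1 v = 0}" by blast
  let ?L = "(\<lambda>c. l c) ` C"
  have lk: "lookup (l c) (single c' 1) = (if c = c' then 1 else 0)" if c: "c \<in> C" "c' \<in> C" for c c'
  proof -
    have "single c' 1 \<notin> keys (\<sigma> c)" using \<sigma>_C[OF c(1)] c(2) unfolding PV_def by force
    then show ?thesis by (auto simp: lookup_minus in_keys_iff Var_def lookup_single when_def dest: arg_cong[of _ _ keys])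
  qed
  have inj: "inj_on l C"
  proof (rule inj_onI)
    fix c c' assume c: "c \<in> C" "c' \<in> C" "l c = l c'"
    then have "lookup (l c') (single c 1) = 1" using lk[of c c] by simp
    then show "c = c'" using lk[of c' c] c by (metis zero_neq_one)
  qed
  have ind: "\<not> mpol.dependent ?L"
    unfolding mpol.dependent_def
  proof
    assume "\<exists>a\<in>?L. a \<in> mpol.span (?L - {a})"
    then obtain c where c: "c \<in> C" "l c \<in> mpol.span (?L - {l c})" by blast
    have "mpol.span (?L - {l c}) \<subseteq> {p. lookup p (single c 1) = 0}"
    proof (rule mpol.span_minimal)
      show "?L - {l c} \<subseteq> {p. lookup p (single c 1) = 0}"
      proof
        fix x assume "x \<in> ?L - {l c}"
        then obtain c' where "c' \<in> C" "c' \<noteq> c" "x = l c'" by blast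
        then show "x \<in> {p. lookup p (single c 1) = 0}" using lk[of c' c] c(1) by simp
      qed
      show "mpol.subspace {p :: 'k mpol. lookup p (single c 1) = 0}"
        by (rule mpol.subspaceI) (auto simp: lookup_add cmul_def)
    qed
    then have "lookup (l c) (single c 1) = 0" using c(2) by blast
    then show False using lk[OF c(1) c(1)] by simp
  qed
  have "?L \<subseteq> xc n 1 ` ?V"
  proof
    fix x assume "x \<in> ?L"
    then obtain c where "c \<in> C" "x = l c" by blast
    then show "x \<in> xc n 1 ` ?V" using quad[of c] by force
  qed
  moreover have "xc n 1 ` ?V \<subseteq> mpol.span D1"
  proof -
    have "xc n 1 f \<in> hform n 1" if "f \<in> ?V" for f using xc_hform[of f n 2 1] that by simp
    then show ?thesis using D1(2) by blast
  qed
  ultimately have "card ?L \<le> mpol.dim (xc n 1 ` ?V)"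
    using mpol.independent_card_le[OF D1(1) _ _ ind] by blast
  then show ?thesis using rn d1 card_image[OF inj] by simp
qed

end

section \<open>Hypotheses inherited by the elimination ideal\<close>

context
  fixes n :: nat and I :: "('k::field) mpol set" and a :: "nat \<Rightarrow> 'k" and I1 :: "'k mpol set"
  assumes I: "hideal (Suc n) I" and I1: "I1 = {f \<in> PV {..<Suc n}. subst (shear n a) f \<in> I}"
begin

private abbreviation (input) "\<Phi> \<equiv> subst (shear n a)"
private abbreviation (input) "\<Psi> \<equiv> subst (shear n (\<lambda>i. - a i))"

lemma dim_shear: "mpol.dim (I1 \<inter> hform (Suc n) 2) \<le> mpol.dim (I \<inter> hform (Suc n) 2)"
proof -
  let ?V = "I1 \<inter> hform (Suc n) 2"
  have h1: "hideal (Suc n) I1" unfolding I1 by (rule hideal_vimage_shear[OF I])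
  obtain D2 where D2: "finite D2" "(hform (Suc n) 2 :: 'k mpol set) \<subseteq> mpol.span D2" using finite_span_hform by blast
  have V: "mpol.subspace ?V"
  proof (rule mpol.subspaceI)
    fix x and c :: 'k assume "x \<in> ?V"
    then show "cmul c x \<in> ?V" using hidealD(4)[OF h1, of "const c" x] by (auto simp: cmul_def hform_const_mult)
  qed (use hidealD(2,3)[OF h1] in \<open>auto intro: hform_add\<close>)
  have lin: "Vector_Spaces.linear cmul cmul \<Phi>" by unfold_locales (auto simp: cmul_def)
  have VD: "?V \<subseteq> mpol.span D2" "I \<inter> hform (Suc n) 2 \<subseteq> mpol.span D2" using D2 by blast+
  have "{v \<in> ?V. \<Phi> v = 0} = {0}"
  proof -
    have "v = 0" if "\<Phi> v = 0" for v using subst_shear_cancel(2)[of n a v] unfolding that by simp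
    then show ?thesis using mpol.subspace_0[OF V] by auto
  qed
  moreover have "mpol.dim {0 :: 'k mpol} = 0" by (rule mpol.dim_unique[of "{}"]) (auto simp: mpol.independent_empty)
  ultimately have "mpol.dim ?V = mpol.dim (\<Phi> ` ?V)" using rank_nullity[OF lin V D2(1) VD(1)] by simp
  also have "\<Phi> ` ?V \<subseteq> I \<inter> hform (Suc n) 2" using subst_shear_hform by (auto simp: I1)
  from mpol.dim_mono_finite[OF D2(1) VD(2) this] have "mpol.dim (\<Phi> ` ?V) \<le> mpol.dim (I \<inter> hform (Suc n) 2)" .
  finally show ?thesis .
qed

lemma hform_Suc: "f \<in> hform n d \<Longrightarrow> f \<in> hform (Suc n) d"
  using PV_mono[of f "{..<n}" "{..<Suc n}"] by (auto simp: hform_def)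

lemma Red_small: assumes "Red (Suc n) I" shows "Red n (I1 \<inter> PV {..<n})"
  unfolding Red_def
proof (intro allI impI)
  fix f d m assume f: "f \<in> hform n d" "f ^ m \<in> I1 \<inter> PV {..<n}"
  have "\<Phi> f \<in> hform (Suc n) d" using subst_shear_hform[OF hform_Suc[OF f(1)]] .
  moreover have "\<Phi> f ^ m \<in> I" using f(2) by (simp add: I1)
  ultimately obtain M where M: "\<And>g. g \<in> hform (Suc n) M \<Longrightarrow> g * \<Phi> f \<in> I" using assms unfolding Red_def by blast
  have "g * f \<in> I1 \<inter> PV {..<n}" if g: "g \<in> hform n M" for g
  proof -
    have "\<Phi> (g * f) \<in> I" using M[OF subst_shear_hform[OF hform_Suc[OF g]]] by simp
    moreover have "g * f \<in> PV {..<n}" using g f(1) by (auto simp: hform_def intro: PV_mult)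
    moreover from this have "g * f \<in> PV {..<Suc n}" by (rule PV_mono) auto
    ultimately show ?thesis by (simp add: I1)
  qed
  then show "\<exists>M. \<forall>g\<in>hform n M. g * f \<in> I1 \<inter> PV {..<n}" by blast
qed

lemma nondeg_small: assumes "nondeg (Suc n) I" shows "nondeg n (I1 \<inter> PV {..<n})"
  unfolding nondeg_def
proof (intro ballI allI impI)
  fix l m assume l: "l \<in> hform n 1" "l ^ m \<in> I1 \<inter> PV {..<n}"
  have "\<Phi> l \<in> hform (Suc n) 1" using subst_shear_hform[OF hform_Suc[OF l(1)]] .
  moreover have "\<Phi> l ^ m \<in> I" using l(2) by (simp add: I1)
  ultimately have "\<Phi> l = 0" using assms unfolding nondeg_def by blast
  then show "l = 0" using subst_shear_cancel(2)[of n a l] by simp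
qed

text \<open>The forms of the smaller ring outside \<open>P'\<close> are a multiplicative set missing
  \<open>I1\<close>, so some prime over \<open>I1\<close> meets the smaller ring inside
  \<open>P'\<close>. A family independent modulo \<open>P'\<close> is independent modulo that prime;
  the count of variables is one less, hence e - 1.\<close>

lemma codim_small:
  assumes cd: "codim_cond (Suc n) e I" and e: "1 \<le> e"
  shows "codim_cond n (e - 1) (I1 \<inter> PV {..<n})"
  unfolding codim_cond_def
proof (intro allI impI)
  fix P' assume P': "hprime n P'" "I1 \<inter> PV {..<n} \<subseteq> P'" and ex: "\<exists>i<n. Var i \<notin> P'"
  have h1: "hideal (Suc n) I1" unfolding I1 by (rule hideal_vimage_shear[OF I])
  note p' = hprimeD[OF P'(1)]
  define U where "U = {f \<in> PV {..<n}. (\<exists>d. homog d f) \<and> f \<notin> P'}"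
  have "hmult (Suc n) U"
    unfolding hmult_def
  proof (intro conjI ballI)
    show "1 \<in> U" using p'(2) by (auto simp: U_def intro: exI[of _ 0])
  next
    fix s assume "s \<in> U"
    then obtain d where "s \<in> hform n d" by (auto simp: U_def hform_def)
    then show "\<exists>d. s \<in> hform (Suc n) d" using hform_Suc by blast
  next
    fix s t assume "s \<in> U" "t \<in> U"
    then show "s * t \<in> U" unfolding U_def using p'(3)[of s t] homog_mult[of _ s _ t] PV_mult[of s "{..<n}" t] by blast
  qed
  moreover have "U \<inter> I1 = {}" using P'(2) by (auto simp: U_def)
  ultimately obtain Q where Q: "hprime (Suc n) Q" "I1 \<subseteq> Q" "Q \<inter> U = {}" using hprime_avoiding[OF h1] by blast
  note q = hprimeD[OF Q(1)]
  have QP: "f \<in> P'" if f: "f \<in> Q" "f \<in> PV {..<n}" for f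
  proof -
    obtain D where D: "f = (\<Sum>d\<le>D. hom_part d f)" using hom_part_decomp by blast
    have "hom_part d f \<in> P'" for d
      using Q(3) hidealD(5)[OF q(1) f(1), of d] PV_hom_part[OF f(2), of d] homog_hom_part[of d f]
      unfolding U_def by blast
    then have "(\<Sum>d\<le>D. hom_part d f) \<in> P'" by (intro hideal_sum[OF p'(1)])
    then show ?thesis using D by simp
  qed
  \<comment> \<open>The hypothesis on codimension speaks of primes over \<open>I\<close>, so the
    prime over \<open>I1\<close> is carried back by the inverse shear.\<close>
  define P where "P = {f \<in> PV {..<Suc n}. \<Psi> f \<in> Q}"
  have hP: "hprime (Suc n) P"
    unfolding hprime_def
  proof (intro conjI ballI impI)
    show "hideal (Suc n) P" unfolding P_def by (rule hideal_vimage_shear[OF q(1)])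
    show "1 \<notin> P" using q(2) by (simp add: P_def)
    fix f g assume "f \<in> PV {..<Suc n}" "g \<in> PV {..<Suc n}" "f * g \<in> P"
    then have "\<Psi> f * \<Psi> g \<in> Q" "\<Psi> f \<in> PV {..<Suc n}" "\<Psi> g \<in> PV {..<Suc n}" "f \<in> PV {..<Suc n}" "g \<in> PV {..<Suc n}"
      using subst_shear_PV by (auto simp: P_def)
    then show "f \<in> P \<or> g \<in> P" using q(3)[of "\<Psi> f" "\<Psi> g"] by (auto simp: P_def)
  qed
  have SP: "f \<in> Q" if "\<Phi> f \<in> P" for f using that subst_shear_cancel(2)[of n a f] by (simp add: P_def)
  have "I \<subseteq> P"
  proof
    fix f assume f: "f \<in> I"
    then have "\<Psi> f \<in> I1" using hidealD(1)[OF I f] subst_shear_PV[of f n "\<lambda>i. - a i"] by (simp add: I1 subst_shear_cancel)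
    then show "f \<in> P" using Q(2) hidealD(1)[OF I f] by (auto simp: P_def)
  qed
  moreover obtain i where i: "i < n" "Var i \<notin> P'" using ex by blast
  have "\<exists>i<Suc n. Var i \<notin> P"
  proof (rule ccontr)
    assume "\<not> ?thesis"
    then have "Var i \<in> P" "Var n \<in> P" using i(1) by auto
    then have "Var i - const (a i) * Var n \<in> P"
      using hideal_minus[OF hprimeD(1)[OF hP]] hidealD(4)[OF hprimeD(1)[OF hP], of "const (a i)"] by simp
    then have "\<Phi> (Var i) \<in> P" using i(1) by (simp add: shear_def)
    then show False using QP[OF SP[of "Var i"]] i by simp
  qed
  ultimately have cP: "codim_ge (Suc n) e P" using cd hP unfolding codim_cond_def by blast
  show "codim_ge n (e - 1) P'"
    unfolding codim_ge_def
  proof (intro allI impI)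
    fix B and g :: "nat \<Rightarrow> 'k mpol"
    assume B: "finite B" "\<forall>b\<in>B. g b \<in> PV {..<n}" "indep_mod P' B g"
    have "indep_mod P B (\<lambda>b. \<Phi> (g b))"
      unfolding indep_mod_def
    proof (intro ballI impI)
      fix h assume h: "h \<in> PV B" "subst (\<lambda>b. \<Phi> (g b)) h \<in> P"
      have "\<Phi> (subst g h) \<in> P" using h(2) by (simp add: subst_subst)
      moreover have "subst g h \<in> PV {..<n}" by (rule subst_in_PV[OF h(1)]) (use B(2) in auto)
      ultimately have "subst g h \<in> P'" using QP SP by blast
      then show "h = 0" using B(3) h(1) unfolding indep_mod_def by blast
    qed
    moreover have "\<forall>b\<in>B. \<Phi> (g b) \<in> PV {..<Suc n}"
    proof
      fix b assume "b \<in> B"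
      then have "g b \<in> PV {..<n}" using B(2) by blast
      then have "g b \<in> PV {..<Suc n}" by (rule PV_mono) auto
      then show "\<Phi> (g b) \<in> PV {..<Suc n}" by (rule subst_shear_PV)
    qed
    ultimately have "card B + e \<le> Suc n"
      using cP[unfolded codim_ge_def, THEN spec[of _ B], THEN spec[of _ "\<lambda>b. \<Phi> (g b)"]] B(1) by simp
    then show "card B + (e - 1) \<le> n" using e by linarith
  qed
qed

end

text \<open>Each projection costs one variable, one unit of codimension and one exterior degree, and
  accounts for |C| \<ge> e quadrics.\<close>

theorem quadrics_lower_bound:
  fixes I :: "'k::{alg_closed_field, field_char_0} mpol set"
  assumes "hideal N I" "Red N I" "nondeg N I" "codim_cond N e I" "0 < N" "p \<le> e"
    "\<And>i j. Suc i \<le> p \<Longrightarrow> j \<ge> 2 \<Longrightarrow> kexact N I (Suc i) (int j)"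
  shows "(\<Sum>i<p. e - i) \<le> mpol.dim (I \<inter> hform N 2)"
  using assms
proof (induction p arbitrary: N e I)
  case (Suc p)
  note I = Suc.prems(1) and kex = Suc.prems(7)
  obtain n where N: "N = Suc n" using Suc.prems(5) by (cases N) auto
  have low: "\<forall>f\<in>I. \<forall>d<2. homog d f \<longrightarrow> f = 0" using nondeg_low[OF I Suc.prems(5,3)] by blast
  have "Var n ^ k \<notin> I" for k
  proof
    assume "Var n ^ k \<in> I"
    then have "Var n = (0 :: 'k mpol)" using Suc.prems(3) Var_hform[of n N] N unfolding nondeg_def by blast
    then show False using Var_neq_0 by blast
  qed
  from reduced_component[OF I Suc.prems(2) _ this] obtain P s where
    P: "hprime N P \<and> I \<subseteq> P \<and> Var n \<notin> P \<and> s \<in> PV {..<N} \<and> s \<notin> P \<and> (\<forall>f\<in>P. s * f \<in> I)" unfolding N by blast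
  have cP: "codim_ge N e P" using Suc.prems(4) P N unfolding codim_cond_def by blast
  have "\<forall>j\<ge>2. kexact (Suc n) I 1 (int j)" using kex[of 0] N by simp
  with generic_position[of n P e I s] P cP I low obtain a C \<sigma> where
    el: "elimination n {f \<in> PV {..<Suc n}. subst (shear n a) f \<in> I} C \<sigma>" "e \<le> card C" unfolding N by blast
  define I1 where "I1 = {f \<in> PV {..<Suc n}. subst (shear n a) f \<in> I}"
  interpret elimination n I1 C \<sigma> using el(1) unfolding I1_def .
  let ?I' = "I1 \<inter> PV {..<n}"
  have I': "hideal (Suc n) I" using I N by simp
  have "(\<Sum>i<p. e - 1 - i) \<le> mpol.dim (?I' \<inter> hform n 2)"
  \<comment> \<open>The induction hypothesis needs a positive number of variables. If p > 0 then e >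
    0, and |C| \<ge> e with \<open>C\<close> contained in {..<n} makes n positive; for p = 0 the sum
    is empty.\<close>
  proof (cases "p = 0")
    case False
    have "card C \<le> n" using card_mono[OF _ C] by simp
    then have n: "0 < n" using el(2) Suc.prems(6) by linarith
    obtain n' where n': "n = Suc n'" using n by (cases n) auto
    show ?thesis
    proof (rule Suc.IH[OF hideal_small])
      show "Red n ?I'" using Red_small[OF I' I1_def] Suc.prems(2) N by simp
      show "nondeg n ?I'" using nondeg_small[OF I' I1_def] Suc.prems(3) N by simp
      show "codim_cond n (e - 1) ?I'" using codim_small[OF I' I1_def] Suc.prems(4,6) N by simp
      show "0 < n" "p \<le> e - 1" using n Suc.prems(6) by auto
      fix i j :: nat assume i: "Suc i \<le> p" and j: "j \<ge> 2"
      show "kexact n ?I' (Suc i) (int j)"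
      proof (rule elimination_kexact[OF _ _ _ j])
        fix j :: int assume "j \<ge> 2"
        \<comment> \<open>Exactness in the single degree \<open>Suc (Suc i)\<close> yields both
          injectivity in degree \<open>Suc i\<close> and surjectivity in degree
          \<open>Suc (Suc i)\<close>.\<close>
        then have k: "kexact (Suc n) I (Suc (Suc i)) j" using kex[of "Suc i" "nat j"] i N by simp
        show "inj_at Var n I1 (Suc i) j" by (rule inj_at_transport[OF I' I1_def shear_inj_at[OF I' k]])
        show "surj_at Var n I1 (Suc (Suc i)) j" by (rule surj_at_transport[OF I' I1_def shear_surj_at[OF I' k]])
      next
        show "\<exists>J. \<forall>j\<ge>J. kexact n ?I' (Suc i) j" using kexact_large_degree[of n' ?I'] hideal_small unfolding n' by blast
      qed
    qed
  qed simp
  moreover have "(\<Sum>i<Suc p. e - i) = e + (\<Sum>i<p. e - 1 - i)" by (subst sum.lessThan_Suc_shift) simp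
  moreover note dim_quadrics dim_shear[OF I' I1_def] el(2)
  ultimately show ?case unfolding N by linarith
qed simp

section \<open>Schemes and their quadratic ideals\<close>

lemma homog_ideal_iff: "homog_ideal n I \<longleftrightarrow> hideal (Suc n) (I :: ('k::field) mpol set)"
proof
  assume h: "homog_ideal n I"
  then interpret ideal I "coord_ring n :: 'k mpol ring" by (simp add: homog_ideal_def)
  have c: "carrier (coord_ring n) = (PV {..<Suc n} :: 'k mpol set)"
    by (simp add: carrier_coord_ring lessThan_Suc_atMost)
  show "hideal (Suc n) I"
    unfolding hideal_def
  proof (intro conjI ballI allI)
    show "I \<subseteq> PV {..<Suc n}" using a_subset c by simp
    show "0 \<in> I" using additive_subgroup.zero_closed[OF is_additive_subgroup] by (simp add: coord_ring_def)
    show "f + g \<in> I" if "f \<in> I" "g \<in> I" for f g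
      using additive_subgroup.a_closed[OF is_additive_subgroup that] by (simp add: coord_ring_def)
    show "r * f \<in> I" if "r \<in> PV {..<Suc n}" "f \<in> I" for r f
      using I_l_closed[OF that(2), of r] that(1) unfolding c by (simp add: coord_ring_def)
    show "hom_part d f \<in> I" if "f \<in> I" for d f using h that by (simp add: homog_ideal_def)
  qed
next
  assume I: "hideal (Suc n) I"
  let ?R = "coord_ring n :: 'k mpol ring"
  interpret cring ?R by (rule cring_coord_ring)
  have c: "carrier ?R = PV {..<Suc n}" by (simp add: carrier_coord_ring lessThan_Suc_atMost)
  have mi: "\<ominus>\<^bsub>?R\<^esub> f = - f" if "f \<in> PV {..<Suc n}" for f
    by (rule minus_equality) (use that c PV_uminus in \<open>auto simp: coord_ring_def[of n]\<close>)
  have "ideal I ?R"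
  proof (rule idealI[OF ring_axioms])
    show "subgroup I (add_monoid ?R)"
    proof (rule subgroup.intro)
      show "I \<subseteq> carrier (add_monoid ?R)" using hidealD(1)[OF I] c by auto
      show "x \<otimes>\<^bsub>add_monoid ?R\<^esub> y \<in> I" if "x \<in> I" "y \<in> I" for x y
        using hidealD(3)[OF I that] by (simp add: coord_ring_def)
      show "\<one>\<^bsub>add_monoid ?R\<^esub> \<in> I" using hidealD(2)[OF I] by (simp add: coord_ring_def)
      show "inv\<^bsub>add_monoid ?R\<^esub> x \<in> I" if "x \<in> I" for x
        using mi[OF hidealD(1)[OF I that]] hideal_uminus[OF I that] unfolding a_inv_def by simp
    qed
    show "x \<otimes>\<^bsub>?R\<^esub> a \<in> I" "a \<otimes>\<^bsub>?R\<^esub> x \<in> I" if "a \<in> I" "x \<in> carrier ?R" for a x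
      using hidealD(4)[OF I _ that(1), of x] that(2) unfolding c by (simp_all add: coord_ring_def mult.commute)
  qed
  then show "homog_ideal n I" using hidealD(5)[OF I] by (simp add: homog_ideal_def)
qed

lemma Proj_iff: "P \<in> Proj n \<longleftrightarrow> hprime (Suc n) P \<and> (\<exists>i<Suc n. Var i \<notin> (P :: ('k::field) mpol set))"
proof -
  have c: "carrier (coord_ring n) = (PV {..<Suc n} :: 'k mpol set)"
    by (simp add: carrier_coord_ring lessThan_Suc_atMost)
  have irr: "irrelevant_ideal n \<subseteq> P \<longleftrightarrow> (\<forall>i<Suc n. Var i \<in> P)" if P: "hideal (Suc n) P"
  proof
    assume "irrelevant_ideal n \<subseteq> P"
    moreover have "lookup (Var i :: 'k mpol) 0 = 0" for i by (simp add: lookup_0_eval)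
    ultimately show "\<forall>i<Suc n. Var i \<in> P" by (auto simp: irrelevant_ideal_def c)
  next
    assume V: "\<forall>i<Suc n. Var i \<in> P"
    show "irrelevant_ideal n \<subseteq> P"
    proof
      fix f :: "'k mpol" assume f: "f \<in> irrelevant_ideal n"
      then have fR: "f \<in> PV {..<Suc n}" "lookup f 0 = 0" by (auto simp: irrelevant_ideal_def c)
      have "f - const (lookup f 0) \<in> P" if "f \<in> PV {..<Suc n}" for f
        using that
      proof (induction rule: PV_induct)
        case (const a)
        then show ?case using hidealD(2)[OF P] by (simp add: lookup_0_eval)
      next
        case (Var i)
        then show ?case using V by (simp add: lookup_0_eval)
      next
        case (add p q)
        have "p + q - const (lookup (p + q) 0) = (p - const (lookup p 0)) + (q - const (lookup q 0))"
          by (simp add: lookup_add const_add)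
        then show ?case using hidealD(3)[OF P add.IH] by (simp only:)
      next
        case (mult p q)
        have "p * q - const (lookup (p * q) 0) = q * (p - const (lookup p 0)) + const (lookup p 0) * (q - const (lookup q 0))"
          by (simp add: lookup_mult_0 const_mult algebra_simps)
        then show ?case
          using hidealD(3)[OF P hidealD(4)[OF P mult.hyps(2) mult.IH(1)] hidealD(4)[OF P PV_const mult.IH(2)]] by (simp only:)
      qed
      from this[OF fR(1)] fR(2) show "f \<in> P" by simp
    qed
  qed
  show ?thesis
  proof
    assume P: "P \<in> Proj n"
    then interpret primeideal P "coord_ring n :: 'k mpol ring" by (simp add: Proj_def)
    have h: "hideal (Suc n) P" using P by (simp add: Proj_def homog_ideal_iff)
    moreover have "1 \<notin> P" using one_imp_carrier I_notcarr by (auto simp: coord_ring_def)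
    moreover have "f \<in> P \<or> g \<in> P" if "f \<in> PV {..<Suc n}" "g \<in> PV {..<Suc n}" "f * g \<in> P" for f g
      using I_prime[of f g] that unfolding c by (simp add: coord_ring_def)
    ultimately show "hprime (Suc n) P \<and> (\<exists>i<Suc n. Var i \<notin> P)"
      using P irr[OF h] unfolding hprime_def by (auto simp: Proj_def)
  next
    assume P: "hprime (Suc n) P \<and> (\<exists>i<Suc n. Var i \<notin> P)"
    then have h: "hideal (Suc n) P" by (simp add: hprime_def)
    have "primeideal P (coord_ring n)"
    proof (rule primeidealI)
      show "ideal P (coord_ring n)" using h by (simp add: homog_ideal_def flip: homog_ideal_iff)
      show "cring (coord_ring n :: 'k mpol ring)" by (rule cring_coord_ring)
      show "carrier (coord_ring n) \<noteq> P" using P c by (auto simp: hprime_def)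
      show "f \<in> P \<or> g \<in> P" if "f \<in> carrier (coord_ring n)" "g \<in> carrier (coord_ring n)" "f \<otimes>\<^bsub>coord_ring n\<^esub> g \<in> P" for f g
        using that P unfolding c hprime_def by (simp add: coord_ring_def)
    qed
    then show "P \<in> Proj n" using P h irr[OF h] by (auto simp: Proj_def homog_ideal_iff)
  qed
qed

lemma zero_Proj: "{0 :: ('k::field) mpol} \<in> Proj n"
  unfolding Proj_iff hprime_def using hideal_0
proof (intro conjI exI[of _ 0])
  have "lookup (Var 0 :: 'k mpol) (single 0 1) = 1" by (simp add: Var_def)
  then show "Var 0 \<notin> {0 :: 'k mpol}" by auto
qed auto

section \<open>Stalks of ideal sheaves and saturation\<close>

text \<open>For homogeneous f this is membership in the homogeneous localization of \<open>I\<close>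
  at \<open>P\<close>, with the denominators cleared.\<close>

definition loc :: "nat \<Rightarrow> ('k::field) mpol set \<Rightarrow> 'k mpol set \<Rightarrow> 'k mpol \<Rightarrow> bool" where
  "loc n I P f \<longleftrightarrow> (\<exists>k. \<exists>b\<in>hform (Suc n) k. b \<notin> P \<and> b * f \<in> I)"

lemma tilde_iff_loc:
  assumes I: "hideal (Suc n) I" and P: "P \<in> Proj n"
    and f: "f \<in> hform (Suc n) (m + d)" and g: "g \<in> hform (Suc n) m" "g \<notin> P"
  shows "Fract f g \<in> tilde n I d P \<longleftrightarrow> loc n I P f"
proof
  have hp: "hprime (Suc n) P" using P by (simp add: Proj_iff)
  note z = hidealD(2)[OF hprimeD(1)[OF hp]]
  have gR: "g \<in> PV {..<Suc n}" using g by (simp add: hform_def)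
  {
    assume "Fract f g \<in> tilde n I d P"
    then obtain f' g' m' where f': "Fract f g = Fract f' g'" "f' \<in> I" "g' \<in> hform (Suc n) m'" "g' \<notin> P"
      unfolding tilde_def forms_hform by blast
    have "g \<noteq> 0" "g' \<noteq> 0" using g(2) f'(4) z by auto
    then have "f * g' = f' * g" using f'(1) by (simp add: eq_fract)
    then have "g' * f \<in> I" using hidealD(4)[OF I gR f'(2)] by (simp add: mult.commute)
    then show "loc n I P f" using f'(3,4) unfolding loc_def by blast
  }
  assume "loc n I P f"
  then obtain k b where b: "b \<in> hform (Suc n) k" "b \<notin> P" "b * f \<in> I" unfolding loc_def by blast
  have "b \<noteq> 0" using b(2) z by auto
  then have "Fract f g = Fract (b * f) (b * g)" by (simp add: mult_fract_cancel)
  moreover have "b * g \<in> hform (Suc n) (k + m)" "b * g \<notin> P"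
    using hform_mult[OF b(1) g(1)] hprimeD(3)[OF hp, of b g] b gR g(2) by (auto simp: hform_def)
  moreover have "homog (k + m + d) (b * f)" using hform_mult[OF b(1) f] by (simp add: hform_def add.assoc)
  ultimately show "Fract f g \<in> tilde n I d P" using b(3) unfolding tilde_def forms_hform by blast
qed

lemma hideal_colon:
  assumes I: "hideal N I" and h: "h \<in> hform N d" shows "hideal N {b \<in> PV {..<N}. b * h \<in> I}"
  unfolding hideal_def
proof (intro conjI ballI allI)
  fix f e assume f: "f \<in> {b \<in> PV {..<N}. b * h \<in> I}"
  have "hom_part (e + d) (f * h) = hom_part e f * h" using hom_part_homog_mult[of d h "e + d" f] h by (simp add: hform_def)
  then have "hom_part e f * h \<in> I" using hidealD(5)[OF I, of "f * h" "e + d"] f by simp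
  then show "hom_part e f \<in> {b \<in> PV {..<N}. b * h \<in> I}" using f by (auto intro: PV_hom_part)
next
  fix r f :: "'a mpol" assume r: "r \<in> PV {..<N}" and f: "f \<in> {b \<in> PV {..<N}. b * h \<in> I}"
  have "r * (f * h) \<in> I" using hidealD(4)[OF I r, of "f * h"] f by simp
  then show "r * f \<in> {b \<in> PV {..<N}. b * h \<in> I}" using r f by (auto simp: mult.assoc intro: PV_mult)
qed (use hidealD(2,3)[OF I] in \<open>auto simp: distrib_right intro: PV_add\<close>)

text \<open>The saturation of \<open>I\<close>: ideals generated by powers of all the variables are
  cofinal with the powers of the irrelevant ideal, so single variables suffice.\<close>

definition Sat :: "nat \<Rightarrow> ('k::field) mpol set \<Rightarrow> 'k mpol set" where
  "Sat N I = {f \<in> PV {..<N}. \<forall>i<N. \<exists>k. Var i ^ k * f \<in> I}"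

lemma Var_power_hform: "i < N \<Longrightarrow> Var i ^ k \<in> hform N k"
  by (auto simp: hform_def homog_Var_power intro: PV_power)

lemma Var_power_mono:
  assumes I: "hideal N I" and i: "i < N" and k: "Var i ^ k * f \<in> I" "k \<le> k'" shows "Var i ^ k' * f \<in> I"
proof -
  have "Var i ^ (k' - k) * (Var i ^ k * f) \<in> I"
    by (rule hidealD(4)[OF I PV_power k(1)]) (use i in auto)
  then show ?thesis using k(2) by (simp flip: mult.assoc power_add)
qed

lemma hideal_Sat:
  assumes I: "hideal N I" shows "hideal N (Sat N I)"
  unfolding hideal_def
proof (intro conjI ballI allI)
  show "Sat N I \<subseteq> PV {..<N}" by (auto simp: Sat_def)
  show "0 \<in> Sat N I" using hidealD(2)[OF I] by (auto simp: Sat_def)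
next
  fix f g assume f: "f \<in> Sat N I" "g \<in> Sat N I"
  have "\<exists>k. Var i ^ k * (f + g) \<in> I" if i: "i < N" for i
  proof -
    obtain k k' where "Var i ^ k * f \<in> I" "Var i ^ k' * g \<in> I" using f i unfolding Sat_def by blast
    then have "Var i ^ max k k' * f \<in> I" "Var i ^ max k k' * g \<in> I" using Var_power_mono[OF I i] by auto
    then show ?thesis using hidealD(3)[OF I] by (auto simp: distrib_left)
  qed
  then show "f + g \<in> Sat N I" using f by (auto simp: Sat_def intro: PV_add)
next
  fix r f :: "'a mpol" assume r: "r \<in> PV {..<N}" and f: "f \<in> Sat N I"
  have "\<exists>k. Var i ^ k * (r * f) \<in> I" if i: "i < N" for i
  proof -
    obtain k where "Var i ^ k * f \<in> I" using f i unfolding Sat_def by blast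
    then have "r * (Var i ^ k * f) \<in> I" by (rule hidealD(4)[OF I r])
    then show ?thesis by (auto simp: mult.left_commute)
  qed
  then show "r * f \<in> Sat N I" using r f by (auto simp: Sat_def intro: PV_mult)
next
  fix f d assume f: "f \<in> Sat N I"
  have "\<exists>k. Var i ^ k * hom_part d f \<in> I" if i: "i < N" for i
  proof -
    obtain k where k: "Var i ^ k * f \<in> I" using f i unfolding Sat_def by blast
    have "hom_part (d + k) (f * Var i ^ k) = hom_part d f * Var i ^ k"
      using hom_part_homog_mult[of k "Var i ^ k" "d + k" f] by (simp add: homog_Var_power)
    then show ?thesis using hidealD(5)[OF I k, of "d + k"] by (auto simp: mult.commute)
  qed
  then show "hom_part d f \<in> Sat N I" using f by (auto simp: Sat_def intro: PV_hom_part)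
qed

lemma subset_Sat: "hideal N I \<Longrightarrow> I \<subseteq> Sat N I"
  unfolding Sat_def using hidealD(1)[of N I] by (auto intro!: exI[of _ 0])

text \<open>If h lies in \<open>I\<close> locally everywhere, the ideal of multipliers taking h into
  \<open>I\<close> is contained in no point of \<open>Proj n\<close>, so it contains a power of each
  variable.\<close>

lemma Sat_iff_loc:
  assumes I: "hideal (Suc n) I" and h: "h \<in> hform (Suc n) d"
  shows "h \<in> Sat (Suc n) I \<longleftrightarrow> (\<forall>P\<in>Proj n. loc n I P h)"
proof
  assume hS: "h \<in> Sat (Suc n) I"
  show "\<forall>P\<in>Proj n. loc n I P h"
  proof
    fix P :: "'a mpol set" assume P: "P \<in> Proj n"
    then obtain i where i: "i < Suc n" "Var i \<notin> P" and hp: "hprime (Suc n) P" by (auto simp: Proj_iff)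
    obtain k where "Var i ^ k * h \<in> I" using hS i(1) unfolding Sat_def by blast
    moreover have "Var i ^ k \<notin> P" using hprime_power[OF hp, of "Var i" k] i by auto
    ultimately show "loc n I P h" using Var_power_hform[OF i(1), of k] unfolding loc_def by blast
  qed
next
  assume L: "\<forall>P\<in>Proj n. loc n I P h"
  let ?J = "{b \<in> PV {..<Suc n}. b * h \<in> I}"
  have "\<exists>k. Var i ^ k \<in> ?J" if i: "i < Suc n" for i
  proof (rule power_in_hideal[OF hideal_colon[OF I h] i])
    fix P assume P: "hprime (Suc n) P" "?J \<subseteq> P"
    show "Var i \<in> P"
    proof (rule ccontr)
      assume "Var i \<notin> P"
      then have "P \<in> Proj n" using P(1) i by (auto simp: Proj_iff)
      then obtain k b where "b \<in> hform (Suc n) k" "b \<notin> P" "b * h \<in> I" using L unfolding loc_def by blast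
      then show False using P(2) by (auto simp: hform_def)
    qed
  qed
  then show "h \<in> Sat (Suc n) I" using h unfolding Sat_def hform_def by blast
qed

lemma Sat_uniform:
  assumes I: "hideal (Suc n) I" and h: "h \<in> Sat (Suc n) I"
  shows "\<exists>M. \<forall>g\<in>hform (Suc n) M. g * h \<in> I"
proof -
  have "\<forall>i. \<exists>k. i < Suc n \<longrightarrow> Var i ^ k * h \<in> I" using h unfolding Sat_def by blast
  then obtain k where k: "\<And>i. i < Suc n \<Longrightarrow> Var i ^ k i * h \<in> I" by metis
  \<comment> \<open>A monomial of degree (n + 1) K is divisible by some x_i^K by the pigeonhole
    principle. The successor makes K positive, which the strict inequality needs.\<close>
  define K where "K = Suc (\<Sum>i<Suc n. k i)"
  have K: "Var i ^ K * h \<in> I" if i: "i < Suc n" for i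
  proof (rule Var_power_mono[OF I i k[OF i]])
    have "k i \<le> (\<Sum>i<Suc n. k i)" by (rule member_le_sum) (use i in auto)
    then show "k i \<le> K" by (simp add: K_def)
  qed
  have "g * h \<in> I" if g: "g \<in> hform (Suc n) (Suc n * K)" for g
  proof -
    have "single m (lookup g m) * h \<in> I" if m: "m \<in> keys g" for m
    proof -
      have km: "keys m \<subseteq> {..<Suc n}" and dm: "mdeg m = Suc n * K" using g m by (auto simp: hform_def PV_def homog_def)
      have "\<exists>i<Suc n. lookup m i \<ge> K"
      proof (rule ccontr)
        assume "\<not> ?thesis"
        then have "lookup m i \<le> K - 1" if "i < Suc n" for i using that by force
        then have "(\<Sum>i<Suc n. lookup m i) \<le> of_nat (card {..<Suc n}) * (K - 1)" by (intro sum_bounded_above) auto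
        moreover have "mdeg m = (\<Sum>i<Suc n. lookup m i)"
          unfolding mdeg_def using km by (intro sum.mono_neutral_left) (auto simp: in_keys_iff)
        moreover have "Suc n * (K - 1) < Suc n * K" by (simp add: K_def)
        ultimately show False using dm by simp
      qed
      then obtain i where i: "i < Suc n" "lookup m i \<ge> K" by blast
      have l: "lookup (m - single i K) j = (if j = i then lookup m j - K else lookup m j)" for j
        by (simp add: lookup_minus lookup_single when_def)
      have "single i K + (m - single i K) = m"
        using i(2) by (intro poly_mapping_eqI) (auto simp: lookup_add l lookup_single when_def)
      then have "single m (lookup g m) = single (m - single i K) (lookup g m) * Var i ^ K"
        by (simp add: Var_power mult_single add.commute)
      moreover have "single (m - single i K) (lookup g m) \<in> PV {..<Suc n}"
        using km by (auto simp: PV_def in_keys_iff l subset_iff split: if_splits)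
      ultimately show ?thesis using hidealD(4)[OF I _ K[OF i(1)]] by (simp add: mult.assoc)
    qed
    then have "(\<Sum>m\<in>keys g. single m (lookup g m) * h) \<in> I" by (rule hideal_sum[OF I])
    then show ?thesis unfolding sum_distrib_right[symmetric] mpol_sum[of g, symmetric] .
  qed
  then show ?thesis by blast
qed

lemma O_twistI:
  "f \<in> hform (Suc n) (m + d) \<Longrightarrow> g \<in> hform (Suc n) m \<Longrightarrow> g \<notin> P \<Longrightarrow> Fract f g \<in> O_twist n d P"
  unfolding tilde_def forms_hform
  by (auto simp: hform_def carrier_coord_ring lessThan_Suc_atMost)

text \<open>Some x_i lies outside \<open>P\<close>, and x_i^d generates O(d) there; this turns a
  fraction of degree d into a product of a germ of degree 0 with a section of O(d).\<close>

lemma twist_eq_tilde: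
  assumes I: "hideal (Suc n) I" and P: "P \<in> Proj n" and X: "X P = tilde n I 0 P"
  shows "twist n X d P = tilde n I d P"
proof
  have hp: "hprime (Suc n) P" using P by (simp add: Proj_iff)
  have c: "carrier (coord_ring n) = (PV {..<Suc n} :: 'a mpol set)"
    by (simp add: carrier_coord_ring lessThan_Suc_atMost)
  show "twist n X d P \<subseteq> tilde n I d P"
  proof
    fix x assume "x \<in> twist n X d P"
    then obtain f g m f' g' m' where x: "x = Fract f g * Fract f' g'" "f \<in> I" "homog m f" "g \<in> hform (Suc n) m" "g \<notin> P"
      "f' \<in> PV {..<Suc n}" "homog (m' + d) f'" "g' \<in> hform (Suc n) m'" "g' \<notin> P"
      unfolding twist_def X tilde_def forms_hform c by auto
    have "x = Fract (f' * f) (g * g')" using x(1) by (simp add: mult.commute)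
    moreover have "f' * f \<in> I" using hidealD(4)[OF I x(6,2)] .
    moreover have "homog (m + m' + d) (f' * f)" using homog_mult[OF x(3,7)] by (simp add: add.assoc mult.commute)
    moreover have "g * g' \<in> hform (Suc n) (m + m')" "g * g' \<notin> P"
      using hform_mult[OF x(4,8)] hprimeD(3)[OF hp, of g g'] x by (auto simp: hform_def)
    ultimately show "x \<in> tilde n I d P" unfolding tilde_def forms_hform by blast
  qed
  show "tilde n I d P \<subseteq> twist n X d P"
  proof
    fix x assume "x \<in> tilde n I d P"
    then obtain f g m where x: "x = Fract f g" "f \<in> I" "homog (m + d) f" "g \<in> hform (Suc n) m" "g \<notin> P"
      unfolding tilde_def forms_hform by blast
    obtain i where i: "i < Suc n" "Var i \<notin> P" using P by (auto simp: Proj_iff)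
    let ?v = "Var i ^ d :: 'a mpol"
    have v: "?v \<in> hform (Suc n) d" "?v \<notin> P" using Var_power_hform[OF i(1)] hprime_power[OF hp, of "Var i" d] i by auto
    have v0: "?v \<noteq> 0" using v(2) hidealD(2)[OF hprimeD(1)[OF hp]] by metis
    have "x = Fract (?v * f) (?v * g)" using x(1) v0 by (simp add: mult_fract_cancel)
    then have "x = Fract f (g * ?v) * Fract ?v 1" by (simp add: mult.commute)
    moreover have "Fract f (g * ?v) \<in> tilde n I 0 P"
      using x hform_mult[OF x(4) v(1)] hprimeD(3)[OF hp, of g ?v] v unfolding tilde_def forms_hform by (auto simp: hform_def)
    moreover have "Fract ?v 1 \<in> O_twist n d P"
      using v(1) hprimeD(2)[OF hp] by (intro O_twistI[of _ _ 0]) (auto simp: hform_def)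
    ultimately show "x \<in> twist n X d P" unfolding twist_def X by blast
  qed
qed

section \<open>Geometric hypotheses in terms of the ideal\<close>

lemma saturated_ideal_eq:
  assumes I: "hideal (Suc n) I" and X: "\<And>P. P \<in> Proj n \<Longrightarrow> X P = tilde n I 0 P"
  shows "saturated_ideal n X = Sat (Suc n) I"
proof -
  have c: "carrier (coord_ring n) = (PV {..<Suc n} :: 'a mpol set)"
    by (simp add: carrier_coord_ring lessThan_Suc_atMost)
  have eq: "(\<forall>P\<in>Proj n. Fract h 1 \<in> twist n X d P) \<longleftrightarrow> h \<in> Sat (Suc n) I" if h: "h \<in> hform (Suc n) d" for h d
  proof -
    have "Fract h 1 \<in> twist n X d P \<longleftrightarrow> loc n I P h" if P: "P \<in> Proj n" for P
    proof -
      have "1 \<notin> P" using P by (simp add: Proj_iff hprime_def)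
      then show ?thesis unfolding twist_eq_tilde[where X = X, OF I P X[OF P]]
        using tilde_iff_loc[OF I P, of h 0 d 1] h by (simp add: hform_def)
    qed
    then show ?thesis unfolding Sat_iff_loc[OF I h] by blast
  qed
  have "f \<in> Sat (Suc n) I \<longleftrightarrow> (\<forall>d. hom_part d f \<in> Sat (Suc n) I)" for f
  proof
    assume a: "\<forall>d. hom_part d f \<in> Sat (Suc n) I"
    obtain D where D: "f = (\<Sum>d\<le>D. hom_part d f)" using hom_part_decomp by blast
    have "(\<Sum>d\<le>D. hom_part d f) \<in> Sat (Suc n) I" using a by (intro hideal_sum[OF hideal_Sat[OF I]]) blast
    then show "f \<in> Sat (Suc n) I" using D by simp
  qed (use hidealD(5)[OF hideal_Sat[OF I]] in blast)
  then show ?thesis unfolding saturated_ideal_def c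
    using eq[OF hform_hom_part] hidealD(1)[OF hideal_Sat[OF I]] by blast
qed

text \<open>Dividing a form by x_i^d with x_i outside \<open>P\<close> makes it a germ of degree 0,
  to which reducedness of the local ring applies.\<close>

lemma Red_of_reduced:
  assumes I: "hideal (Suc n) I" and X: "\<And>P. P \<in> Proj n \<Longrightarrow> X P = tilde n I 0 P"
    and red: "reduced n X" and f: "f \<in> hform (Suc n) d" "f ^ m \<in> I"
  shows "f \<in> Sat (Suc n) I"
  unfolding Sat_iff_loc[OF I f(1)]
proof
  fix P :: "'a mpol set" assume P: "P \<in> Proj n"
  then obtain i where i: "i < Suc n" "Var i \<notin> P" and hp: "hprime (Suc n) P" by (auto simp: Proj_iff)
  let ?v = "Var i ^ d :: 'a mpol"
  have v: "?v \<in> hform (Suc n) d" "?v \<notin> P" using Var_power_hform[OF i(1)] hprime_power[OF hp, of "Var i" d] i by auto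
  have "Fract f ?v \<in> carrier (local_ring n P)"
    using f(1) v O_twistI[of f n d 0 ?v P] by (simp add: local_ring_def)
  moreover have "Fract f ?v ^ m = Fract (f ^ m) (?v ^ m)"
    by (induction m) (simp_all add: One_fract_def)
  moreover have "?v ^ m \<in> hform (Suc n) (m * d)" "?v ^ m \<notin> P"
    using v hprime_power[OF hp, of ?v m] by (auto simp: hform_def intro: PV_power homog_power)
  then have "Fract (f ^ m) (?v ^ m) \<in> X P"
    using f homog_power[of d f m] unfolding X[OF P] tilde_def forms_hform by (auto simp: hform_def)
  ultimately have "Fract f ?v \<in> X P" using red P unfolding reduced_def by metis
  then show "loc n I P f" unfolding X[OF P] using tilde_iff_loc[OF I P _ v, of f 0] f(1) by simp
qed

lemma linear_form_Sat:
  assumes I: "hideal (Suc n) I" and X: "\<And>P. P \<in> Proj n \<Longrightarrow> X P = tilde n I 0 P"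
    and nd: "nondegenerate n X" and l: "l \<in> hform (Suc n) 1" "l \<in> Sat (Suc n) I"
  shows "l = 0"
proof (rule ccontr)
  assume "l \<noteq> 0"
  let ?R = "coord_ring n :: 'a mpol ring"
  interpret cring ?R by (rule cring_coord_ring)
  have "ideal (Sat (Suc n) I) ?R" using hideal_Sat[OF I] by (simp add: homog_ideal_def flip: homog_ideal_iff)
  from genideal_minimal[OF this, of "{l}"] have gS: "genideal ?R {l} \<subseteq> Sat (Suc n) I" using l(2) by simp
  have "tilde n (genideal ?R {l}) 0 P \<subseteq> X P" if P: "P \<in> Proj n" for P
  proof
    fix x assume "x \<in> tilde n (genideal ?R {l}) 0 P"
    then obtain f g m where x: "x = Fract f g" "f \<in> Sat (Suc n) I" "homog m f" "g \<in> hform (Suc n) m" "g \<notin> P"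
      using gS unfolding tilde_def forms_hform by auto
    have f: "f \<in> hform (Suc n) m" using x by (auto simp: hform_def Sat_def)
    then have "loc n I P f" using x(2) P Sat_iff_loc[OF I f] by blast
    then show "x \<in> X P" unfolding X[OF P] x(1) using tilde_iff_loc[OF I P _ x(4,5), of f 0] f by simp
  qed
  then show False using nd l(1) \<open>l \<noteq> 0\<close> unfolding nondegenerate_def forms_hform by blast
qed

text \<open>A prime containing \<open>I\<close> is in the support of X, so its height is at least e.
  If all chains ending at it had length below e, their supremum would be at most e - 1; so a chain
  of length at least e exists, also when the height is infinite.\<close>

lemma chain_of_codim:
  assumes I: "hideal (Suc n) I" and X: "\<And>P. P \<in> Proj n \<Longrightarrow> X P = tilde n I 0 P"
    and e: "enat e \<le> codim n X" and P: "P \<in> Proj n" "I \<subseteq> P"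
  shows "\<exists>m c. e \<le> m \<and> c m = P \<and> (\<forall>i\<le>m. c i \<in> Proj n) \<and> (\<forall>i<m. c i \<subset> c (Suc i))"
proof -
  have "1 \<notin> P" using P(1) by (simp add: Proj_iff hprime_def)
  have 1: "1 \<in> hform (Suc n) 0" by (simp add: hform_def)
  have "Fract 1 1 \<in> carrier (local_ring n P)"
    using 1 \<open>1 \<notin> P\<close> O_twistI[of 1 n 0 0 1 P] by (simp add: local_ring_def)
  moreover have "Fract 1 1 \<notin> X P"
    unfolding X[OF P(1)] using tilde_iff_loc[OF I P(1), of 1 0 0 1] 1 \<open>1 \<notin> P\<close> P(2) by (auto simp: loc_def)
  ultimately have "P \<in> supp n X" using P(1) unfolding supp_def by auto
  then have hle: "enat e \<le> height n P" using e unfolding codim_def by (meson INF_lower order_trans)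
  have hlt: "height n P < enat e" if no: "\<not> ?thesis" "e = Suc e'" for e'
  proof -
    have "height n P \<le> enat e'" 
    proof (unfold height_def, rule SUP_least)
      fix m assume "m \<in> {m. \<exists>c. c m = P \<and> (\<forall>i\<le>m. c i \<in> Proj n) \<and> (\<forall>i<m. c i \<subset> c (Suc i))}"
      then have "\<not> e \<le> m" using no(1) by blast
      then show "enat m \<le> enat e'" using no(2) by simp
    qed
    then show ?thesis using no(2) by (metis enat_ord_simps(2) lessI order_le_less_trans)
  qed
  show ?thesis
  proof (cases e)
    case 0
    then show ?thesis using P(1) by (intro exI[of _ 0] exI[of _ "\<lambda>_. P"]) auto
  next
    case (Suc e')
    show ?thesis by (rule ccontr) (use hlt[OF _ Suc] hle in simp)
  qed
qed

section \<open>Global sections\<close>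

text \<open>
  A fraction \<open>f/g\<close> whose denominator ideal contains powers of \<open>x\<^sub>0\<close> and of \<open>x\<^sub>1\<close> is a polynomial; on \<open>\<bbbP>\<^sup>0\<close>,
  where there is only one variable, this is replaced by a comparison of degrees.
\<close>

lemma fraction_is_form:
  fixes f g :: "('k::field) mpol"
  assumes f: "f \<in> hform (Suc n) (m + d)" and g: "g \<in> hform (Suc n) m" "g \<noteq> 0"
    and D: "\<And>i. i < Suc n \<Longrightarrow> \<exists>k. \<exists>a\<in>PV {..<Suc n}. Var i ^ k * f = a * g"
  shows "\<exists>h\<in>hform (Suc n) d. f = h * g"
proof -
  have "\<exists>h\<in>PV {..<Suc n}. f = h * g"
  proof (cases n)
    case 0
    have one: "p = const (lookup p (single 0 e)) * Var 0 ^ e" if p: "p \<in> hform (Suc n) e" for p :: "'k mpol" and e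
    proof (rule poly_mapping_eqI)
      fix x
      have "x = single 0 e" if x: "x \<in> keys p"
      proof -
        have k: "keys x \<subseteq> {0}" and mx: "mdeg x = e" using p x 0 by (auto simp: hform_def PV_def homog_def)
        have "x = single 0 (lookup x 0)"
          using k by (intro poly_mapping_eqI) (auto simp: lookup_single when_def in_keys_iff)
        moreover from this have "mdeg x = lookup x 0" using mdeg_single by metis
        ultimately show ?thesis using mx by simp
      qed
      then show "lookup p x = lookup (const (lookup p (single 0 e)) * Var 0 ^ e) x"
        by (auto simp: Var_power lookup_single when_def in_keys_iff)
    qed
    obtain a b where ab: "f = const a * Var 0 ^ (m + d)" "g = const b * Var 0 ^ m" using one[OF f] one[OF g(1)] by blast
    have "b \<noteq> 0" using ab(2) g(2) by auto
    then have "const (a / b) * const b = const a" by (simp flip: const_mult)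
    moreover have "(const (a / b) * Var 0 ^ d) * g = (const (a / b) * const b) * Var 0 ^ (m + d)"
      unfolding ab(2) power_add by (simp only: mult_ac)
    ultimately have "f = (const (a / b) * Var 0 ^ d) * g" unfolding ab(1) by simp
    moreover have "const (a / b) * Var 0 ^ d \<in> PV {..<Suc n}" by (auto intro!: PV_mult PV_power)
    ultimately show ?thesis by blast
  next
    case (Suc n')
    obtain k a where a: "a \<in> PV {..<Suc n}" "Var 0 ^ k * f = a * g" using D[of 0] by auto
    obtain l b where b: "Var 1 ^ l * f = b * g" using D[of 1] Suc by auto
    have "(Var 1 ^ l * a) * g = Var 1 ^ l * (Var 0 ^ k * f)" unfolding a(2) by (simp add: mult.assoc)
    also have "\<dots> = Var 0 ^ k * (Var 1 ^ l * f)" by (simp add: mult.left_commute)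
    also have "\<dots> = (Var 0 ^ k * b) * g" unfolding b by (simp add: mult.assoc)
    finally have ab: "Var 1 ^ l * a = Var 0 ^ k * b" using g(2) by simp
    have sh: "lookup (Var i ^ j * p) (single i j + x) = lookup p x" for i j x and p :: "'k mpol"
      unfolding Var_power
    proof (induction p rule: mpol_induct)
      case (single m c)
      then show ?case by (simp add: mult_single lookup_single when_def)
    qed (auto simp: distrib_left lookup_add)
    have k0: "k \<le> lookup x 0" if x: "x \<in> keys a" for x
    proof -
      have "single 1 l + x \<in> keys (Var 1 ^ l * a)" using x sh[of 1 l a x] by (simp add: in_keys_iff)
      then obtain y z where "single 1 l + x = y + z" "y \<in> keys (Var 0 ^ k :: 'k mpol)"
        unfolding ab using Poly_Mapping.keys_mult[of "Var 0 ^ k" b] by blast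
      then have "single 1 l + x = single 0 k + z" by (simp add: Var_power)
      from arg_cong[OF this, of "\<lambda>w. lookup w 0"] show ?thesis by (simp add: lookup_add lookup_single)
    qed
    let ?h = "\<Sum>x\<in>keys a. single (x - single 0 k) (lookup a x)"
    have l: "lookup (x - single 0 k) j = (if j = 0 then lookup x j - k else lookup x j)" for x :: "nat \<Rightarrow>\<^sub>0 nat" and j
      by (simp add: lookup_minus lookup_single when_def)
    have "Var 0 ^ k * single (x - single 0 k) (lookup a x) = single x (lookup a x)" if x: "x \<in> keys a" for x
    proof -
      have "single 0 k + (x - single 0 k) = x"
        using k0[OF x] by (intro poly_mapping_eqI) (auto simp: lookup_add l lookup_single when_def)
      then show ?thesis by (simp add: Var_power mult_single)
    qed
    then have "Var 0 ^ k * ?h = (\<Sum>x\<in>keys a. single x (lookup a x))" unfolding sum_distrib_left by (rule sum.cong[OF refl])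
    then have ah: "Var 0 ^ k * ?h = a" unfolding mpol_sum[of a, symmetric] .
    have "Var 0 ^ k * f = Var 0 ^ k * (?h * g)" unfolding a(2) mult.assoc[symmetric] ah ..
    moreover have "Var 0 ^ k \<noteq> (0 :: 'k mpol)"
    proof
      assume "Var 0 ^ k = (0 :: 'k mpol)"
      from arg_cong[OF this, of "\<lambda>p. lookup p (single 0 k)"] show False by (simp add: Var_power)
    qed
    ultimately have "f = ?h * g" using mult_left_cancel by blast
    moreover have "?h \<in> PV {..<Suc n}"
    proof (rule PV_sum)
      fix x assume "x \<in> keys a"
      then have "keys x \<subseteq> {..<Suc n}" using a(1) by (auto simp: PV_def)
      moreover have "keys (x - single 0 k) \<subseteq> keys x" by (auto simp: in_keys_iff l split: if_splits)
      ultimately show "single (x - single 0 k) (lookup a x) \<in> PV {..<Suc n}" by (auto simp: PV_def)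
    qed
    ultimately show ?thesis by blast
  qed
  then obtain h where h: "h \<in> PV {..<Suc n}" "f = h * g" by blast
  have "f = hom_part (m + d) (h * g)" using hom_part_homog[of "m + d" f "m + d"] f h(2) by (simp add: hform_def)
  also have "\<dots> = hom_part d h * g" using hom_part_homog_mult[of m g "m + d" h] g(1) by (simp add: hform_def)
  finally show ?thesis using hform_hom_part[OF h(1)] by blast
qed

text \<open>The zero ideal is a point in every nonempty basic open set, so a locally constant
  section has a single value f/g. Its local representatives show that the ideal of all b with b f in
  (g) is contained in no point, so it contains a power of every variable.\<close>

lemma global_section_is_form:
  assumes I: "hideal (Suc n) I" and s: "s \<in> global_sections n F" and F: "\<And>P. P \<in> Proj n \<Longrightarrow> F P = tilde n I d P"
  shows "\<exists>h \<in> Sat (Suc n) I \<inter> hform (Suc n) d. s = (\<lambda>P. if P \<in> Proj n then Fract h 1 else 0)"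
proof -
  let ?q = "s {0}"
  have sec: "\<forall>P\<in>Proj n. s P \<in> F P \<and> (\<exists>d. \<exists>h\<in>forms n d. h \<notin> P \<and> (\<forall>Q\<in>Proj n. h \<notin> Q \<longrightarrow> s Q = s P))"
    using s unfolding global_sections_def mem_Collect_eq by (rule conjunct2)
  have s0: "s P = 0" if "P \<notin> Proj n" for P
    using s that unfolding global_sections_def mem_Collect_eq by (elim conjE allE impE)
  have q: "s P = ?q" if P: "P \<in> Proj n" for P
  proof -
    from sec[rule_format, OF P] obtain e h where h: "h \<notin> P" "\<forall>Q\<in>Proj n. h \<notin> Q \<longrightarrow> s Q = s P" by (elim conjE exE bexE)
    have "0 \<in> P" using P by (intro hidealD(2)[of "Suc n"]) (simp add: Proj_iff hprime_def)
    then have "h \<notin> {0}" using h(1) by auto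
    from h(2)[rule_format, OF zero_Proj this] show ?thesis ..
  qed
  have qt: "?q \<in> tilde n I d P" if P: "P \<in> Proj n" for P
    using sec[rule_format, OF P, THEN conjunct1] unfolding q[OF P] F[OF P] .
  obtain f g m where fg: "?q = Fract f g" "f \<in> I" "homog (m + d) f" "g \<in> hform (Suc n) m" "g \<notin> {0}"
    using qt[OF zero_Proj] unfolding tilde_def forms_hform by blast
  have f: "f \<in> hform (Suc n) (m + d)" and gR: "g \<in> PV {..<Suc n}" and g0: "g \<noteq> 0"
    using fg hidealD(1)[OF I fg(2)] by (auto simp: hform_def)
  let ?G = "{a * g | a. a \<in> PV {..<Suc n}}"
  have G: "hideal (Suc n) ?G"
    unfolding hideal_def
  proof (intro conjI ballI allI)
    show "?G \<subseteq> PV {..<Suc n}" using gR by (auto intro: PV_mult)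
    show "0 \<in> ?G" by (auto intro: exI[of _ 0])
    fix x y assume "x \<in> ?G" "y \<in> ?G"
    then obtain a b where "x = a * g" "y = b * g" "a \<in> PV {..<Suc n}" "b \<in> PV {..<Suc n}" by blast
    then show "x + y \<in> ?G" by (auto intro!: exI[of _ "a + b"] PV_add simp: distrib_right)
  next
    fix r x :: "'a mpol" assume "r \<in> PV {..<Suc n}" "x \<in> ?G"
    then obtain a where "x = a * g" "a \<in> PV {..<Suc n}" "r \<in> PV {..<Suc n}" by blast
    then show "r * x \<in> ?G" by (auto intro!: exI[of _ "r * a"] PV_mult simp: mult.assoc)
  next
    fix x e assume "x \<in> ?G"
    then obtain a where a: "x = a * g" "a \<in> PV {..<Suc n}" by blast
    have "hom_part e x = (if m \<le> e then hom_part (e - m) a else 0) * g"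
      unfolding a(1) using hom_part_homog_mult[of m g e a] fg(4) by (simp add: hform_def)
    then show "hom_part e x \<in> ?G" using PV_hom_part[OF a(2)] by (intro CollectI exI[of _ "if m \<le> e then hom_part (e - m) a else 0"]) auto
  qed
  let ?J = "{b \<in> PV {..<Suc n}. b * f \<in> ?G}"
  have D: "\<exists>k. \<exists>a\<in>PV {..<Suc n}. Var i ^ k * f = a * g" if i: "i < Suc n" for i
  proof -
    have "\<exists>k. Var i ^ k \<in> ?J"
    proof (rule power_in_hideal[OF hideal_colon[OF G f] i])
      fix P assume P: "hprime (Suc n) P" "?J \<subseteq> P"
      show "Var i \<in> P"
      proof (rule ccontr)
        assume "Var i \<notin> P"
        then have PP: "P \<in> Proj n" using P(1) i by (auto simp: Proj_iff)
        obtain f' g' m' where f': "?q = Fract f' g'" "f' \<in> I" "g' \<in> hform (Suc n) m'" "g' \<notin> P"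
          using qt[OF PP] unfolding tilde_def forms_hform by blast
        have "g' \<noteq> 0" using f'(4) hidealD(2)[OF hprimeD(1)[OF P(1)]] by auto
        then have "f * g' = f' * g" using f'(1) fg(1) g0 by (simp add: eq_fract)
        then have "g' * f = f' * g" by (simp add: mult.commute)
        then have "g' \<in> ?J" using f'(3) hidealD(1)[OF I f'(2)] by (auto simp: hform_def)
        then show False using P(2) f'(4) by blast
      qed
    qed
    then show ?thesis by blast
  qed
  obtain h where h: "h \<in> hform (Suc n) d" "f = h * g" using fraction_is_form[OF f fg(4) g0 D] by blast
  have qh: "?q = Fract h 1" unfolding fg(1) h(2) using g0 by (simp add: eq_fract)
  have "loc n I P h" if P: "P \<in> Proj n" for P
  proof -
    have "1 \<notin> P" using P by (simp add: Proj_iff hprime_def)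
    then show ?thesis using qt[OF P] tilde_iff_loc[OF I P, of h 0 d 1] h(1) unfolding qh by (simp add: hform_def)
  qed
  then have "h \<in> Sat (Suc n) I" using Sat_iff_loc[OF I h(1)] by blast
  moreover have "s = (\<lambda>P. if P \<in> Proj n then Fract h 1 else 0)"
  proof
    fix P show "s P = (if P \<in> Proj n then Fract h 1 else 0)"
      using q[of P] qh s0[of P] by simp
  qed
  ultimately show ?thesis using h(1) by blast
qed

lemma h0_eq_dim:
  assumes I: "hideal (Suc n) I" and F: "\<And>P. P \<in> Proj n \<Longrightarrow> F P = tilde n I d P"
  shows "h0 n F = mpol.dim (Sat (Suc n) I \<inter> hform (Suc n) d)"
proof -
  interpret sec: vector_space "scale_section :: 'a \<Rightarrow> _" by (rule vector_space_scale_section)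
  let ?V = "Sat (Suc n) I \<inter> hform (Suc n) d"
  define T where "T h = (\<lambda>P :: 'a mpol set. if P \<in> Proj n then Fract h 1 else 0)" for h :: "'a mpol"
  note S = hideal_Sat[OF I]
  have lin: "Vector_Spaces.linear cmul scale_section T"
  proof unfold_locales
    fix b1 b2 :: "'a mpol" and r
    show "T (b1 + b2) = T b1 + T b2" by (auto simp: T_def fun_eq_iff)
    show "T (cmul r b1) = scale_section r (T b1)" by (auto simp: T_def fun_eq_iff scale_section_def cmul_def)
  qed
  have V: "mpol.subspace ?V"
  proof (rule mpol.subspaceI)
    fix x c assume "x \<in> ?V"
    then show "cmul c x \<in> ?V" using hidealD(4)[OF S, of "const c" x] by (auto simp: cmul_def hform_const_mult)
  qed (use hidealD(2,3)[OF S] in \<open>auto intro: hform_add\<close>)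
  obtain D where D: "finite D" "(hform (Suc n) d :: 'a mpol set) \<subseteq> mpol.span D" using finite_span_hform by blast
  have "?V \<subseteq> mpol.span D" using D(2) by blast
  note rn = rank_nullity[OF lin V D(1) this]
  have "{v \<in> ?V. T v = 0} = {0}"
  proof -
    have "v = 0" if "T v = 0" for v
    proof -
      have "T v {0} = 0" using that by simp
      then have "Fract v 1 = 0" using zero_Proj[where 'k = 'a, of n] by (simp add: T_def)
      then show ?thesis by (simp add: Zero_fract_def eq_fract)
    qed
    then show ?thesis using mpol.subspace_0[OF V] mpol.subspace_0[OF V] by (auto simp: T_def Zero_fract_def fun_eq_iff)
  qed
  moreover have "mpol.dim {0 :: 'a mpol} = 0" by (rule mpol.dim_unique[of "{}"]) (auto simp: mpol.independent_empty)
  moreover have "T ` ?V = global_sections n F"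
  proof
    show "global_sections n F \<subseteq> T ` ?V"
      using global_section_is_form[OF I _ F] unfolding T_def by blast
    show "T ` ?V \<subseteq> global_sections n F"
    proof
      fix x assume "x \<in> T ` ?V"
      then obtain h where h: "h \<in> Sat (Suc n) I" "h \<in> hform (Suc n) d" "x = T h" by blast
      have "Fract h 1 \<in> F P" if P: "P \<in> Proj n" for P
      proof -
        have "1 \<notin> P" using P by (simp add: Proj_iff hprime_def)
        then show ?thesis using h(1) P unfolding F[OF P] Sat_iff_loc[OF I h(2)]
          using tilde_iff_loc[OF I P, of h 0 d 1] h(2) by (simp add: hform_def)
      qed
      moreover have "1 \<in> forms n 0" by (simp add: forms_hform hform_def)
      moreover have "1 \<notin> P" if "P \<in> Proj n" for P :: "'a mpol set" using that by (simp add: Proj_iff hprime_def)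
      ultimately show "x \<in> global_sections n F" unfolding h(3) global_sections_def T_def by auto
    qed
  qed
  ultimately show ?thesis using rn by (simp add: h0_def)
qed

text \<open>For p > e the quadratic expression is past its maximum: its value at e exceeds the one
  at p by (p - e)(p - e - 1)/2 \<ge> 0. So \<open>min p e\<close> projections suffice.\<close>

lemma sum_lower_bound:
  "real e * real p - real p * (real p - 1) / 2 \<le> real (\<Sum>i<min p e. e - i)"
proof -
  have s: "q \<le> e \<Longrightarrow> real (\<Sum>i<q. e - i) = real e * real q - real q * (real q - 1) / 2" for q
    by (induction q) (auto simp: field_simps of_nat_diff)
  show ?thesis
  proof (cases "p \<le> e")
    case False
    have "0 \<le> (real p - real e) * (real p - real e - 1)" using False by (intro mult_nonneg_nonneg) auto
    then have "real e * real p - real p * (real p - 1) / 2 \<le> real e * real e - real e * (real e - 1) / 2"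
      by (simp add: field_simps)
    then show ?thesis using s[of e] False by simp
  qed (use s in simp)
qed

theorem corollary3p8:
  fixes r e p :: nat
    and X :: "('k::{alg_closed_field, field_char_0}) stalks"
    and I :: "'k mpol set"
  assumes "closed_subscheme (r + e) X"
    and "nondegenerate (r + e) X"
    and "reduced (r + e) X"
    and "codim (r + e) X = enat e"
    and "quadratic_ideal (r + e) I X"
    and "1 \<le> p"
    and "property_N2 (r + e) p I"
  shows "real e * real p - real p * (real p - 1) / 2 \<le> real (betti02 (r + e) I)
    \<and> betti02 (r + e) I \<le> betti02 (r + e) (saturated_ideal (r + e) X)
    \<and> betti02 (r + e) (saturated_ideal (r + e) X) = h0 (r + e) (twist (r + e) X 2)"
proof -
  define n where "n = r + e"
  note nd = assms(2)[folded n_def] and red = assms(3)[folded n_def] and cd = assms(4)[folded n_def]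
    and N2 = assms(7)[folded n_def]
  have I: "hideal (Suc n) I" and X: "\<And>P. P \<in> Proj n \<Longrightarrow> X P = tilde n I 0 P"
    using assms(5) unfolding n_def quadratic_ideal_def homog_ideal_iff by auto
  note S = hideal_Sat[OF I]
  let ?S = "Sat (Suc n) I"
  have sat: "saturated_ideal n X = ?S" by (rule saturated_ideal_eq[where X = X, OF I X])
  have red': "f \<in> ?S" if "f \<in> hform (Suc n) d" "f ^ m \<in> I" for f d m
    by (rule Red_of_reduced[where X = X, OF I _ red that]) (rule X)
  \<comment> \<open>Nondegeneracy is proved for the saturated ideal and inherited by
    \<open>I\<close>. It excludes forms of degree below 2 from both, so that their Betti numbers are
    dimensions of spaces of quadrics.\<close>
  have "nondeg (Suc n) ?S"
    unfolding nondeg_def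
  proof (intro ballI allI impI)
    fix l :: "'k mpol" and m assume l: "l \<in> hform (Suc n) 1" "l ^ m \<in> ?S"
    have "loc n I P l" if P: "P \<in> Proj n" for P
    proof -
      obtain i where i: "i < Suc n" "Var i \<notin> P" and hp: "hprime (Suc n) P" using P by (auto simp: Proj_iff)
      obtain k where k: "Var i ^ k * l ^ m \<in> I" using l(2) i(1) unfolding Sat_def by blast
      have vl: "Var i ^ k * l \<in> hform (Suc n) (k + 1)" by (rule hform_mult[OF Var_power_hform[OF i(1)] l(1)])
      have vP: "Var i ^ j \<notin> P" for j using hprime_power[OF hp, of "Var i" j] i by auto
      \<comment> \<open>Only a multiple x_i^k l^m is known to lie in \<open>I\<close>, so
        reducedness is applied to x_i^k l: its power with exponent m + 1 is a multiple of that
        element.\<close>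
      have "(Var i ^ k * l) ^ Suc m = (l * Var i ^ (k * m)) * (Var i ^ k * l ^ m)"
        by (simp add: power_mult_distrib power_mult mult_ac)
      also have "\<dots> \<in> I"
        using l(1) i(1) by (intro hidealD(4)[OF I _ k] PV_mult PV_power) (auto simp: hform_def)
      finally have "Var i ^ k * l \<in> ?S" by (rule red'[OF vl])
      then obtain j where "Var i ^ j * (Var i ^ k * l) \<in> I" using i(1) unfolding Sat_def by blast
      then have "Var i ^ (j + k) * l \<in> I" by (simp add: power_add mult.assoc)
      then show ?thesis unfolding loc_def using Var_power_hform[OF i(1), of "j + k"] vP by blast
    qed
    then have lS: "l \<in> ?S" using Sat_iff_loc[OF I l(1)] by blast
    show "l = 0" by (rule linear_form_Sat[where X = X, OF I _ nd l(1) lS]) (rule X)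
  qed
  note ndS = this
  have ndI: "nondeg (Suc n) I" using ndS subset_Sat[OF I] unfolding nondeg_def by blast
  have low: "f = 0" if "f \<in> ?S" "homog d f" "d < 2" for f d
    using nondeg_low[OF S _ ndS that] by simp
  have bI: "betti02 n I = mpol.dim (I \<inter> hform (Suc n) 2)"
    using low subset_Sat[OF I] by (intro betti02_eq_dim[OF I]) blast
  have bS: "betti02 n ?S = mpol.dim (?S \<inter> hform (Suc n) 2)"
    using low by (intro betti02_eq_dim[OF S])
  have "Red (Suc n) I" unfolding Red_def using Sat_uniform[OF I] red' by blast
  moreover have "codim_cond (Suc n) e I"
    unfolding codim_cond_def
  proof (intro allI impI)
    fix P assume P: "hprime (Suc n) P" "I \<subseteq> P" "\<exists>i<Suc n. Var i \<notin> P"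
    then have PP: "P \<in> Proj n" by (simp add: Proj_iff)
    have "enat e \<le> codim n X" using cd by simp
    have "\<exists>m c. e \<le> m \<and> c m = P \<and> (\<forall>i\<le>m. c i \<in> Proj n) \<and> (\<forall>i<m. c i \<subset> c (Suc i))"
      by (rule chain_of_codim[where X = X, OF I _ \<open>enat e \<le> codim n X\<close> PP P(2)]) (rule X)
    then obtain m c where c: "e \<le> m" "c m = P" "\<forall>i\<le>m. c i \<in> Proj n" "\<forall>i<m. c i \<subset> c (Suc i)" by blast
    have "codim_ge (Suc n) m (c m)"
      using c(3,4) by (intro chain_codim_ge) (auto simp: Proj_iff)
    then show "codim_ge (Suc n) e P" using c(1) unfolding c(2) codim_ge_def by fastforce
  qed
  \<comment> \<open>Truncating p at e meets the side condition of the induction that p is at most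
    the codimension.\<close>
  moreover have "kexact (Suc n) I (Suc i) (int j)" if "Suc i \<le> min p e" "j \<ge> 2" for i j
    using property_N2_kexact[OF I N2 _ that(2)] that(1) by simp
  ultimately have "(\<Sum>i<min p e. e - i) \<le> betti02 n I"
    unfolding bI by (intro quadrics_lower_bound[OF I _ ndI]) auto
  then have 1: "real e * real p - real p * (real p - 1) / 2 \<le> real (betti02 n I)"
    using sum_lower_bound[of e p] by linarith
  obtain D where D: "finite D" "(hform (Suc n) 2 :: 'k mpol set) \<subseteq> mpol.span D" using finite_span_hform by blast
  have 2: "betti02 n I \<le> betti02 n ?S"
    unfolding bI bS using D subset_Sat[OF I] by (intro mpol.dim_mono_finite[OF D(1)]) blast+
  have "twist n X 2 P = tilde n I 2 P" if "P \<in> Proj n" for P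
    by (rule twist_eq_tilde[where X = X, OF I that X[OF that]])
  then have 3: "betti02 n ?S = h0 n (twist n X 2)"
    unfolding bS by (rule h0_eq_dim[OF I, symmetric])
  show ?thesis using 1 2 3 unfolding n_def[symmetric] sat by blast
qed

end
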